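(* Let $p\ge 2$ be an integer, let $q=\frac{p}{p-1}$ (so $\frac1p+\frac1q=1$), let $E\subset\mathbb{C}$ be a rectifiable Jordan curve with bounded complementary component $G$, and let $\sigma$ be a finite positive Borel measure concentrated on $E$ whose absolutely continuous part with respect to arc length is $\rho(t)|dt|$, where $\rho\ge 0$ satisfies $$\int_E\rho(t)\,|dt|<\infty,\qquad \int_E\log(\rho(t))\,|\varphi'(t)|\,|dt|>-\infty .$$ Let $0\in G$ and fix $\xi\in G$. Let $D_{E,\rho}$ be the Szegő function, $m_{n,E}$ the extremal constants, $Q_n$ ($n\in\mathbb{N}$) the $L_p$ extremal polynomials, and $J_n,\Phi$ the functions on $G$, all as defined in the context. Then for every $n\in\mathbb{N}$, $$\|J_n-\Phi\|_\infty\;\le\;\frac{m_{n,E}}{2}\left(\frac{\gamma_{p,q}}{D_{E,\rho}(0)}+\|Q_n\|_{L^p(G,\nu)}\right)^{p-1},$$ where $\|J_n-\Phi\|_\infty=\sup_{z\in G}|J_n(z)-\Phi(z)|$, $\nu(t)=\rho(t)^{1-q}$ for $t\in E$, and $$\gamma_{p,q}=\left(\int_E |D_{E,\rho}(t)|^{p(2-q)}\,|\varphi'(t)|^{1-q}\,|dt|\right)^{1/p}.$$ In particular, if $m_{n,E}\to 0$ as $n\to\infty$, then $J_n\to\Phi$ uniformly on compact subsets of $G$, i.e. $\sup_{z\in K}|J_n(z)-\Phi(z)|\to 0$ for every compact $K\subset G$.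
   Context: $|dt|$ denotes arc length measure on $E$. $\varphi$ is a conformal mapping of $G$ onto the unit disk with $\varphi(\xi)=0$ and $\varphi'(\xi)>0$. It extends to a homeomorphism of the closures with $|\varphi(t)|=1$ for $t\in E$, and $\varphi'(t)$, $t\in E$, denotes its boundary values, defined a.e. on $E$; $|\varphi'(t)|\,|dt|$ is the pull-back to $E$ of arc length $|du|$ on $|u|=1$ under $u=\varphi(t)$. For a nonnegative weight $w$ on $E$ and a function $f$ defined a.e. on $E$ (for analytic functions in $G$, by boundary values), $\|f\|_{L^p(G,w)}=\left(\int_E|f(t)|^p w(t)\,|dt|\right)^{1/p}\in[0,\infty]$. Szegő function: $D_{E,\rho}$ is analytic and nonvanishing in $G$, satisfies $D_{E,\rho}(0)>0$, and has boundary values with $|D_{E,\rho}(t)|^p\,|\varphi'(t)|=\rho(t)$ for (a.e.) $t\in E$. It is given, up to the unimodular constant factor fixed by the condition $D_{E,\rho}(0)>0$, by $D_{E,\rho}(z)=D_G(\varphi(z))$ with $$D_G(w)=\exp\left\{\frac{1}{2p\pi}\int_E \frac{\varphi(t)+w}{\varphi(t)-w}\,\log\frac{\rho(t)}{|\varphi'(t)|}\;|\varphi'(t)|\,|dt|\right\},\qquad |w|<1 .$$ Extremal constants and polynomials: for $n\in\mathbb{N}$, $$m_{n,E}=\inf\left\{\left\|\frac{D_{E,\rho}}{D_{E,\rho}(0)}-P_n\right\|_{L^p(G,\rho)}: P_n \text{ a polynomial of degree at most } n,\ P_n(\xi)=1\right\},$$ and $Q_n$ is a polynomial of degree at most $n$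 with $Q_n(\xi)=1$ attaining this infimum, i.e. $m_{n,E}=\left\|\frac{D_{E,\rho}}{D_{E,\rho}(0)}-Q_n\right\|_{L^p(G,\rho)}$. For $z\in G$, $$J_n(z)=\int_\xi^z Q_n(t)^p\,dt,\qquad \Phi(z)=\int_\xi^z\left(\frac{D_{E,\rho}(t)}{D_{E,\rho}(0)}\right)^p dt,$$ the integrals being taken along any rectifiable path in $G$. The right-hand side of the inequality may be $+\infty$; a product $0\cdot\infty$ is read as $0$. *)

theory Defs
  imports "HOL-Complex_Analysis.Complex_Analysis"
begin

section \<open>Rectifiable curves and arc length measure\<close>

text \<open>Length of \<open>g\<close> on \<open>[a,b]\<close>: supremum of the lengths of inscribed polygons.\<close>

definition curve_length :: "(real \<Rightarrow> complex) \<Rightarrow> real \<Rightarrow> real \<Rightarrow> ennreal" where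
  "curve_length g a b =
     (SUP xs\<in>{xs. sorted xs \<and> set xs \<subseteq> {a..b}}.
        \<Sum>i<length xs - 1. ennreal (dist (g (xs ! i)) (g (xs ! Suc i))))"

definition rectifiable :: "(real \<Rightarrow> complex) \<Rightarrow> bool" where
  "rectifiable g \<longleftrightarrow> curve_length g 0 1 < \<infinity>"

text \<open>Arc length measure \<open>|dt|\<close> of a rectifiable simple curve \<open>g\<close>, as a measure on the complex
  plane concentrated on the image of \<open>g\<close>: the image under \<open>g\<close> of the Stieltjes measure of the length
  function \<open>s \<mapsto> length (g restricted to [0,s])\<close>. It does not depend on the parametrization. It is
  completed, so that functions which are only defined almost everywhere can be integrated.\<close>

definition arc_length_measure :: "(real \<Rightarrow> complex) \<Rightarrow> complex measure" where
  "arc_length_measure g =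
     completion (distr
       (restrict_space
         (interval_measure (\<lambda>s. enn2real (curve_length g 0 (max 0 (min 1 s))))) {0..1})
       borel g)"

text \<open>\<open>\<rho> d\<Lambda>\<close> is the absolutely continuous part of the Borel measure \<open>\<sigma>\<close> in its Lebesgue decomposition
  with respect to \<open>\<Lambda>\<close>; \<open>\<tau>\<close> is the singular part.\<close>

definition abs_cont_part ::
    "complex measure \<Rightarrow> complex measure \<Rightarrow> (complex \<Rightarrow> real) \<Rightarrow> bool" where
  "abs_cont_part \<sigma> \<Lambda> \<rho> \<longleftrightarrow>
     \<rho> \<in> borel_measurable \<Lambda> \<and>
     (\<exists>\<tau> N. sets \<tau> = sets borel \<and> N \<in> sets borel \<and>
        emeasure \<Lambda> N = 0 \<and> emeasure \<tau> (- N) = 0 \<and>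
        (\<forall>A\<in>sets borel. emeasure \<sigma> A = (\<integral>\<^sup>+t\<in>A. ennreal (\<rho> t) \<partial>\<Lambda>) + emeasure \<tau> A))"


section \<open>Boundary values\<close>

text \<open>Boundary values are nontangential limits, with the approach regions intrinsic to the domain.
  Where no such limit exists \<open>bvalue\<close> is an unspecified value.\<close>

definition approach_region :: "complex set \<Rightarrow> real \<Rightarrow> complex \<Rightarrow> complex set" where
  "approach_region G \<alpha> t = {z \<in> G. dist z t < \<alpha> * infdist z (frontier G)}"

definition bvalue :: "complex set \<Rightarrow> (complex \<Rightarrow> complex) \<Rightarrow> complex \<Rightarrow> complex" where
  "bvalue G f t = (THE L. \<forall>\<alpha>>1. (f \<longlongrightarrow> L) (at t within approach_region G \<alpha> t))"


section \<open>Conformal map and Szego function\<close>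

text \<open>\<open>\<phi>\<close> is the normalized conformal map of \<open>G\<close> onto the unit disk, together with its homeomorphic
  extension to the closures.\<close>

definition normalized_conformal_map ::
    "complex set \<Rightarrow> complex \<Rightarrow> (complex \<Rightarrow> complex) \<Rightarrow> bool" where
  "normalized_conformal_map G \<xi> \<phi> \<longleftrightarrow>
     \<phi> holomorphic_on G \<and> bij_betw \<phi> G (ball 0 1) \<and>
     \<phi> \<xi> = 0 \<and> Im (deriv \<phi> \<xi>) = 0 \<and> 0 < Re (deriv \<phi> \<xi>) \<and>
     (\<exists>\<psi>. homeomorphism (closure G) (cball 0 1) \<phi> \<psi>) \<and>
     (\<forall>t\<in>frontier G. cmod (\<phi> t) = 1)"

text \<open>Throughout, \<open>\<Lambda>\<close> is the arc length measure and \<open>\<phi>'\<close> stands for the boundary values of the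
  derivative of \<open>\<phi>\<close>.

  \<open>\<integral> log \<rho> |\<phi>'| |dt| > -\<infinity>\<close> says that the negative part of \<open>log \<rho>\<close> has a finite integral, where
  \<open>log 0 = -\<infinity>\<close>; the embedding \<open>ennreal\<close> sends negative reals to 0.\<close>

definition szego_condition ::
    "complex measure \<Rightarrow> (complex \<Rightarrow> complex) \<Rightarrow> (complex \<Rightarrow> real) \<Rightarrow> bool" where
  "szego_condition \<Lambda> \<phi>' \<rho> \<longleftrightarrow>
     (\<integral>\<^sup>+t. (if \<rho> t = 0 then \<infinity> else ennreal (- ln (\<rho> t))) * ennreal (cmod (\<phi>' t)) \<partial>\<Lambda>) < \<infinity>"

definition szego_disk ::
    "nat \<Rightarrow> complex measure \<Rightarrow> (complex \<Rightarrow> complex) \<Rightarrow> (complex \<Rightarrow> complex) \<Rightarrow>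
       (complex \<Rightarrow> real) \<Rightarrow> complex \<Rightarrow> complex" where
  "szego_disk p \<Lambda> \<phi> \<phi>' \<rho> w =
     exp (of_real (1 / (2 * real p * pi)) *
       (\<integral>t. (\<phi> t + w) / (\<phi> t - w) *
            of_real (ln (\<rho> t / cmod (\<phi>' t)) * cmod (\<phi>' t)) \<partial>\<Lambda>))"

text \<open>The unimodular factor in front makes the value at 0 positive.\<close>

definition szego_function ::
    "nat \<Rightarrow> complex measure \<Rightarrow> (complex \<Rightarrow> complex) \<Rightarrow> (complex \<Rightarrow> complex) \<Rightarrow>
       (complex \<Rightarrow> real) \<Rightarrow> complex \<Rightarrow> complex" where
  "szego_function p \<Lambda> \<phi> \<phi>' \<rho> z =
     of_real (cmod (szego_disk p \<Lambda> \<phi> \<phi>' \<rho> (\<phi> 0))) / szego_disk p \<Lambda> \<phi> \<phi>' \<rho> (\<phi> 0) *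
     szego_disk p \<Lambda> \<phi> \<phi>' \<rho> (\<phi> z)"


section \<open>Norms and extremal polynomials\<close>

text \<open>Positive real powers of elements of \<open>[0,\<infinity>]\<close>.\<close>

definition ennreal_powr :: "ennreal \<Rightarrow> real \<Rightarrow> ennreal" where
  "ennreal_powr x a = (if x = \<infinity> then \<infinity> else ennreal (enn2real x powr a))"

definition Lp_norm ::
    "nat \<Rightarrow> complex measure \<Rightarrow> (complex \<Rightarrow> real) \<Rightarrow> (complex \<Rightarrow> complex) \<Rightarrow> ennreal" where
  "Lp_norm p \<Lambda> w f = ennreal_powr (\<integral>\<^sup>+t. ennreal (cmod (f t) ^ p * w t) \<partial>\<Lambda>) (1 / real p)"

definition admissible_polys :: "nat \<Rightarrow> complex \<Rightarrow> complex poly set" where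
  "admissible_polys n \<xi> = {P. degree P \<le> n \<and> poly P \<xi> = 1}"

text \<open>The norm of \<open>D/D(0) - P\<close>, the function \<open>D\<close> on \<open>G\<close> entering through its boundary values.\<close>

definition extremal_dist ::
    "nat \<Rightarrow> complex measure \<Rightarrow> complex set \<Rightarrow> (complex \<Rightarrow> real) \<Rightarrow> (complex \<Rightarrow> complex) \<Rightarrow>
       complex poly \<Rightarrow> ennreal" where
  "extremal_dist p \<Lambda> G \<rho> D P = Lp_norm p \<Lambda> \<rho> (\<lambda>t. bvalue G D t / D 0 - poly P t)"

definition extremal_constant ::
    "nat \<Rightarrow> complex measure \<Rightarrow> complex set \<Rightarrow> (complex \<Rightarrow> real) \<Rightarrow> (complex \<Rightarrow> complex) \<Rightarrow>
       complex \<Rightarrow> nat \<Rightarrow> ennreal" where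
  "extremal_constant p \<Lambda> G \<rho> D \<xi> n =
     (INF P\<in>admissible_polys n \<xi>. extremal_dist p \<Lambda> G \<rho> D P)"

definition extremal_poly ::
    "nat \<Rightarrow> complex measure \<Rightarrow> complex set \<Rightarrow> (complex \<Rightarrow> real) \<Rightarrow> (complex \<Rightarrow> complex) \<Rightarrow>
       complex \<Rightarrow> nat \<Rightarrow> complex poly \<Rightarrow> bool" where
  "extremal_poly p \<Lambda> G \<rho> D \<xi> n P \<longleftrightarrow>
     P \<in> admissible_polys n \<xi> \<and> extremal_constant p \<Lambda> G \<rho> D \<xi> n = extremal_dist p \<Lambda> G \<rho> D P"

definition gamma_const ::
    "nat \<Rightarrow> real \<Rightarrow> complex measure \<Rightarrow> complex set \<Rightarrow> (complex \<Rightarrow> complex) \<Rightarrow>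
       (complex \<Rightarrow> complex) \<Rightarrow> ennreal" where
  "gamma_const p q \<Lambda> G \<phi>' D =
     ennreal_powr
       (\<integral>\<^sup>+t. ennreal (cmod (bvalue G D t) powr (real p * (2 - q)) * cmod (\<phi>' t) powr (1 - q)) \<partial>\<Lambda>)
       (1 / real p)"

text \<open>\<open>\<integral>\<^sub>\<xi>\<^sup>z f(t) dt\<close> as the common value of the integrals along all (piecewise continuously
  differentiable) paths in \<open>G\<close>.\<close>

definition path_integral ::
    "complex set \<Rightarrow> complex \<Rightarrow> (complex \<Rightarrow> complex) \<Rightarrow> complex \<Rightarrow> complex" where
  "path_integral G \<xi> f z =
     (THE I. \<forall>c. valid_path c \<and> path_image c \<subseteq> G \<and> pathstart c = \<xi> \<and> pathfinish c = z \<longrightarrow>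
        (f has_contour_integral I) c)"

end

theory Submission
 imports Defs "HOL-Probability.Distribution_Functions"
begin

text \<open>
 Let \<open>B = D / D(0)\<close>. Both \<open>J\<^sub>n\<close> and \<open>\<Phi>\<close> are primitives vanishing at \<open>\<xi>\<close>, so \<open>J\<^sub>n - \<Phi>\<close> is the primitive of
 \<open>Q\<^sub>n\<^sup>p - B\<^sup>p\<close>. The factor \<open>1/2\<close> comes from a geometric fact: a point of a closed curve has distance at most half the length
 of the curve from the mean of the curve. The image of a circle \<open>\<bar>w\<bar> = r\<close> under the primitive, read off in the disk, is a closed curve with mean
 \<open>0\<close> and length \<open>\<integral> \<bar>Q\<^sub>n\<^sup>p - B\<^sup>p\<bar> \<bar>\<psi>'\<bar>\<close>; letting \<open>r\<close> tend to \<open>1\<close> bounds \<open>\<bar>J\<^sub>n - \<Phi>\<bar>\<close> by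
 \<open>(1/2) \<integral> \<bar>Q\<^sub>n\<^sup>p - B\<^sup>p\<bar> \<bar>dt\<bar>\<close> over the curve (\<open>half_length_bound\<close>, \<open>smirnov_primitive_bound\<close>). Next,
 \<open>\<bar>Q\<^sup>p - B\<^sup>p\<bar> \<le> \<bar>Q - B\<bar> (\<bar>Q\<bar> + \<bar>B\<bar>)\<^sup>p\<^sup>-\<^sup>1\<close>, and the weights \<open>\<rho>\<close> and \<open>\<nu>\<close> are dual in the sense that
 \<open>\<rho>\<^bsup>1/p\<^esup> \<nu>\<^bsup>(p-1)/p\<^esup> = 1\<close>, so the inequalities of Hoelder and Minkowski give the bound (\<open>weighted_hoelder\<close>, \<open>error_estimate\<close>);
 on the curve \<open>\<bar>D\<bar>\<^sup>p \<bar>\<phi>'\<bar> = \<rho>\<close>, which identifies the norm of \<open>D\<close> with weight \<open>\<nu>\<close> as \<open>\<gamma>\<close>.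

 The second claim is a statement about compact sets. The function \<open>(Q\<^sub>n - B) D\<close>, carried to the disk, has on the circle the \<open>L\<^sup>p\<close> norm
 \<open>m\<^sub>n\<close>, and Cauchy's formula bounds it on compact sets by a constant times this norm (\<open>smirnov_pointwise_bound\<close>). As
 \<open>D\<close> has no zeros, \<open>Q\<^sub>n\<close> tends to \<open>B\<close> locally uniformly, and so do the primitives of the \<open>p\<close>-th powers (\<open>compact_error\<close>).

 Most of the work lies in the boundary behaviour that these arguments rest on. Let \<open>\<psi>\<close> be the inverse of the conformal map.
 The theorem of F. and M. Riesz (\<open>boundary_derivative\<close>) says that \<open>\<psi>'\<close> has nontangential limits \<open>F \<noteq> 0\<close> almost everywhere,
 is approximated by its dilates in \<open>L\<^sup>1\<close>, and has \<open>log \<bar>F\<bar>\<close> integrable. It rests on the inequality between the lengths of the image of a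
 concentric circle and of the boundary (\<open>curve_length_concentric_le\<close>) and on Fatou's theorem, which in turn
 needs Lebesgue points and the boundary functions of the Hardy space \<open>H\<^sup>2\<close>. Consequently arc length is \<open>\<bar>F\<bar> dt\<close> on the parameter circle
 (\<open>arc_length_measure_eq\<close>) and \<open>\<bar>\<phi>'\<bar> = 1 / \<bar>F\<bar>\<close>.

 Boundary values on the curve are limits along approach regions of the domain, whereas those on the disk are limits along Stolz regions.
 At almost every boundary point the curve has a tangent and \<open>\<psi>\<close> an angular derivative, and there the two notions
 agree (\<open>bvalue_eq\<close>). The topological part of this is that the domain lies on one side of its tangent; it follows from the
 behaviour of the winding number across a segment (\<open>no_crossing\<close>).

 The Szego function, carried to the disk, is the exponential of a Herglotz integral (\<open>szego_function_outer\<close>): an outer function.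
 For such functions boundary integrals control interior values, although they need not be bounded, since suitable
 multipliers of modulus at most one make them bounded; this is the Smirnov class (\<open>smirnov_outer\<close>).
\<close>

section \<open>Lebesgue points\<close>

lemma tendsto_0_ennreal_le:
 fixes a b :: "nat \<Rightarrow> ennreal"
 assumes "b \<longlonglongrightarrow> 0" "\<And>k. a k \<le> b k"
 shows "a \<longlonglongrightarrow> 0"
proof (rule tendsto_sandwich[where f = "\<lambda>_. 0" and h = b])
 show "\<forall>\<^sub>F k in sequentially. a k \<le> b k" using assms(2) by (rule always_eventually[OF allI])
qed (use assms(1) in auto)

text \<open>The average is over an interval of length \<open>2 h\<close>, so a bound \<open>\<epsilon> h\<close> on the integral is the usual condition up to a factor.\<close>

definition lebesgue_point :: "(real \<Rightarrow> 'a::real_normed_vector) \<Rightarrow> real \<Rightarrow> bool" where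
 "lebesgue_point f x \<longleftrightarrow> (\<forall>\<epsilon>>0. \<exists>\<delta>>0. \<forall>h. 0 < h \<and> h < \<delta> \<longrightarrow>
  (\<integral>\<^sup>+t\<in>ball x h. ennreal (norm (f t - f x)) \<partial>lborel) \<le> ennreal (\<epsilon> * h))"

text \<open>The weak type (1,1) bound of the Hardy-Littlewood maximal function: by Vitali's covering lemma
 the balls on which the average exceeds \<open>c\<close> can be thinned out to a disjoint family whose fivefold
 enlargements still cover.\<close>

lemma maximal_function_weak_type:
 fixes g :: "real \<Rightarrow> ennreal"
 assumes [measurable]: "g \<in> borel_measurable borel" and c: "0 < (c::real)"
 obtains U where "U \<in> sets lborel"
  "{x. \<exists>h. 0 < h \<and> h \<le> 1 \<and> ennreal (c * h) < (\<integral>\<^sup>+t\<in>ball x h. g t \<partial>lborel)} \<subseteq> U"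
  "emeasure lborel U \<le> ennreal (10 / c) * (\<integral>\<^sup>+t. g t \<partial>lborel)"
proof -
 define S where "S = {x. \<exists>h. 0 < h \<and> h \<le> 1 \<and> ennreal (c * h) < (\<integral>\<^sup>+t\<in>ball x h. g t \<partial>lborel)}"
 have "\<forall>x\<in>S. \<exists>h. 0 < h \<and> h \<le> 1 \<and> ennreal (c * h) < (\<integral>\<^sup>+t\<in>ball x h. g t \<partial>lborel)"
  by (auto simp: S_def)
 then obtain r where r: "\<And>x. x \<in> S \<Longrightarrow> 0 < r x \<and> r x \<le> 1"
   "\<And>x. x \<in> S \<Longrightarrow> ennreal (c * r x) < (\<integral>\<^sup>+t\<in>ball x (r x). g t \<partial>lborel)"
  by metis
 have "S \<subseteq> (\<Union>x\<in>S. ball x (r x))"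
  using r(1) by fastforce
 then obtain C where C: "countable C" "C \<subseteq> S"
   "pairwise (\<lambda>i j. disjnt (ball i (r i)) (ball j (r j))) C"
   "S \<subseteq> (\<Union>i\<in>C. ball i (5 * r i))"
  by (rule Vitali_covering_lemma_balls[where a = "\<lambda>x. x" and r = r]) (use r(1) in auto)
 define U where "U = (\<Union>i\<in>C. ball i (5 * r i))"
 have disj: "disjoint_family_on (\<lambda>i. ball i (r i)) C"
  using C(3) by (auto simp: disjoint_family_on_def pairwise_def disjnt_def)
 have "emeasure lborel U \<le> (\<integral>\<^sup>+i. emeasure lborel (ball i (5 * r i)) \<partial>count_space C)"
 proof -
  have "emeasure lborel U = (\<integral>\<^sup>+t. indicator U t \<partial>lborel)"
   unfolding U_def using C(1) by (intro nn_integral_indicator[symmetric] sets.countable_UN'') auto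
  also have "\<dots> \<le> (\<integral>\<^sup>+t. (\<integral>\<^sup>+i. indicator (ball i (5 * r i)) t \<partial>count_space C) \<partial>lborel)"
  proof (rule nn_integral_mono)
   fix t
   show "indicator U t \<le> (\<integral>\<^sup>+i. indicator (ball i (5 * r i)) t \<partial>count_space C)"
   proof (cases "t \<in> U")
    case True
    then obtain i where i: "i \<in> C" "t \<in> ball i (5 * r i)" by (auto simp: U_def)
    have "1 = (\<integral>\<^sup>+j. indicator {i} j \<partial>count_space C)"
     using i by simp
    also have "\<dots> \<le> (\<integral>\<^sup>+j. indicator (ball j (5 * r j)) t \<partial>count_space C)"
     using i by (intro nn_integral_mono) (auto split: split_indicator)
    finally show ?thesis using True by simp
   qed simp
  qed
  also have "\<dots> = (\<integral>\<^sup>+i. (\<integral>\<^sup>+t. indicator (ball i (5 * r i)) t \<partial>lborel) \<partial>count_space C)"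
   by (intro nn_integral_count_space_nn_integral[OF C(1)] borel_measurable_indicator) simp
  finally show ?thesis by simp
 qed
 also have "\<dots> \<le> (\<integral>\<^sup>+i. ennreal (10 / c) * (\<integral>\<^sup>+t\<in>ball i (r i). g t \<partial>lborel) \<partial>count_space C)"
 proof (rule nn_integral_mono)
  fix i assume "i \<in> space (count_space C)"
  then have i: "i \<in> S" using C by auto
  have "ball i (5 * r i) = {i - 5 * r i<..<i + 5 * r i}"
   by (auto simp: ball_def dist_real_def)
  then have "emeasure lborel (ball i (5 * r i)) = ennreal (10 / c) * ennreal (c * r i)"
   using r(1)[OF i] c by (simp add: ennreal_mult[symmetric])
  also have "\<dots> \<le> ennreal (10 / c) * (\<integral>\<^sup>+t\<in>ball i (r i). g t \<partial>lborel)"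
   using r(2)[OF i] by (intro mult_left_mono) auto
  finally show "emeasure lborel (ball i (5 * r i)) \<le> \<dots>" .
 qed
 also have "\<dots> = ennreal (10 / c) * (\<integral>\<^sup>+i. (\<integral>\<^sup>+t\<in>ball i (r i). g t \<partial>lborel) \<partial>count_space C)"
  by (rule nn_integral_cmult) simp
 also have "(\<integral>\<^sup>+i. (\<integral>\<^sup>+t\<in>ball i (r i). g t \<partial>lborel) \<partial>count_space C) =
   (\<integral>\<^sup>+i. emeasure (density lborel g) (ball i (r i)) \<partial>count_space C)"
  by (intro nn_integral_cong) (simp add: emeasure_density)
 also have "\<dots> = emeasure (density lborel g) (\<Union>i\<in>C. ball i (r i))"
  by (rule emeasure_UN_countable[symmetric]) (use C disj in auto)
 also have "\<dots> \<le> emeasure (density lborel g) UNIV"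
  by (rule emeasure_mono) auto
 also have "\<dots> = (\<integral>\<^sup>+t. g t \<partial>lborel)"
  by (simp add: emeasure_density)
 finally have "emeasure lborel U \<le> ennreal (10 / c) * (\<integral>\<^sup>+t. g t \<partial>lborel)"
  by (simp add: mult_left_mono)
 moreover have "U \<in> sets lborel"
  unfolding U_def using C(1) by (intro sets.countable_UN'') auto
 ultimately show ?thesis
  using C(4) by (intro that[of U]) (auto simp: S_def U_def)
qed

text \<open>A set caught in sets of arbitrarily small measure from some index on is a null set.\<close>

lemma AE_not_eventually_in_small_sets:
 assumes U: "\<And>i. U i \<in> sets M" and lim: "(\<lambda>i. emeasure M (U i)) \<longlonglongrightarrow> 0"
 shows "AE x in M. \<not> (\<forall>\<^sub>F i in sequentially. x \<in> U i)"
proof -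
 have null: "(\<Inter>i\<in>{N..}. U i) \<in> null_sets M" for N
 proof (rule null_setsI)
  show meas: "(\<Inter>i\<in>{N..}. U i) \<in> sets M"
   using U by (intro sets.countable_INT') auto
  have "emeasure M (\<Inter>i\<in>{N..}. U i) \<le> 0"
  proof (rule LIMSEQ_le_const[OF lim], intro exI allI impI)
   fix n assume "N \<le> n"
   then show "emeasure M (\<Inter>i\<in>{N..}. U i) \<le> emeasure M (U n)"
    using U by (intro emeasure_mono) auto
  qed
  then show "emeasure M (\<Inter>i\<in>{N..}. U i) = 0" by simp
 qed
 have "(\<Union>N. \<Inter>i\<in>{N..}. U i) \<in> null_sets M"
  using null by auto
 then show ?thesis
  by (rule AE_I') (auto simp: eventually_sequentially)
qed

text \<open>Approximating \<open>A\<close> by open supersets \<open>V\<close>, a ball around a point of \<open>A\<close> that meets the complement of \<open>A\<close> substantially does so, when it is small, within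
 \<open>V - A\<close>; the weak type bound shows that such points form a small set.\<close>

lemma AE_density_point:
 fixes A :: "real set"
 assumes A: "A \<in> sets lborel"
 shows "AE x in lborel. x \<in> A \<longrightarrow>
  (\<forall>\<epsilon>>0. \<exists>\<delta>>0. \<forall>h. 0 < h \<and> h < \<delta> \<longrightarrow> emeasure lborel (ball x h - A) \<le> ennreal (\<epsilon> * h))"
proof -
 have "AE x in lborel. x \<in> A \<longrightarrow>
  (\<exists>\<delta>>0. \<forall>h. 0 < h \<and> h < \<delta> \<longrightarrow> emeasure lborel (ball x h - A) \<le> ennreal (inverse (real (Suc k)) * h))"
  for k
 proof -
  define e where "e = inverse (real (Suc k))"
  have e: "e > 0" by (simp add: e_def)
  have "\<exists>V. open V \<and> A \<subseteq> V \<and> emeasure lborel (V - A) < ennreal (inverse (real (Suc n)))" for n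
   by (rule outer_regular_lborel[of A "inverse (real (Suc n))"]) (use A in auto)
  then obtain V where V: "\<And>n. open (V n)" "\<And>n. A \<subseteq> V n"
    "\<And>n. emeasure lborel (V n - A) < ennreal (inverse (real (Suc n)))" by metis
  have Vm[measurable]: "V n - A \<in> sets borel" for n
   using V(1)[of n] A by auto
  have "\<exists>U. U \<in> sets lborel \<and> {x. \<exists>h. 0 < h \<and> h \<le> 1 \<and>
    ennreal (e * h) < (\<integral>\<^sup>+t\<in>ball x h. indicator (V n - A) t \<partial>lborel)} \<subseteq> U \<and>
    emeasure lborel U \<le> ennreal (10 / e) * (\<integral>\<^sup>+t. indicator (V n - A) t \<partial>lborel)" for n
   by (rule maximal_function_weak_type[of "indicator (V n - A) :: real \<Rightarrow> ennreal", OF _ e]) auto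
  from choice[OF allI, OF this] obtain U where U': "\<forall>n. U n \<in> sets lborel \<and> {x. \<exists>h. 0 < h \<and> h \<le> 1 \<and>
    ennreal (e * h) < (\<integral>\<^sup>+t\<in>ball x h. indicator (V n - A) t \<partial>lborel)} \<subseteq> U n \<and>
    emeasure lborel (U n) \<le> ennreal (10 / e) * (\<integral>\<^sup>+t. indicator (V n - A) t \<partial>lborel)" by (rule exE)
  note U = U'[rule_format, THEN conjunct1] U'[rule_format, THEN conjunct2, THEN conjunct1]
   U'[rule_format, THEN conjunct2, THEN conjunct2]
  have bd: "emeasure lborel (U n) \<le> ennreal (10 / e * inverse (real (Suc n)))" for n
  proof -
   have "emeasure lborel (U n) \<le> ennreal (10 / e) * emeasure lborel (V n - A)"
    using U(3)[of n] Vm by simp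
   also have "\<dots> \<le> ennreal (10 / e) * ennreal (inverse (real (Suc n)))"
    using V(3)[of n] by (intro mult_left_mono) auto
   also have "\<dots> = ennreal (10 / e * inverse (real (Suc n)))"
    using e by (intro ennreal_mult[symmetric]) auto
   finally show ?thesis .
  qed
  have "(\<lambda>n. ennreal (10 / e * inverse (real (Suc n)))) \<longlonglongrightarrow> ennreal (10 / e * 0)"
   by (intro tendsto_intros LIMSEQ_inverse_real_of_nat)
  then have "(\<lambda>n. emeasure lborel (U n)) \<longlonglongrightarrow> 0"
   by (intro tendsto_0_ennreal_le[OF _ bd]) simp
  from AE_not_eventually_in_small_sets[OF U(1) this] show ?thesis
  proof eventually_elim
   case (elim x)
   then have ex: "\<exists>n. x \<notin> U n"
    by (meson always_eventually)
   show ?case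
   proof
    assume x: "x \<in> A"
    from ex obtain n where n: "x \<notin> U n" ..
    obtain d where d: "d > 0" "ball x d \<subseteq> V n"
     using V(1,2)[of n] x openE by blast
    show "\<exists>\<delta>>0. \<forall>h. 0 < h \<and> h < \<delta> \<longrightarrow> emeasure lborel (ball x h - A) \<le> ennreal (inverse (real (Suc k)) * h)"
    proof (intro exI[of _ "min d 1"] conjI allI impI)
     fix h assume h: "0 < h \<and> h < min d 1"
     have "ball x h - A \<subseteq> ball x h \<inter> (V n - A)"
      using d h by force
     then have "emeasure lborel (ball x h - A) \<le> emeasure lborel (ball x h \<inter> (V n - A))"
      using Vm by (intro emeasure_mono) auto
     also have "\<dots> = (\<integral>\<^sup>+t. indicator (ball x h \<inter> (V n - A)) t \<partial>lborel)"
      using Vm[of n] by (intro nn_integral_indicator[symmetric]) auto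
     also have "\<dots> = (\<integral>\<^sup>+t\<in>ball x h. indicator (V n - A) t \<partial>lborel)"
      by (intro nn_integral_cong) (auto split: split_indicator)
     also have "\<dots> \<le> ennreal (e * h)"
      using n U(2)[of n] h by (force simp: not_less[symmetric])
     finally show "emeasure lborel (ball x h - A) \<le> ennreal (inverse (real (Suc k)) * h)"
      by (simp add: e_def)
    qed (use d in auto)
   qed
  qed
 qed
 then have "AE x in lborel. \<forall>k. x \<in> A \<longrightarrow>
  (\<exists>\<delta>>0. \<forall>h. 0 < h \<and> h < \<delta> \<longrightarrow> emeasure lborel (ball x h - A) \<le> ennreal (inverse (real (Suc k)) * h))"
  unfolding AE_all_countable by blast
 then show ?thesis
 proof eventually_elim
  case (elim x)
  show ?case
  proof (intro impI allI)
   fix \<epsilon> :: real assume x: "x \<in> A" and \<epsilon>: "\<epsilon> > 0"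
   obtain k where k: "inverse (real (Suc k)) < \<epsilon>"
    using \<epsilon> reals_Archimedean by blast
   obtain \<delta> where \<delta>: "\<delta> > 0" "\<And>h. 0 < h \<and> h < \<delta> \<Longrightarrow>
     emeasure lborel (ball x h - A) \<le> ennreal (inverse (real (Suc k)) * h)"
    using elim x by blast
   show "\<exists>\<delta>>0. \<forall>h. 0 < h \<and> h < \<delta> \<longrightarrow> emeasure lborel (ball x h - A) \<le> ennreal (\<epsilon> * h)"
    using k by (intro exI[of _ \<delta>] conjI allI impI \<delta>(1) order.trans[OF \<delta>(2)] ennreal_leI mult_right_mono) auto
  qed
 qed
qed

lemma lebesgue_point_add:
 fixes f g :: "real \<Rightarrow> 'a::{real_normed_vector, second_countable_topology}"
 assumes [measurable]: "f \<in> borel_measurable lborel" "g \<in> borel_measurable lborel"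
  and "lebesgue_point f x" "lebesgue_point g x"
 shows "lebesgue_point (\<lambda>x. f x + g x) x"
 unfolding lebesgue_point_def
proof (intro allI impI)
 fix \<epsilon> :: real assume \<epsilon>: "\<epsilon> > 0"
 obtain \<delta>1 where 1: "\<delta>1 > 0" "\<And>h. 0 < h \<Longrightarrow> h < \<delta>1 \<Longrightarrow>
   (\<integral>\<^sup>+t\<in>ball x h. ennreal (norm (f t - f x)) \<partial>lborel) \<le> ennreal (\<epsilon> / 2 * h)"
  using assms(3) \<epsilon> unfolding lebesgue_point_def by (meson half_gt_zero)
 obtain \<delta>2 where 2: "\<delta>2 > 0" "\<And>h. 0 < h \<Longrightarrow> h < \<delta>2 \<Longrightarrow>
   (\<integral>\<^sup>+t\<in>ball x h. ennreal (norm (g t - g x)) \<partial>lborel) \<le> ennreal (\<epsilon> / 2 * h)"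
  using assms(4) \<epsilon> unfolding lebesgue_point_def by (meson half_gt_zero)
 show "\<exists>\<delta>>0. \<forall>h. 0 < h \<and> h < \<delta> \<longrightarrow>
   (\<integral>\<^sup>+t\<in>ball x h. ennreal (norm (f t + g t - (f x + g x))) \<partial>lborel) \<le> ennreal (\<epsilon> * h)"
 proof (intro exI[of _ "min \<delta>1 \<delta>2"] conjI allI impI)
  fix h assume h: "0 < h \<and> h < min \<delta>1 \<delta>2"
  have "(\<integral>\<^sup>+t\<in>ball x h. ennreal (norm (f t + g t - (f x + g x))) \<partial>lborel) \<le>
   (\<integral>\<^sup>+t. ennreal (norm (f t - f x)) * indicator (ball x h) t + ennreal (norm (g t - g x)) * indicator (ball x h) t \<partial>lborel)"
   by (intro nn_integral_mono) (auto simp: ennreal_plus[symmetric] simp del: ennreal_plus split: split_indicator intro!: ennreal_leI norm_diff_triangle_ineq)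
  also have "\<dots> = (\<integral>\<^sup>+t\<in>ball x h. ennreal (norm (f t - f x)) \<partial>lborel) + (\<integral>\<^sup>+t\<in>ball x h. ennreal (norm (g t - g x)) \<partial>lborel)"
  proof (rule nn_integral_add)
   have [measurable]: "ball x h \<in> sets borel" by simp
   show "(\<lambda>t. ennreal (norm (f t - f x)) * indicator (ball x h) t) \<in> borel_measurable lborel"
    "(\<lambda>t. ennreal (norm (g t - g x)) * indicator (ball x h) t) \<in> borel_measurable lborel"
    by measurable
  qed
  also have "\<dots> \<le> ennreal (\<epsilon> / 2 * h) + ennreal (\<epsilon> / 2 * h)"
   using h by (intro add_mono 1 2) auto
  also have "\<dots> = ennreal (\<epsilon> * h)"
   using h \<epsilon> by (simp add: ennreal_plus[symmetric] del: ennreal_plus)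
  finally show "(\<integral>\<^sup>+t\<in>ball x h. ennreal (norm (f t + g t - (f x + g x))) \<partial>lborel) \<le> ennreal (\<epsilon> * h)" .
 qed (use 1 2 in auto)
qed

text \<open>Lebesgue's differentiation theorem. The passage to the limit in the induction over integrable
 functions is where the weak type bound enters: it makes the set where the averages of
 \<open>\<bar>f - s\<^sub>i\<bar>\<close> are large small in measure.\<close>

theorem AE_lebesgue_point:
 fixes f :: "real \<Rightarrow> 'a::{banach, second_countable_topology}"
 assumes "integrable lborel f"
 shows "AE x in lborel. lebesgue_point f x"
 using assms
proof (induction rule: integrable_induct)
 case (base A c)
 have [measurable]: "A \<in> sets borel" using base by simp
 have *: "(\<integral>\<^sup>+t\<in>ball x h. ennreal (norm (indicator A t *\<^sub>R c - indicator A x *\<^sub>R c)) \<partial>lborel) =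
   ennreal (norm c) * emeasure lborel (ball x h - (if x \<in> A then A else - A))" for x h
 proof -
  have "(\<integral>\<^sup>+t\<in>ball x h. ennreal (norm (indicator A t *\<^sub>R c - indicator A x *\<^sub>R c)) \<partial>lborel) =
    (\<integral>\<^sup>+t. ennreal (norm c) * indicator (ball x h - (if x \<in> A then A else - A)) t \<partial>lborel)"
   by (intro nn_integral_cong) (auto split: split_indicator)
  also have "\<dots> = ennreal (norm c) * emeasure lborel (ball x h - (if x \<in> A then A else - A))"
   by (subst nn_integral_cmult_indicator) auto
  finally show ?thesis .
 qed
 have "- A \<in> sets lborel" using borel_comp[of A] by simp
 from AE_density_point[OF base(1)] AE_density_point[OF this] show ?case
 proof eventually_elim
  case (elim x)
  show ?case
   unfolding lebesgue_point_def *
  proof (intro allI impI)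
   fix \<epsilon> :: real assume \<epsilon>: "\<epsilon> > 0"
   then have "\<epsilon> / (norm c + 1) > 0" by (simp add: add_nonneg_pos)
   moreover have "x \<in> (if x \<in> A then A else - A)" by simp
   ultimately have "\<exists>\<delta>>0. \<forall>h. 0 < h \<and> h < \<delta> \<longrightarrow>
     emeasure lborel (ball x h - (if x \<in> A then A else - A)) \<le> ennreal (\<epsilon> / (norm c + 1) * h)"
    using elim by presburger
   then obtain \<delta> where \<delta>: "\<delta> > 0" "\<And>h. 0 < h \<and> h < \<delta> \<Longrightarrow>
     emeasure lborel (ball x h - (if x \<in> A then A else - A)) \<le> ennreal (\<epsilon> / (norm c + 1) * h)"
    by blast
   show "\<exists>\<delta>>0. \<forall>h. 0 < h \<and> h < \<delta> \<longrightarrow>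
     ennreal (norm c) * emeasure lborel (ball x h - (if x \<in> A then A else - A)) \<le> ennreal (\<epsilon> * h)"
   proof (intro exI[of _ \<delta>] conjI allI impI \<delta>(1))
    fix h assume h: "0 < h \<and> h < \<delta>"
    have "ennreal (norm c) * emeasure lborel (ball x h - (if x \<in> A then A else - A))
      \<le> ennreal (norm c) * ennreal (\<epsilon> / (norm c + 1) * h)"
     by (intro mult_left_mono \<delta>(2) h) auto
    also have "\<dots> = ennreal (norm c * (\<epsilon> / (norm c + 1) * h))"
     using h \<epsilon> by (subst ennreal_mult) auto
    also have "\<dots> \<le> ennreal (\<epsilon> * h)"
    proof (rule ennreal_leI)
     have "norm c * (\<epsilon> / (norm c + 1) * h) = \<epsilon> * h * (norm c / (norm c + 1))" by (simp add: field_simps)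
     also have "\<dots> \<le> \<epsilon> * h * 1"
      using h \<epsilon> by (intro mult_left_mono) (auto simp: divide_simps add_nonneg_pos)
     finally show "norm c * (\<epsilon> / (norm c + 1) * h) \<le> \<epsilon> * h" by simp
    qed
    finally show "ennreal (norm c) * emeasure lborel (ball x h - (if x \<in> A then A else - A)) \<le> ennreal (\<epsilon> * h)" .
   qed
  qed
 qed
next
 case (add f g)
 then have [measurable]: "f \<in> borel_measurable lborel" "g \<in> borel_measurable lborel" by auto
 from add(3,4) show ?case
  by eventually_elim (rule lebesgue_point_add, auto)
next
 case (lim f s)
 have [measurable]: "f \<in> borel_measurable lborel" "\<And>i. s i \<in> borel_measurable lborel"
  using lim by auto
 define N where "N i = (\<integral>\<^sup>+t. ennreal (norm (f t - s i t)) \<partial>lborel)" for i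
 have N0: "N \<longlonglongrightarrow> 0"
 proof -
  have "(\<lambda>i. \<integral>\<^sup>+t. ennreal (norm (f t - s i t)) \<partial>lborel) \<longlonglongrightarrow> (\<integral>\<^sup>+(t::real). 0 \<partial>lborel)"
  proof (rule nn_integral_dominated_convergence[where w = "\<lambda>t. ennreal (3 * norm (f t))" and
     u = "\<lambda>i t. ennreal (norm (f t - s i t))" and u' = "\<lambda>t. 0"])
   show "(\<integral>\<^sup>+t. ennreal (3 * norm (f t)) \<partial>lborel) < \<infinity>"
    using lim(4) by (simp add: ennreal_mult nn_integral_cmult integrable_iff_bounded ennreal_mult_less_top)
   show "AE x in lborel. ennreal (norm (f x - s j x)) \<le> ennreal (3 * norm (f x))" for j
   proof (rule AE_I2, rule ennreal_leI)
    fix x show "norm (f x - s j x) \<le> 3 * norm (f x)"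
     using lim(3)[of x j] norm_triangle_ineq4[of "f x" "s j x"] by simp
   qed
   show "AE x in lborel. (\<lambda>i. ennreal (norm (f x - s i x))) \<longlonglongrightarrow> 0"
   proof (rule AE_I2)
    fix x
    have "(\<lambda>i. norm (f x - s i x)) \<longlonglongrightarrow> norm (f x - f x)"
     using lim(2)[of x] by (intro tendsto_intros) auto
    then show "(\<lambda>i. ennreal (norm (f x - s i x))) \<longlonglongrightarrow> 0"
     using tendsto_ennrealI by fastforce
   qed
  qed auto
  then show ?thesis by (simp add: N_def[abs_def])
 qed
 have "AE x in lborel. \<exists>\<delta>>0. \<forall>h. 0 < h \<and> h < \<delta> \<longrightarrow>
  (\<integral>\<^sup>+t\<in>ball x h. ennreal (norm (f t - f x)) \<partial>lborel) \<le> ennreal (inverse (real (Suc k)) * h)" for k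
 proof -
  define e where "e = inverse (real (Suc k)) / 4"
  have e: "e > 0" by (simp add: e_def)
  have "\<exists>U. U \<in> sets lborel \<and> {x. \<exists>h. 0 < h \<and> h \<le> 1 \<and>
    ennreal (e * h) < (\<integral>\<^sup>+t\<in>ball x h. ennreal (norm (f t - s n t)) \<partial>lborel)} \<subseteq> U \<and>
    emeasure lborel U \<le> ennreal (10 / e) * N n" for n
   unfolding N_def by (rule maximal_function_weak_type[of "\<lambda>t. ennreal (norm (f t - s n t))", OF _ e]) auto
  from choice[OF allI, OF this] obtain U where U': "\<forall>n. U n \<in> sets lborel \<and> {x. \<exists>h. 0 < h \<and> h \<le> 1 \<and>
    ennreal (e * h) < (\<integral>\<^sup>+t\<in>ball x h. ennreal (norm (f t - s n t)) \<partial>lborel)} \<subseteq> U n \<and>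
    emeasure lborel (U n) \<le> ennreal (10 / e) * N n" by (rule exE)
  note U = U'[rule_format, THEN conjunct1] U'[rule_format, THEN conjunct2, THEN conjunct1]
   U'[rule_format, THEN conjunct2, THEN conjunct2]
  have "(\<lambda>n. ennreal (10 / e) * N n) \<longlonglongrightarrow> ennreal (10 / e) * 0"
   by (rule ennreal_tendsto_cmult[OF _ N0]) (simp add: ennreal_less_top)
  then have "(\<lambda>n. emeasure lborel (U n)) \<longlonglongrightarrow> 0"
   by (intro tendsto_0_ennreal_le[OF _ U(3)]) simp
  note AE_not_eventually_in_small_sets[OF U(1) this]
  moreover have "AE x in lborel. \<forall>i. lebesgue_point (s i) x"
   using lim(5) by (simp add: AE_all_countable)
  ultimately show ?thesis
  proof eventually_elim
   case (elim x)
   have "\<forall>\<^sub>F n in sequentially. dist (s n x) (f x) < e"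
    using lim(2)[of x] e tendstoD by force
   have "\<exists>n. x \<notin> U n \<and> dist (s n x) (f x) < e"
   proof (rule ccontr)
    assume "\<not> ?thesis"
    then have "x \<in> U n" if "dist (s n x) (f x) < e" for n using that by blast
    with \<open>\<forall>\<^sub>F n in sequentially. dist (s n x) (f x) < e\<close> have "\<forall>\<^sub>F n in sequentially. x \<in> U n"
     by (rule eventually_mono)
    with elim(1) show False by simp
   qed
   then obtain n where n: "x \<notin> U n" "dist (s n x) (f x) < e" by blast
   obtain \<delta> where \<delta>: "\<delta> > 0" "\<And>h. 0 < h \<and> h < \<delta> \<Longrightarrow>
     (\<integral>\<^sup>+t\<in>ball x h. ennreal (norm (s n t - s n x)) \<partial>lborel) \<le> ennreal (e * h)"
    using elim(2) e unfolding lebesgue_point_def by blast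
   show ?case
   proof (intro exI[of _ "min \<delta> 1"] conjI allI impI)
    fix h assume h: "0 < h \<and> h < min \<delta> 1"
    have "(\<integral>\<^sup>+t\<in>ball x h. ennreal (norm (f t - f x)) \<partial>lborel) \<le>
     (\<integral>\<^sup>+t. ennreal (norm (f t - s n t)) * indicator (ball x h) t +
      (ennreal (norm (s n t - s n x)) * indicator (ball x h) t + ennreal e * indicator (ball x h) t) \<partial>lborel)"
    proof (rule nn_integral_mono)
     fix t
     have "norm (f t - f x) \<le> norm (f t - s n t) + (norm (s n t - s n x) + norm (s n x - f x))"
      by norm
     then have "norm (f t - f x) \<le> norm (f t - s n t) + (norm (s n t - s n x) + e)"
      using n(2) by (simp add: dist_norm)
     then show "ennreal (norm (f t - f x)) * indicator (ball x h) t \<le> ennreal (norm (f t - s n t)) * indicator (ball x h) t +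
      (ennreal (norm (s n t - s n x)) * indicator (ball x h) t + ennreal e * indicator (ball x h) t)"
      using e by (auto simp: ennreal_plus[symmetric] simp del: ennreal_plus split: split_indicator)
    qed
    also have "\<dots> = (\<integral>\<^sup>+t\<in>ball x h. ennreal (norm (f t - s n t)) \<partial>lborel) +
     ((\<integral>\<^sup>+t\<in>ball x h. ennreal (norm (s n t - s n x)) \<partial>lborel) + (\<integral>\<^sup>+t\<in>ball x h. ennreal e \<partial>lborel))"
    proof -
     have [measurable]: "ball x h \<in> sets borel" by simp
     show ?thesis
      by (subst nn_integral_add, measurable, subst nn_integral_add, measurable)
    qed
    also have "\<dots> \<le> ennreal (e * h) + (ennreal (e * h) + ennreal (e * (2 * h)))"
    proof (intro add_mono)
     show "(\<integral>\<^sup>+t\<in>ball x h. ennreal (norm (f t - s n t)) \<partial>lborel) \<le> ennreal (e * h)"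
      using n(1) U(2)[of n] h by (force simp: not_less[symmetric])
     show "(\<integral>\<^sup>+t\<in>ball x h. ennreal (norm (s n t - s n x)) \<partial>lborel) \<le> ennreal (e * h)"
      using \<delta>(2) h by auto
     have "ball x h = {x - h<..<x + h}" by (auto simp: ball_def dist_real_def)
     then have "emeasure lborel (ball x h) = ennreal (2 * h)" using h by simp
     then show "(\<integral>\<^sup>+t\<in>ball x h. ennreal e \<partial>lborel) \<le> ennreal (e * (2 * h))"
      using e h by (simp add: nn_integral_cmult_indicator ennreal_mult)
    qed
    also have "\<dots> = ennreal (inverse (real (Suc k)) * h)"
     using e h by (simp add: ennreal_plus[symmetric] e_def algebra_simps del: ennreal_plus)
    finally show "(\<integral>\<^sup>+t\<in>ball x h. ennreal (norm (f t - f x)) \<partial>lborel) \<le> ennreal (inverse (real (Suc k)) * h)" .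
   qed (use \<delta> in auto)
  qed
 qed
 then have "AE x in lborel. \<forall>k. \<exists>\<delta>>0. \<forall>h. 0 < h \<and> h < \<delta> \<longrightarrow>
  (\<integral>\<^sup>+t\<in>ball x h. ennreal (norm (f t - f x)) \<partial>lborel) \<le> ennreal (inverse (real (Suc k)) * h)"
  by (simp add: AE_all_countable)
 then show ?case
 proof eventually_elim
  case (elim x)
  show ?case unfolding lebesgue_point_def
  proof (intro allI impI)
   fix \<epsilon> :: real assume "\<epsilon> > 0"
   then obtain k where k: "inverse (real (Suc k)) < \<epsilon>" using reals_Archimedean by blast
   obtain \<delta> where \<delta>: "\<delta> > 0" "\<And>h. 0 < h \<and> h < \<delta> \<Longrightarrow>
     (\<integral>\<^sup>+t\<in>ball x h. ennreal (norm (f t - f x)) \<partial>lborel) \<le> ennreal (inverse (real (Suc k)) * h)"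
    using elim by blast
   show "\<exists>\<delta>>0. \<forall>h. 0 < h \<and> h < \<delta> \<longrightarrow>
     (\<integral>\<^sup>+t\<in>ball x h. ennreal (norm (f t - f x)) \<partial>lborel) \<le> ennreal (\<epsilon> * h)"
    using k by (intro exI[of _ \<delta>] conjI allI impI \<delta>(1) order.trans[OF \<delta>(2)] ennreal_leI mult_right_mono) auto
  qed
 qed
qed

section \<open>Nontangential convergence at Lebesgue points\<close>

text \<open>The unit circle is represented by the angle in \<open>[0, 2\<pi>]\<close>. Both endpoints stand for the point \<open>1\<close>, which is harmless as they form a null set.\<close>

definition circle :: "real measure" where
 "circle = restrict_space lborel {0..2*pi}"

lemma space_circle [simp]: "space circle = {0..2*pi}"
 by (simp add: circle_def space_restrict_space)

lemma sets_circle [measurable_cong]: "sets circle = sets (restrict_space borel {0..2*pi})"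
 unfolding circle_def by (rule sets_restrict_space_cong) simp

lemma borel_measurable_circle:
 "f \<in> borel_measurable borel \<Longrightarrow> f \<in> borel_measurable circle"
 unfolding circle_def by (rule measurable_restrict_space1) simp

lemma borel_measurable_circle_continuous:
 "continuous_on {0..2*pi} f \<Longrightarrow> f \<in> borel_measurable circle"
 using borel_measurable_continuous_on_restrict[of "{0..2*pi}" f]
 by (subst measurable_cong_sets[OF sets_circle refl])

lemma finite_measure_circle: "finite_measure circle"
 unfolding circle_def
 by (rule finite_measureI) (simp add: emeasure_restrict_space space_restrict_space)

lemma measure_circle [simp]: "measure circle {0..2*pi} = 2 * pi"
 by (simp add: circle_def measure_restrict_space)

lemma emeasure_circle [simp]: "emeasure circle {0..2*pi} = ennreal (2 * pi)"
 by (simp add: circle_def emeasure_restrict_space)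

lemma integrable_circle_bounded:
 fixes f :: "real \<Rightarrow> 'a::{banach, second_countable_topology}"
 assumes "f \<in> borel_measurable circle" "\<And>t. t \<in> {0..2*pi} \<Longrightarrow> norm (f t) \<le> B"
 shows "integrable circle f"
 by (rule finite_measure.integrable_const_bound[OF finite_measure_circle, of _ B])
  (use assms in \<open>auto intro!: AE_I2\<close>)

lemma integrable_circle_continuous:
 fixes f :: "real \<Rightarrow> 'a::{banach, second_countable_topology}"
 assumes "continuous_on {0..2*pi} f"
 shows "integrable circle f"
proof -
 have "compact (f ` {0..2*pi})"
  using assms by (intro compact_continuous_image) auto
 then obtain B where "\<And>t. t \<in> {0..2*pi} \<Longrightarrow> norm (f t) \<le> B"
  using compact_imp_bounded bounded_iff by (metis imageI)
 then show ?thesis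
  using borel_measurable_circle_continuous[OF assms] integrable_circle_bounded by blast
qed

lemma nn_integral_circle:
 "(\<integral>\<^sup>+t. f t \<partial>circle) = (\<integral>\<^sup>+t\<in>{0..2*pi}. f t \<partial>lborel)"
 unfolding circle_def by (rule nn_integral_restrict_space) simp

lemma AE_circle: "(AE t in circle. P t) \<longleftrightarrow> (AE t in lborel. t \<in> {0..2*pi} \<longrightarrow> P t)"
 unfolding circle_def by (rule AE_restrict_space_iff) simp

lemma AE_circle_interior: "AE t in circle. 0 < t \<and> t < 2 * pi"
proof -
 have "AE t in lborel. t \<noteq> (0::real)" "AE t in lborel. t \<noteq> 2 * pi"
  by (rule AE_lborel_singleton)+
 then show ?thesis unfolding AE_circle
  by eventually_elim auto
qed

lemma circle_has_integral:
 fixes f :: "real \<Rightarrow> 'a::euclidean_space"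
 assumes "integrable circle f"
 shows "(f has_integral (\<integral>t. f t \<partial>circle)) {0..2*pi}"
proof -
 have *: "set_integrable lborel {0..2*pi} f"
  using assms by (simp add: circle_def integrable_restrict_space set_integrable_def)
 have "(\<integral>t. f t \<partial>circle) = (LINT t:{0..2*pi}|lborel. f t)"
  by (simp add: circle_def integral_restrict_space set_lebesgue_integral_def)
 then show ?thesis
  using set_borel_integral_eq_integral[OF *] by (simp add: has_integral_iff)
qed

text \<open>The angles \<open>0\<close> and \<open>2\<pi>\<close> are excluded because a neighbourhood of \<open>1\<close> on the circle is not an interval of angles.\<close>

definition circle_lebesgue_point :: "(real \<Rightarrow> 'a::real_normed_vector) \<Rightarrow> real \<Rightarrow> bool" where
 "circle_lebesgue_point f x \<longleftrightarrow>
  0 < x \<and> x < 2 * pi \<and> lebesgue_point (\<lambda>t. indicator {0..2*pi} t *\<^sub>R f t) x"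

lemma AE_circle_lebesgue_point:
 fixes f :: "real \<Rightarrow> 'a::{banach, second_countable_topology}"
 assumes "integrable circle f"
 shows "AE x in circle. circle_lebesgue_point f x"
proof -
 have "integrable lborel (\<lambda>t. indicator {0..2*pi} t *\<^sub>R f t)"
  using assms by (simp add: circle_def integrable_restrict_space)
 from AE_lebesgue_point[OF this]
 have "AE x in circle. lebesgue_point (\<lambda>t. indicator {0..2*pi} t *\<^sub>R f t) x"
  unfolding AE_circle by eventually_elim auto
 with AE_circle_interior show ?thesis
  unfolding circle_lebesgue_point_def by eventually_elim auto
qed

text \<open>Cutting the kernel \<open>h / (h\<^sup>2 + (t - x)\<^sup>2)\<close> into dyadic shells around \<open>x\<close> bounds its action by
 averages over balls, which are small at a Lebesgue point.\<close>

lemma circle_lebesgue_point_kernel: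
 fixes f :: "real \<Rightarrow> 'a::{banach, second_countable_topology}"
 assumes int: "integrable circle f" and lp: "circle_lebesgue_point f x" and \<epsilon>: "0 < \<epsilon>"
 obtains \<delta> where "\<delta> > 0"
  "\<And>h. 0 < h \<Longrightarrow> h < \<delta> \<Longrightarrow>
   (\<integral>\<^sup>+t. ennreal (h / (h\<^sup>2 + (t - x)\<^sup>2) * norm (f t - f x)) \<partial>circle) \<le> ennreal \<epsilon>"
proof -
 define F where "F t = indicator {0..2*pi} t *\<^sub>R f t" for t
 have F_int: "integrable lborel F"
  using int by (simp add: circle_def integrable_restrict_space F_def[abs_def])
 then have [measurable]: "F \<in> borel_measurable borel" by auto
 have x: "0 < x" "x < 2 * pi" and "lebesgue_point F x"
  using lp by (auto simp: circle_lebesgue_point_def F_def[abs_def])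
 then have Fx: "F x = f x" by (simp add: F_def)
 have "\<epsilon> / 16 > 0" using \<epsilon> by simp
 then obtain \<delta>0 where \<delta>0: "\<delta>0 > 0" "\<And>h. 0 < h \<Longrightarrow> h < \<delta>0 \<Longrightarrow>
   (\<integral>\<^sup>+t\<in>ball x h. ennreal (norm (F t - F x)) \<partial>lborel) \<le> ennreal (\<epsilon> / 16 * h)"
  using \<open>lebesgue_point F x\<close>[unfolded lebesgue_point_def, rule_format, OF \<open>\<epsilon> / 16 > 0\<close>] by auto
 define d where "d = \<delta>0 / 2"
 have d: "0 < d" "d < \<delta>0" using \<delta>0 by (auto simp: d_def)
 define g where "g t = ennreal (norm (F t - F x)) * indicator {0..2*pi} t" for t
 have [measurable]: "g \<in> borel_measurable borel" unfolding g_def by measurable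
 define I where "I = (\<integral>\<^sup>+t. g t \<partial>lborel)"
 have "I = (\<integral>\<^sup>+t. ennreal (norm (f t - f x)) \<partial>circle)"
  unfolding I_def nn_integral_circle g_def Fx
  by (intro nn_integral_cong) (auto simp: F_def split: split_indicator)
 also have "\<dots> < \<infinity>"
 proof -
  have "integrable circle (\<lambda>t. f t - f x)"
   using int finite_measure.integrable_const[OF finite_measure_circle] by (intro Bochner_Integration.integrable_diff)
  then show ?thesis by (simp add: integrable_iff_bounded)
 qed
 finally obtain I' where I': "I = ennreal I'" "I' \<ge> 0"
  by (cases I) auto
 \<comment> \<open>Small enough for the part of the circle at distance at least \<open>d\<close> from \<open>x\<close>.\<close>
 define \<delta> where "\<delta> = \<epsilon> * d\<^sup>2 / (2 * (I' + 1))"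
 have \<delta>: "\<delta> > 0" using \<epsilon> d I' by (simp add: \<delta>_def add_nonneg_pos)
 have bd: "(\<integral>\<^sup>+t\<in>ball x (min (2 ^ k * h) d). g t \<partial>lborel) \<le> ennreal (\<epsilon> / 16 * (2 ^ k * h))"
  if "h > 0" for k h
 proof -
  have "(\<integral>\<^sup>+t\<in>ball x (min (2 ^ k * h) d). g t \<partial>lborel) \<le>
    (\<integral>\<^sup>+t\<in>ball x (min (2 ^ k * h) d). ennreal (norm (F t - F x)) \<partial>lborel)"
   by (intro nn_integral_mono) (auto simp: g_def split: split_indicator)
  also have "\<dots> \<le> ennreal (\<epsilon> / 16 * min (2 ^ k * h) d)"
   using that d by (intro \<delta>0(2)) auto
  also have "\<dots> \<le> ennreal (\<epsilon> / 16 * (2 ^ k * h))"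
   using \<epsilon> by (intro ennreal_leI mult_left_mono) auto
  finally show ?thesis .
 qed
 show ?thesis
 proof (rule that[OF \<delta>])
  fix h assume h: "0 < h" "h < \<delta>"
  \<comment> \<open>\<open>c k\<close> bounds the kernel outside the ball of radius \<open>2\<^sup>k\<^sup>-\<^sup>1 h\<close>; its product with the radius \<open>2\<^sup>k h\<close> decays geometrically.\<close>
  define c where "c k = 4 / (4 ^ k * h)" for k :: nat
  have c0: "c k \<ge> 0" for k using h by (simp add: c_def)
  have point: "ennreal (h / (h\<^sup>2 + (t - x)\<^sup>2)) * g t \<le>
    ennreal (h / d\<^sup>2) * g t + (\<Sum>k. ennreal (c k) * (g t * indicator (ball x (min (2 ^ k * h) d)) t))" for t
  proof (cases "\<bar>t - x\<bar> < d")
   case False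
   then have "d\<^sup>2 \<le> (t - x)\<^sup>2" using d by (simp add: abs_le_square_iff[symmetric])
   then have "h / (h\<^sup>2 + (t - x)\<^sup>2) \<le> h / d\<^sup>2"
    using h d by (intro divide_left_mono) (auto intro!: mult_pos_pos add_pos_nonneg add_increasing)
   then have "ennreal (h / (h\<^sup>2 + (t - x)\<^sup>2)) * g t \<le> ennreal (h / d\<^sup>2) * g t"
    by (intro mult_right_mono ennreal_leI) auto
   then show ?thesis by (simp add: add_increasing2)
  next
   case True
   have "\<exists>k. \<bar>t - x\<bar> < 2 ^ k * h"
    using real_arch_pow[of 2 "\<bar>t - x\<bar> / h"] h by (auto simp: field_simps)
   define k where "k = (LEAST k. \<bar>t - x\<bar> < 2 ^ k * h)"
   have k: "\<bar>t - x\<bar> < 2 ^ k * h" unfolding k_def by (rule LeastI_ex) fact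
   have le: "h / (h\<^sup>2 + (t - x)\<^sup>2) \<le> c k"
   proof (cases k)
    case 0
    have "h / (h\<^sup>2 + (t - x)\<^sup>2) \<le> h / h\<^sup>2"
     using h by (intro divide_left_mono) (auto intro!: mult_pos_pos add_pos_nonneg)
    also have "\<dots> \<le> c k" using h 0 by (simp add: c_def power2_eq_square divide_simps)
    finally show ?thesis .
   next
    case (Suc j)
    then have "\<not> \<bar>t - x\<bar> < 2 ^ j * h"
     using not_less_Least[of j "\<lambda>k. \<bar>t - x\<bar> < 2 ^ k * h"] by (simp add: k_def)
    then have "(2 ^ j * h)\<^sup>2 \<le> (t - x)\<^sup>2" using h by (simp add: abs_le_square_iff[symmetric])
    then have "h / (h\<^sup>2 + (t - x)\<^sup>2) \<le> h / (2 ^ j * h)\<^sup>2"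
     using h by (intro divide_left_mono) (auto intro!: mult_pos_pos add_pos_nonneg add_increasing)
    also have "\<dots> = c k"
    proof -
     have "(2 ^ j * h)\<^sup>2 = 4 ^ j * h * h" by (simp add: power2_eq_square power_mult_distrib[symmetric])
     then show ?thesis using h Suc by (simp add: c_def)
    qed
    finally show ?thesis .
   qed
   have "ennreal (h / (h\<^sup>2 + (t - x)\<^sup>2)) * g t \<le> ennreal (c k) * (g t * indicator (ball x (min (2 ^ k * h) d)) t)"
    using k True le by (auto intro!: mult_right_mono ennreal_leI simp: dist_real_def abs_minus_commute)
   also have "\<dots> \<le> (\<Sum>k. ennreal (c k) * (g t * indicator (ball x (min (2 ^ k * h) d)) t))"
    using sum_le_suminf[OF summableI, of "{k}" "\<lambda>k. ennreal (c k) * (g t * indicator (ball x (min (2 ^ k * h) d)) t)"] by simp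
   finally show ?thesis by (simp add: add_increasing)
  qed
  have [measurable]: "ball x r \<in> sets borel" for r by simp
  have "(\<integral>\<^sup>+t. ennreal (h / (h\<^sup>2 + (t - x)\<^sup>2) * norm (f t - f x)) \<partial>circle) =
    (\<integral>\<^sup>+t. ennreal (h / (h\<^sup>2 + (t - x)\<^sup>2)) * g t \<partial>lborel)"
   unfolding nn_integral_circle g_def Fx using h
   by (intro nn_integral_cong) (auto simp: F_def ennreal_mult[symmetric] split: split_indicator)
  also have "\<dots> \<le> (\<integral>\<^sup>+t. ennreal (h / d\<^sup>2) * g t + (\<Sum>k. ennreal (c k) * (g t * indicator (ball x (min (2 ^ k * h) d)) t)) \<partial>lborel)"
   by (intro nn_integral_mono point)
  also have "\<dots> = ennreal (h / d\<^sup>2) * I + (\<Sum>k. ennreal (c k) * (\<integral>\<^sup>+t. g t * indicator (ball x (min (2 ^ k * h) d)) t \<partial>lborel))"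
   unfolding I_def
   by (subst nn_integral_add, measurable, subst nn_integral_cmult, measurable,
     subst nn_integral_suminf, measurable, subst nn_integral_cmult, measurable)
  also have "\<dots> \<le> ennreal (\<epsilon> / 2) + (\<Sum>k. ennreal (\<epsilon> / 4 * (1 / 2) ^ k))"
  proof (intro add_mono suminf_le summableI)
   have "h / d\<^sup>2 * I' \<le> \<epsilon> / 2"
   proof -
    have "h * I' \<le> \<delta> * (I' + 1)" using h I' \<delta> by (intro mult_mono) auto
    also have "\<dots> = \<epsilon> / 2 * d\<^sup>2" using I' by (simp add: \<delta>_def divide_simps add_nonneg_eq_0_iff)
    finally show ?thesis using d by (simp add: divide_simps)
   qed
   then show "ennreal (h / d\<^sup>2) * I \<le> ennreal (\<epsilon> / 2)"
    using h I' by (simp add: ennreal_mult[symmetric] ennreal_leI)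
   fix k
   have "ennreal (c k) * (\<integral>\<^sup>+t. g t * indicator (ball x (min (2 ^ k * h) d)) t \<partial>lborel) \<le>
    ennreal (c k) * ennreal (\<epsilon> / 16 * (2 ^ k * h))"
    by (intro mult_left_mono bd h) auto
   also have "\<dots> = ennreal (c k * (\<epsilon> / 16 * (2 ^ k * h)))"
    using h \<epsilon> c0 by (intro ennreal_mult[symmetric]) auto
   also have "c k * (\<epsilon> / 16 * (2 ^ k * h)) = \<epsilon> / 4 * (1 / 2) ^ k"
   proof -
    have "(4::real) ^ k = 2 ^ k * 2 ^ k" by (simp add: power_mult_distrib[symmetric])
    then show ?thesis using h by (simp add: c_def power_divide)
   qed
   finally show "ennreal (c k) * (\<integral>\<^sup>+t. g t * indicator (ball x (min (2 ^ k * h) d)) t \<partial>lborel) \<le> ennreal (\<epsilon> / 4 * (1 / 2) ^ k)" .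
  qed
  also have "(\<Sum>k. ennreal (\<epsilon> / 4 * (1 / 2) ^ k)) = ennreal (\<epsilon> / 2)"
  proof (rule suminf_ennreal_eq)
   show "(\<lambda>k. \<epsilon> / 4 * (1 / 2) ^ k) sums (\<epsilon> / 2)"
    using sums_mult[OF geometric_sums[of "1/2::real"], of "\<epsilon> / 4"] by simp
  qed (use \<epsilon> in auto)
  also have "ennreal (\<epsilon> / 2) + ennreal (\<epsilon> / 2) = ennreal \<epsilon>"
   using \<epsilon> by (simp add: ennreal_plus[symmetric] del: ennreal_plus)
  finally show "(\<integral>\<^sup>+t. ennreal (h / (h\<^sup>2 + (t - x)\<^sup>2) * norm (f t - f x)) \<partial>circle) \<le> ennreal \<epsilon>" .
 qed
qed

definition stolz :: "real \<Rightarrow> complex \<Rightarrow> complex set" where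
 "stolz \<beta> \<zeta> = {w. cmod w < 1 \<and> dist w \<zeta> < \<beta> * (1 - cmod w)}"

text \<open>Nontangential limits: the angle of the Stolz region is arbitrary, but the limit is not uniform in it. The region \<open>stolz \<beta> \<zeta>\<close> is empty for \<open>\<beta> \<le> 1\<close>.\<close>

definition ntlim :: "(complex \<Rightarrow> 'a::topological_space) \<Rightarrow> complex \<Rightarrow> 'a \<Rightarrow> bool" where
 "ntlim f \<zeta> L \<longleftrightarrow> (\<forall>\<beta>>1. (f \<longlongrightarrow> L) (at \<zeta> within stolz \<beta> \<zeta>))"

lemma continuous_on_cis' [continuous_intros]:
 "continuous_on A f \<Longrightarrow> continuous_on A (\<lambda>x. cis (f x))"
 by (simp add: cis_conv_exp continuous_intros)

lemma cis_eq_imp_eq: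
 assumes "cis t = cis x" "\<bar>t - x\<bar> < 2 * pi"
 shows "t = x"
proof -
 have "sin t = sin x \<and> cos t = cos x" using assms(1) by (simp add: complex_eq_iff)
 then obtain n :: int where n: "t = x + 2 * pi * n" using sin_cos_eq_iff by blast
 then have "\<bar>2 * pi * n\<bar> < 2 * pi" using assms(2) by simp
 then have "\<bar>real_of_int n\<bar> < 1" by (simp add: abs_mult)
 then have "n = 0" by linarith
 with n show ?thesis by simp
qed

text \<open>Close to \<open>x\<close> the chord is comparable to the arc; elsewhere it is bounded below by compactness, as \<open>x\<close> is not an endpoint.\<close>

lemma chord_lower_bound:
 assumes x: "0 < x" "x < 2 * pi"
 obtains c where "0 < c" "\<And>t. t \<in> {0..2*pi} \<Longrightarrow> c * \<bar>t - x\<bar> \<le> cmod (cis t - cis x)"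
proof -
 have "(sin has_field_derivative 1) (at (0::real))" using DERIV_sin[of "0::real"] by simp
 then have "((\<lambda>h::real. sin h / h) \<longlongrightarrow> 1) (at 0)" by (simp add: has_field_derivative_iff)
 then have "\<forall>\<^sub>F h::real in at 0. 1 / 2 < sin h / h" by (rule order_tendstoD) simp
 then obtain \<delta> where \<delta>: "\<delta> > 0" "\<And>h::real. h \<noteq> 0 \<Longrightarrow> \<bar>h\<bar> < \<delta> \<Longrightarrow> 1 / 2 < sin h / h"
  by (auto simp: eventually_at)
 have near: "1 / 2 * \<bar>t - x\<bar> \<le> cmod (cis t - cis x)" if "\<bar>t - x\<bar> < \<delta>" for t
 proof (cases "t = x")
  case False
  then have "1 / 2 < \<bar>sin (t - x) / (t - x)\<bar>" using \<delta>(2)[of "t - x"] that by linarith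
  then have "1 / 2 * \<bar>t - x\<bar> \<le> \<bar>sin (t - x)\<bar>" using False by (simp add: field_simps)
  also have "sin (t - x) = Im ((cis t - cis x) * cis (- x))" by (simp add: algebra_simps cis_mult sin_diff)
  also have "\<bar>\<dots>\<bar> \<le> cmod ((cis t - cis x) * cis (- x))" by (rule abs_Im_le_cmod)
  finally show ?thesis by (simp add: norm_mult)
 qed simp
 define K where "K = {0..2*pi} - ball x \<delta>"
 have "compact K" unfolding K_def by (intro compact_diff) auto
 have far: "\<exists>c>0. \<forall>t\<in>K. c \<le> cmod (cis t - cis x)"
 proof (cases "K = {}")
  case False
  have "continuous_on K (\<lambda>t. cmod (cis t - cis x))" by (intro continuous_intros)
  from continuous_attains_inf[OF \<open>compact K\<close> False this]
  obtain t0 where t0: "t0 \<in> K" "\<And>t. t \<in> K \<Longrightarrow> cmod (cis t0 - cis x) \<le> cmod (cis t - cis x)" by auto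
  have "cis t0 \<noteq> cis x"
  proof
   assume "cis t0 = cis x"
   moreover have "\<bar>t0 - x\<bar> < 2 * pi" using t0(1) x by (auto simp: K_def abs_if)
   ultimately have "t0 = x" by (rule cis_eq_imp_eq)
   then show False using t0(1) \<delta>(1) by (simp add: K_def)
  qed
  then show ?thesis using t0 by (intro exI[of _ "cmod (cis t0 - cis x)"]) auto
 qed (auto intro: exI[of _ 1])
 then obtain c where c: "c > 0" "\<And>t. t \<in> K \<Longrightarrow> c \<le> cmod (cis t - cis x)" by blast
 show ?thesis
 proof (rule that[of "min (1 / 2) (c / (2 * pi))"])
  show "0 < min (1 / 2) (c / (2 * pi))" using c by simp
  fix t assume t: "t \<in> {0..2*pi}"
  show "min (1 / 2) (c / (2 * pi)) * \<bar>t - x\<bar> \<le> cmod (cis t - cis x)"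
  proof (cases "\<bar>t - x\<bar> < \<delta>")
   case True
   have "min (1 / 2) (c / (2 * pi)) * \<bar>t - x\<bar> \<le> 1 / 2 * \<bar>t - x\<bar>" by (intro mult_right_mono) auto
   then show ?thesis using near[OF True] by linarith
  next
   case False
   have "min (1 / 2) (c / (2 * pi)) * \<bar>t - x\<bar> \<le> c / (2 * pi) * (2 * pi)"
    using c t x by (intro mult_mono) auto
   also have "\<dots> = c" by simp
   also have "c \<le> cmod (cis t - cis x)" using t False by (intro c(2)) (auto simp: K_def dist_real_def)
   finally show ?thesis .
  qed
 qed
qed

text \<open>Within a Stolz region the Poisson kernel is therefore at most a multiple of \<open>h / (h\<^sup>2 + (t - x)\<^sup>2)\<close> with \<open>h = 1 - \<bar>w\<bar>\<close>, a kernel that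
 depends on \<open>w\<close> through its modulus alone.\<close>

lemma stolz_chord_lower_bound:
 assumes x: "0 < x" "x < 2 * pi" and \<beta>: "\<beta> > 0"
 obtains c where "0 < c" "\<And>t w. t \<in> {0..2*pi} \<Longrightarrow> w \<in> stolz \<beta> (cis x) \<Longrightarrow>
  c * ((1 - cmod w)\<^sup>2 + (t - x)\<^sup>2) \<le> (cmod (cis t - w))\<^sup>2"
proof -
 obtain c where c: "0 < c" "\<And>t. t \<in> {0..2*pi} \<Longrightarrow> c * \<bar>t - x\<bar> \<le> cmod (cis t - cis x)"
  using chord_lower_bound[OF x] by blast
 define b where "b = c / (1 + \<beta>)"
 have b: "b > 0" using c \<beta> by (simp add: b_def)
 show ?thesis
 proof (rule that[of "min 1 (b\<^sup>2) / 2"])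
  show "0 < min 1 (b\<^sup>2) / 2" using b by simp
  fix t w assume t: "t \<in> {0..2*pi}" and w: "w \<in> stolz \<beta> (cis x)"
  define m where "m = cmod (cis t - w)"
  have w1: "cmod w < 1" "dist w (cis x) < \<beta> * (1 - cmod w)" using w by (auto simp: stolz_def)
  have h: "1 - cmod w \<le> m"
   using norm_triangle_ineq2[of "cis t" w] by (simp add: m_def)
  have "c * \<bar>t - x\<bar> \<le> cmod (cis t - cis x)" by (rule c(2)[OF t])
  also have "\<dots> \<le> m + dist w (cis x)"
   unfolding m_def dist_norm by norm
  also have "\<dots> \<le> m + \<beta> * m" using w1 h \<beta> by (smt (verit) mult_left_mono)
  finally have "b * \<bar>t - x\<bar> \<le> m" using \<beta> by (simp add: b_def field_simps)
  then have 1: "b\<^sup>2 * (t - x)\<^sup>2 \<le> m\<^sup>2"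
   using b power_mono[of "b * \<bar>t - x\<bar>" m 2] by (simp add: power_mult_distrib)
  have 2: "(1 - cmod w)\<^sup>2 \<le> m\<^sup>2" using h w1 by (intro power_mono) auto
  have "min 1 (b\<^sup>2) * (1 - cmod w)\<^sup>2 \<le> 1 * (1 - cmod w)\<^sup>2" "min 1 (b\<^sup>2) * (t - x)\<^sup>2 \<le> b\<^sup>2 * (t - x)\<^sup>2"
   by (intro mult_right_mono; simp)+
  with 1 2 show "min 1 (b\<^sup>2) / 2 * ((1 - cmod w)\<^sup>2 + (t - x)\<^sup>2) \<le> (cmod (cis t - w))\<^sup>2"
   unfolding m_def[symmetric] by (simp add: algebra_simps)
 qed
qed

definition poisson :: "complex \<Rightarrow> real \<Rightarrow> real" where
 "poisson w t = (1 - (cmod w)\<^sup>2) / (cmod (cis t - w))\<^sup>2"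

lemma cis_minus_ne_0: "cmod w < 1 \<Longrightarrow> cis t - w \<noteq> 0"
 by (metis eq_iff_diff_eq_0 less_irrefl norm_cis)

lemma poisson_nonneg: "cmod w < 1 \<Longrightarrow> 0 \<le> poisson w t"
 by (simp add: poisson_def power_le_one)

lemma continuous_on_poisson [continuous_intros]: "cmod w < 1 \<Longrightarrow> continuous_on A (poisson w)"
 unfolding poisson_def[abs_def] by (intro continuous_intros) (use cis_minus_ne_0 in force)

lemma poisson_lebesgue_point:
 fixes f :: "real \<Rightarrow> 'a::{banach, second_countable_topology}"
 assumes int: "integrable circle f" and lp: "circle_lebesgue_point f x"
  and \<beta>: "\<beta> > 1" and \<epsilon>: "\<epsilon> > 0"
 shows "\<forall>\<^sub>F w in at (cis x) within stolz \<beta> (cis x).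
  (\<integral>\<^sup>+t. ennreal (poisson w t * norm (f t - f x)) \<partial>circle) \<le> ennreal \<epsilon>"
proof -
 have x: "0 < x" "x < 2 * pi" using lp by (auto simp: circle_lebesgue_point_def)
 obtain c where c: "0 < c" "\<And>t w. t \<in> {0..2*pi} \<Longrightarrow> w \<in> stolz \<beta> (cis x) \<Longrightarrow>
  c * ((1 - cmod w)\<^sup>2 + (t - x)\<^sup>2) \<le> (cmod (cis t - w))\<^sup>2"
  using stolz_chord_lower_bound[OF x, of \<beta>] \<beta> by auto
 have "\<epsilon> * c / 2 > 0" using \<epsilon> c by simp
 from circle_lebesgue_point_kernel[OF int lp this]
 obtain \<delta> where \<delta>: "\<delta> > 0" "\<And>h. 0 < h \<Longrightarrow> h < \<delta> \<Longrightarrow>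
   (\<integral>\<^sup>+t. ennreal (h / (h\<^sup>2 + (t - x)\<^sup>2) * norm (f t - f x)) \<partial>circle) \<le> ennreal (\<epsilon> * c / 2)"
  by blast
 have "\<forall>\<^sub>F w in at (cis x) within stolz \<beta> (cis x). w \<in> stolz \<beta> (cis x) \<and> dist w (cis x) < \<delta>"
  unfolding eventually_at using \<delta>(1) by blast
 then show ?thesis
 proof eventually_elim
  case (elim w)
  then have w: "w \<in> stolz \<beta> (cis x)" "dist w (cis x) < \<delta>" by auto
  then have w1: "cmod w < 1" by (simp add: stolz_def)
  define h where "h = 1 - cmod w"
  have h: "0 < h" "h < \<delta>"
   using w w1 norm_triangle_ineq2[of "cis x" w] by (auto simp: h_def dist_norm norm_minus_commute)
  have "(\<integral>\<^sup>+t. ennreal (poisson w t * norm (f t - f x)) \<partial>circle) \<le>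
   (\<integral>\<^sup>+t. ennreal (2 / c) * ennreal (h / (h\<^sup>2 + (t - x)\<^sup>2) * norm (f t - f x)) \<partial>circle)"
  proof (rule nn_integral_mono)
   fix t assume "t \<in> space circle"
   then have t: "t \<in> {0..2*pi}" by simp
   have pos: "0 < c * (h\<^sup>2 + (t - x)\<^sup>2)" using h c by (intro mult_pos_pos add_pos_nonneg) auto
   have "1 - (cmod w)\<^sup>2 = (1 + cmod w) * h" by (simp add: h_def power2_eq_square algebra_simps)
   also have "\<dots> \<le> 2 * h" using w1 h by (intro mult_right_mono) auto
   finally have "poisson w t \<le> 2 * h / (c * (h\<^sup>2 + (t - x)\<^sup>2))"
    unfolding poisson_def using c(2)[OF t w(1)] pos h by (intro frac_le) (auto simp: h_def)
   then have "poisson w t * norm (f t - f x) \<le> 2 * h / (c * (h\<^sup>2 + (t - x)\<^sup>2)) * norm (f t - f x)"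
    by (intro mult_right_mono) auto
   also have "\<dots> = 2 / c * (h / (h\<^sup>2 + (t - x)\<^sup>2) * norm (f t - f x))"
    by simp
   finally show "ennreal (poisson w t * norm (f t - f x)) \<le> ennreal (2 / c) * ennreal (h / (h\<^sup>2 + (t - x)\<^sup>2) * norm (f t - f x))"
    using c h by (subst ennreal_mult[symmetric]) (auto intro!: ennreal_leI)
  qed
  also have "\<dots> = ennreal (2 / c) * (\<integral>\<^sup>+t. ennreal (h / (h\<^sup>2 + (t - x)\<^sup>2) * norm (f t - f x)) \<partial>circle)"
  proof (rule nn_integral_cmult)
   have [measurable]: "f \<in> borel_measurable circle" using int by auto
   have [measurable]: "(\<lambda>t. h / (h\<^sup>2 + (t - x)\<^sup>2)) \<in> borel_measurable circle"
    by (rule borel_measurable_circle) measurable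
   show "(\<lambda>t. ennreal (h / (h\<^sup>2 + (t - x)\<^sup>2) * norm (f t - f x))) \<in> borel_measurable circle"
    by measurable
  qed
  also have "\<dots> \<le> ennreal (2 / c) * ennreal (\<epsilon> * c / 2)"
   by (intro mult_left_mono \<delta> h) auto
  also have "\<dots> = ennreal \<epsilon>" using c \<epsilon> by (simp add: ennreal_mult[symmetric])
  finally show ?case .
 qed
qed

section \<open>Boundary functions of the Hardy space \<open>H\<^sup>2\<close>\<close>

lemma circle_Cauchy_formula:
 fixes F :: "complex \<Rightarrow> complex"
 assumes "continuous_on (cball 0 1) F" "F holomorphic_on ball 0 1" "cmod w < 1"
 shows "(\<integral>t. F (cis t) * (cis t / (cis t - w)) \<partial>circle) = 2 * pi * F w"
proof -
 have "((\<lambda>u. F u / (u - w) ^ Suc 0) has_contour_integral ((2 * pi * \<i>) / (fact 0) * (deriv ^^ 0) F w)) (circlepath 0 1)"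
  by (rule Cauchy_has_contour_integral_higher_derivative_circlepath) (use assms in auto)
 then have "((\<lambda>t. F (cis t) / (cis t - w) * \<i> * cis t) has_integral (2 * pi * \<i> * F w)) {0..2*pi}"
  unfolding circlepath_def by (subst (asm) has_contour_integral_part_circlepath_iff) auto
 from has_integral_mult_right[OF this, of "- \<i>"]
 have 1: "((\<lambda>t. F (cis t) * (cis t / (cis t - w))) has_integral (2 * pi * F w)) {0..2*pi}"
  by (simp add: algebra_simps)
 have "continuous_on {0..2*pi} (\<lambda>t. F (cis t) * (cis t / (cis t - w)))"
  using cis_minus_ne_0[OF assms(3)]
  by (intro continuous_intros continuous_on_compose2[OF assms(1)]) auto
 from circle_has_integral[OF integrable_circle_continuous[OF this]] 1 show ?thesis
  by (rule has_integral_unique)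
qed

lemma poisson_eq_Re: "cmod w < 1 \<Longrightarrow> poisson w t = Re ((cis t + w) / (cis t - w))"
proof -
 assume w: "cmod w < 1"
 have "(cis t + w) / (cis t - w) = (cis t + w) * cnj (cis t - w) / (cmod (cis t - w))\<^sup>2"
  using complex_div_cnj[of "cis t + w" "cis t - w"] by (simp only: of_real_power)
 also have "Re \<dots> = Re ((cis t + w) * cnj (cis t - w)) / (cmod (cis t - w))\<^sup>2"
  unfolding of_real_power[symmetric] by (rule Re_divide_of_real)
 also have "Re ((cis t + w) * cnj (cis t - w)) = (cmod (cis t))\<^sup>2 - (cmod w)\<^sup>2"
  unfolding cmod_power2 by (simp add: algebra_simps power2_eq_square)
 finally show ?thesis by (simp add: poisson_def)
qed

lemma circle_Poisson_formula:
 fixes F :: "complex \<Rightarrow> complex"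
 assumes F: "continuous_on (cball 0 1) F" "F holomorphic_on ball 0 1" and w: "cmod w < 1"
 shows "(\<integral>t. poisson w t *\<^sub>R F (cis t) \<partial>circle) = 2 * pi * F w"
proof -
 define H where "H u = u * cnj w * F u / (1 - cnj w * u)" for u
 have nz: "1 - cnj w * u \<noteq> 0" if "cmod u \<le> 1" for u
 proof
  assume "1 - cnj w * u = 0"
  then have "cmod (cnj w * u) = 1" by simp
  moreover have "cmod (cnj w * u) \<le> cmod w * 1" unfolding norm_mult using that by (intro mult_mono) auto
  ultimately show False using w by simp
 qed
 have H: "continuous_on (cball 0 1) H" "H holomorphic_on ball 0 1"
  unfolding H_def using nz F by (auto intro!: continuous_intros holomorphic_intros)
 have c1: "continuous_on {0..2*pi} (\<lambda>t. F (cis t) * (cis t / (cis t - w)))"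
  using cis_minus_ne_0[OF w]
  by (intro continuous_intros continuous_on_compose2[OF F(1)]) auto
 have c2: "continuous_on {0..2*pi} (\<lambda>t. H (cis t) * (cis t / (cis t - 0)))"
  by (intro continuous_intros continuous_on_compose2[OF H(1)]) auto
 have "poisson w t *\<^sub>R F (cis t) = F (cis t) * (cis t / (cis t - w)) + H (cis t) * (cis t / (cis t - 0))" for t
 proof -
  define u where "u = cis t"
  have u: "u * cnj u = 1" "u \<noteq> 0" "u - w \<noteq> 0" using cis_minus_ne_0[OF w, of t]
   by (auto simp: u_def cis_cnj cis_mult)
  have "1 - cnj w * u = u * cnj (u - w)" using u(1) by (simp add: algebra_simps)
  then have "H u = cnj w / cnj (u - w) * F u" using u by (simp add: H_def)
  moreover have "complex_of_real (poisson w t) = u / (u - w) + cnj w / cnj (u - w)"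
  proof -
   have "u / (u - w) + cnj w / cnj (u - w) = (u * cnj (u - w) + cnj w * (u - w)) / ((u - w) * cnj (u - w))"
    using u by (simp add: divide_simps)
   also have "u * cnj (u - w) + cnj w * (u - w) = of_real (1 - (cmod w)\<^sup>2)"
   proof -
    have cw: "complex_of_real ((cmod w)\<^sup>2) = w * cnj w" by (rule complex_norm_square)
    have "u * cnj (u - w) + cnj w * (u - w) = 1 - w * cnj w" using u(1) by (simp add: algebra_simps)
    then show ?thesis by (simp only: cw of_real_diff of_real_1)
   qed
   also have "(u - w) * cnj (u - w) = of_real ((cmod (u - w))\<^sup>2)" by (rule complex_norm_square[symmetric])
   finally show ?thesis by (simp add: poisson_def u_def)
  qed
  ultimately show ?thesis unfolding u_def[symmetric] scaleR_conv_of_real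
   using u by (simp add: algebra_simps)
 qed
 then have "(\<integral>t. poisson w t *\<^sub>R F (cis t) \<partial>circle) =
   (\<integral>t. F (cis t) * (cis t / (cis t - w)) \<partial>circle) + (\<integral>t. H (cis t) * (cis t / (cis t - 0)) \<partial>circle)"
  using integrable_circle_continuous[OF c1] integrable_circle_continuous[OF c2] by simp
 also have "\<dots> = 2 * pi * F w + 2 * pi * H 0"
  by (subst circle_Cauchy_formula[OF F w], subst circle_Cauchy_formula[OF H]) auto
 finally show ?thesis by (simp add: H_def)
qed

lemma integral_poisson: "cmod w < 1 \<Longrightarrow> (\<integral>t. poisson w t \<partial>circle) = 2 * pi"
proof -
 assume w: "cmod w < 1"
 have "(\<integral>t. poisson w t *\<^sub>R (1::complex) \<partial>circle) = of_real (\<integral>t. poisson w t \<partial>circle)"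
  by (simp add: scaleR_conv_of_real)
 then have "complex_of_real (\<integral>t. poisson w t \<partial>circle) = complex_of_real (2 * pi)"
  using circle_Poisson_formula[of "\<lambda>_. 1" w] w by simp
 then show ?thesis by (simp only: of_real_eq_iff)
qed

lemma integrable_poisson_mult:
 fixes f :: "real \<Rightarrow> 'a::{banach, second_countable_topology}"
 assumes f: "integrable circle f" and w: "cmod w < 1"
 shows "integrable circle (\<lambda>t. poisson w t *\<^sub>R f t)"
proof -
 have [measurable]: "f \<in> borel_measurable circle" using f by auto
 have [measurable]: "poisson w \<in> borel_measurable circle"
  by (intro borel_measurable_circle_continuous continuous_intros w)
 have "continuous_on {0..2*pi} (poisson w)" by (intro continuous_intros w)
 then have "compact (poisson w ` {0..2*pi})" by (intro compact_continuous_image) auto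
 then obtain B where B: "\<And>t. t \<in> {0..2*pi} \<Longrightarrow> norm (poisson w t) \<le> B"
  using compact_imp_bounded bounded_iff by (metis imageI)
 show ?thesis
  by (rule Bochner_Integration.integrable_bound[of _ "\<lambda>t. B * norm (f t)"])
   (use f B in \<open>auto intro!: AE_I2 mult_right_mono\<close>, metis abs_ge_self atLeastAtMost_iff mult_right_mono norm_ge_zero order_trans)
qed

text \<open>Fatou's theorem for Poisson integrals: the kernel has total mass \<open>2\<pi>\<close> and concentrates at the Lebesgue point.\<close>

lemma poisson_integral_ntlim:
 fixes f :: "real \<Rightarrow> 'a::{banach, second_countable_topology}"
 assumes int: "integrable circle f" and lp: "circle_lebesgue_point f x"
 shows "ntlim (\<lambda>w. (1 / (2 * pi)) *\<^sub>R (\<integral>t. poisson w t *\<^sub>R f t \<partial>circle)) (cis x) (f x)"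
 unfolding ntlim_def
proof (intro allI impI tendstoI)
 fix \<beta> \<epsilon> :: real assume \<beta>: "1 < \<beta>" and \<epsilon>: "0 < \<epsilon>"
 have "\<forall>\<^sub>F w in at (cis x) within stolz \<beta> (cis x). w \<in> stolz \<beta> (cis x)"
  by (auto simp: eventually_at intro: exI[of _ 1])
 with poisson_lebesgue_point[OF int lp \<beta> \<epsilon>]
 show "\<forall>\<^sub>F w in at (cis x) within stolz \<beta> (cis x).
   dist ((1 / (2 * pi)) *\<^sub>R (\<integral>t. poisson w t *\<^sub>R f t \<partial>circle)) (f x) < \<epsilon>"
 proof eventually_elim
  case (elim w)
  then have w: "cmod w < 1" by (simp add: stolz_def)
  have c: "integrable circle (\<lambda>t. f x)"
   by (rule finite_measure.integrable_const[OF finite_measure_circle])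
  then have d: "integrable circle (\<lambda>t. f t - f x)" using int by (rule Bochner_Integration.integrable_diff[rotated])
  note i = integrable_poisson_mult[OF d w]
  have pint: "integrable circle (poisson w)"
   by (intro integrable_circle_continuous continuous_intros w)
  have "(\<integral>t. poisson w t *\<^sub>R f t \<partial>circle) =
    (\<integral>t. poisson w t *\<^sub>R (f t - f x) + poisson w t *\<^sub>R f x \<partial>circle)"
   by (simp add: algebra_simps)
  also have "\<dots> = (\<integral>t. poisson w t *\<^sub>R (f t - f x) \<partial>circle) + (2 * pi) *\<^sub>R f x"
   by (subst Bochner_Integration.integral_add[OF i]) (use pint integral_poisson[OF w] in auto)
  finally have "(1 / (2 * pi)) *\<^sub>R (\<integral>t. poisson w t *\<^sub>R f t \<partial>circle) - f x =
    (1 / (2 * pi)) *\<^sub>R (\<integral>t. poisson w t *\<^sub>R (f t - f x) \<partial>circle)"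
   by (simp add: scaleR_add_right)
  moreover have "norm (\<integral>t. poisson w t *\<^sub>R (f t - f x) \<partial>circle) \<le> \<epsilon>"
  proof -
   have "ennreal (norm (\<integral>t. poisson w t *\<^sub>R (f t - f x) \<partial>circle)) \<le>
     (\<integral>\<^sup>+t. ennreal (norm (poisson w t *\<^sub>R (f t - f x))) \<partial>circle)"
    by (rule integral_norm_bound_ennreal[OF i])
   also have "\<dots> \<le> ennreal \<epsilon>"
    using elim(1) poisson_nonneg[OF w] by simp
   finally show ?thesis using \<epsilon> by simp
  qed
  moreover have "\<epsilon> / (2 * pi) < \<epsilon>"
   using \<epsilon> pi_gt3 by (simp add: divide_simps)
  ultimately show ?case
   unfolding dist_norm by (simp add: divide_right_mono le_less_trans[of _ "\<epsilon> / (2 * pi)"])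
 qed
qed

lemma circle_coefficient:
 fixes s :: "complex \<Rightarrow> complex" and \<rho> :: real
 assumes s: "s holomorphic_on ball 0 1" and \<rho>: "0 < \<rho>" "\<rho> < 1"
 shows "(\<integral>t. s (\<rho> * cis t) * cnj (cis t ^ n) \<partial>circle) = 2 * pi * ((deriv ^^ n) s 0 / fact n * \<rho> ^ n)"
proof -
 have sub: "cball 0 \<rho> \<subseteq> ball (0::complex) 1" using \<rho> by auto
 have "((\<lambda>u. s u / (u - 0) ^ Suc n) has_contour_integral ((2 * pi * \<i>) / (fact n) * (deriv ^^ n) s 0)) (circlepath 0 \<rho>)"
  by (rule Cauchy_has_contour_integral_higher_derivative_circlepath)
   (use \<rho> sub in \<open>auto intro!: holomorphic_on_imp_continuous_on holomorphic_on_subset[OF s]\<close>)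
 then have "((\<lambda>t. s (\<rho> * cis t) / (\<rho> * cis t) ^ Suc n * \<rho> * \<i> * cis t) has_integral ((2 * pi * \<i>) / (fact n) * (deriv ^^ n) s 0)) {0..2*pi}"
  unfolding circlepath_def by (subst (asm) has_contour_integral_part_circlepath_iff) auto
 from has_integral_mult_right[OF this, of "- \<i> * \<rho> ^ n"]
 have "((\<lambda>t. - \<i> * \<rho> ^ n * (s (\<rho> * cis t) / (\<rho> * cis t) ^ Suc n * \<rho> * \<i> * cis t)) has_integral
   (2 * pi * ((deriv ^^ n) s 0 / fact n * \<rho> ^ n))) {0..2*pi}"
  by (simp add: algebra_simps)
 moreover have "- \<i> * \<rho> ^ n * (s (\<rho> * cis t) / (\<rho> * cis t) ^ Suc n * \<rho> * \<i> * cis t) = s (\<rho> * cis t) * cnj (cis t ^ n)" for t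
 proof -
  have "cnj (cis t ^ n) * cis t ^ n = 1"
   by (simp add: power_mult_distrib[symmetric] cis_cnj cis_mult)
  then have "cnj (cis t ^ n) = 1 / cis t ^ n" by (simp add: field_simps)
  then show ?thesis using \<rho> by (simp add: power_mult_distrib field_simps)
 qed
 ultimately have 1: "((\<lambda>t. s (\<rho> * cis t) * cnj (cis t ^ n)) has_integral
   (2 * pi * ((deriv ^^ n) s 0 / fact n * \<rho> ^ n))) {0..2*pi}"
  by simp
 have "continuous_on {0..2*pi} (\<lambda>t. s (\<rho> * cis t) * cnj (cis t ^ n))"
  using \<rho> by (intro continuous_intros continuous_on_compose2[OF holomorphic_on_imp_continuous_on[OF s]])
   (auto simp: norm_mult)
 from circle_has_integral[OF integrable_circle_continuous[OF this]] 1 show ?thesis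
  by (rule has_integral_unique)
qed

text \<open>The scalar product of two dilates with different radii is computed, since it is needed for the distance of the dilates.\<close>

lemma Parseval:
 fixes s :: "complex \<Rightarrow> complex" and r \<rho> :: real
 assumes s: "s holomorphic_on ball 0 1" and r: "0 < r" "r < 1" and \<rho>: "0 < \<rho>" "\<rho> < 1"
 shows "(\<lambda>n. 2 * pi * (cmod ((deriv ^^ n) s 0 / fact n))\<^sup>2 * (r * \<rho>) ^ n) sums
  Re (\<integral>t. s (r * cis t) * cnj (s (\<rho> * cis t)) \<partial>circle)"
proof -
 define a where "a n = (deriv ^^ n) s 0 / fact n" for n
 have sums: "(\<lambda>n. a n * w ^ n) sums s w" if "cmod w < 1" for w
  using holomorphic_power_series[OF s, of w] that by (simp add: a_def)
 have cont: "continuous_on {0..2*pi} (\<lambda>t. cnj (s (\<rho> * cis t)))"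
  using \<rho> by (intro continuous_intros continuous_on_compose2[OF holomorphic_on_imp_continuous_on[OF s]])
   (auto simp: norm_mult)
 then have "compact ((\<lambda>t. cnj (s (\<rho> * cis t))) ` {0..2*pi})" by (intro compact_continuous_image) auto
 then obtain B where B: "\<And>t. t \<in> {0..2*pi} \<Longrightarrow> cmod (cnj (s (\<rho> * cis t))) \<le> B"
  using compact_imp_bounded bounded_iff by (metis imageI)
 have asum: "summable (\<lambda>n. cmod (a n) * r ^ n)"
 proof -
  have "summable (\<lambda>n. a n * of_real ((1 + r) / 2) ^ n)"
   using sums[of "of_real ((1 + r) / 2)"] r unfolding norm_of_real by (auto simp: sums_iff)
  from powser_insidea[OF this, of "of_real r"] r have "summable (\<lambda>n. cmod (a n * of_real r ^ n))"
   unfolding norm_of_real by (simp add: field_simps)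
  then show ?thesis using r by (simp add: norm_mult norm_power)
 qed
 define f where "f n t = a n * (r * cis t) ^ n * cnj (s (\<rho> * cis t))" for n t
 have fint: "integrable circle (f n)" for n
  unfolding f_def by (intro integrable_circle_continuous continuous_intros continuous_on_mult cont)
 have fbd: "cmod (f n t) \<le> cmod (a n) * r ^ n * B" if "t \<in> {0..2*pi}" for n t
  unfolding f_def norm_mult norm_power using B[OF that] r by (intro mult_mono) auto
 have "(\<lambda>n. \<integral>t. f n t \<partial>circle) sums (\<integral>t. (\<Sum>n. f n t) \<partial>circle)"
 proof (rule sums_integral[OF fint])
  show "AE t in circle. summable (\<lambda>n. norm (f n t))"
  proof (rule AE_I2)
   fix t assume "t \<in> space circle"
   then show "summable (\<lambda>n. norm (f n t))"
    by (intro summable_comparison_test'[OF summable_mult2[OF asum, of B]]) (use fbd in auto)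
  qed
  show "summable (\<lambda>n. \<integral>t. norm (f n t) \<partial>circle)"
  proof (rule summable_comparison_test'[OF summable_mult2[OF asum, of "B * (2 * pi)"]])
   fix n
   have "(\<integral>t. norm (f n t) \<partial>circle) \<le> (\<integral>t. cmod (a n) * r ^ n * B \<partial>circle)"
    using fint fbd by (intro integral_mono finite_measure.integrable_const[OF finite_measure_circle]) auto
   also have "\<dots> = cmod (a n) * r ^ n * (B * (2 * pi))" by simp
   finally show "norm (\<integral>t. norm (f n t) \<partial>circle) \<le> cmod (a n) * r ^ n * (B * (2 * pi))"
    by simp
  qed
 qed
 also have "(\<integral>t. (\<Sum>n. f n t) \<partial>circle) = (\<integral>t. s (r * cis t) * cnj (s (\<rho> * cis t)) \<partial>circle)"
 proof (intro Bochner_Integration.integral_cong refl)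
  fix t
  have "(\<lambda>n. f n t) sums (s (r * cis t) * cnj (s (\<rho> * cis t)))"
   unfolding f_def using r by (intro sums_mult2 sums) (simp add: norm_mult)
  then show "(\<Sum>n. f n t) = s (r * cis t) * cnj (s (\<rho> * cis t))" by (simp add: sums_iff)
 qed
 also have "(\<lambda>n. \<integral>t. f n t \<partial>circle) = (\<lambda>n. of_real (2 * pi * (cmod (a n))\<^sup>2 * (r * \<rho>) ^ n))"
 proof
  fix n
  have "(\<integral>t. f n t \<partial>circle) = (\<integral>t. (a n * r ^ n) * cnj (s (\<rho> * cis t) * cnj (cis t ^ n)) \<partial>circle)"
   by (intro Bochner_Integration.integral_cong refl) (simp add: f_def power_mult_distrib)
  also have "\<dots> = a n * r ^ n * cnj (\<integral>t. s (\<rho> * cis t) * cnj (cis t ^ n) \<partial>circle)"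
   by (simp only: integral_mult_right_zero Bochner_Integration.integral_cnj)
  also have "\<dots> = of_real (2 * pi * (cmod (a n))\<^sup>2 * (r * \<rho>) ^ n)"
   unfolding circle_coefficient[OF s \<rho>] a_def[symmetric]
   unfolding of_real_mult complex_norm_square by (simp add: power_mult_distrib algebra_simps)
  finally show "(\<integral>t. f n t \<partial>circle) = of_real (2 * pi * (cmod (a n))\<^sup>2 * (r * \<rho>) ^ n)" .
 qed
 finally show ?thesis
  unfolding a_def[symmetric] by (drule_tac sums_Re) simp
qed

lemma sq_diff_integral_eq:
 fixes s :: "complex \<Rightarrow> complex" and r \<rho> :: real
 assumes s: "s holomorphic_on ball 0 1" and r: "0 < r" "r < 1" and \<rho>: "0 < \<rho>" "\<rho> < 1"
 shows "(\<integral>t. (cmod (s (r * cis t) - s (\<rho> * cis t)))\<^sup>2 \<partial>circle) =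
  Re (\<integral>t. s (r * cis t) * cnj (s (r * cis t)) \<partial>circle) +
  Re (\<integral>t. s (\<rho> * cis t) * cnj (s (\<rho> * cis t)) \<partial>circle) -
  2 * Re (\<integral>t. s (r * cis t) * cnj (s (\<rho> * cis t)) \<partial>circle)"
proof -
 have c: "continuous_on {0..2*pi} (\<lambda>t. s (x * cis t))" if "0 < x" "x < 1" for x :: real
  using that by (intro continuous_intros continuous_on_compose2[OF holomorphic_on_imp_continuous_on[OF s]])
   (auto simp: norm_mult)
 have i: "integrable circle (\<lambda>t. s (x * cis t) * cnj (s (y * cis t)))"
  if "0 < x" "x < 1" "0 < y" "y < 1" for x y :: real
  using that by (intro integrable_circle_continuous continuous_intros c)
 have Re_int: "Re (\<integral>t. s (x * cis t) * cnj (s (y * cis t)) \<partial>circle) =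
  (\<integral>t. Re (s (x * cis t) * cnj (s (y * cis t))) \<partial>circle)"
  if "0 < x" "x < 1" "0 < y" "y < 1" for x y :: real
  using i[OF that] by (rule integral_Re[symmetric])
 have eq: "(cmod (u - v))\<^sup>2 = Re (u * cnj u) + Re (v * cnj v) - 2 * Re (u * cnj v)" for u v
  unfolding cmod_power2 by (simp add: power2_eq_square algebra_simps)
 define X Y Z where "X t = Re (s (r * cis t) * cnj (s (r * cis t)))"
  and "Y t = Re (s (\<rho> * cis t) * cnj (s (\<rho> * cis t)))"
  and "Z t = Re (s (r * cis t) * cnj (s (\<rho> * cis t)))" for t
 have "integrable circle X" "integrable circle Y" "integrable circle Z"
  unfolding X_def Y_def Z_def by (intro integrable_Re i r \<rho>)+
 then have "(\<integral>t. X t + Y t - 2 * Z t \<partial>circle) = integral\<^sup>L circle X + integral\<^sup>L circle Y - 2 * integral\<^sup>L circle Z"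
  by simp
 then show ?thesis
  unfolding Re_int[OF r r] Re_int[OF \<rho> \<rho>] Re_int[OF r \<rho>] X_def Y_def Z_def eq .
qed

text \<open>An \<open>H\<^sup>2\<close> function has a boundary function in \<open>L\<^sup>2\<close>. The radii are chosen so that the
 successive differences are summable in the norm, hence almost everywhere; by Parseval's identity the
 distance of two dilates is controlled by the tail of the series \<open>\<Sum> \<bar>a\<^sub>n\<bar>\<^sup>2\<close>.\<close>

theorem H2_boundary_function:
 fixes s :: "complex \<Rightarrow> complex"
 assumes s: "s holomorphic_on ball 0 1"
  and bd: "\<And>r::real. 0 < r \<Longrightarrow> r < 1 \<Longrightarrow> (\<integral>t. (cmod (s (r * cis t)))\<^sup>2 \<partial>circle) \<le> C"
 obtains f :: "real \<Rightarrow> complex" and r :: "nat \<Rightarrow> real"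
 where "f \<in> borel_measurable circle" "(\<integral>\<^sup>+t. ennreal ((cmod (f t))\<^sup>2) \<partial>circle) < \<infinity>"
  "\<And>k. 0 < r k" "\<And>k. r k < 1" "r \<longlonglongrightarrow> 1"
  "(\<lambda>k. \<integral>\<^sup>+t. ennreal ((cmod (s (r k * cis t) - f t))\<^sup>2) \<partial>circle) \<longlonglongrightarrow> 0"
proof -
 define b where "b n = 2 * pi * (cmod ((deriv ^^ n) s 0 / fact n))\<^sup>2" for n
 have b0: "b n \<ge> 0" for n by (simp add: b_def)
 define G where "G x y = Re (\<integral>t. s (of_real x * cis t) * cnj (s (of_real y * cis t)) \<partial>circle)" for x y
 have Gs: "(\<lambda>n. b n * (x * y) ^ n) sums G x y" if "0 < x" "x < 1" "0 < y" "y < 1" for x y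
  using Parseval[OF s that] by (simp add: b_def G_def)
 have cs: "continuous_on {0..2*pi} (\<lambda>t. s (x * cis t))" if "0 < x" "x < 1" for x :: real
  using that by (intro continuous_intros continuous_on_compose2[OF holomorphic_on_imp_continuous_on[OF s]])
   (auto simp: norm_mult)
 have GC: "G x x \<le> C" if "0 < x" "x < 1" for x
 proof -
  have "G x x = (\<integral>t. Re (s (x * cis t) * cnj (s (x * cis t))) \<partial>circle)"
   unfolding G_def by (intro integral_Re[symmetric] integrable_circle_continuous continuous_intros cs that)
  also have "\<dots> = (\<integral>t. (cmod (s (x * cis t)))\<^sup>2 \<partial>circle)"
   unfolding cmod_power2 by (simp add: power2_eq_square)
  finally show ?thesis using bd[OF that] by simp
 qed
 have Gpart: "(\<Sum>n<N. b n * (x * x) ^ n) \<le> G x x" if "0 < x" "x < 1" for x N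
 proof -
  have "(\<Sum>n<N. b n * (x * x) ^ n) \<le> (\<Sum>n. b n * (x * x) ^ n)"
   using Gs[of x x] that b0 by (intro sum_le_suminf) (auto simp: sums_iff)
  then show ?thesis using Gs[of x x] that by (simp add: sums_iff)
 qed
 have fin: "(\<Sum>n<N. b n) \<le> C" for N
 proof (rule tendsto_upperbound)
  show "((\<lambda>x. \<Sum>n<N. b n * (x * x) ^ n) \<longlongrightarrow> (\<Sum>n<N. b n)) (at_left 1)"
   by (rule tendsto_eq_intros refl | simp)+
  show "\<forall>\<^sub>F x in at_left 1. (\<Sum>n<N. b n * (x * x) ^ n) \<le> C"
  proof -
   have "\<forall>\<^sub>F x in at_left (1::real). x \<in> {0<..<1}" by (rule eventually_at_left_real) simp
   then show ?thesis
   proof eventually_elim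
    case (elim x)
    then have "(\<Sum>n<N. b n * (x * x) ^ n) \<le> G x x"
     by (intro Gpart) auto
    with GC[of x] elim show ?case by simp
   qed
  qed
 qed simp
 have bsum: "summable b" by (rule bounded_imp_summable[where B = C, OF b0]) (use fin[of "Suc _"] in \<open>simp add: lessThan_Suc_atMost\<close>)
 define A where "A = (\<Sum>n. b n)"
 have GA: "G x y \<le> A" if "0 < x" "x < 1" "0 < y" "y < 1" for x y
 proof -
  have "b n * (x * y) ^ n \<le> b n * 1" for n
   using that b0 by (intro mult_left_mono power_le_one) (auto intro: mult_le_one)
  then have "(\<Sum>n. b n * (x * y) ^ n) \<le> (\<Sum>n. b n)"
   using Gs[OF that] bsum by (intro suminf_le) (auto simp: sums_iff)
  then show ?thesis using Gs[OF that] by (simp add: A_def sums_iff)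
 qed
 have Gmono: "G x x \<le> G x y" if "0 < x" "x \<le> y" "y < 1" for x y
 proof -
  have "b n * (x * x) ^ n \<le> b n * (x * y) ^ n" for n
   using that b0 by (intro mult_left_mono power_mono) auto
  then have "(\<Sum>n. b n * (x * x) ^ n) \<le> (\<Sum>n. b n * (x * y) ^ n)"
   using Gs[of x x] Gs[of x y] that by (intro suminf_le) (auto simp: sums_iff)
  then show ?thesis using Gs[of x x] Gs[of x y] that by (simp add: sums_iff)
 qed
 have diff: "(\<integral>t. (cmod (s (x * cis t) - s (y * cis t)))\<^sup>2 \<partial>circle) \<le> 2 * e"
  if "0 < x" "x < 1" "0 < y" "y < 1" "A - e \<le> G x x" "A - e \<le> G y y" for x y e
 proof -
  have "A - e \<le> G x y"
  proof (cases "x \<le> y")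
   case True then show ?thesis using Gmono[of x y] that by simp
  next
   case False
   have "G x y = G y x" using Gs[of x y] Gs[of y x] that by (simp add: sums_iff mult.commute)
   then show ?thesis using Gmono[of y x] that False by simp
  qed
  then show ?thesis
   using sq_diff_integral_eq[OF s that(1-4)] GA[of x x] GA[of y y] that unfolding G_def by simp
 qed
 \<comment> \<open>The squared distance of two of the dilates will be at most \<open>2 (1/4)\<^sup>k\<close>, which is summable even after taking roots.\<close>
 have "\<exists>x. 0 < x \<and> x < 1 \<and> 1 - inverse (real (Suc k)) < x \<and> A - (1/4)^k \<le> G x x" for k
 proof -
  have "(\<lambda>N. \<Sum>n<N. b n) \<longlonglongrightarrow> A" unfolding A_def using bsum by (rule summable_LIMSEQ)
  then have "\<forall>\<^sub>F N in sequentially. A - (1/4)^k < (\<Sum>n<N. b n)" by (rule order_tendstoD) simp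
  then obtain N where N: "A - (1/4)^k < (\<Sum>n<N. b n)" by (auto simp: eventually_sequentially)
  have "((\<lambda>x. \<Sum>n<N. b n * (x * x) ^ n) \<longlongrightarrow> (\<Sum>n<N. b n)) (at_left 1)"
   by (rule tendsto_eq_intros refl | simp)+
  then have "\<forall>\<^sub>F x in at_left 1. A - (1/4)^k < (\<Sum>n<N. b n * (x * x) ^ n)" using N by (rule order_tendstoD)
  moreover have "\<forall>\<^sub>F x in at_left (1::real). x \<in> {max 0 (1 - inverse (real (Suc k)))<..<1}"
   by (rule eventually_at_left_real) simp
  ultimately have "\<forall>\<^sub>F x in at_left (1::real). 0 < x \<and> x < 1 \<and> 1 - inverse (real (Suc k)) < x \<and> A - (1/4)^k \<le> G x x"
  proof eventually_elim
   case (elim x)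
   then have "(\<Sum>n<N. b n * (x * x) ^ n) \<le> G x x"
    by (intro Gpart) auto
   with elim show ?case by auto
  qed
  then show ?thesis by (rule eventually_happens'[OF trivial_limit_at_left_real])
 qed
 from choice[OF allI, OF this] obtain r where r': "\<forall>k. 0 < r k \<and> r k < 1 \<and>
   1 - inverse (real (Suc k)) < r k \<and> A - (1/4)^k \<le> G (r k) (r k)" by (rule exE)
 then have r: "0 < r k" "r k < 1" "1 - inverse (real (Suc k)) < r k" "A - (1/4)^k \<le> G (r k) (r k)" for k
  by blast+
 have r_lim: "r \<longlonglongrightarrow> 1"
 proof (rule tendsto_sandwich[where f = "\<lambda>k. 1 - inverse (real (Suc k))" and h = "\<lambda>_. 1"])
  show "(\<lambda>k. 1 - inverse (real (Suc k))) \<longlonglongrightarrow> 1"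
   using tendsto_diff[OF tendsto_const[of "1::real"] LIMSEQ_inverse_real_of_nat] by simp
 qed (use r in \<open>auto intro!: always_eventually less_imp_le\<close>)
 define S where "S k t = s (of_real (r k) * cis t)" for k t
 have Sc: "continuous_on {0..2*pi} (S k)" for k unfolding S_def by (rule cs[OF r(1,2)])
 have [measurable]: "S k \<in> borel_measurable circle" for k
  by (rule borel_measurable_circle_continuous[OF Sc])
 have d: "(\<integral>\<^sup>+t. ennreal ((cmod (S j t - S k t))\<^sup>2) \<partial>circle) \<le> ennreal (2 * (1/4)^k)" if "k \<le> j" for j k
 proof -
  have "(1/4::real)^j \<le> (1/4)^k" using that by (intro power_decreasing) auto
  then have "A - (1/4)^k \<le> G (r j) (r j)" using r(4)[of j] by linarith
  then have "(\<integral>t. (cmod (S j t - S k t))\<^sup>2 \<partial>circle) \<le> 2 * (1/4)^k"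
   unfolding S_def by (intro diff r)
  moreover have "(\<integral>\<^sup>+t. ennreal ((cmod (S j t - S k t))\<^sup>2) \<partial>circle) = ennreal (\<integral>t. (cmod (S j t - S k t))\<^sup>2 \<partial>circle)"
   by (intro nn_integral_eq_integral integrable_circle_continuous continuous_intros Sc) auto
  ultimately show ?thesis by (simp add: ennreal_leI)
 qed
 define f where "f t = lim (\<lambda>k. S k t)" for t
 have [measurable]: "f \<in> borel_measurable circle" unfolding f_def by measurable
 have AEconv: "AE t in circle. (\<lambda>k. S k t) \<longlonglongrightarrow> f t"
 proof -
  have "(\<integral>\<^sup>+t. (\<Sum>k. ennreal (cmod (S (Suc k) t - S k t))) \<partial>circle) =
    (\<Sum>k. \<integral>\<^sup>+t. ennreal (cmod (S (Suc k) t - S k t)) \<partial>circle)"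
   by (intro nn_integral_suminf) measurable
  also have "\<dots> \<le> (\<Sum>k. ennreal ((2 * pi + 2) * (1/2)^k))"
  proof (intro suminf_le summableI)
   fix k
   have "(\<integral>\<^sup>+t. ennreal (cmod (S (Suc k) t - S k t)) \<partial>circle) \<le>
     (\<integral>\<^sup>+t. ennreal ((1/2)^k) + ennreal (2^k) * ennreal ((cmod (S (Suc k) t - S k t))\<^sup>2) \<partial>circle)"
   proof (rule nn_integral_mono)
    fix t
    define z where "z = cmod (S (Suc k) t - S k t)"
    have "z \<le> (1/2)^k + 2^k * z\<^sup>2"
    proof (cases "z \<le> (1/2)^k")
     case True then show ?thesis by (simp add: add_increasing2)
    next
     case False
     then have "1 \<le> 2^k * z" by (simp add: power_one_over field_simps)
     then have "1 * z \<le> 2^k * z * z" by (intro mult_right_mono) (auto simp: z_def)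
     then have "z \<le> 2^k * z\<^sup>2" by (simp add: power2_eq_square)
     then show ?thesis by (simp add: add_increasing)
    qed
    then show "ennreal (cmod (S (Suc k) t - S k t)) \<le> ennreal ((1/2)^k) + ennreal (2^k) * ennreal ((cmod (S (Suc k) t - S k t))\<^sup>2)"
     unfolding z_def[symmetric] by (simp add: ennreal_mult[symmetric] ennreal_plus[symmetric] ennreal_leI del: ennreal_plus)
   qed
   also have "\<dots> = ennreal ((1/2)^k) * ennreal (2 * pi) + ennreal (2^k) * (\<integral>\<^sup>+t. ennreal ((cmod (S (Suc k) t - S k t))\<^sup>2) \<partial>circle)"
    by (subst nn_integral_add, measurable, subst nn_integral_cmult, measurable)
   also have "\<dots> \<le> ennreal ((1/2)^k) * ennreal (2 * pi) + ennreal (2^k) * ennreal (2 * (1/4)^k)"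
    by (intro add_left_mono mult_left_mono d) auto
   also have "\<dots> = ennreal ((1/2)^k * (2 * pi) + 2^k * (2 * (1/4)^k))"
    by (simp add: ennreal_mult[symmetric] ennreal_plus[symmetric] del: ennreal_plus)
   also have "(1/2)^k * (2 * pi) + 2^k * (2 * (1/4)^k) = (2 * pi + 2) * (1/2)^k"
   proof -
    have "(2::real)^k * (1/4)^k = (1/2)^k" by (simp add: power_mult_distrib[symmetric])
    then show ?thesis by (simp add: algebra_simps)
   qed
   finally show "(\<integral>\<^sup>+t. ennreal (cmod (S (Suc k) t - S k t)) \<partial>circle) \<le> ennreal ((2 * pi + 2) * (1/2)^k)" .
  qed
  also have "\<dots> = ennreal ((2 * pi + 2) * 2)"
  proof (rule suminf_ennreal_eq)
   show "(\<lambda>k. (2 * pi + 2) * (1/2)^k) sums ((2 * pi + 2) * 2)"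
    using sums_mult[OF geometric_sums[of "1/2::real"], of "2 * pi + 2"] by simp
  qed auto
  finally have "(\<integral>\<^sup>+t. (\<Sum>k. ennreal (cmod (S (Suc k) t - S k t))) \<partial>circle) \<noteq> \<infinity>"
   by (auto simp: top_unique)
  then have "AE t in circle. (\<Sum>k. ennreal (cmod (S (Suc k) t - S k t))) \<noteq> \<infinity>"
   by (intro nn_integral_PInf_AE) measurable
  then show ?thesis
  proof eventually_elim
   case (elim t)
   then have "summable (\<lambda>k. cmod (S (Suc k) t - S k t))"
    by (intro summable_suminf_not_top) (auto simp: infinity_ennreal_def)
   then have "summable (\<lambda>k. S (Suc k) t - S k t)" by (rule summable_norm_cancel)
   then have "convergent (\<lambda>n. \<Sum>k<n. S (Suc k) t - S k t)" by (simp add: summable_iff_convergent)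
   moreover have "(\<Sum>k<n. S (Suc k) t - S k t) = S n t - S 0 t" for n
    by (rule sum_lessThan_telescope)
   ultimately have "convergent (\<lambda>n. S n t - S 0 t + S 0 t)" by (intro convergent_add convergent_const) simp
   then have "convergent (\<lambda>k. S k t)" by simp
   then show ?case unfolding f_def by (simp add: convergent_LIMSEQ_iff)
  qed
 qed
 \<comment> \<open>Fatou's lemma identifies the pointwise limit as the limit in \<open>L\<^sup>2\<close>.\<close>
 have L2: "(\<integral>\<^sup>+t. ennreal ((cmod (S k t - f t))\<^sup>2) \<partial>circle) \<le> ennreal (2 * (1/4)^k)" for k
 proof -
  have "(\<integral>\<^sup>+t. ennreal ((cmod (S k t - f t))\<^sup>2) \<partial>circle) =
   (\<integral>\<^sup>+t. liminf (\<lambda>j. ennreal ((cmod (S j t - S k t))\<^sup>2)) \<partial>circle)"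
  proof (rule nn_integral_cong_AE)
   from AEconv show "AE t in circle. ennreal ((cmod (S k t - f t))\<^sup>2) = liminf (\<lambda>j. ennreal ((cmod (S j t - S k t))\<^sup>2))"
   proof eventually_elim
    case (elim t)
    have "(\<lambda>j. ennreal ((cmod (S j t - S k t))\<^sup>2)) \<longlonglongrightarrow> ennreal ((cmod (f t - S k t))\<^sup>2)"
     by (intro tendsto_ennrealI tendsto_intros elim)
    then have "liminf (\<lambda>j. ennreal ((cmod (S j t - S k t))\<^sup>2)) = ennreal ((cmod (f t - S k t))\<^sup>2)"
     by (rule lim_imp_Liminf[rotated]) simp
    then show ?case by (simp only: norm_minus_commute[of "S k t" "f t"])
   qed
  qed
  also have "\<dots> \<le> liminf (\<lambda>j. \<integral>\<^sup>+t. ennreal ((cmod (S j t - S k t))\<^sup>2) \<partial>circle)"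
   by (rule nn_integral_liminf) measurable
  also have "\<dots> \<le> liminf (\<lambda>j. ennreal (2 * (1/4)^k))"
   by (rule Liminf_mono) (use d in \<open>auto simp: eventually_sequentially\<close>)
  also have "\<dots> = ennreal (2 * (1/4)^k)" by (simp add: Liminf_const)
  finally show ?thesis .
 qed
 have "(\<integral>\<^sup>+t. ennreal ((cmod (f t))\<^sup>2) \<partial>circle) \<le>
   (\<integral>\<^sup>+t. ennreal (2 * (cmod (S 0 t))\<^sup>2) + ennreal 2 * ennreal ((cmod (S 0 t - f t))\<^sup>2) \<partial>circle)"
 proof (rule nn_integral_mono)
  fix t
  have "(cmod (f t))\<^sup>2 \<le> (cmod (S 0 t) + cmod (S 0 t - f t))\<^sup>2" by (intro power_mono) (norm, simp)
  also have "\<dots> \<le> 2 * (cmod (S 0 t))\<^sup>2 + 2 * (cmod (S 0 t - f t))\<^sup>2"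
   using sum_squares_bound[of "cmod (S 0 t)" "cmod (S 0 t - f t)"] by (simp add: power2_sum)
  finally show "ennreal ((cmod (f t))\<^sup>2) \<le> ennreal (2 * (cmod (S 0 t))\<^sup>2) + ennreal 2 * ennreal ((cmod (S 0 t - f t))\<^sup>2)"
   by (simp add: ennreal_mult[symmetric] ennreal_plus[symmetric] ennreal_leI del: ennreal_plus ennreal_numeral)
 qed
 also have "\<dots> = (\<integral>\<^sup>+t. ennreal (2 * (cmod (S 0 t))\<^sup>2) \<partial>circle) + ennreal 2 * (\<integral>\<^sup>+t. ennreal ((cmod (S 0 t - f t))\<^sup>2) \<partial>circle)"
  by (subst nn_integral_add, measurable, subst nn_integral_cmult, measurable)
 also have "\<dots> < \<infinity>"
 proof -
  have "integrable circle (\<lambda>t. 2 * (cmod (S 0 t))\<^sup>2)"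
   by (intro integrable_circle_continuous continuous_intros Sc)
  moreover have "norm (2 * (cmod (S 0 t))\<^sup>2) = 2 * (cmod (S 0 t))\<^sup>2" for t by simp
  ultimately have "(\<integral>\<^sup>+t. ennreal (2 * (cmod (S 0 t))\<^sup>2) \<partial>circle) < \<infinity>"
   by (simp only: integrable_iff_bounded)
  moreover have "ennreal 2 * (\<integral>\<^sup>+t. ennreal ((cmod (S 0 t - f t))\<^sup>2) \<partial>circle) < \<infinity>"
  proof -
   have "(\<integral>\<^sup>+t. ennreal ((cmod (S 0 t - f t))\<^sup>2) \<partial>circle) < top"
    by (rule le_less_trans[OF L2[of 0]]) simp
   then show ?thesis by (simp add: ennreal_mult_less_top)
  qed
  ultimately show ?thesis by simp
 qed
 finally have fL2: "(\<integral>\<^sup>+t. ennreal ((cmod (f t))\<^sup>2) \<partial>circle) < \<infinity>" .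
 have "(\<lambda>k. 2 * (1/4::real)^k) \<longlonglongrightarrow> 2 * 0"
  by (intro tendsto_mult tendsto_const LIMSEQ_realpow_zero) auto
 from tendsto_ennrealI[OF this]
 have "(\<lambda>k. ennreal (2 * (1/4)^k)) \<longlonglongrightarrow> 0" by simp
 then have "(\<lambda>k. \<integral>\<^sup>+t. ennreal ((cmod (S k t - f t))\<^sup>2) \<partial>circle) \<longlonglongrightarrow> 0"
  by (rule tendsto_0_ennreal_le[OF _ L2])
 then show ?thesis
  by (intro that[of f r]) (use r r_lim fL2 in \<open>auto simp: S_def\<close>)
qed

section \<open>Nontangential limits of outer functions\<close>

lemma stolz_nontrivial:
 assumes "cmod \<zeta> = 1" "1 < \<beta>"
 shows "at \<zeta> within stolz \<beta> \<zeta> \<noteq> bot"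
proof -
 have "\<zeta> islimpt stolz \<beta> \<zeta>"
  unfolding islimpt_approachable
 proof (intro allI impI)
  fix e :: real assume e: "0 < e"
  define r where "r = 1 - min e 1 / 2"
  have r: "0 < r" "r < 1" "1 - r < e" using e by (auto simp: r_def)
  have d: "dist (r * \<zeta>) \<zeta> = 1 - r"
  proof -
   have "r * \<zeta> - \<zeta> = - (of_real (1 - r) * \<zeta>)" by (simp add: algebra_simps)
   then have "dist (r * \<zeta>) \<zeta> = cmod (of_real (1 - r) * \<zeta>)" by (simp add: dist_norm)
   also have "\<dots> = 1 - r" unfolding norm_mult norm_of_real using assms r by simp
   finally show ?thesis .
  qed
  show "\<exists>w\<in>stolz \<beta> \<zeta>. w \<noteq> \<zeta> \<and> dist w \<zeta> < e"
  proof (intro bexI conjI)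
   show "r * \<zeta> \<noteq> \<zeta>" using d r by auto
   show "dist (r * \<zeta>) \<zeta> < e" using d r by simp
   show "r * \<zeta> \<in> stolz \<beta> \<zeta>" using d r assms by (simp add: stolz_def norm_mult)
  qed
 qed
 then show ?thesis using trivial_limit_within by blast
qed

lemma ntlim_unique:
 fixes L L' :: "'a::t2_space"
 assumes "cmod \<zeta> = 1" "ntlim f \<zeta> L" "ntlim f \<zeta> L'"
 shows "L = L'"
 using assms tendsto_unique[OF stolz_nontrivial[OF assms(1), of 2], of f L L'] by (simp add: ntlim_def)

lemma ntlim_radial:
 assumes nt: "ntlim f \<zeta> L" and \<zeta>: "cmod \<zeta> = 1" and r: "\<And>k. 0 < r k" "\<And>k. r k < 1" "r \<longlonglongrightarrow> 1"
 shows "(\<lambda>k. f (of_real (r k) * \<zeta>)) \<longlonglongrightarrow> L"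
proof -
 have t: "(f \<longlongrightarrow> L) (at \<zeta> within stolz 2 \<zeta>)" using nt by (simp add: ntlim_def)
 have l: "(\<lambda>k. of_real (r k) * \<zeta>) \<longlonglongrightarrow> of_real 1 * \<zeta>"
  by (intro tendsto_intros r)
 have d: "dist (of_real (r k) * \<zeta>) \<zeta> = 1 - r k" for k
 proof -
  have "r k * \<zeta> - \<zeta> = - (of_real (1 - r k) * \<zeta>)" by (simp add: algebra_simps)
  then have "dist (r k * \<zeta>) \<zeta> = cmod (of_real (1 - r k) * \<zeta>)" by (simp add: dist_norm)
  also have "\<dots> = 1 - r k" unfolding norm_mult norm_of_real using \<zeta> r(2)[of k] by simp
  finally show ?thesis .
 qed
 have "of_real (r k) * \<zeta> \<in> stolz 2 \<zeta> - {\<zeta>}" for k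
  using d[of k] r(1,2)[of k] \<zeta> by (auto simp: stolz_def norm_mult)
 with t l show ?thesis
  unfolding tendsto_at_iff_sequentially comp_def by simp
qed

text \<open>The holomorphic function whose real part is the Poisson integral of \<open>u\<close>, with real value at \<open>0\<close>.\<close>

definition herglotz :: "(real \<Rightarrow> real) \<Rightarrow> complex \<Rightarrow> complex" where
 "herglotz u w = of_real (1 / (2 * pi)) * (\<integral>t. (cis t + w) / (cis t - w) * of_real (u t) \<partial>circle)"

lemma herglotz_integrable:
 assumes u: "integrable circle u" and w: "cmod w < 1"
 shows "integrable circle (\<lambda>t. (cis t + w) / (cis t - w) * of_real (u t))"
proof -
 have [measurable]: "u \<in> borel_measurable circle" using u by auto
 have c: "continuous_on {0..2*pi} (\<lambda>t. (cis t + w) / (cis t - w))"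
  by (intro continuous_intros) (use cis_minus_ne_0[OF w] in auto)
 note [measurable] = borel_measurable_circle_continuous[OF c]
 show ?thesis
 proof (rule Bochner_Integration.integrable_bound)
  show "integrable circle (\<lambda>t. 2 / (1 - cmod w) * \<bar>u t\<bar>)" using u by auto
  show "AE t in circle. norm ((cis t + w) / (cis t - w) * of_real (u t)) \<le> norm (2 / (1 - cmod w) * \<bar>u t\<bar>)"
  proof (rule AE_I2)
   fix t
   have "cmod (cis t + w) \<le> 2" using norm_triangle_ineq[of "cis t" w] w by simp
   moreover have "1 - cmod w \<le> cmod (cis t - w)" using norm_triangle_ineq2[of "cis t" w] by simp
   ultimately have "cmod (cis t + w) / cmod (cis t - w) \<le> 2 / (1 - cmod w)" using w by (intro frac_le) auto
   then have "norm ((cis t + w) / (cis t - w) * of_real (u t)) \<le> 2 / (1 - cmod w) * \<bar>u t\<bar>"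
    unfolding norm_mult norm_divide norm_of_real by (intro mult_right_mono) auto
   then show "norm ((cis t + w) / (cis t - w) * of_real (u t)) \<le> norm (2 / (1 - cmod w) * \<bar>u t\<bar>)" using w by simp
  qed
 qed measurable
qed

lemma herglotz_holomorphic:
 assumes u: "integrable circle u"
 shows "herglotz u holomorphic_on ball 0 1"
proof (rule holomorphic_onI)
 fix w :: complex assume "w \<in> ball 0 1"
 then have w: "cmod w < 1" by simp
 have [measurable]: "u \<in> borel_measurable circle" using u by auto
 define d where "d = (1 - cmod w) / 2"
 have d: "d > 0" using w by (simp add: d_def)
 have near: "d \<le> cmod (cis t - v)" "cmod v < 1" if "v \<in> ball w d" for v t
 proof -
  have "cmod v < cmod w + d" using that norm_triangle_ineq2[of v w] by (simp add: dist_norm norm_minus_commute)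
  then have "cmod v \<le> 1 - d" by (simp add: d_def field_simps)
  then show "d \<le> cmod (cis t - v)" "cmod v < 1" using norm_triangle_ineq2[of "cis t" v] d by auto
 qed
 define I where "I = (\<integral>t. 2 * cis t / ((cis t - w) * (cis t - w)) * of_real (u t) \<partial>circle)"
 have "((\<lambda>v. (herglotz u v - herglotz u w) / (v - w)) \<longlongrightarrow> of_real (1 / (2 * pi)) * I) (at w within ball w d)"
  unfolding tendsto_at_iff_sequentially
 proof (intro allI impI)
  fix X assume X: "\<forall>i. X i \<in> ball w d - {w}" and lim: "X \<longlonglongrightarrow> w"
  have X': "X i \<in> ball w d" "X i \<noteq> w" for i using X by auto
  have cont: "continuous_on {0..2*pi} (\<lambda>t. 2 * cis t / ((cis t - X i) * (cis t - w)))" for i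
   using cis_minus_ne_0[OF near(2)[OF X'(1)]] cis_minus_ne_0[OF w] by (intro continuous_intros) auto
  have cont': "continuous_on {0..2*pi} (\<lambda>t. 2 * cis t / ((cis t - w) * (cis t - w)))"
   using cis_minus_ne_0[OF w] by (intro continuous_intros) auto
  note [measurable] = borel_measurable_circle_continuous[OF cont] borel_measurable_circle_continuous[OF cont']
  have eq: "(herglotz u (X i) - herglotz u w) / (X i - w) =
    of_real (1 / (2 * pi)) * (\<integral>t. 2 * cis t / ((cis t - X i) * (cis t - w)) * of_real (u t) \<partial>circle)" for i
  proof -
   have "(herglotz u (X i) - herglotz u w) / (X i - w) =
    of_real (1 / (2 * pi)) * (1 / (X i - w) * ((\<integral>t. (cis t + X i) / (cis t - X i) * of_real (u t) \<partial>circle) -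
     (\<integral>t. (cis t + w) / (cis t - w) * of_real (u t) \<partial>circle)))"
    by (simp add: herglotz_def diff_divide_distrib algebra_simps)
   also have "(\<integral>t. (cis t + X i) / (cis t - X i) * of_real (u t) \<partial>circle) -
     (\<integral>t. (cis t + w) / (cis t - w) * of_real (u t) \<partial>circle) =
     (\<integral>t. (cis t + X i) / (cis t - X i) * of_real (u t) - (cis t + w) / (cis t - w) * of_real (u t) \<partial>circle)"
    by (intro Bochner_Integration.integral_diff[symmetric] herglotz_integrable u w near(2)[OF X'(1)])
   also have "1 / (X i - w) * \<dots> = (\<integral>t. 1 / (X i - w) * ((cis t + X i) / (cis t - X i) * of_real (u t) - (cis t + w) / (cis t - w) * of_real (u t)) \<partial>circle)"
    by (simp only: integral_mult_right_zero)
   also have "\<dots> = (\<integral>t. 2 * cis t / ((cis t - X i) * (cis t - w)) * of_real (u t) \<partial>circle)"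
   proof (intro Bochner_Integration.integral_cong refl)
    fix t
    have nz: "cis t - X i \<noteq> 0" "cis t - w \<noteq> 0" "X i - w \<noteq> 0"
     using cis_minus_ne_0[OF near(2)[OF X'(1)]] cis_minus_ne_0[OF w] X'(2) by auto
    have "(cis t + X i) / (cis t - X i) - (cis t + w) / (cis t - w) =
      (X i - w) * (2 * cis t / ((cis t - X i) * (cis t - w)))"
     using nz(1,2) by (simp add: diff_frac_eq) (simp add: algebra_simps)
    then have "(cis t + X i) / (cis t - X i) * of_real (u t) - (cis t + w) / (cis t - w) * of_real (u t) =
      (X i - w) * (2 * cis t / ((cis t - X i) * (cis t - w))) * of_real (u t)"
     by (simp only: left_diff_distrib[symmetric])
    then show "1 / (X i - w) * ((cis t + X i) / (cis t - X i) * of_real (u t) - (cis t + w) / (cis t - w) * of_real (u t)) =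
      2 * cis t / ((cis t - X i) * (cis t - w)) * of_real (u t)"
     using nz(3) by simp
   qed
   finally show ?thesis .
  qed
  have "(\<lambda>i. \<integral>t. 2 * cis t / ((cis t - X i) * (cis t - w)) * of_real (u t) \<partial>circle) \<longlonglongrightarrow> I"
   unfolding I_def
  proof (rule integral_dominated_convergence[where w = "\<lambda>t. 2 / (d * d) * \<bar>u t\<bar>"])
   show "integrable circle (\<lambda>t. 2 / (d * d) * \<bar>u t\<bar>)" using u by auto
   show "AE t in circle. (\<lambda>i. 2 * cis t / ((cis t - X i) * (cis t - w)) * of_real (u t)) \<longlonglongrightarrow>
     2 * cis t / ((cis t - w) * (cis t - w)) * of_real (u t)"
    by (rule AE_I2, intro tendsto_intros lim) (use cis_minus_ne_0[OF w] in auto)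
   fix i
   show "AE t in circle. norm (2 * cis t / ((cis t - X i) * (cis t - w)) * of_real (u t)) \<le> 2 / (d * d) * \<bar>u t\<bar>"
   proof (rule AE_I2)
    fix t
    have "d * d \<le> cmod (cis t - X i) * cmod (cis t - w)"
     using near(1)[OF X'(1)] near(1)[of w] d by (intro mult_mono) auto
    then have "2 / (cmod (cis t - X i) * cmod (cis t - w)) \<le> 2 / (d * d)"
     using d by (intro divide_left_mono) (auto intro!: mult_pos_pos order.strict_trans2[OF d near(1)] X')
    then have "2 / (cmod (cis t - X i) * cmod (cis t - w)) * \<bar>u t\<bar> \<le> 2 / (d * d) * \<bar>u t\<bar>"
     by (intro mult_right_mono) auto
    then show "norm (2 * cis t / ((cis t - X i) * (cis t - w)) * of_real (u t)) \<le> 2 / (d * d) * \<bar>u t\<bar>"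
     by (simp add: norm_mult norm_divide)
   qed
  qed measurable
  then show "((\<lambda>v. (herglotz u v - herglotz u w) / (v - w)) \<circ> X) \<longlonglongrightarrow> of_real (1 / (2 * pi)) * I"
   unfolding comp_def eq by (intro tendsto_intros)
 qed
 then have "(herglotz u has_field_derivative of_real (1 / (2 * pi)) * I) (at w within ball w d)"
  by (simp add: has_field_derivative_iff)
 then have "(herglotz u has_field_derivative of_real (1 / (2 * pi)) * I) (at w)"
  using d at_within_open[of w "ball w d"] by simp
 then show "herglotz u field_differentiable at w within ball 0 1"
  using field_differentiable_def field_differentiable_at_within by blast
qed

lemma Re_herglotz:
 assumes u: "integrable circle u" and w: "cmod w < 1"
 shows "Re (herglotz u w) = 1 / (2 * pi) * (\<integral>t. poisson w t * u t \<partial>circle)"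
proof -
 have "Re (herglotz u w) = 1 / (2 * pi) * Re (\<integral>t. (cis t + w) / (cis t - w) * of_real (u t) \<partial>circle)"
  unfolding herglotz_def by (simp del: of_real_divide of_real_mult)
 also have "Re (\<integral>t. (cis t + w) / (cis t - w) * of_real (u t) \<partial>circle) =
   (\<integral>t. Re ((cis t + w) / (cis t - w) * of_real (u t)) \<partial>circle)"
  by (rule integral_Re[symmetric, OF herglotz_integrable[OF u w]])
 also have "\<dots> = (\<integral>t. poisson w t * u t \<partial>circle)"
 proof -
  have "Re (z * of_real x) = Re z * x" for z x by simp
  then show ?thesis unfolding poisson_eq_Re[OF w] by (intro Bochner_Integration.integral_cong refl)
 qed
 finally show ?thesis .
qed

lemma herglotz_diff:
 assumes u: "integrable circle u" "integrable circle v" and w: "cmod w < 1"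
 shows "herglotz (\<lambda>t. u t - v t) w = herglotz u w - herglotz v w"
proof -
 have "(\<integral>t. (cis t + w) / (cis t - w) * of_real (u t - v t) \<partial>circle) =
   (\<integral>t. (cis t + w) / (cis t - w) * of_real (u t) - (cis t + w) / (cis t - w) * of_real (v t) \<partial>circle)"
  by (simp only: of_real_diff right_diff_distrib)
 also have "\<dots> = (\<integral>t. (cis t + w) / (cis t - w) * of_real (u t) \<partial>circle) -
   (\<integral>t. (cis t + w) / (cis t - w) * of_real (v t) \<partial>circle)"
  by (rule Bochner_Integration.integral_diff[OF herglotz_integrable[OF u(1) w] herglotz_integrable[OF u(2) w]])
 finally show ?thesis by (simp only: herglotz_def right_diff_distrib)
qed

lemma Re_herglotz_mono:
 assumes u: "integrable circle u" "integrable circle v" and w: "cmod w < 1"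
  and le: "\<And>t. u t \<le> v t"
 shows "Re (herglotz u w) \<le> Re (herglotz v w)"
proof -
 have "(\<integral>t. poisson w t * u t \<partial>circle) \<le> (\<integral>t. poisson w t * v t \<partial>circle)"
  using integrable_poisson_mult[OF u(1) w] integrable_poisson_mult[OF u(2) w]
  by (intro integral_mono mult_left_mono le poisson_nonneg w) auto
 then show ?thesis unfolding Re_herglotz[OF u(1) w] Re_herglotz[OF u(2) w] by (intro mult_left_mono) auto
qed

lemma herglotz_const: "cmod w < 1 \<Longrightarrow> Re (herglotz (\<lambda>_. c) w) = c"
 by (subst Re_herglotz) (auto simp: integral_poisson finite_measure.integrable_const[OF finite_measure_circle])

lemma Re_herglotz_ntlim:
 assumes u: "integrable circle u" and lp: "circle_lebesgue_point u x"
 shows "ntlim (\<lambda>w. Re (herglotz u w)) (cis x) (u x)"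
 unfolding ntlim_def
proof (intro allI impI)
 fix \<beta> :: real assume "1 < \<beta>"
 then have "((\<lambda>w. (1 / (2 * pi)) *\<^sub>R (\<integral>t. poisson w t *\<^sub>R u t \<partial>circle)) \<longlongrightarrow> u x) (at (cis x) within stolz \<beta> (cis x))"
  using poisson_integral_ntlim[OF u lp] by (simp add: ntlim_def)
 moreover have "\<forall>\<^sub>F w in at (cis x) within stolz \<beta> (cis x). (1 / (2 * pi)) *\<^sub>R (\<integral>t. poisson w t *\<^sub>R u t \<partial>circle) = Re (herglotz u w)"
 proof -
  have "\<forall>\<^sub>F w in at (cis x) within stolz \<beta> (cis x). w \<in> stolz \<beta> (cis x)"
   by (auto simp: eventually_at intro: exI[of _ 1])
  then show ?thesis by eventually_elim (simp add: Re_herglotz[OF u] stolz_def)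
 qed
 ultimately show "((\<lambda>w. Re (herglotz u w)) \<longlongrightarrow> u x) (at (cis x) within stolz \<beta> (cis x))"
  by (rule Lim_transform_eventually)
qed

text \<open>Arithmetic-geometric splitting turns convergence in \<open>L\<^sup>2\<close> into convergence in \<open>L\<^sup>1\<close>, without
 square roots.\<close>

lemma tendsto_0_by_splitting:
 fixes a b :: "nat \<Rightarrow> ennreal" and A :: ennreal
 assumes b: "b \<longlonglongrightarrow> 0" and A: "A < \<infinity>"
  and le: "\<And>\<eta> k. 0 < \<eta> \<Longrightarrow> a k \<le> ennreal \<eta> * A + ennreal (1 + 1 / \<eta>) * b k"
 shows "a \<longlonglongrightarrow> 0"
proof (rule order_tendstoI)
 fix e :: ennreal assume "0 < e"
 then obtain e' where e': "0 < e'" "ennreal e' < e"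
  using ennreal_rat_dense by (metis ennreal_less_zero_iff zero_less_iff_neq_zero ennreal_0 dense less_top_ennreal order_less_le_trans top_greatest)
 obtain A' where A': "A = ennreal A'" "0 \<le> A'" using A by (cases A) auto
 define \<eta> where "\<eta> = e' / (2 * (A' + 1))"
 have \<eta>: "0 < \<eta>" using e' A' by (simp add: \<eta>_def)
 have "ennreal \<eta> * A \<le> ennreal (e' / 2)"
 proof -
  have "\<eta> * A' \<le> \<eta> * (A' + 1)" using \<eta> by (intro mult_left_mono) auto
  also have "\<dots> = e' / 2" using A' by (simp add: \<eta>_def divide_simps)
  finally show ?thesis using A' \<eta> by (simp add: ennreal_mult[symmetric] ennreal_leI)
 qed
 moreover have "\<forall>\<^sub>F k in sequentially. ennreal (1 + 1 / \<eta>) * b k < ennreal (e' / 2)"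
 proof -
  have "(\<lambda>k. ennreal (1 + 1 / \<eta>) * b k) \<longlonglongrightarrow> ennreal (1 + 1 / \<eta>) * 0"
   by (rule ennreal_tendsto_cmult[OF _ b]) simp
  then show ?thesis using e' by (intro order_tendstoD(2)[of _ 0]) auto
 qed
 ultimately show "\<forall>\<^sub>F k in sequentially. a k < e"
 proof (elim eventually_mono)
  fix k assume "ennreal \<eta> * A \<le> ennreal (e' / 2)" and k: "ennreal (1 + 1 / \<eta>) * b k < ennreal (e' / 2)"
  have "a k \<le> ennreal \<eta> * A + ennreal (1 + 1 / \<eta>) * b k" by (rule le[OF \<eta>])
  also have "\<dots> \<le> ennreal (e' / 2) + ennreal (e' / 2)" using \<open>ennreal \<eta> * A \<le> ennreal (e' / 2)\<close> k by (intro add_mono) auto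
  also have "\<dots> = ennreal e'" using e' by (simp add: ennreal_plus[symmetric] del: ennreal_plus)
  finally show "a k < e" using e'(2) by simp
 qed
qed simp

lemma norm_square_diff_split:
 fixes x y :: complex
 assumes \<eta>: "0 < \<eta>"
 shows "cmod (x\<^sup>2 - y\<^sup>2) \<le> \<eta> * (cmod y)\<^sup>2 + (1 + 1 / \<eta>) * (cmod (x - y))\<^sup>2"
  and "cmod (x - y) \<le> \<eta> + (1 + 1 / \<eta>) * (cmod (x - y))\<^sup>2"
proof -
 have am: "2 * a * b \<le> \<eta> * a\<^sup>2 + 1 / \<eta> * b\<^sup>2" for a b :: real
 proof -
  have "0 \<le> (\<eta> * a - b)\<^sup>2 / \<eta>" using \<eta> by simp
  also have "\<dots> = \<eta> * a\<^sup>2 + 1 / \<eta> * b\<^sup>2 - 2 * a * b"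
   using \<eta> by (simp add: power2_eq_square field_simps)
  finally show ?thesis by simp
 qed
 define z where "z = x - y"
 have "x\<^sup>2 - y\<^sup>2 = z\<^sup>2 + 2 * y * z" by (simp add: z_def power2_eq_square algebra_simps)
 then have "cmod (x\<^sup>2 - y\<^sup>2) \<le> (cmod z)\<^sup>2 + 2 * cmod y * cmod z"
  using norm_triangle_ineq[of "z\<^sup>2" "2 * y * z"] by (simp add: norm_mult norm_power)
 also have "\<dots> \<le> (cmod z)\<^sup>2 + (\<eta> * (cmod y)\<^sup>2 + 1 / \<eta> * (cmod z)\<^sup>2)" using am by (intro add_left_mono)
 finally show "cmod (x\<^sup>2 - y\<^sup>2) \<le> \<eta> * (cmod y)\<^sup>2 + (1 + 1 / \<eta>) * (cmod (x - y))\<^sup>2"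
  by (simp add: z_def algebra_simps)
 have "2 * 1 * cmod z \<le> \<eta> * 1\<^sup>2 + 1 / \<eta> * (cmod z)\<^sup>2" by (rule am)
 also have "\<dots> \<le> \<eta> + (1 + 1 / \<eta>) * (cmod z)\<^sup>2" by (simp add: algebra_simps)
 finally show "cmod (x - y) \<le> \<eta> + (1 + 1 / \<eta>) * (cmod (x - y))\<^sup>2" unfolding z_def[symmetric] using norm_ge_zero[of z] by linarith
qed

lemma L2_imp_L1_tendsto:
 fixes S :: "nat \<Rightarrow> real \<Rightarrow> complex"
 assumes [measurable]: "\<And>k. S k \<in> borel_measurable circle" "f \<in> borel_measurable circle"
  and fin: "(\<integral>\<^sup>+t. ennreal ((cmod (f t))\<^sup>2) \<partial>circle) < \<infinity>"
  and lim: "(\<lambda>k. \<integral>\<^sup>+t. ennreal ((cmod (S k t - f t))\<^sup>2) \<partial>circle) \<longlonglongrightarrow> 0"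
 shows "(\<lambda>k. \<integral>\<^sup>+t. ennreal (cmod (S k t - f t)) \<partial>circle) \<longlonglongrightarrow> 0"
  and "(\<lambda>k. \<integral>\<^sup>+t. ennreal (cmod ((S k t)\<^sup>2 - (f t)\<^sup>2)) \<partial>circle) \<longlonglongrightarrow> 0"
proof -
 show "(\<lambda>k. \<integral>\<^sup>+t. ennreal (cmod (S k t - f t)) \<partial>circle) \<longlonglongrightarrow> 0"
 proof (rule tendsto_0_by_splitting[OF lim, of "ennreal (2 * pi)"])
  fix \<eta> :: real and k assume \<eta>: "0 < \<eta>"
  have "(\<integral>\<^sup>+t. ennreal (cmod (S k t - f t)) \<partial>circle) \<le>
   (\<integral>\<^sup>+t. ennreal \<eta> + ennreal (1 + 1 / \<eta>) * ennreal ((cmod (S k t - f t))\<^sup>2) \<partial>circle)"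
   using norm_square_diff_split(2)[OF \<eta>] \<eta>
   by (intro nn_integral_mono) (simp add: ennreal_mult[symmetric] ennreal_plus[symmetric] ennreal_leI del: ennreal_plus)
  also have "\<dots> = ennreal \<eta> * ennreal (2 * pi) + ennreal (1 + 1 / \<eta>) * (\<integral>\<^sup>+t. ennreal ((cmod (S k t - f t))\<^sup>2) \<partial>circle)"
   by (subst nn_integral_add, measurable, subst nn_integral_cmult, measurable)
  finally show "(\<integral>\<^sup>+t. ennreal (cmod (S k t - f t)) \<partial>circle) \<le> ennreal \<eta> * ennreal (2 * pi) +
    ennreal (1 + 1 / \<eta>) * (\<integral>\<^sup>+t. ennreal ((cmod (S k t - f t))\<^sup>2) \<partial>circle)" .
 qed simp
 show "(\<lambda>k. \<integral>\<^sup>+t. ennreal (cmod ((S k t)\<^sup>2 - (f t)\<^sup>2)) \<partial>circle) \<longlonglongrightarrow> 0"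
 proof (rule tendsto_0_by_splitting[OF lim fin])
  fix \<eta> :: real and k assume \<eta>: "0 < \<eta>"
  have "(\<integral>\<^sup>+t. ennreal (cmod ((S k t)\<^sup>2 - (f t)\<^sup>2)) \<partial>circle) \<le>
   (\<integral>\<^sup>+t. ennreal \<eta> * ennreal ((cmod (f t))\<^sup>2) + ennreal (1 + 1 / \<eta>) * ennreal ((cmod (S k t - f t))\<^sup>2) \<partial>circle)"
   using norm_square_diff_split(1)[OF \<eta>] \<eta>
   by (intro nn_integral_mono) (simp add: ennreal_mult[symmetric] ennreal_plus[symmetric] ennreal_leI del: ennreal_plus)
  also have "\<dots> = ennreal \<eta> * (\<integral>\<^sup>+t. ennreal ((cmod (f t))\<^sup>2) \<partial>circle) + ennreal (1 + 1 / \<eta>) * (\<integral>\<^sup>+t. ennreal ((cmod (S k t - f t))\<^sup>2) \<partial>circle)"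
   by (subst nn_integral_add, measurable, subst nn_integral_cmult, measurable, subst nn_integral_cmult, measurable)
  finally show "(\<integral>\<^sup>+t. ennreal (cmod ((S k t)\<^sup>2 - (f t)\<^sup>2)) \<partial>circle) \<le>
    ennreal \<eta> * (\<integral>\<^sup>+t. ennreal ((cmod (f t))\<^sup>2) \<partial>circle) +
    ennreal (1 + 1 / \<eta>) * (\<integral>\<^sup>+t. ennreal ((cmod (S k t - f t))\<^sup>2) \<partial>circle)" .
 qed
qed

lemma continuous_on_radial:
 fixes s :: "complex \<Rightarrow> complex" and r :: real
 assumes "s holomorphic_on ball 0 1" "0 < r" "r < 1"
 shows "continuous_on A (\<lambda>t. s (of_real r * cis t))"
 using assms(2,3) by (intro continuous_intros continuous_on_compose2[OF holomorphic_on_imp_continuous_on[OF assms(1)]])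
  (auto simp: norm_mult)

lemma integrable_of_nn_square:
 fixes f :: "real \<Rightarrow> complex"
 assumes [measurable]: "f \<in> borel_measurable circle"
  and "(\<integral>\<^sup>+t. ennreal ((cmod (f t))\<^sup>2) \<partial>circle) < \<infinity>"
 shows "integrable circle f" "integrable circle (\<lambda>t. (f t)\<^sup>2)"
proof -
 show i2: "integrable circle (\<lambda>t. (f t)\<^sup>2)"
  by (rule integrableI_bounded) (use assms in \<open>auto simp: norm_power\<close>)
 show "integrable circle f"
 proof (rule Bochner_Integration.integrable_bound)
  show "integrable circle (\<lambda>t. 1 + cmod ((f t)\<^sup>2))"
   by (intro Bochner_Integration.integrable_add integrable_norm i2 finite_measure.integrable_const[OF finite_measure_circle])
  have "x \<le> 1 + x\<^sup>2" if "0 \<le> x" for x :: real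
   using sum_squares_bound[of 1 x] that by simp
  then show "AE t in circle. norm (f t) \<le> norm (1 + cmod ((f t)\<^sup>2))"
   by (simp add: norm_power)
 qed simp
qed

text \<open>Fatou's theorem for \<open>H\<^sup>2\<close>: the function is the Poisson integral of its boundary function.\<close>

theorem H2_ntlim:
 fixes s :: "complex \<Rightarrow> complex" and r :: "nat \<Rightarrow> real"
 assumes s: "s holomorphic_on ball 0 1"
  and f[measurable]: "f \<in> borel_measurable circle" "(\<integral>\<^sup>+t. ennreal ((cmod (f t))\<^sup>2) \<partial>circle) < \<infinity>"
  and r: "\<And>k. 0 < r k" "\<And>k. r k < 1" "r \<longlonglongrightarrow> 1"
  and lim: "(\<lambda>k. \<integral>\<^sup>+t. ennreal ((cmod (s (r k * cis t) - f t))\<^sup>2) \<partial>circle) \<longlonglongrightarrow> 0"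
 shows "AE t in circle. ntlim s (cis t) (f t)"
proof -
 define S where "S k t = s (of_real (r k) * cis t)" for k t
 have Sc: "continuous_on {0..2*pi} (S k)" for k
  unfolding S_def by (rule continuous_on_radial[OF s r(1,2)])
 have [measurable]: "S k \<in> borel_measurable circle" for k
  by (rule borel_measurable_circle_continuous[OF Sc])
 have L1: "(\<lambda>k. \<integral>\<^sup>+t. ennreal (cmod (S k t - f t)) \<partial>circle) \<longlonglongrightarrow> 0"
 proof (rule L2_imp_L1_tendsto(1)[OF _ f])
  show "(\<lambda>k. \<integral>\<^sup>+t. ennreal ((cmod (S k t - f t))\<^sup>2) \<partial>circle) \<longlonglongrightarrow> 0"
   using lim by (simp add: S_def)
 qed measurable
 have fint: "integrable circle f" by (rule integrable_of_nn_square[OF f])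
 have rep: "s w = (1 / (2 * pi)) *\<^sub>R (\<integral>t. poisson w t *\<^sub>R f t \<partial>circle)" if w: "cmod w < 1" for w
 proof -
  have "continuous_on {0..2*pi} (poisson w)" by (intro continuous_intros w)
  then have "compact (poisson w ` {0..2*pi})" by (intro compact_continuous_image) auto
  then obtain B where B: "\<And>t. t \<in> {0..2*pi} \<Longrightarrow> \<bar>poisson w t\<bar> \<le> B"
   using compact_imp_bounded bounded_iff by (metis imageI real_norm_def)
  have "(\<lambda>k. \<integral>t. poisson w t *\<^sub>R S k t \<partial>circle) \<longlonglongrightarrow> (\<integral>t. poisson w t *\<^sub>R f t \<partial>circle)"
  proof (rule tendsto_L1_int)
   show "integrable circle (\<lambda>t. poisson w t *\<^sub>R S k t)" for k
    by (rule integrable_poisson_mult[OF integrable_circle_continuous[OF Sc] w])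
   show "integrable circle (\<lambda>t. poisson w t *\<^sub>R f t)"
    by (rule integrable_poisson_mult[OF fint w])
   have "(\<lambda>k. ennreal B * (\<integral>\<^sup>+t. ennreal (cmod (S k t - f t)) \<partial>circle)) \<longlonglongrightarrow> ennreal B * 0"
    by (rule ennreal_tendsto_cmult[OF _ L1]) simp
   moreover have le: "(\<integral>\<^sup>+t. ennreal (norm (poisson w t *\<^sub>R S k t - poisson w t *\<^sub>R f t)) \<partial>circle) \<le>
     ennreal B * (\<integral>\<^sup>+t. ennreal (cmod (S k t - f t)) \<partial>circle)" for k
   proof -
    have "(\<integral>\<^sup>+t. ennreal (norm (poisson w t *\<^sub>R S k t - poisson w t *\<^sub>R f t)) \<partial>circle) \<le>
     (\<integral>\<^sup>+t. ennreal B * ennreal (cmod (S k t - f t)) \<partial>circle)"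
    proof (rule nn_integral_mono)
     fix t assume "t \<in> space circle"
     then have "\<bar>poisson w t\<bar> \<le> B" using B by simp
     then have "norm (poisson w t *\<^sub>R S k t - poisson w t *\<^sub>R f t) \<le> B * cmod (S k t - f t)"
      unfolding scaleR_diff_right[symmetric] norm_scaleR by (intro mult_right_mono) auto
     then show "ennreal (norm (poisson w t *\<^sub>R S k t - poisson w t *\<^sub>R f t)) \<le> ennreal B * ennreal (cmod (S k t - f t))"
      by (simp add: ennreal_mult''[symmetric] ennreal_leI)
    qed
    also have "\<dots> = ennreal B * (\<integral>\<^sup>+t. ennreal (cmod (S k t - f t)) \<partial>circle)"
     by (rule nn_integral_cmult) measurable
    finally show ?thesis .
   qed
   ultimately show "(\<lambda>k. \<integral>\<^sup>+t. ennreal (norm (poisson w t *\<^sub>R S k t - poisson w t *\<^sub>R f t)) \<partial>circle) \<longlonglongrightarrow> 0"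
    by (intro tendsto_0_ennreal_le[OF _ le]) simp
  qed
  moreover have "(\<integral>t. poisson w t *\<^sub>R S k t \<partial>circle) = 2 * pi * s (r k * w)" for k
  proof -
   have "continuous_on (cball 0 1) (\<lambda>z::complex. s (r k * z))" "(\<lambda>z. s (r k * z)) holomorphic_on ball 0 1"
   proof -
    have m: "r k * cmod z < 1" if "cmod z \<le> 1" for z :: complex
     using r(1,2)[of k] that by (smt (verit) mult_left_le)
    show "continuous_on (cball 0 1) (\<lambda>z::complex. s (r k * z))"
     using m r(1)[of k] by (intro continuous_intros continuous_on_compose2[OF holomorphic_on_imp_continuous_on[OF s]])
      (auto simp: norm_mult)
    show "(\<lambda>z. s (r k * z)) holomorphic_on ball 0 1"
     by (rule holomorphic_on_compose_gen[OF _ s, of "\<lambda>z. r k * z", unfolded comp_def])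
      (use m r(1)[of k] in \<open>auto intro!: holomorphic_intros simp: norm_mult\<close>)
   qed
   from circle_Poisson_formula[OF this w] show ?thesis by (simp add: S_def)
  qed
  moreover have "(\<lambda>k. 2 * pi * s (r k * w)) \<longlonglongrightarrow> 2 * pi * s (of_real 1 * w)"
  proof -
   have "isCont s w" using s w holomorphic_on_imp_differentiable_at[of s "ball 0 1" w] field_differentiable_imp_continuous_at by auto
   then have "(\<lambda>k. s (r k * w)) \<longlonglongrightarrow> s w"
    by (rule isCont_tendsto_compose) (use tendsto_mult[OF tendsto_of_real[OF r(3)] tendsto_const[of w]] in simp)
   then show ?thesis by (intro tendsto_mult tendsto_const) simp
  qed
  ultimately have "(\<integral>t. poisson w t *\<^sub>R f t \<partial>circle) = 2 * pi * s (of_real 1 * w)"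
   by (simp only: LIMSEQ_unique)
  then have "2 * pi * s w = (\<integral>t. poisson w t *\<^sub>R f t \<partial>circle)"
   by simp
  then show ?thesis by (simp add: scaleR_conv_of_real field_simps)
 qed
 from AE_circle_lebesgue_point[OF fint] show ?thesis
 proof eventually_elim
  case (elim x)
  show ?case unfolding ntlim_def
  proof (intro allI impI)
   fix \<beta> :: real assume "1 < \<beta>"
   then have "((\<lambda>w. (1 / (2 * pi)) *\<^sub>R (\<integral>t. poisson w t *\<^sub>R f t \<partial>circle)) \<longlongrightarrow> f x) (at (cis x) within stolz \<beta> (cis x))"
    using poisson_integral_ntlim[OF fint elim] by (simp add: ntlim_def)
   moreover have "\<forall>\<^sub>F w in at (cis x) within stolz \<beta> (cis x). (1 / (2 * pi)) *\<^sub>R (\<integral>t. poisson w t *\<^sub>R f t \<partial>circle) = s w"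
   proof -
    have "\<forall>\<^sub>F w in at (cis x) within stolz \<beta> (cis x). w \<in> stolz \<beta> (cis x)"
     by (auto simp: eventually_at intro: exI[of _ 1])
    then show ?thesis by eventually_elim (simp add: rep stolz_def)
   qed
   ultimately show "(s \<longlongrightarrow> f x) (at (cis x) within stolz \<beta> (cis x))"
    by (rule Lim_transform_eventually)
  qed
 qed
qed

text \<open>A bounded function belongs to \<open>H\<^sup>2\<close>.\<close>

lemma bounded_holomorphic_ntlim:
 assumes b: "b holomorphic_on ball 0 1" and bd: "\<And>w. cmod w < 1 \<Longrightarrow> cmod (b w) \<le> B"
 obtains f where "f \<in> borel_measurable circle" "AE t in circle. ntlim b (cis t) (f t)"
proof -
 have bnd: "(\<integral>t. (cmod (b (r * cis t)))\<^sup>2 \<partial>circle) \<le> B\<^sup>2 * (2 * pi)" if r: "0 < r" "r < 1" for r :: real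
 proof -
  have "(\<integral>t. (cmod (b (r * cis t)))\<^sup>2 \<partial>circle) \<le> (\<integral>t. B\<^sup>2 \<partial>circle)"
  proof (rule integral_mono)
   show "integrable circle (\<lambda>t. (cmod (b (r * cis t)))\<^sup>2)"
    by (intro integrable_circle_continuous continuous_intros continuous_on_radial b r)
   show "(cmod (b (r * cis t)))\<^sup>2 \<le> B\<^sup>2" for t
    using r by (intro power_mono bd) (auto simp: norm_mult)
  qed (rule finite_measure.integrable_const[OF finite_measure_circle])
  also have "(\<integral>t. B\<^sup>2 \<partial>circle) = B\<^sup>2 * (2 * pi)" by simp
  finally show ?thesis .
 qed
 show ?thesis
 proof (rule H2_boundary_function[OF b bnd])
  fix f and r :: "nat \<Rightarrow> real"
  assume *: "f \<in> borel_measurable circle" "(\<integral>\<^sup>+t. ennreal ((cmod (f t))\<^sup>2) \<partial>circle) < \<infinity>"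
   "\<And>k. 0 < r k" "\<And>k. r k < 1" "r \<longlonglongrightarrow> 1"
   "(\<lambda>k. \<integral>\<^sup>+t. ennreal ((cmod (b (r k * cis t) - f t))\<^sup>2) \<partial>circle) \<longlonglongrightarrow> 0"
  show ?thesis
   by (rule that[OF *(1) H2_ntlim[OF b *]])
 qed
qed

lemma ntlim_compose_eventually:
 assumes "ntlim f \<zeta> L" "\<And>w. cmod w < 1 \<Longrightarrow> g w = F (f w)" "isCont F L"
 shows "ntlim g \<zeta> (F L)"
 unfolding ntlim_def
proof (intro allI impI)
 fix \<beta> :: real assume \<beta>: "1 < \<beta>"
 have "((\<lambda>w. F (f w)) \<longlongrightarrow> F L) (at \<zeta> within stolz \<beta> \<zeta>)"
  using assms(1) \<beta> by (intro isCont_tendsto_compose[OF assms(3)]) (simp add: ntlim_def)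
 moreover have "\<forall>\<^sub>F w in at \<zeta> within stolz \<beta> \<zeta>. F (f w) = g w"
  by (auto simp: eventually_at stolz_def assms(2) intro: exI[of _ 1])
 ultimately show "(g \<longlongrightarrow> F L) (at \<zeta> within stolz \<beta> \<zeta>)" by (rule Lim_transform_eventually)
qed

text \<open>\<open>exp (herglotz u)\<close> is a quotient of two bounded functions, obtained from the positive and the negative
 part of \<open>u\<close>. Both have nontangential limits by Fatou's theorem, and the limit of the denominator
 is nonzero because its modulus is the exponential of a Poisson integral.\<close>

theorem outer_ntlim:
 assumes u: "integrable circle u"
 obtains f where "f \<in> borel_measurable circle"
  "AE t in circle. ntlim (\<lambda>w. exp (herglotz u w)) (cis t) (f t) \<and> cmod (f t) = exp (u t)"
proof -
 define up un where "up t = max (u t) 0" and "un t = max (- u t) 0" for t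
 have up: "integrable circle up" and un: "integrable circle un"
  unfolding up_def un_def by (intro integrable_max integrable_minus u integrable_zero)+
 have udiff: "u = (\<lambda>t. up t - un t)" by (auto simp: up_def un_def)
 have bex: "\<exists>f. f \<in> borel_measurable circle \<and> (AE t in circle. ntlim (\<lambda>w. exp (- herglotz v w)) (cis t) (f t))"
  if v: "integrable circle v" "\<And>t. 0 \<le> v t" for v
 proof -
  have "(\<lambda>w. exp (- herglotz v w)) holomorphic_on ball 0 1"
   by (intro holomorphic_intros herglotz_holomorphic v)
  moreover have "cmod (exp (- herglotz v w)) \<le> 1" if w: "cmod w < 1" for w
  proof -
   have "0 \<le> Re (herglotz v w)"
    using Re_herglotz_mono[OF finite_measure.integrable_const[OF finite_measure_circle, of 0] v(1) w v(2)] herglotz_const[OF w, of 0]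
    by simp
   then show ?thesis by simp
  qed
  ultimately obtain f where "f \<in> borel_measurable circle"
    "AE t in circle. ntlim (\<lambda>w. exp (- herglotz v w)) (cis t) (f t)"
   by (rule bounded_holomorphic_ntlim[where B = 1])
  then show ?thesis by blast
 qed
 obtain f1 where f1[measurable]: "f1 \<in> borel_measurable circle" and n1: "AE t in circle. ntlim (\<lambda>w. exp (- herglotz un w)) (cis t) (f1 t)"
  using bex[OF un] by (auto simp: un_def)
 obtain f2 where f2[measurable]: "f2 \<in> borel_measurable circle" and n2: "AE t in circle. ntlim (\<lambda>w. exp (- herglotz up w)) (cis t) (f2 t)"
  using bex[OF up] by (auto simp: up_def)
 show ?thesis
 proof (rule that)
  show "(\<lambda>t. f1 t / f2 t) \<in> borel_measurable circle" by measurable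
  from n1 n2 AE_circle_lebesgue_point[OF u] AE_circle_lebesgue_point[OF up]
  show "AE t in circle. ntlim (\<lambda>w. exp (herglotz u w)) (cis t) (f1 t / f2 t) \<and> cmod (f1 t / f2 t) = exp (u t)"
  proof eventually_elim
   case (elim x)
   have modulus: "cmod L = exp (c * v x)"
    if "integrable circle v" "circle_lebesgue_point v x" "ntlim (\<lambda>w. exp (of_real c * herglotz v w)) (cis x) L" for v c L
   proof -
    have "ntlim (\<lambda>w. cmod (exp (of_real c * herglotz v w))) (cis x) (cmod L)"
     by (rule ntlim_compose_eventually[OF that(3)]) auto
    moreover have "ntlim (\<lambda>w. cmod (exp (of_real c * herglotz v w))) (cis x) (exp (c * v x))"
     by (rule ntlim_compose_eventually[OF Re_herglotz_ntlim[OF that(1,2)], where F = "\<lambda>y. exp (c * y)"]) auto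
    ultimately show ?thesis by (rule ntlim_unique[OF norm_cis])
   qed
   have "cmod (f2 x) = exp (- up x)" using modulus[OF up elim(4), of "-1"] elim(2) by simp
   then have nz: "f2 x \<noteq> 0" by auto
   have nt: "ntlim (\<lambda>w. exp (herglotz u w)) (cis x) (f1 x / f2 x)"
    unfolding ntlim_def
   proof (intro allI impI)
    fix \<beta> :: real assume \<beta>: "1 < \<beta>"
    have "((\<lambda>w. exp (- herglotz un w) / exp (- herglotz up w)) \<longlongrightarrow> f1 x / f2 x) (at (cis x) within stolz \<beta> (cis x))"
     using elim \<beta> nz by (intro tendsto_divide) (auto simp: ntlim_def)
    moreover have "\<forall>\<^sub>F w in at (cis x) within stolz \<beta> (cis x). exp (- herglotz un w) / exp (- herglotz up w) = exp (herglotz u w)"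
    proof -
     have "exp (- herglotz un w) / exp (- herglotz up w) = exp (herglotz u w)" if "cmod w < 1" for w
      using herglotz_diff[OF up un that] by (simp add: udiff exp_diff[symmetric])
     then show ?thesis by (auto simp: eventually_at stolz_def intro: exI[of _ 1])
    qed
    ultimately show "((\<lambda>w. exp (herglotz u w)) \<longlongrightarrow> f1 x / f2 x) (at (cis x) within stolz \<beta> (cis x))"
     by (rule Lim_transform_eventually)
   qed
   moreover have "cmod (f1 x / f2 x) = exp (u x)"
    using modulus[OF u elim(3), of 1] nt by simp
   ultimately show ?case by blast
  qed
 qed
qed

section \<open>The Smirnov class\<close>

text \<open>A holomorphic function on the disk belongs to the Smirnov class if it can be made bounded by factors
 of modulus at most one that tend to one. The estimates by boundary values below hold in this class
 and not for all functions of bounded characteristic.\<close>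

definition smirnov :: "(complex \<Rightarrow> complex) \<Rightarrow> bool" where
 "smirnov F \<longleftrightarrow> F holomorphic_on ball 0 1 \<and>
  (\<exists>E. (\<forall>k::nat. E k holomorphic_on ball 0 1 \<and> (\<forall>w\<in>ball 0 1. cmod (E k w) \<le> 1) \<and>
      (\<exists>B. \<forall>w\<in>ball 0 1. cmod (F w * E k w) \<le> B)) \<and>
     (\<forall>w\<in>ball 0 1. (\<lambda>k. E k w) \<longlonglongrightarrow> 1))"

lemma smirnov_bounded:
 assumes "F holomorphic_on ball 0 1" "\<And>w. w \<in> ball 0 1 \<Longrightarrow> cmod (F w) \<le> B"
 shows "smirnov F"
proof -
 have "\<exists>B. \<forall>w\<in>ball 0 1. cmod (F w * 1) \<le> B" using assms(2) by (intro exI[of _ B]) auto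
 then show ?thesis
  unfolding smirnov_def using assms(1) by (intro conjI exI[of _ "\<lambda>_ _. 1"]) auto
qed

lemma smirnov_binary:
 assumes F: "smirnov F" and G: "smirnov G"
 shows "smirnov (\<lambda>w. F w + G w)" "smirnov (\<lambda>w. F w * G w)"
proof -
 obtain E where E: "\<And>k::nat. E k holomorphic_on ball 0 1" "\<And>k w. w \<in> ball 0 1 \<Longrightarrow> cmod (E k w) \<le> 1"
   "\<And>k. \<exists>B. \<forall>w\<in>ball 0 1. cmod (F w * E k w) \<le> B" "\<And>w. w \<in> ball 0 1 \<Longrightarrow> (\<lambda>k. E k w) \<longlonglongrightarrow> 1"
  using F unfolding smirnov_def by blast
 obtain E' where E': "\<And>k::nat. E' k holomorphic_on ball 0 1" "\<And>k w. w \<in> ball 0 1 \<Longrightarrow> cmod (E' k w) \<le> 1"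
   "\<And>k. \<exists>B. \<forall>w\<in>ball 0 1. cmod (G w * E' k w) \<le> B" "\<And>w. w \<in> ball 0 1 \<Longrightarrow> (\<lambda>k. E' k w) \<longlonglongrightarrow> 1"
  using G unfolding smirnov_def by blast
 have hol: "F holomorphic_on ball 0 1" "G holomorphic_on ball 0 1" using F G by (auto simp: smirnov_def)
 have le1: "cmod (E k w * E' k w) \<le> 1" if "w \<in> ball 0 1" for k w
  using E(2)[OF that, of k] E'(2)[OF that, of k] by (simp add: norm_mult mult_le_one)
 have lim: "(\<lambda>k. E k w * E' k w) \<longlonglongrightarrow> 1" if "w \<in> ball 0 1" for w
  using tendsto_mult[OF E(4)[OF that] E'(4)[OF that]] by simp
 have sum: "\<exists>B. \<forall>w\<in>ball 0 1. cmod ((F w + G w) * (E k w * E' k w)) \<le> B"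
  and prod: "\<exists>B. \<forall>w\<in>ball 0 1. cmod ((F w * G w) * (E k w * E' k w)) \<le> B" for k
 proof -
  obtain B where B: "\<And>w. w \<in> ball 0 1 \<Longrightarrow> cmod (F w * E k w) \<le> B" using E(3) by blast
  obtain B' where B': "\<And>w. w \<in> ball 0 1 \<Longrightarrow> cmod (G w * E' k w) \<le> B'" using E'(3) by blast
  show "\<exists>B. \<forall>w\<in>ball 0 1. cmod ((F w + G w) * (E k w * E' k w)) \<le> B"
  proof (intro exI ballI)
   fix w :: complex assume w: "w \<in> ball 0 1"
   have "(F w + G w) * (E k w * E' k w) = (F w * E k w) * E' k w + (G w * E' k w) * E k w"
    by (simp add: algebra_simps)
   also have "cmod \<dots> \<le> cmod (F w * E k w) * cmod (E' k w) + cmod (G w * E' k w) * cmod (E k w)"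
    by (metis norm_mult norm_triangle_ineq)
   also have "\<dots> \<le> cmod (F w * E k w) * 1 + cmod (G w * E' k w) * 1"
    using E(2)[OF w, of k] E'(2)[OF w, of k] by (intro add_mono mult_left_mono) auto
   also have "\<dots> \<le> B + B'" using B[OF w] B'[OF w] by simp
   finally show "cmod ((F w + G w) * (E k w * E' k w)) \<le> B + B'" .
  qed
  show "\<exists>B. \<forall>w\<in>ball 0 1. cmod ((F w * G w) * (E k w * E' k w)) \<le> B"
  proof (intro exI ballI)
   fix w :: complex assume w: "w \<in> ball 0 1"
   have "(F w * G w) * (E k w * E' k w) = (F w * E k w) * (G w * E' k w)" by simp
   also have "cmod \<dots> = cmod (F w * E k w) * cmod (G w * E' k w)" by (rule norm_mult)
   also have "\<dots> \<le> B * B'" using B[OF w] B'[OF w] by (intro mult_mono order_trans[OF norm_ge_zero B[OF w]]) auto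
   finally show "cmod ((F w * G w) * (E k w * E' k w)) \<le> B * B'" .
  qed
 qed
 show "smirnov (\<lambda>w. F w + G w)"
  unfolding smirnov_def using hol E(1) E'(1) le1 lim sum
  by (intro conjI exI[of _ "\<lambda>k w. E k w * E' k w"]) (auto intro!: holomorphic_intros)
 show "smirnov (\<lambda>w. F w * G w)"
  unfolding smirnov_def using hol E(1) E'(1) le1 lim prod
  by (intro conjI exI[of _ "\<lambda>k w. E k w * E' k w"]) (auto intro!: holomorphic_intros)
qed

lemma smirnov_const: "smirnov (\<lambda>_. c)"
 by (rule smirnov_bounded[of _ "cmod c"]) auto

lemma smirnov_cmult: "smirnov F \<Longrightarrow> smirnov (\<lambda>w. c * F w)"
 by (intro smirnov_binary(2) smirnov_const)

lemma smirnov_diff: "smirnov F \<Longrightarrow> smirnov G \<Longrightarrow> smirnov (\<lambda>w. F w - G w)"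
 using smirnov_binary(1)[of F "\<lambda>w. -1 * G w"] smirnov_cmult[of G "-1"] by simp

lemma smirnov_power: "smirnov F \<Longrightarrow> smirnov (\<lambda>w. F w ^ n)"
 by (induction n) (auto intro: smirnov_const smirnov_binary)

text \<open>For an outer function the factors come from truncating \<open>u\<close> from above.\<close>

lemma smirnov_outer:
 assumes u: "integrable circle u"
 shows "smirnov (\<lambda>w. exp (herglotz u w))"
 unfolding smirnov_def
proof (intro conjI exI[of _ "\<lambda>k w. exp (herglotz (\<lambda>t. min (u t) (real k) - u t) w)"] allI ballI)
 have [measurable]: "u \<in> borel_measurable circle" using u by auto
 note const = finite_measure.integrable_const[OF finite_measure_circle]
 have um: "integrable circle (\<lambda>t. min (u t) (real k))" for k by (intro integrable_min u const)
 then have ud: "integrable circle (\<lambda>t. min (u t) (real k) - u t)" for k using u by auto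
 show "(\<lambda>w. exp (herglotz u w)) holomorphic_on ball 0 1"
  by (intro holomorphic_intros herglotz_holomorphic u)
 fix k :: nat
 show "(\<lambda>w. exp (herglotz (\<lambda>t. min (u t) (real k) - u t) w)) holomorphic_on ball 0 1"
  by (intro holomorphic_intros herglotz_holomorphic ud)
 show "cmod (exp (herglotz (\<lambda>t. min (u t) (real k) - u t) w)) \<le> 1" if "w \<in> ball 0 1" for w
  using that Re_herglotz_mono[OF ud const[of 0], of w k] herglotz_const[of w 0] by simp
 have "cmod (exp (herglotz u w) * exp (herglotz (\<lambda>t. min (u t) (real k) - u t) w)) \<le> exp (real k)" if "w \<in> ball 0 1" for w
 proof -
  have w: "cmod w < 1" using that by simp
  have "exp (herglotz u w) * exp (herglotz (\<lambda>t. min (u t) (real k) - u t) w) = exp (herglotz (\<lambda>t. min (u t) (real k)) w)"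
   unfolding exp_add[symmetric] herglotz_diff[OF um u w] by simp
  moreover have "Re (herglotz (\<lambda>t. min (u t) (real k)) w) \<le> real k"
   using Re_herglotz_mono[OF um const[of "real k"] w, of k] herglotz_const[OF w, of "real k"] by simp
  ultimately show ?thesis by simp
 qed
 then show "\<exists>B. \<forall>w\<in>ball 0 1. cmod (exp (herglotz u w) * exp (herglotz (\<lambda>t. min (u t) (real k) - u t) w)) \<le> B" by blast
next
 have [measurable]: "u \<in> borel_measurable circle" using u by auto
 fix w :: complex assume "w \<in> ball 0 1"
 then have w: "cmod w < 1" by simp
 have "continuous_on {0..2*pi} (\<lambda>t. (cis t + w) / (cis t - w))"
  by (intro continuous_intros) (use cis_minus_ne_0[OF w] in auto)
 note [measurable] = borel_measurable_circle_continuous[OF this]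
 have "(\<lambda>k. \<integral>t. (cis t + w) / (cis t - w) * of_real (min (u t) (real k) - u t) \<partial>circle) \<longlonglongrightarrow> (\<integral>t. 0 \<partial>circle)"
 proof (rule integral_dominated_convergence[where w = "\<lambda>t. norm ((cis t + w) / (cis t - w) * of_real (u t))"])
  show "integrable circle (\<lambda>t. norm ((cis t + w) / (cis t - w) * of_real (u t)))"
   by (intro integrable_norm herglotz_integrable u w)
  show "AE t in circle. (\<lambda>k. (cis t + w) / (cis t - w) * of_real (min (u t) (real k) - u t)) \<longlonglongrightarrow> 0"
  proof (rule AE_I2)
   fix t
   have "\<forall>\<^sub>F k in sequentially. u t \<le> real k"
    using real_arch_simple[of "u t"] by (auto simp: eventually_sequentially) (meson of_nat_mono order_trans)
   then have "\<forall>\<^sub>F k in sequentially. 0 = (cis t + w) / (cis t - w) * of_real (min (u t) (real k) - u t)"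
    by eventually_elim (simp add: min_def)
   then show "(\<lambda>k. (cis t + w) / (cis t - w) * of_real (min (u t) (real k) - u t)) \<longlonglongrightarrow> 0"
    by (rule Lim_transform_eventually[OF tendsto_const])
  qed
  fix k
  show "AE t in circle. norm ((cis t + w) / (cis t - w) * of_real (min (u t) (real k) - u t)) \<le> norm ((cis t + w) / (cis t - w) * of_real (u t))"
   unfolding norm_mult norm_of_real by (intro AE_I2 mult_left_mono) (auto simp: min_def)
 qed measurable
 then have "(\<lambda>k. exp (of_real (1 / (2 * pi)) * (\<integral>t. (cis t + w) / (cis t - w) * of_real (min (u t) (real k) - u t) \<partial>circle))) \<longlonglongrightarrow>
   exp (of_real (1 / (2 * pi)) * (\<integral>t. 0 \<partial>circle))"
  by (intro tendsto_intros)
 then show "(\<lambda>k. exp (herglotz (\<lambda>t. min (u t) (real k) - u t) w)) \<longlonglongrightarrow> 1"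
  by (simp add: herglotz_def)
qed

section \<open>Boundary values through the conformal map\<close>

text \<open>A closed curve that runs along a straight segment changes its winding number by one across the segment.
 So a connected set that avoids a domain cannot come close to a point of a segment of the domain from both sides.\<close>

lemma no_crossing_normalized:
 fixes G S :: "complex set"
 assumes G: "open G" "connected G" and S: "connected S" "S \<inter> G = {}" "0 \<notin> S" "0 \<notin> G"
  and seg: "0 < r" "\<And>x::real. 0 < \<bar>x\<bar> \<Longrightarrow> \<bar>x\<bar> < r \<Longrightarrow> of_real x \<in> G"
  and up: "\<And>e. 0 < e \<Longrightarrow> \<exists>u\<in>S. cmod u < e \<and> 0 < Im u"
  and down: "\<And>e. 0 < e \<Longrightarrow> \<exists>u\<in>S. cmod u < e \<and> Im u < 0"
 shows False
proof -
 define a where "a = r / 2"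
 have a: "0 < a" "a < r" using seg by (auto simp: a_def)
 have "path_connected G" using G connected_open_path_connected by blast
 moreover have "of_real a \<in> G" "of_real (- a) \<in> G" by (rule seg(2); use a in simp)+
 \<comment> \<open>A path in \<open>G\<close> from the right end of the segment to the left one is closed up by the segment itself.\<close>
 ultimately obtain c where c: "path c" "path_image c \<subseteq> G" "pathstart c = of_real a" "pathfinish c = of_real (- a)"
  unfolding path_connected_def by blast
 have "0 \<notin> path_image c" using c(2) S(4) by auto
 moreover have "closed (path_image c)" using c(1) by (simp add: closed_path_image)
 ultimately obtain e where e: "0 < e" "ball 0 e \<inter> path_image c = {}"
  using open_contains_ball[of "- path_image c"] by (metis ComplI Compl_iff disjoint_eq_subset_Compl open_Compl)
 define l where "l = linepath (of_real (- a)) (of_real a :: complex)"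
 have l_image: "path_image l \<subseteq> \<real>"
 proof -
  have "path_image l = closed_segment (of_real (- a)) (of_real a)" by (simp add: l_def)
  also have "\<dots> \<subseteq> \<real>" by (intro closed_segment_subset) (auto simp: convex_Reals)
  finally show ?thesis .
 qed
 have l_G: "path_image l \<subseteq> G \<union> {0}"
 proof
  fix z assume "z \<in> path_image l"
  then have "z \<in> closed_segment (of_real (- a)) (of_real a)" by (simp add: l_def)
  then obtain s where s: "0 \<le> s" "s \<le> 1" "z = (1 - s) *\<^sub>R of_real (- a) + s *\<^sub>R of_real a" by (auto simp: in_segment)
  define x where "x = (2 * s - 1) * a"
  have "z = of_real x" using s(3) by (simp add: x_def scaleR_conv_of_real algebra_simps)
  moreover have "(2 * s - 1) * a \<le> 1 * a" "- 1 * a \<le> (2 * s - 1) * a" using s a by (intro mult_right_mono; simp)+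
  then have "- a \<le> x" "x \<le> a" by (auto simp: x_def)
  ultimately show "z \<in> G \<union> {0}" using seg(2)[of x] a by (cases "x = 0") auto
 qed
 define \<Gamma> where "\<Gamma> = c +++ l"
 have \<Gamma>: "path \<Gamma>" "pathfinish \<Gamma> = pathstart \<Gamma>" "path_image \<Gamma> = path_image c \<union> path_image l"
  using c by (auto simp: \<Gamma>_def l_def path_image_join)
 have S\<Gamma>: "S \<inter> path_image \<Gamma> = {}" using \<Gamma>(3) c(2) l_G S by auto
 have half: "winding_number \<Gamma> z = winding_number \<Gamma> z'"
  if "z \<in> ball 0 e" "z' \<in> ball 0 e" "Im z * Im z' > 0" for z z'
 proof -
  have seg: "closed_segment z z' \<subseteq> ball 0 e" using that by (intro closed_segment_subset) auto
  have "closed_segment z z' \<inter> \<real> = {}"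
  proof -
   have "Im w \<noteq> 0" if "w \<in> closed_segment z z'" for w
   proof -
    from that obtain s where s: "0 \<le> s" "s \<le> 1" "w = (1 - s) *\<^sub>R z + s *\<^sub>R z'" by (auto simp: in_segment)
    then have im: "Im w = (1 - s) * Im z + s * Im z'" by simp
    have pos: "0 < (1 - s) * p + s * q" if "0 < p" "0 < q" for p q
     using s that by (cases "s = 0") (auto intro!: add_nonneg_pos mult_nonneg_nonneg mult_pos_pos)
    consider "Im z > 0" "Im z' > 0" | "- Im z > 0" "- Im z' > 0" using \<open>Im z * Im z' > 0\<close> by (auto simp: zero_less_mult_iff)
    then show ?thesis
    proof cases
     case 1
     then show ?thesis using im pos[OF 1] by simp
    next
     case 2
     then show ?thesis using im pos[OF 2] by simp
    qed
   qed
   then show ?thesis using complex_is_Real_iff by blast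
  qed
  then have "closed_segment z z' \<inter> path_image \<Gamma> = {}" using seg e(2) l_image \<Gamma>(3) by auto
  from winding_number_constant[OF \<Gamma>(1,2) connected_segment(1) this]
  show ?thesis unfolding constant_on_def by (metis ends_in_segment)
 qed
 obtain u1 where u1: "u1 \<in> S" "cmod u1 < e" "0 < Im u1" using up[OF e(1)] by blast
 obtain u2 where u2: "u2 \<in> S" "cmod u2 < e" "Im u2 < 0" using down[OF e(1)] by blast
 \<comment> \<open>The set \<open>S\<close> avoids the closed curve, so the winding numbers just above and just below the segment agree.\<close>
 have "winding_number \<Gamma> u1 = winding_number \<Gamma> u2"
  using winding_number_constant[OF \<Gamma>(1,2) S(1) S\<Gamma>] u1(1) u2(1) unfolding constant_on_def by metis
 then have eq: "winding_number \<Gamma> (\<i> * y) = winding_number \<Gamma> (- \<i> * y)" if "0 < y" "y < e" for y :: real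
  using half[of u1 "\<i> * y"] half[of u2 "- \<i> * y"] u1 u2 that e(1) mult_neg_pos[OF u2(3) that(1)]
  by (simp add: norm_mult)
 have line: "winding_number l (\<i> * y) = (Ln (of_real a - \<i> * y) - Ln (of_real a + \<i> * y) + \<i> * pi) / (2 * pi * \<i>)"
  "winding_number l (- \<i> * y) = (Ln (of_real a + \<i> * y) - Ln (of_real a - \<i> * y) - \<i> * pi) / (2 * pi * \<i>)"
  if y: "0 < y" for y :: real
 proof -
  have prim: "winding_number l z = (Ln (of_real a - z) - Ln (of_real (- a) - z)) / (2 * pi * \<i>)" if z: "Im z \<noteq> 0" for z
  proof -
   have "z \<notin> \<real>" using z complex_is_Real_iff by auto
   then have "z \<notin> path_image l" using l_image by auto
   then have "winding_number l z = 1 / (2 * pi * \<i>) * contour_integral l (\<lambda>w. 1 / (w - z))"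
    by (intro winding_number_valid_path) (auto simp: l_def)
   moreover have "((\<lambda>w. 1 / (w - z)) has_contour_integral (Ln (pathfinish l - z) - Ln (pathstart l - z))) l"
   proof (rule contour_integral_primitive[where S = \<real>])
    fix w :: complex assume "w \<in> \<real>"
    then have "Im (w - z) \<noteq> 0" using z complex_is_Real_iff by auto
    then have "w - z \<notin> \<real>\<^sub>\<le>\<^sub>0" using complex_nonpos_Reals_iff by auto
    then show "((\<lambda>w. Ln (w - z)) has_field_derivative 1 / (w - z)) (at w within \<real>)"
     by (auto intro!: derivative_eq_intros simp: inverse_eq_divide)
   qed (use l_image in \<open>auto simp: l_def\<close>)
   ultimately show ?thesis by (simp add: contour_integral_unique l_def)
  qed
  have "Ln (- (of_real a + \<i> * y)) = Ln (of_real a + \<i> * y) - \<i> * pi"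
   using y a by (subst Ln_minus) (auto simp: complex_eq_iff)
  moreover have "of_real (- a) - \<i> * y = - (of_real a + \<i> * y)" by simp
  ultimately show "winding_number l (\<i> * y) = (Ln (of_real a - \<i> * y) - Ln (of_real a + \<i> * y) + \<i> * pi) / (2 * pi * \<i>)"
   using y by (subst prim) simp_all
  have "Ln (- (of_real a - \<i> * y)) = Ln (of_real a - \<i> * y) + \<i> * pi"
   using y a by (subst Ln_minus) (auto simp: complex_eq_iff)
  moreover have "of_real (- a) - (- \<i> * y) = - (of_real a - \<i> * y)" by simp
  ultimately show "winding_number l (- \<i> * y) = (Ln (of_real a + \<i> * y) - Ln (of_real a - \<i> * y) - \<i> * pi) / (2 * pi * \<i>)"
   using y by (subst prim) simp_all
 qed
 define y where "y n = e / 2 * inverse (real (Suc n))" for n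
 have y: "0 < y n" "y n < e" for n using e(1) by (auto simp: y_def divide_simps)
 have y0: "(\<lambda>n. y n) \<longlonglongrightarrow> 0"
  unfolding y_def using tendsto_mult[OF tendsto_const LIMSEQ_inverse_real_of_nat, of "e / 2"] by simp
 have iy0: "(\<lambda>n. \<i> * complex_of_real (y n)) \<longlonglongrightarrow> 0" "(\<lambda>n. - \<i> * complex_of_real (y n)) \<longlonglongrightarrow> 0"
  using tendsto_mult[OF tendsto_const tendsto_of_real[OF y0], of "\<i>"] tendsto_mult[OF tendsto_const tendsto_of_real[OF y0], of "- \<i>"] by simp_all
 have cont: "isCont (winding_number c) 0"
  using continuous_at_winding_number[OF c(1)] \<open>0 \<notin> path_image c\<close> by simp
 have cdiff: "(\<lambda>n. winding_number c (\<i> * y n) - winding_number c (- \<i> * y n)) \<longlonglongrightarrow> winding_number c 0 - winding_number c 0"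
  by (intro tendsto_diff isCont_tendsto_compose[OF cont] iy0)
 have lnc: "isCont Ln (of_real a)" using a by (intro continuous_at_Ln) (simp add: complex_nonpos_Reals_iff)
 have ldiff: "(\<lambda>n. winding_number l (\<i> * y n) - winding_number l (- \<i> * y n)) \<longlonglongrightarrow>
   (Ln (of_real a) - Ln (of_real a) + \<i> * pi) / (2 * pi * \<i>) - (Ln (of_real a) - Ln (of_real a) - \<i> * pi) / (2 * pi * \<i>)"
 proof -
  have p: "(\<lambda>n. of_real a + \<i> * y n) \<longlonglongrightarrow> of_real a" using tendsto_add[OF tendsto_const iy0(1), of "of_real a"] by simp
  have m: "(\<lambda>n. of_real a - \<i> * y n) \<longlonglongrightarrow> of_real a" using tendsto_diff[OF tendsto_const iy0(1), of "of_real a"] by simp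
  show ?thesis
   unfolding line[OF y(1)]
   by (intro tendsto_diff tendsto_divide tendsto_add tendsto_const isCont_tendsto_compose[OF lnc] p m) auto
 qed
 have "winding_number l (\<i> * y n) - winding_number l (- \<i> * y n) = - (winding_number c (\<i> * y n) - winding_number c (- \<i> * y n))" for n
 proof -
  have "\<i> * y n \<notin> path_image c" "- \<i> * y n \<notin> path_image c"
   using y[of n] e(2) by (auto simp: disjoint_iff norm_mult)
  moreover have "\<i> * y n \<notin> \<real>" "- \<i> * y n \<notin> \<real>" using y[of n] by (auto simp: complex_is_Real_iff)
  then have "\<i> * y n \<notin> path_image l" "- \<i> * y n \<notin> path_image l" using l_image by blast+
  ultimately have "winding_number \<Gamma> (\<i> * y n) = winding_number c (\<i> * y n) + winding_number l (\<i> * y n)"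
   "winding_number \<Gamma> (- \<i> * y n) = winding_number c (- \<i> * y n) + winding_number l (- \<i> * y n)"
   unfolding \<Gamma>_def using c by (auto intro!: winding_number_join simp: l_def)
  then show ?thesis using eq[OF y] by (simp add: algebra_simps)
 qed
 with ldiff have "(\<lambda>n. - (winding_number c (\<i> * y n) - winding_number c (- \<i> * y n))) \<longlonglongrightarrow>
   (Ln (of_real a) - Ln (of_real a) + \<i> * pi) / (2 * pi * \<i>) - (Ln (of_real a) - Ln (of_real a) - \<i> * pi) / (2 * pi * \<i>)"
  by simp
 from LIMSEQ_unique[OF this tendsto_minus[OF cdiff]] show False
  by (simp add: field_simps)
qed

lemma no_crossing:
 fixes G S :: "complex set"
 assumes G: "open G" "connected G" and S: "connected S" "S \<inter> G = {}" "t \<notin> S" "t \<notin> G" and v: "v \<noteq> 0"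
  and seg: "0 < r" "\<And>x::real. 0 < \<bar>x\<bar> \<Longrightarrow> \<bar>x\<bar> < r \<Longrightarrow> t + v * of_real x \<in> G"
  and up: "\<And>e. 0 < e \<Longrightarrow> \<exists>u. t + v * u \<in> S \<and> cmod u < e \<and> 0 < Im u"
  and down: "\<And>e. 0 < e \<Longrightarrow> \<exists>u. t + v * u \<in> S \<and> cmod u < e \<and> Im u < 0"
 shows False
proof -
 define h where "h z = (z - t) / v" for z
 have mem: "u \<in> h ` X \<longleftrightarrow> t + v * u \<in> X" for u X
  using v by (auto simp: h_def image_iff intro!: bexI[of _ "t + v * u"])
 have hc: "continuous_on X h" for X unfolding h_def by (intro continuous_intros) (use v in auto)
 show False
 proof (rule no_crossing_normalized[of "h ` G" "h ` S" r])
  have "h ` G = (\<lambda>u. t + v * u) -` G" using mem by auto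
  moreover have "open ((\<lambda>u. t + v * u) -` G)" by (intro open_vimage G continuous_intros)
  ultimately show "open (h ` G)" by simp
  show "connected (h ` G)" "connected (h ` S)" by (intro connected_continuous_image hc G S)+
  show "h ` S \<inter> h ` G = {}" unfolding disjoint_iff mem using S(2) by auto
  show "0 \<notin> h ` S" "0 \<notin> h ` G" unfolding mem using S by auto
  show "0 < r" by (rule seg)
  show "of_real x \<in> h ` G" if "0 < \<bar>x\<bar>" "\<bar>x\<bar> < r" for x unfolding mem by (rule seg(2)[OF that])
  show "\<exists>u\<in>h ` S. cmod u < e \<and> 0 < Im u" if "0 < e" for e
   unfolding Bex_def mem by (rule up[OF that])
  show "\<exists>u\<in>h ` S. cmod u < e \<and> Im u < 0" if "0 < e" for e
   unfolding Bex_def mem by (rule down[OF that])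
 qed
qed

lemma convex_stolz: "0 < \<beta> \<Longrightarrow> convex (stolz \<beta> \<zeta>)"
proof (rule convexI)
 fix x y :: complex and a b :: real
 assume \<beta>: "0 < \<beta>" and xy: "x \<in> stolz \<beta> \<zeta>" "y \<in> stolz \<beta> \<zeta>" and ab: "0 \<le> a" "0 \<le> b" "a + b = 1"
 define w where "w = a *\<^sub>R x + b *\<^sub>R y"
 have n: "cmod w \<le> a * cmod x + b * cmod y"
  unfolding w_def using ab norm_triangle_ineq[of "a *\<^sub>R x" "b *\<^sub>R y"] by simp
 have "w - \<zeta> = a *\<^sub>R (x - \<zeta>) + b *\<^sub>R (y - \<zeta>)"
  using ab by (simp add: w_def algebra_simps flip: scaleR_add_left)
 then have d: "dist w \<zeta> \<le> a * dist x \<zeta> + b * dist y \<zeta>"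
  using ab norm_triangle_ineq[of "a *\<^sub>R (x - \<zeta>)" "b *\<^sub>R (y - \<zeta>)"] by (simp add: dist_norm)
 have comb: "a * p + b * q < a * p' + b * q'" if "p < p'" "q < q'" for p q p' q' :: real
 proof (cases "a = 0")
  case False
  then show ?thesis using ab that by (intro add_less_le_mono mult_strict_left_mono mult_left_mono) auto
 qed (use ab that in auto)
 have "a * dist x \<zeta> + b * dist y \<zeta> < a * (\<beta> * (1 - cmod x)) + b * (\<beta> * (1 - cmod y))"
  using xy by (intro comb) (auto simp: stolz_def)
 also have "\<dots> = \<beta> * ((a + b) - (a * cmod x + b * cmod y))" by (simp add: algebra_simps)
 also have "\<dots> \<le> \<beta> * (1 - cmod w)" using \<beta> n ab by (intro mult_left_mono) auto
 finally have "dist w \<zeta> < \<beta> * (1 - cmod w)" using d by simp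
 moreover have "a * cmod x + b * cmod y < a * 1 + b * 1" using xy by (intro comb) (auto simp: stolz_def)
 then have "cmod w < 1" using n ab by simp
 ultimately show "a *\<^sub>R x + b *\<^sub>R y \<in> stolz \<beta> \<zeta>" by (simp add: stolz_def w_def)
qed

text \<open>Used to approach \<open>\<zeta>\<close> from \<open>w\<close> without leaving the region.\<close>

lemma stolz_starlike:
 assumes w: "w \<in> stolz \<beta> \<zeta>" and \<zeta>: "cmod \<zeta> = 1" and \<beta>: "0 < \<beta>" and s: "0 < s" "s \<le> 1"
 shows "\<zeta> + s *\<^sub>R (w - \<zeta>) \<in> stolz \<beta> \<zeta>"
proof -
 define z where "z = \<zeta> + s *\<^sub>R (w - \<zeta>)"
 have "z = (1 - s) *\<^sub>R \<zeta> + s *\<^sub>R w" by (simp add: z_def algebra_simps)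
 then have "cmod z \<le> (1 - s) + s * cmod w"
  using norm_triangle_ineq[of "(1 - s) *\<^sub>R \<zeta>" "s *\<^sub>R w"] s \<zeta> by simp
 then have le: "s * (1 - cmod w) \<le> 1 - cmod z" by (simp add: algebra_simps)
 have "dist z \<zeta> = s * dist w \<zeta>" using s by (simp add: z_def dist_norm)
 also have "\<dots> < s * (\<beta> * (1 - cmod w))" using w s by (intro mult_strict_left_mono) (auto simp: stolz_def)
 also have "\<dots> \<le> \<beta> * (1 - cmod z)" using \<beta> le by (simp add: mult.left_commute mult_left_mono)
 finally have "dist z \<zeta> < \<beta> * (1 - cmod z)" .
 moreover have "0 < s * (1 - cmod w)" using w s by (intro mult_pos_pos) (auto simp: stolz_def)
 ultimately show ?thesis using le by (simp add: stolz_def z_def)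
qed

text \<open>The mean value inequality for \<open>\<psi> - d z\<close> on the convex region, whose points can be joined to \<open>\<zeta>\<close> within the region. A finite limit of the
 derivative is thus an angular derivative.\<close>

lemma angular_derivative:
 assumes hol: "\<psi> holomorphic_on ball 0 1" and cont: "continuous_on (cball 0 1) \<psi>"
  and \<zeta>: "cmod \<zeta> = 1" and nt: "ntlim (deriv \<psi>) \<zeta> d" and \<beta>: "1 < \<beta>" and \<epsilon>: "0 < \<epsilon>"
 obtains \<delta> where "0 < \<delta>" "\<And>w. w \<in> stolz \<beta> \<zeta> \<Longrightarrow> dist w \<zeta> < \<delta> \<Longrightarrow> cmod (\<psi> w - \<psi> \<zeta> - d * (w - \<zeta>)) \<le> \<epsilon> * cmod (w - \<zeta>)"
proof -
 have "(deriv \<psi> \<longlongrightarrow> d) (at \<zeta> within stolz \<beta> \<zeta>)" using nt \<beta> by (simp add: ntlim_def)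
 then have "\<forall>\<^sub>F w in at \<zeta> within stolz \<beta> \<zeta>. dist (deriv \<psi> w) d < \<epsilon>" using \<epsilon> by (rule tendstoD)
 then obtain \<delta> where \<delta>: "0 < \<delta>" "\<And>w. w \<in> stolz \<beta> \<zeta> \<Longrightarrow> w \<noteq> \<zeta> \<Longrightarrow> dist w \<zeta> < \<delta> \<Longrightarrow> dist (deriv \<psi> w) d < \<epsilon>"
  unfolding eventually_at by blast
 define C where "C = stolz \<beta> \<zeta> \<inter> ball \<zeta> \<delta>"
 have C: "convex C" unfolding C_def using \<beta> by (intro convex_Int convex_stolz) auto
 define k where "k z = \<psi> z - d * z" for z
 have lip: "cmod (k x - k y) \<le> \<epsilon> * cmod (x - y)" if "x \<in> C" "y \<in> C" for x y
 proof (rule field_differentiable_bound[OF C _ _ that])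
  fix z assume z: "z \<in> C"
  then have z1: "z \<in> ball 0 1" "z \<noteq> \<zeta>" using \<zeta> by (auto simp: C_def stolz_def)
  have "(k has_field_derivative (deriv \<psi> z - d * 1)) (at z)"
   unfolding k_def by (intro DERIV_diff DERIV_cmult DERIV_ident holomorphic_derivI[OF hol open_ball z1(1)])
  then show "(k has_field_derivative (deriv \<psi> z - d)) (at z within C)"
   by (simp add: has_field_derivative_at_within)
  show "cmod (deriv \<psi> z - d) \<le> \<epsilon>"
   using \<delta>(2)[of z] z z1 by (auto simp: C_def dist_norm norm_minus_commute)
 qed
 show ?thesis
 proof (rule that[OF \<delta>(1)])
  fix w assume w: "w \<in> stolz \<beta> \<zeta>" "dist w \<zeta> < \<delta>"
  define X where "X n = \<zeta> + inverse (real (Suc n)) *\<^sub>R (w - \<zeta>)" for n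
  have s: "0 < inverse (real (Suc n))" "inverse (real (Suc n)) \<le> 1" for n by (auto simp: field_simps)
  have XC: "X n \<in> C" for n
  proof -
   have "X n \<in> stolz \<beta> \<zeta>" unfolding X_def using \<beta> s[of n] by (intro stolz_starlike w \<zeta>) auto
   moreover have "dist (X n) \<zeta> = inverse (real (Suc n)) * dist w \<zeta>" by (simp add: X_def dist_norm)
   moreover have "inverse (real (Suc n)) * dist w \<zeta> \<le> 1 * dist w \<zeta>" by (intro mult_right_mono s) auto
   ultimately show ?thesis using w by (simp add: C_def dist_commute)
  qed
  have Xlim: "X \<longlonglongrightarrow> \<zeta>"
   unfolding X_def using tendsto_add[OF tendsto_const tendsto_scaleR[OF LIMSEQ_inverse_real_of_nat tendsto_const], of \<zeta> "w - \<zeta>"] by simp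
  have kcont: "continuous_on (cball 0 1) k" unfolding k_def by (intro continuous_intros cont)
  have klim: "(\<lambda>n. k (X n)) \<longlonglongrightarrow> k \<zeta>"
  proof (rule continuous_on_tendsto_compose[OF kcont Xlim])
   show "\<zeta> \<in> cball 0 1" using \<zeta> by simp
   show "\<forall>\<^sub>F n in sequentially. X n \<in> cball 0 1"
    using XC by (auto simp: C_def stolz_def intro!: always_eventually less_imp_le)
  qed
  have wC: "w \<in> C" using w by (simp add: C_def dist_commute)
  have "cmod (k w - k \<zeta>) \<le> \<epsilon> * cmod (w - \<zeta>)"
  proof (rule LIMSEQ_le)
   show "(\<lambda>n. cmod (k w - k (X n))) \<longlonglongrightarrow> cmod (k w - k \<zeta>)" by (intro tendsto_intros klim)
   show "(\<lambda>n. \<epsilon> * cmod (w - X n)) \<longlonglongrightarrow> \<epsilon> * cmod (w - \<zeta>)" by (intro tendsto_intros Xlim)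
   show "\<exists>N. \<forall>n\<ge>N. cmod (k w - k (X n)) \<le> \<epsilon> * cmod (w - X n)" using lip[OF wC XC] by blast
  qed
  then show "cmod (\<psi> w - \<psi> \<zeta> - d * (w - \<zeta>)) \<le> \<epsilon> * cmod (w - \<zeta>)" by (simp add: k_def algebra_simps)
 qed
qed

text \<open>In the coordinate \<open>v\<close> with \<open>w = \<zeta> (1 + v)\<close>, cones around the inner normal and Stolz regions are interchangeable close to \<open>\<zeta>\<close>.
 The condition \<open>\<bar>v\<bar> \<le> c\<close> makes the quadratic term in \<open>\<bar>1 + v\<bar>\<^sup>2\<close> smaller than the linear one.\<close>

lemma cone_subset_stolz:
 assumes c: "0 < c" "c \<le> 1" and v: "v \<noteq> 0" "c * cmod v \<le> - Re v" "cmod v \<le> c" and \<zeta>: "cmod \<zeta> = 1"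
 shows "\<zeta> * (1 + v) \<in> stolz (3 / c) \<zeta>"
proof -
 have "(cmod (1 + v))\<^sup>2 = 1 + 2 * Re v + (cmod v)\<^sup>2" unfolding cmod_power2 by (simp add: power2_eq_square algebra_simps)
 also have "\<dots> \<le> 1 - 2 * (c * cmod v) + c * cmod v"
 proof -
  have "(cmod v)\<^sup>2 \<le> c * cmod v" unfolding power2_eq_square by (intro mult_right_mono v) simp
  then show ?thesis using v(2) by linarith
 qed
 also have "\<dots> \<le> (1 - c * cmod v / 2)\<^sup>2"
 proof -
  have "(1 - c * cmod v / 2)\<^sup>2 = 1 - c * cmod v + (c * cmod v / 2)\<^sup>2" by (simp add: power2_diff)
  then show ?thesis using zero_le_power2[of "c * cmod v / 2"] by linarith
 qed
 finally have "(cmod (1 + v))\<^sup>2 \<le> (1 - c * cmod v / 2)\<^sup>2" .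
 moreover have "c * cmod v \<le> 1 * 1" using c v(3) by (intro mult_mono norm_ge_zero) linarith+
 then have "0 \<le> 1 - c * cmod v / 2" by linarith
 ultimately have le: "cmod (1 + v) \<le> 1 - c * cmod v / 2" by (rule power2_le_imp_le)
 have pos: "0 < c * cmod v" using c(1) v(1) by simp
 have n: "cmod (\<zeta> * (1 + v)) = cmod (1 + v)" by (simp add: norm_mult \<zeta>)
 have "dist (\<zeta> * (1 + v)) \<zeta> = cmod (\<zeta> * v)" by (simp add: dist_norm algebra_simps)
 then have "dist (\<zeta> * (1 + v)) \<zeta> = cmod v" by (simp add: norm_mult \<zeta>)
 moreover have "cmod v < 3 / c * (c * cmod v / 2)" using c v by simp
 moreover have "3 / c * (c * cmod v / 2) \<le> 3 / c * (1 - cmod (1 + v))" using le c by (intro mult_left_mono) auto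
 ultimately have "dist (\<zeta> * (1 + v)) \<zeta> < 3 / c * (1 - cmod (1 + v))" by linarith
 moreover have "cmod (1 + v) < 1" using le pos by linarith
 ultimately show ?thesis unfolding stolz_def mem_Collect_eq n by blast
qed

text \<open>Where the angular derivative is nonzero, the image of a Stolz region covers a truncated sector; the
 preimage is a fixed point of a map that Brouwer's theorem provides with one.\<close>

lemma angular_derivative_sector:
 assumes hol: "\<psi> holomorphic_on ball 0 1" and cont: "continuous_on (cball 0 1) \<psi>"
  and \<zeta>: "cmod \<zeta> = 1" and nt: "ntlim (deriv \<psi>) \<zeta> d" and d: "d \<noteq> 0" and c: "0 < c" "c \<le> 1"
 obtains r where "0 < r" "\<And>u. u \<noteq> 0 \<Longrightarrow> cmod u < r \<Longrightarrow> 2 * c * cmod u \<le> - Re u \<Longrightarrow>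
   \<exists>w\<in>stolz (3 / c) \<zeta>. \<psi> w = \<psi> \<zeta> + d * \<zeta> * u"
proof -
 have \<zeta>0: "\<zeta> \<noteq> 0" using \<zeta> by auto
 have "1 < 3 / c" "0 < cmod d * c / 4" using c d by (auto simp: field_simps)
 from angular_derivative[OF hol cont \<zeta> nt this]
 obtain \<delta> where \<delta>: "0 < \<delta>" "\<And>w. w \<in> stolz (3 / c) \<zeta> \<Longrightarrow> dist w \<zeta> < \<delta> \<Longrightarrow>
   cmod (\<psi> w - \<psi> \<zeta> - d * (w - \<zeta>)) \<le> cmod d * c / 4 * cmod (w - \<zeta>)" by blast
 show ?thesis
 proof (rule that[of "min (c / 2) (\<delta> / 2)"])
  show "0 < min (c / 2) (\<delta> / 2)" using c \<delta> by simp
  fix u assume u: "u \<noteq> 0" "cmod u < min (c / 2) (\<delta> / 2)" "2 * c * cmod u \<le> - Re u"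
  define K where "K = cball u (c / 2 * cmod u)"
  \<comment> \<open>A fixed point of \<open>k\<close> solves \<open>\<psi> (\<zeta> (1 + v)) = \<psi> \<zeta> + d \<zeta> u\<close>; this is one step of the simplified Newton iteration.\<close>
  define k where "k v = v - (\<psi> (\<zeta> * (1 + v)) - (\<psi> \<zeta> + d * \<zeta> * u)) / (d * \<zeta>)" for v
  have K: "\<zeta> * (1 + v) \<in> stolz (3 / c) \<zeta>" "cmod v < \<delta>" "cmod v \<le> 2 * cmod u" if "v \<in> K" for v
  proof -
   have vu: "cmod (v - u) \<le> c / 2 * cmod u" using that by (simp add: K_def dist_norm norm_minus_commute)
   also have "\<dots> \<le> 1 / 2 * cmod u" using c by (intro mult_right_mono) auto
   finally have vu2: "cmod (v - u) \<le> 1 / 2 * cmod u" .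
   have v1: "cmod v \<le> 3 / 2 * cmod u" using norm_triangle_ineq2[of v u] vu2 by simp
   have "1 / 2 * cmod u \<le> cmod v" using norm_triangle_ineq2[of u v] vu2 by (simp add: norm_minus_commute)
   then have v0: "v \<noteq> 0" using u(1) by auto
   have "Re v \<le> Re u + cmod (v - u)" using complex_Re_le_cmod[of "v - u"] by simp
   then have "Re v \<le> - (2 * c * cmod u) + c / 2 * cmod u" using u(3) vu by linarith
   moreover have "c * cmod v \<le> c * (3 / 2 * cmod u)" using c v1 by (intro mult_left_mono) auto
   ultimately have re: "c * cmod v \<le> - Re v" by (simp add: algebra_simps)
   have "cmod u < c / 2" using u(2) by simp
   then have "cmod v \<le> c" using v1 c(1) by linarith
   then show "\<zeta> * (1 + v) \<in> stolz (3 / c) \<zeta>" by (intro cone_subset_stolz c v0 re \<zeta>)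
   have "cmod u < \<delta> / 2" using u(2) by simp
   then show "cmod v < \<delta>" "cmod v \<le> 2 * cmod u" using v1 norm_ge_zero[of u] by linarith+
  qed
  have "continuous_on K k" unfolding k_def
  proof (intro continuous_intros continuous_on_compose2[OF cont])
   show "(\<lambda>v. \<zeta> * (1 + v)) ` K \<subseteq> cball 0 1" using K(1) by (fastforce simp: stolz_def)
  qed (use d \<zeta>0 in auto)
  moreover have "k \<in> K \<rightarrow> K"
  proof
   fix v assume v: "v \<in> K"
   define A where "A = \<psi> (\<zeta> * (1 + v)) - \<psi> \<zeta> - d * (\<zeta> * (1 + v) - \<zeta>)"
   have nv: "cmod (\<zeta> * (1 + v) - \<zeta>) = cmod v" by (simp add: algebra_simps norm_mult \<zeta>)
   have "cmod A \<le> cmod d * c / 4 * cmod (\<zeta> * (1 + v) - \<zeta>)"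
    unfolding A_def using K[OF v] by (intro \<delta>(2)) (auto simp: dist_norm nv)
   also have "\<dots> \<le> cmod d * c / 4 * (2 * cmod u)"
    unfolding nv using K(3)[OF v] c by (intro mult_left_mono) auto
   finally have "cmod A \<le> cmod d * (c / 2 * cmod u)" by (simp add: mult_ac)
   moreover have "u - k v = A / (d * \<zeta>)"
    using d \<zeta>0 by (simp add: k_def A_def field_simps)
   then have "cmod (u - k v) = cmod A / cmod d" by (simp add: norm_divide norm_mult \<zeta>)
   ultimately have "cmod (u - k v) \<le> cmod d * (c / 2 * cmod u) / cmod d"
    by (simp only: divide_right_mono norm_ge_zero)
   then have "cmod (u - k v) \<le> c / 2 * cmod u" using d by simp
   then show "k v \<in> K" by (simp add: K_def dist_norm)
  qed
  moreover have "u \<in> K" using c by (simp add: K_def)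
  then have "compact K" "convex K" "K \<noteq> {}" by (auto simp: K_def)
  ultimately obtain v where v: "v \<in> K" "k v = v"
   using brouwer[of K k] by blast
  then have "\<psi> (\<zeta> * (1 + v)) = \<psi> \<zeta> + d * \<zeta> * u" using d \<zeta>0 by (simp add: k_def)
  then show "\<exists>w\<in>stolz (3 / c) \<zeta>. \<psi> w = \<psi> \<zeta> + d * \<zeta> * u" using K(1)[OF v(1)] by blast
 qed
qed

text \<open>A Jordan domain with its Riemann map \<open>\<psi>\<close> from the disk, extended to the closed disk as in Caratheodory's theorem, and the inverse \<open>\<phi>\<close> of the extension.\<close>

locale jordan_disk =
 fixes G :: "complex set" and \<psi> \<phi> :: "complex \<Rightarrow> complex"
 assumes open_G: "open G" and connected_G: "connected G"
  and hol: "\<psi> holomorphic_on ball 0 1"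
  and homeo: "homeomorphism (cball 0 1) (closure G) \<psi> \<phi>"
  and image: "\<psi> ` ball 0 1 = G"
begin

lemma cont: "continuous_on (cball 0 1) \<psi>"
 and cont_\<phi>: "continuous_on (closure G) \<phi>"
 and \<phi>\<psi>: "\<And>w. cmod w \<le> 1 \<Longrightarrow> \<phi> (\<psi> w) = w"
 and image_cball: "\<psi> ` cball 0 1 = closure G"
 using homeo by (auto simp: homeomorphism_def)

lemma inj: "inj_on \<psi> (cball 0 1)"
 using \<phi>\<psi> by (intro inj_on_inverseI[of _ \<phi>]) auto

lemma mem_G_iff: "cmod w \<le> 1 \<Longrightarrow> \<psi> w \<in> G \<longleftrightarrow> cmod w < 1"
 using image \<phi>\<psi> by (metis imageE imageI less_imp_le mem_ball_0)

lemma frontier_eq: "frontier G = \<psi> ` sphere 0 1"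
proof -
 have "frontier G = \<psi> ` cball 0 1 - \<psi> ` ball 0 1"
  using open_G by (simp add: frontier_def interior_open image_cball image)
 also have "\<dots> = \<psi> ` (cball 0 1 - ball 0 1)"
  by (rule inj_on_image_set_diff[OF inj, symmetric]) auto
 also have "cball 0 1 - ball 0 1 = sphere (0::complex) 1" by (auto simp: dist_norm)
 finally show ?thesis .
qed

lemma frontier_disjoint: "frontier G \<inter> G = {}"
 using open_G by (simp add: frontier_def interior_open Diff_Int_distrib2)

lemma connected_frontier_minus_point:
 "connected (frontier G - {\<psi> (cis x)})"
proof -
 have "frontier G - {\<psi> (cis x)} = (\<lambda>t. \<psi> (cis t)) ` {x<..<x + 2 * pi}"
 proof (intro equalityI subsetI)
  fix z assume z: "z \<in> frontier G - {\<psi> (cis x)}"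
  then obtain u where u: "cmod u = 1" "z = \<psi> u" by (auto simp: frontier_eq dist_norm)
  then have "u \<noteq> cis x" using z by auto
  note u = u this
  define s where "s = Arg2pi (u / cis x)"
  have "u / cis x = cis s"
   using Arg2pi_eq[of "u / cis x"] u by (simp add: s_def norm_divide cis_conv_exp)
  then have us: "u = cis (x + s)" by (simp add: cis_mult[symmetric] field_simps)
  then have "s \<noteq> 0" using u(3) by auto
  then have "0 < s" "s < 2 * pi" using Arg2pi_ge_0[of "u / cis x"] Arg2pi_lt_2pi[of "u / cis x"] by (auto simp: s_def)
  then show "z \<in> (\<lambda>t. \<psi> (cis t)) ` {x<..<x + 2 * pi}"
   using us u by (intro image_eqI[of _ _ "x + s"]) auto
 next
  fix z assume "z \<in> (\<lambda>t. \<psi> (cis t)) ` {x<..<x + 2 * pi}"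
  then obtain t where t: "x < t" "t < x + 2 * pi" "z = \<psi> (cis t)" by auto
  have "cis t \<noteq> cis x" using cis_eq_imp_eq[of t x] t by auto
  then have "z \<noteq> \<psi> (cis x)" using inj t(3) by (auto simp: inj_on_def)
  then show "z \<in> frontier G - {\<psi> (cis x)}" using t by (auto simp: frontier_eq)
 qed
 moreover have "continuous_on {x<..<x + 2 * pi} (\<lambda>t. \<psi> (cis t))"
  by (intro continuous_on_compose2[OF cont] continuous_intros) auto
 then have "connected ((\<lambda>t. \<psi> (cis t)) ` {x<..<x + 2 * pi})"
  by (intro connected_continuous_image) auto
 ultimately show ?thesis by simp
qed

text \<open>At such points \<open>\<psi>\<close> has a nonzero angular derivative from inside and the boundary curve a tangent, in the direction predicted by \<open>d\<close>.\<close>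

definition regular :: "real \<Rightarrow> complex \<Rightarrow> bool" where
 "regular x d \<longleftrightarrow> d \<noteq> 0 \<and> ntlim (deriv \<psi>) (cis x) d \<and>
  ((\<lambda>\<theta>. \<psi> (cis \<theta>)) has_vector_derivative (d * (\<i> * cis x))) (at x)"

text \<open>In the coordinate \<open>u\<close> the boundary point is \<open>0\<close>, the tangent is the imaginary axis, and the inner normal points in the negative real direction.\<close>

lemma frontier_near_tangent:
 assumes reg: "regular x d" and \<epsilon>: "0 < \<epsilon>"
 obtains \<delta> where "0 < \<delta>" "\<And>s. \<bar>s\<bar> < \<delta> \<Longrightarrow> \<exists>u. \<psi> (cis (x + s)) = \<psi> (cis x) + d * cis x * u \<and> cmod (u - \<i> * s) \<le> \<epsilon> * \<bar>s\<bar>"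
proof -
 have d: "d \<noteq> 0" using reg by (simp add: regular_def)
 have "((\<lambda>\<theta>. \<psi> (cis \<theta>)) has_derivative (\<lambda>h. h *\<^sub>R (d * (\<i> * cis x)))) (at x)"
  using reg by (simp add: regular_def has_vector_derivative_def)
 moreover have "0 < \<epsilon> * cmod d" using \<epsilon> d by simp
 ultimately obtain \<delta> where \<delta>: "0 < \<delta>" "\<And>y. \<bar>y - x\<bar> < \<delta> \<Longrightarrow>
   cmod (\<psi> (cis y) - \<psi> (cis x) - (y - x) *\<^sub>R (d * (\<i> * cis x))) \<le> \<epsilon> * cmod d * \<bar>y - x\<bar>"
  unfolding has_derivative_at_alt real_norm_def by metis
 show ?thesis
 proof (rule that[OF \<delta>(1)])
  fix s assume s: "\<bar>s\<bar> < \<delta>"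
  define u where "u = (\<psi> (cis (x + s)) - \<psi> (cis x)) / (d * cis x)"
  have "\<psi> (cis (x + s)) = \<psi> (cis x) + d * cis x * u" using d by (simp add: u_def)
  moreover have "cmod (u - \<i> * s) \<le> \<epsilon> * \<bar>s\<bar>"
  proof -
   have "u - \<i> * s = (\<psi> (cis (x + s)) - \<psi> (cis x) - s *\<^sub>R (d * (\<i> * cis x))) / (d * cis x)"
    using d by (simp add: u_def scaleR_conv_of_real field_simps)
   then have "cmod (u - \<i> * s) = cmod (\<psi> (cis (x + s)) - \<psi> (cis x) - s *\<^sub>R (d * (\<i> * cis x))) / cmod d"
    by (simp add: norm_divide norm_mult)
   also have "\<dots> \<le> \<epsilon> * cmod d * \<bar>s\<bar> / cmod d" using \<delta>(2)[of "x + s"] s by (intro divide_right_mono) auto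
   finally show ?thesis using d by simp
  qed
  ultimately show "\<exists>u. \<psi> (cis (x + s)) = \<psi> (cis x) + d * cis x * u \<and> cmod (u - \<i> * s) \<le> \<epsilon> * \<bar>s\<bar>" by blast
 qed
qed

text \<open>Points of the boundary with parameter close to \<open>x\<close> are close to the tangent; the others have a positive distance.\<close>

lemma frontier_avoids_cone:
 assumes reg: "regular x d" and c: "0 < c" "c \<le> 1"
 obtains r where "0 < r" "\<And>u. u \<noteq> 0 \<Longrightarrow> cmod u < r \<Longrightarrow> c * cmod u \<le> \<bar>Re u\<bar> \<Longrightarrow> \<psi> (cis x) + d * cis x * u \<notin> frontier G"
proof -
 have d: "d \<noteq> 0" using reg by (simp add: regular_def)
 have "0 < c / 4" using c by simp
 from frontier_near_tangent[OF reg this]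
 obtain \<delta> where \<delta>: "0 < \<delta>" "\<And>s. \<bar>s\<bar> < \<delta> \<Longrightarrow> \<exists>u. \<psi> (cis (x + s)) = \<psi> (cis x) + d * cis x * u \<and> cmod (u - \<i> * s) \<le> c / 4 * \<bar>s\<bar>"
  by blast
 define K where "K = (\<lambda>t. \<psi> (cis t)) ` ({x - pi..x + pi} - ball x \<delta>)"
 have "compact K" unfolding K_def
  by (intro compact_continuous_image compact_diff continuous_on_compose2[OF cont] continuous_intros) auto
 moreover have "\<psi> (cis x) \<notin> K"
 proof
  assume "\<psi> (cis x) \<in> K"
  then obtain t where t: "t \<in> {x - pi..x + pi}" "t \<notin> ball x \<delta>" "\<psi> (cis x) = \<psi> (cis t)" by (auto simp: K_def)
  then have "cis t = cis x" using inj by (auto simp: inj_on_def)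
  moreover have "\<bar>t - x\<bar> \<le> pi" using t(1) by (auto simp: abs_if)
  then have "\<bar>t - x\<bar> < 2 * pi" using pi_gt_zero by linarith
  ultimately have "t = x" by (rule cis_eq_imp_eq)
  then show False using t(2) \<delta>(1) by simp
 qed
 ultimately have "\<exists>\<rho>>0. \<forall>z\<in>K. \<rho> \<le> dist (\<psi> (cis x)) z"
  by (intro separate_point_closed compact_imp_closed)
 then obtain \<rho> where \<rho>: "0 < \<rho>" "\<And>z. z \<in> K \<Longrightarrow> \<rho> \<le> dist (\<psi> (cis x)) z"
  by auto
 show ?thesis
 proof (rule that[of "\<rho> / cmod d"])
  show "0 < \<rho> / cmod d" using \<rho> d by simp
  fix u assume u: "u \<noteq> 0" "cmod u < \<rho> / cmod d" "c * cmod u \<le> \<bar>Re u\<bar>"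
  show "\<psi> (cis x) + d * cis x * u \<notin> frontier G"
  proof
   assume "\<psi> (cis x) + d * cis x * u \<in> frontier G"
   then obtain v where v: "cmod v = 1" "\<psi> (cis x) + d * cis x * u = \<psi> v" by (auto simp: frontier_eq)
   define s where "s = Arg (v / cis x)"
   have "v / cis x \<noteq> 0" using v(1) by auto
   then have "v / cis x = cis s"
    using Arg_eq[of "v / cis x"] v by (simp add: s_def norm_divide cis_conv_exp)
   then have vs: "v = cis (x + s)" by (simp add: cis_mult[symmetric] field_simps)
   have s: "- pi < s" "s \<le> pi" using mpi_less_Arg[of "v / cis x"] Arg_le_pi[of "v / cis x"] by (auto simp: s_def)
   show False
   proof (cases "\<bar>s\<bar> < \<delta>")
    case True
    from \<delta>(2)[OF True] obtain u' where u': "\<psi> (cis (x + s)) = \<psi> (cis x) + d * cis x * u'" "cmod (u' - \<i> * s) \<le> c / 4 * \<bar>s\<bar>" by blast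
    have "u' = u" using u'(1) v(2) vs d by simp
    then have us: "cmod (u - \<i> * s) \<le> c / 4 * \<bar>s\<bar>" using u'(2) by simp
    have "s \<noteq> 0" using us u(1) by auto
    have "\<bar>Re u\<bar> \<le> c / 4 * \<bar>s\<bar>" using abs_Re_le_cmod[of "u - \<i> * s"] us by simp
    moreover have "\<bar>s\<bar> - c / 4 * \<bar>s\<bar> \<le> cmod u"
     using norm_triangle_ineq2[of "\<i> * s" u] us by (simp add: norm_mult norm_minus_commute)
    then have "c * (\<bar>s\<bar> - c / 4 * \<bar>s\<bar>) \<le> c * cmod u" using c by (intro mult_left_mono) auto
    moreover have "c * (c / 4 * \<bar>s\<bar>) \<le> 1 * (c / 4 * \<bar>s\<bar>)" using c by (intro mult_right_mono) auto
    ultimately have "c * \<bar>s\<bar> \<le> c / 2 * \<bar>s\<bar>" using u(3) by (simp add: algebra_simps)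
    then show False using c \<open>s \<noteq> 0\<close> by simp
   next
    case False
    then have "\<psi> v \<in> K" unfolding K_def vs using s by (intro imageI) (auto simp: dist_real_def)
    then have "\<rho> \<le> dist (\<psi> (cis x)) (\<psi> v)" by (rule \<rho>(2))
    also have "\<dots> = cmod d * cmod u" using v(2)[symmetric] by (simp add: dist_norm norm_mult)
    finally show False using u(2) d by (simp add: field_simps)
   qed
  qed
 qed
qed

text \<open>The sector on the far side of the tangent lies outside \<open>G\<close>: otherwise a segment of \<open>G\<close> through the boundary point
 would separate the two branches of the boundary, which are connected to each other.\<close>

lemma outer_cone_not_in_G:
 assumes reg: "regular x d" and c: "0 < c" "c \<le> 1"
 obtains r where "0 < r" "\<And>u. cmod u < r \<Longrightarrow> 0 < Re u \<Longrightarrow> c * cmod u \<le> Re u \<Longrightarrow> \<psi> (cis x) + d * cis x * u \<notin> G"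
proof -
 define t where "t = \<psi> (cis x)"
 define v where "v = d * cis x"
 have d: "d \<noteq> 0" and nt: "ntlim (deriv \<psi>) (cis x) d" using reg by (auto simp: regular_def)
 obtain r1 where r1: "0 < r1" "\<And>u. u \<noteq> 0 \<Longrightarrow> cmod u < r1 \<Longrightarrow> c * cmod u \<le> \<bar>Re u\<bar> \<Longrightarrow> t + v * u \<notin> frontier G"
  by (rule frontier_avoids_cone[OF reg c]) (simp add: t_def v_def)
 obtain r2 where r2: "0 < r2" "\<And>u. u \<noteq> 0 \<Longrightarrow> cmod u < r2 \<Longrightarrow> 2 * (1 / 2) * cmod u \<le> - Re u \<Longrightarrow>
   \<exists>w\<in>stolz (3 / (1 / 2)) (cis x). \<psi> w = \<psi> (cis x) + d * cis x * u"
  by (rule angular_derivative_sector[OF hol cont norm_cis nt d, of "1 / 2"]) auto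
 define r where "r = min r1 r2"
 have r: "0 < r" using r1 r2 by (simp add: r_def)
 show ?thesis
 proof (rule that[OF r], rule notI)
  fix u assume u: "cmod u < r" "0 < Re u" "c * cmod u \<le> Re u" and uG: "\<psi> (cis x) + d * cis x * u \<in> G"
  define P where "P = {u. 0 < Re u \<and> c * cmod u \<le> Re u} \<inter> ball 0 r"
  have "convex {u. 0 < Re u \<and> c * cmod u \<le> Re u}"
  proof (rule convexI)
   fix p q :: complex and a b :: real
   assume pq: "p \<in> {u. 0 < Re u \<and> c * cmod u \<le> Re u}" "q \<in> {u. 0 < Re u \<and> c * cmod u \<le> Re u}" and ab: "0 \<le> a" "0 \<le> b" "a + b = 1"
   have "c * cmod (a *\<^sub>R p + b *\<^sub>R q) \<le> c * (a * cmod p + b * cmod q)"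
    using c ab norm_triangle_ineq[of "a *\<^sub>R p" "b *\<^sub>R q"] by (intro mult_left_mono) auto
   also have "\<dots> = a * (c * cmod p) + b * (c * cmod q)" by (simp add: algebra_simps)
   also have "\<dots> \<le> a * Re p + b * Re q" using pq ab by (intro add_mono mult_left_mono) auto
   finally have "c * cmod (a *\<^sub>R p + b *\<^sub>R q) \<le> Re (a *\<^sub>R p + b *\<^sub>R q)" by simp
   moreover have "0 < a * Re p + b * Re q"
   proof (cases "a = 0")
    case False
    then show ?thesis using pq ab by (intro add_pos_nonneg mult_pos_pos mult_nonneg_nonneg) auto
   qed (use pq ab in auto)
   ultimately show "a *\<^sub>R p + b *\<^sub>R q \<in> {u. 0 < Re u \<and> c * cmod u \<le> Re u}" by simp
  qed
  then have "connected P" unfolding P_def by (intro convex_connected convex_Int) auto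
  then have conn: "connected ((\<lambda>u. t + v * u) ` P)"
   by (intro connected_continuous_image continuous_intros)
  have "t + v * u \<notin> frontier G" if "u \<in> P" for u
  proof -
   from that have "u \<noteq> 0" "cmod u < r1" "c * cmod u \<le> \<bar>Re u\<bar>" by (auto simp: P_def r_def)
   then show ?thesis by (rule r1(2))
  qed
  then have "(\<lambda>u. t + v * u) ` P \<inter> frontier G = {}" by blast
  moreover have "(\<lambda>u. t + v * u) ` P \<inter> G \<noteq> {}"
  proof -
   have "u \<in> P" using u by (simp add: P_def)
   then have "t + v * u \<in> (\<lambda>u. t + v * u) ` P" by (rule imageI)
   moreover have "t + v * u \<in> G" using uG by (simp add: t_def v_def)
   ultimately show ?thesis by blast
  qed
  ultimately have PG: "(\<lambda>u. t + v * u) ` P \<subseteq> G" using connected_Int_frontier[OF conn, of G] by blast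
  have tF: "t \<in> frontier G" by (auto simp: t_def frontier_eq)
  show False
  proof (rule no_crossing[OF open_G connected_G connected_frontier_minus_point[of x],
     where t = "\<psi> (cis x)" and v = v and r = r])
   show "(frontier G - {\<psi> (cis x)}) \<inter> G = {}" using frontier_disjoint by blast
   show "\<psi> (cis x) \<notin> frontier G - {\<psi> (cis x)}" by simp
   show "\<psi> (cis x) \<notin> G" using tF frontier_disjoint by (auto simp: t_def)
   show "v \<noteq> 0" using d by (simp add: v_def)
   show "0 < r" by (rule r)
   show "\<psi> (cis x) + v * of_real y \<in> G" if y: "0 < \<bar>y\<bar>" "\<bar>y\<bar> < r" for y
   proof (cases "0 < y")
    case True
    have "c * \<bar>y\<bar> \<le> 1 * \<bar>y\<bar>" using c by (intro mult_right_mono) auto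
    then have "of_real y \<in> P" using True y by (auto simp: P_def)
    then show ?thesis using PG by (auto simp: t_def)
   next
    case False
    then have "\<exists>w\<in>stolz (3 / (1 / 2)) (cis x). \<psi> w = \<psi> (cis x) + d * cis x * of_real y"
     using y by (intro r2(2)) (auto simp: r_def)
    then obtain w where "cmod w < 1" "\<psi> w = \<psi> (cis x) + v * of_real y" by (auto simp: stolz_def v_def)
    then show ?thesis using image by (metis imageI mem_ball_0)
   qed
   have both: "\<exists>u. \<psi> (cis x) + v * u \<in> frontier G - {\<psi> (cis x)} \<and> cmod u < e \<and> 0 < Im u * \<sigma>"
    if e: "0 < e" and \<sigma>: "\<bar>\<sigma>\<bar> = 1" for e \<sigma> :: real
   proof -
    obtain \<delta> where \<delta>: "0 < \<delta>" "\<And>s. \<bar>s\<bar> < \<delta> \<Longrightarrow> \<exists>u. \<psi> (cis (x + s)) = \<psi> (cis x) + d * cis x * u \<and> cmod (u - \<i> * s) \<le> 1 / 2 * \<bar>s\<bar>"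
     using frontier_near_tangent[OF reg, of "1 / 2"] by auto
    define s where "s = min (\<delta> / 2) (e / 2) * \<sigma>"
    have s: "\<bar>s\<bar> = min (\<delta> / 2) (e / 2)" using \<sigma> \<delta> e by (simp add: s_def abs_mult)
    have s\<sigma>: "s * \<sigma> = \<bar>s\<bar>"
    proof -
     have "\<sigma> * \<sigma> = 1" using \<sigma> by (metis abs_mult_self_eq mult_1)
     then show ?thesis unfolding s by (simp add: s_def mult.assoc)
    qed
    have "\<bar>s\<bar> < \<delta>" "0 < \<bar>s\<bar>" using s \<delta> e by auto
    from \<delta>(2)[OF this(1)] obtain u where u: "\<psi> (cis (x + s)) = \<psi> (cis x) + v * u" "cmod (u - \<i> * s) \<le> 1 / 2 * \<bar>s\<bar>"
     by (auto simp: v_def)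
    have "cmod u \<le> cmod (\<i> * s) + cmod (u - \<i> * s)" by norm
    then have "cmod u \<le> \<bar>s\<bar> + cmod (u - \<i> * s)" by (simp add: norm_mult)
    moreover have "\<bar>s\<bar> \<le> e / 2" unfolding s by simp
    ultimately have "cmod u < e" using u(2) e by linarith
    have "\<bar>Im (u - \<i> * s)\<bar> \<le> 1 / 2 * \<bar>s\<bar>" using abs_Im_le_cmod[of "u - \<i> * s"] u(2) by linarith
    then have "\<bar>Im u - s\<bar> \<le> 1 / 2 * \<bar>s\<bar>" by simp
    then have "\<bar>(Im u - s) * \<sigma>\<bar> \<le> 1 / 2 * \<bar>s\<bar>" using \<sigma> by (simp add: abs_mult)
    moreover have "(Im u - s) * \<sigma> = Im u * \<sigma> - \<bar>s\<bar>" using s\<sigma> by (simp add: algebra_simps)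
    ultimately have "0 < Im u * \<sigma>" using \<open>0 < \<bar>s\<bar>\<close> by linarith
    moreover have "\<psi> (cis x) + v * u \<in> frontier G" using u(1)[symmetric] by (auto simp: frontier_eq)
    moreover have "\<psi> (cis x) + v * u \<noteq> \<psi> (cis x)" using \<open>0 < Im u * \<sigma>\<close> d by (auto simp: v_def)
    ultimately show ?thesis using \<open>cmod u < e\<close> by blast
   qed
   show "\<exists>u. \<psi> (cis x) + v * u \<in> frontier G - {\<psi> (cis x)} \<and> cmod u < e \<and> 0 < Im u" if "0 < e" for e
    using both[OF that, of 1] by simp
   show "\<exists>u. \<psi> (cis x) + v * u \<in> frontier G - {\<psi> (cis x)} \<and> cmod u < e \<and> Im u < 0" if "0 < e" for e
    using both[OF that, of "-1"] by simp
  qed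
 qed
qed

text \<open>A point of an approach region is not too close to the boundary, compared to its distance from the vertex, hence not too close to the tangent. As the
 outer cone lies outside \<open>G\<close>, it lies in the inner cone, which is covered by the image of a Stolz region.\<close>

lemma approach_region_subset_stolz:
 assumes reg: "regular x d" and \<alpha>: "1 < \<alpha>"
 obtains \<beta> \<delta> where "1 < \<beta>" "0 < \<delta>"
  "\<And>z. z \<in> approach_region G \<alpha> (\<psi> (cis x)) \<Longrightarrow> z \<noteq> \<psi> (cis x) \<Longrightarrow> dist z (\<psi> (cis x)) < \<delta> \<Longrightarrow> \<phi> z \<in> stolz \<beta> (cis x)"
proof -
 define t where "t = \<psi> (cis x)"
 define v where "v = d * cis x"
 have d: "d \<noteq> 0" and nt: "ntlim (deriv \<psi>) (cis x) d" using reg by (auto simp: regular_def)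
 have v: "v \<noteq> 0" "cmod v = cmod d" using d by (auto simp: v_def norm_mult)
 define c where "c = 1 / (4 * \<alpha>)"
 have c: "0 < c" "c \<le> 1" using \<alpha> by (auto simp: c_def field_simps)
 then have c2: "0 < c / 2" "c / 2 \<le> 1" by auto
 obtain \<delta> where \<delta>: "0 < \<delta>" "\<And>s. \<bar>s\<bar> < \<delta> \<Longrightarrow> \<exists>u. \<psi> (cis (x + s)) = t + v * u \<and> cmod (u - \<i> * s) \<le> c * \<bar>s\<bar>"
  by (rule frontier_near_tangent[OF reg c(1)]) (simp add: t_def v_def)
 obtain r1 where r1: "0 < r1" "\<And>u. u \<noteq> 0 \<Longrightarrow> cmod u < r1 \<Longrightarrow> 2 * (c / 2) * cmod u \<le> - Re u \<Longrightarrow>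
   \<exists>w\<in>stolz (3 / (c / 2)) (cis x). \<psi> w = t + v * u"
  by (rule angular_derivative_sector[OF hol cont norm_cis nt d c2]) (simp add: t_def v_def)
 obtain r2 where r2: "0 < r2" "\<And>u. cmod u < r2 \<Longrightarrow> 0 < Re u \<Longrightarrow> c * cmod u \<le> Re u \<Longrightarrow> t + v * u \<notin> G"
  by (rule outer_cone_not_in_G[OF reg c]) (simp add: t_def v_def)
 define r where "r = min \<delta> (min r1 r2)"
 have r: "0 < r" using \<delta> r1 r2 by (simp add: r_def)
 have \<beta>: "1 < 3 / (c / 2)" using c by (simp add: field_simps)
 show ?thesis
 proof (rule that[OF \<beta>, of "r * cmod d"])
  show "0 < r * cmod d" using r d by simp
  fix z assume z: "z \<in> approach_region G \<alpha> (\<psi> (cis x))" "z \<noteq> \<psi> (cis x)" "dist z (\<psi> (cis x)) < r * cmod d"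
  have zG: "z \<in> G" and app: "dist z t < \<alpha> * infdist z (frontier G)" using z(1) by (auto simp: approach_region_def t_def)
  define u where "u = (z - t) / v"
  have zu: "z = t + v * u" using v by (simp add: u_def)
  have dzt: "dist z t = cmod d * cmod u" by (simp add: zu dist_norm norm_mult v)
  have u0: "u \<noteq> 0" using z(2) by (auto simp: zu t_def)
  have ur: "cmod u < r" using z(3) d by (simp add: dzt[unfolded t_def] mult.commute)
  have cone: "c * cmod u \<le> \<bar>Re u\<bar>"
  proof (rule ccontr)
   assume "\<not> ?thesis"
   then have re: "\<bar>Re u\<bar> < c * cmod u" by simp
   have im: "\<bar>Im u\<bar> \<le> cmod u" by (rule abs_Im_le_cmod)
   then obtain u' where u': "\<psi> (cis (x + Im u)) = t + v * u'" "cmod (u' - \<i> * Im u) \<le> c * \<bar>Im u\<bar>"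
    using \<delta>(2)[of "Im u"] ur by (auto simp: r_def)
   have "cmod (u - \<i> * Im u) = \<bar>Re u\<bar>" by (subst (1) complex_eq[of u]) simp
   then have "cmod (u - u') \<le> \<bar>Re u\<bar> + c * \<bar>Im u\<bar>"
    using norm_triangle_ineq4[of "u - \<i> * Im u" "u' - \<i> * Im u"] u'(2) by simp
   moreover have "c * \<bar>Im u\<bar> \<le> c * cmod u" using im c by (intro mult_left_mono) auto
   ultimately have uu: "cmod (u - u') \<le> 2 * c * cmod u" using re by linarith
   have "infdist z (frontier G) \<le> dist z (\<psi> (cis (x + Im u)))"
    by (intro infdist_le) (auto simp: frontier_eq)
   also have "\<dots> = cmod d * cmod (u - u')"
    unfolding u'(1) zu dist_norm v(2)[symmetric] norm_mult[symmetric] by (simp add: algebra_simps)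
   also have "\<dots> \<le> cmod d * (2 * c * cmod u)" using uu by (intro mult_left_mono) auto
   finally have "\<alpha> * infdist z (frontier G) \<le> \<alpha> * (cmod d * (2 * c * cmod u))" using \<alpha> by (intro mult_left_mono) auto
   also have "\<dots> = dist z t / 2" using \<alpha> by (simp add: dzt c_def)
   finally have "dist z t < dist z t / 2" using app by linarith
   then show False using zero_le_dist[of z t] by linarith
  qed
  have "Re u < 0"
  proof (rule ccontr)
   assume "\<not> Re u < 0"
   then have "c * cmod u \<le> Re u" using cone by simp
   moreover have "0 < c * cmod u" using c u0 by simp
   ultimately show False using r2(2)[of u] ur zG zu by (auto simp: r_def)
  qed
  then have "2 * (c / 2) * cmod u \<le> - Re u" using cone by simp
  with r1(2)[OF u0] ur obtain w where w: "w \<in> stolz (3 / (c / 2)) (cis x)" "\<psi> w = z"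
   by (auto simp: r_def zu)
  then have "\<phi> z = w" using \<phi>\<psi>[of w] by (auto simp: stolz_def)
  then show "\<phi> z \<in> stolz (3 / (c / 2)) (cis x)" using w by simp
 qed
qed

text \<open>A point at distance \<open>s\<close> on the inner normal has distance at least \<open>s / 4\<close> from the boundary, because the latter avoids a cone
 around the normal. This makes the boundary value unique.\<close>

lemma approach_region_nontrivial:
 assumes reg: "regular x d"
 shows "at (\<psi> (cis x)) within approach_region G 5 (\<psi> (cis x)) \<noteq> bot"
proof -
 define t where "t = \<psi> (cis x)"
 define v where "v = d * cis x"
 have d: "d \<noteq> 0" and nt: "ntlim (deriv \<psi>) (cis x) d" using reg by (auto simp: regular_def)
 have v: "v \<noteq> 0" "cmod v = cmod d" using d by (auto simp: v_def norm_mult)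
 obtain r1 where r1: "0 < r1" "\<And>u. u \<noteq> 0 \<Longrightarrow> cmod u < r1 \<Longrightarrow> 1 / 2 * cmod u \<le> \<bar>Re u\<bar> \<Longrightarrow> t + v * u \<notin> frontier G"
  by (rule frontier_avoids_cone[OF reg, of "1 / 2"]) (auto simp: t_def v_def)
 obtain r2 where r2: "0 < r2" "\<And>u. u \<noteq> 0 \<Longrightarrow> cmod u < r2 \<Longrightarrow> 2 * (1 / 2) * cmod u \<le> - Re u \<Longrightarrow>
   \<exists>w\<in>stolz (3 / (1 / 2)) (cis x). \<psi> w = \<psi> (cis x) + d * cis x * u"
  by (rule angular_derivative_sector[OF hol cont norm_cis nt d, of "1 / 2"]) auto
 have "t islimpt approach_region G 5 t"
  unfolding islimpt_approachable
 proof (intro allI impI)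
  fix e :: real assume e: "0 < e"
  define s where "s = min (r1 / 2) (min (r2 / 2) (e / (2 * cmod d)))"
  have s: "0 < s" "s \<le> r1 / 2" "s < r2" "s * cmod d < e"
  proof -
   have "s \<le> e / (2 * cmod d)" by (simp add: s_def)
   then have "s * cmod d \<le> e / 2" using d by (simp add: field_simps)
   then show "s * cmod d < e" using e by simp
  qed (use r1 r2 e d in \<open>auto simp: s_def\<close>)
  define z where "z = t + v * of_real (- s)"
  have zt: "dist z t = cmod d * s" using s by (simp add: z_def dist_norm norm_mult v)
  have "\<exists>w\<in>stolz (3 / (1 / 2)) (cis x). \<psi> w = \<psi> (cis x) + d * cis x * of_real (- s)"
   using s by (intro r2(2)) auto
  then obtain w where "cmod w < 1" "\<psi> w = z" by (auto simp: stolz_def z_def t_def v_def)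
  then have zG: "z \<in> G" using image by (metis imageI mem_ball_0)
  have "cmod d * (s / 4) \<le> infdist z (frontier G)"
  proof -
   have "cmod d * (s / 4) \<le> dist z y" if y: "y \<in> frontier G" for y
   proof -
    define u where "u = (y - t) / v"
    have yu: "y = t + v * u" using v by (simp add: u_def)
    have dzy: "dist z y = cmod d * cmod (u + of_real s)"
     unfolding yu z_def dist_norm v(2)[symmetric] norm_mult[symmetric]
     by (subst norm_minus_cancel[symmetric]) (simp add: algebra_simps)
    have "s / 4 \<le> cmod (u + of_real s)"
    proof (cases "cmod u < r1")
     case True
     show ?thesis
     proof (cases "u = 0")
      case False
      then have "\<not> 1 / 2 * cmod u \<le> \<bar>Re u\<bar>" using r1(2)[OF False True] y yu by auto
      then have "s - cmod u / 2 \<le> cmod (u + of_real s)"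
       using complex_Re_le_cmod[of "u + of_real s"] by simp
      moreover have "cmod u - s \<le> cmod (u + of_real s)"
       using norm_triangle_ineq2[of u "- of_real s"] s by simp
      ultimately show ?thesis using s by linarith
     qed (use s in simp)
    next
     case False
     then show ?thesis using norm_triangle_ineq2[of u "- of_real s"] s by simp
    qed
    then show ?thesis unfolding dzy by (intro mult_left_mono) auto
   qed
   moreover have ne: "frontier G \<noteq> {}" by (simp add: frontier_eq)
   ultimately have "cmod d * (s / 4) \<le> (INF y\<in>frontier G. dist z y)" by (intro cINF_greatest)
   then show ?thesis by (simp only: infdist_notempty[OF ne])
  qed
  then have "4 * (cmod d * (s / 4)) \<le> 4 * infdist z (frontier G)" by simp
  moreover have "0 < cmod d * s" using s d by simp
  ultimately have "dist z t < 5 * infdist z (frontier G)" unfolding zt by linarith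
  then have "z \<in> approach_region G 5 t" using zG by (simp add: approach_region_def)
  moreover have "z \<noteq> t" using s v by (simp add: z_def)
  moreover have "dist z t < e" using s(4) by (simp add: zt mult.commute)
  ultimately show "\<exists>z\<in>approach_region G 5 t. z \<noteq> t \<and> dist z t < e" by blast
 qed
 then show ?thesis unfolding t_def using trivial_limit_within by blast
qed

text \<open>The inverse map sends approach regions of \<open>G\<close> into Stolz regions, so the limits transfer; they are unique because an approach
 region of aperture \<open>5\<close> accumulates at the point.\<close>

theorem bvalue_eq:
 assumes reg: "regular x d" and lim: "ntlim (\<lambda>w. f (\<psi> w)) (cis x) L"
 shows "bvalue G f (\<psi> (cis x)) = L"
proof -
 define t where "t = \<psi> (cis x)"
 have tend: "(f \<longlongrightarrow> L) (at t within approach_region G \<alpha> t)" if \<alpha>: "1 < \<alpha>" for \<alpha>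
 proof -
  obtain \<beta> \<delta> where \<beta>: "1 < \<beta>" and \<delta>: "0 < \<delta>"
   "\<And>z. z \<in> approach_region G \<alpha> t \<Longrightarrow> z \<noteq> t \<Longrightarrow> dist z t < \<delta> \<Longrightarrow> \<phi> z \<in> stolz \<beta> (cis x)"
   by (rule approach_region_subset_stolz[OF reg \<alpha>]) (simp add: t_def)
  have tcl: "t \<in> closure G" using image_cball by (auto simp: t_def)
  have sub: "approach_region G \<alpha> t \<subseteq> closure G" using closure_subset by (auto simp: approach_region_def)
  have "(\<phi> \<longlongrightarrow> \<phi> t) (at t within closure G)"
   using cont_\<phi> tcl by (simp add: continuous_on_def)
  then have 1: "(\<phi> \<longlongrightarrow> cis x) (at t within approach_region G \<alpha> t)"
   using tendsto_within_subset[OF _ sub] \<phi>\<psi>[of "cis x"] by (simp add: t_def)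
  have 2: "\<forall>\<^sub>F z in at t within approach_region G \<alpha> t. \<phi> z \<in> stolz \<beta> (cis x) \<and> \<phi> z \<noteq> cis x"
  proof -
   have ne: "\<phi> z \<noteq> cis x" if "\<phi> z \<in> stolz \<beta> (cis x)" for z using that by (auto simp: stolz_def)
   then show ?thesis unfolding eventually_at using \<delta> by blast
  qed
  have "filterlim \<phi> (at (cis x) within stolz \<beta> (cis x)) (at t within approach_region G \<alpha> t)"
   unfolding filterlim_at using 1 2 by simp
  then have "((\<lambda>z. f (\<psi> (\<phi> z))) \<longlongrightarrow> L) (at t within approach_region G \<alpha> t)"
   by (rule filterlim_compose[rotated]) (use lim \<beta> in \<open>simp add: ntlim_def\<close>)
  moreover have "\<forall>\<^sub>F z in at t within approach_region G \<alpha> t. f (\<psi> (\<phi> z)) = f z"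
  proof -
   have "\<psi> (\<phi> z) = z" if "z \<in> G" for z
    using that homeo closure_subset[of G] by (auto simp: homeomorphism_def)
   then show ?thesis by (auto simp: eventually_at approach_region_def intro!: exI[of _ 1])
  qed
  ultimately show ?thesis by (rule Lim_transform_eventually)
 qed
 show ?thesis
  unfolding bvalue_def t_def[symmetric]
 proof (rule the_equality)
  show "\<forall>\<alpha>>1. (f \<longlongrightarrow> L) (at t within approach_region G \<alpha> t)" using tend by blast
  fix M assume "\<forall>\<alpha>>1. (f \<longlongrightarrow> M) (at t within approach_region G \<alpha> t)"
  then have "(f \<longlongrightarrow> M) (at t within approach_region G 5 t)" by simp
  moreover have "(f \<longlongrightarrow> L) (at t within approach_region G 5 t)" by (rule tend) simp
  ultimately show "M = L"
   using tendsto_unique approach_region_nontrivial[OF reg] unfolding t_def by blast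
 qed
qed

end

section \<open>Curve length\<close>

text \<open>A recursive form of the sum of sides in the definition of \<open>curve_length\<close>, suited to induction over the list of vertices.\<close>

fun polygon_length :: "(real \<Rightarrow> complex) \<Rightarrow> real list \<Rightarrow> real" where
 "polygon_length g (x # y # xs) = dist (g x) (g y) + polygon_length g (y # xs)"
| "polygon_length g _ = 0"

lemma polygon_length_nonneg: "0 \<le> polygon_length g xs"
 by (induction g xs rule: polygon_length.induct) auto

lemma polygon_length_eq_sum:
 "polygon_length g xs = (\<Sum>i<length xs - 1. dist (g (xs ! i)) (g (xs ! Suc i)))"
proof (induction g xs rule: polygon_length.induct)
 case (1 g x y xs)
 have "(\<Sum>i<length (x # y # xs) - 1. dist (g ((x # y # xs) ! i)) (g ((x # y # xs) ! Suc i))) =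
   dist (g x) (g y) + (\<Sum>i<length (y # xs) - 1. dist (g ((y # xs) ! i)) (g ((y # xs) ! Suc i)))"
  by (simp add: sum.lessThan_Suc_shift del: sum.lessThan_Suc)
 then show ?case using 1 by simp
qed auto

lemma curve_length_polygon:
 "curve_length g a b = (SUP xs\<in>{xs. sorted xs \<and> set xs \<subseteq> {a..b}}. ennreal (polygon_length g xs))"
 unfolding curve_length_def polygon_length_eq_sum by (simp add: sum_ennreal)

lemma polygon_le_curve_length:
 "sorted xs \<Longrightarrow> set xs \<subseteq> {a..b} \<Longrightarrow> ennreal (polygon_length g xs) \<le> curve_length g a b"
 unfolding curve_length_polygon by (rule SUP_upper) simp

lemma curve_length_le:
 "(\<And>xs. sorted xs \<Longrightarrow> set xs \<subseteq> {a..b} \<Longrightarrow> ennreal (polygon_length g xs) \<le> C) \<Longrightarrow> curve_length g a b \<le> C"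
 unfolding curve_length_polygon by (rule SUP_least) simp

lemma polygon_length_append: "polygon_length g (xs @ y # ys) = polygon_length g (xs @ [y]) + polygon_length g (y # ys)"
proof (induction xs)
 case (Cons a xs)
 then show ?case by (cases xs) auto
qed simp

lemma polygon_length_snoc_le: "polygon_length g xs \<le> polygon_length g (xs @ [y])"
proof (induction xs)
 case (Cons a xs)
 then show ?case by (cases xs) auto
qed simp

lemma polygon_length_Cons_le: "polygon_length g xs \<le> polygon_length g (y # xs)"
 by (cases xs) auto

lemma polygon_length_append_le: "polygon_length g xs + polygon_length g ys \<le> polygon_length g (xs @ ys)"
proof (cases ys)
 case (Cons y ys')
 then show ?thesis using polygon_length_append[of g xs y ys'] polygon_length_snoc_le[of g xs y] by simp
qed simp

text \<open>The triangle inequality at the additional vertex; it makes the curve length subadditive.\<close>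

lemma polygon_length_insert_le: "polygon_length g (xs @ ys) \<le> polygon_length g (xs @ [m]) + polygon_length g (m # ys)"
proof (induction xs)
 case Nil
 then show ?case using polygon_length_Cons_le by simp
next
 case (Cons a xs)
 show ?case
 proof (cases xs)
  case Nil
  then show ?thesis
  proof (cases ys)
   case (Cons y ys')
   then show ?thesis using Nil dist_triangle[of "g a" "g y" "g m"] by simp
  qed auto
 next
  case (Cons b xs')
  then show ?thesis using Cons.IH by simp
 qed
qed

lemma polygon_length_map: "polygon_length (\<lambda>t. g (h t)) xs = polygon_length g (map h xs)"
 by (induction "\<lambda>t. g (h t)" xs rule: polygon_length.induct) auto

lemma polygon_length_cong: "(\<And>t. t \<in> set xs \<Longrightarrow> g t = g' t) \<Longrightarrow> polygon_length g xs = polygon_length g' xs"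
 by (induction g xs rule: polygon_length.induct) auto

lemma polygon_length_rev: "polygon_length g (rev xs) = polygon_length g xs"
proof (induction xs)
 case (Cons a xs)
 show ?case
 proof (cases xs)
  case (Cons b ys)
  then have "polygon_length g (rev (a # xs)) = polygon_length g (rev ys @ b # [a])" by simp
  also have "\<dots> = polygon_length g (rev ys @ [b]) + dist (g b) (g a)"
   by (subst polygon_length_append) simp
  also have "\<dots> = polygon_length g (a # xs)" using Cons.IH Cons by (simp add: dist_commute)
  finally show ?thesis .
 qed simp
qed simp

lemma curve_length_superadditive:
 assumes "a \<le> b" "b \<le> c"
 shows "curve_length g a b + curve_length g b c \<le> curve_length g a c"
proof -
 define A where "A = {xs. sorted xs \<and> set xs \<subseteq> {a..b}}"
 define B where "B = {xs. sorted xs \<and> set xs \<subseteq> {b..c}}"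
 have ne: "A \<noteq> {}" "B \<noteq> {}" by (auto simp: A_def B_def intro: exI[of _ "[]"])
 have 1: "ennreal (polygon_length g xs) + ennreal (polygon_length g ys) \<le> curve_length g a c" if "xs \<in> A" "ys \<in> B" for xs ys
 proof -
  have "sorted (xs @ ys)" "set (xs @ ys) \<subseteq> {a..c}"
   using that assms by (fastforce simp: A_def B_def sorted_append)+
  then have "ennreal (polygon_length g (xs @ ys)) \<le> curve_length g a c" by (rule polygon_le_curve_length)
  moreover have "ennreal (polygon_length g xs) + ennreal (polygon_length g ys) \<le> ennreal (polygon_length g (xs @ ys))"
   using polygon_length_append_le by (simp add: ennreal_plus[symmetric] polygon_length_nonneg ennreal_leI del: ennreal_plus)
  ultimately show ?thesis by simp
 qed
 have 2: "ennreal (polygon_length g xs) + curve_length g b c \<le> curve_length g a c" if "xs \<in> A" for xs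
 proof -
  have "ennreal (polygon_length g xs) + curve_length g b c = (SUP ys\<in>B. ennreal (polygon_length g xs) + ennreal (polygon_length g ys))"
   unfolding curve_length_polygon B_def[symmetric] by (rule ennreal_SUP_add_right[OF ne(2)])
  also have "\<dots> \<le> curve_length g a c" using 1[OF that] by (intro SUP_least)
  finally show ?thesis .
 qed
 have "curve_length g a b + curve_length g b c = (SUP xs\<in>A. ennreal (polygon_length g xs) + curve_length g b c)"
  unfolding curve_length_polygon[of g a b] A_def[symmetric] by (rule ennreal_SUP_add_left[OF ne(1), symmetric])
 also have "\<dots> \<le> curve_length g a c" using 2 by (intro SUP_least)
 finally show ?thesis .
qed

lemma curve_length_subadditive:
 assumes "a \<le> b" "b \<le> c"
 shows "curve_length g a c \<le> curve_length g a b + curve_length g b c"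
proof (rule curve_length_le)
 fix xs :: "real list" assume xs: "sorted xs" "set xs \<subseteq> {a..c}"
 define ys zs where "ys = takeWhile (\<lambda>x. x \<le> b) xs" and "zs = dropWhile (\<lambda>x. x \<le> b) xs"
 have eq: "xs = ys @ zs" by (simp add: ys_def zs_def)
 have sorted: "sorted ys" "sorted zs" "\<forall>y\<in>set ys. \<forall>z\<in>set zs. y \<le> z" using xs(1) by (simp_all add: eq sorted_append)
 have ysb: "y \<le> b" if "y \<in> set ys" for y using that by (auto simp: ys_def dest: set_takeWhileD)
 have zsb: "b \<le> z" if "z \<in> set zs" for z
 proof (cases zs)
  case (Cons w ws)
  then have "b < w" using hd_dropWhile[of "\<lambda>x. x \<le> b" xs] by (auto simp: zs_def)
  moreover have "w \<le> z" using sorted(2) that Cons by auto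
  ultimately show ?thesis by simp
 qed (use that in simp)
 have "polygon_length g xs \<le> polygon_length g (ys @ [b]) + polygon_length g (b # zs)"
  unfolding eq by (rule polygon_length_insert_le)
 then have "ennreal (polygon_length g xs) \<le> ennreal (polygon_length g (ys @ [b])) + ennreal (polygon_length g (b # zs))"
  by (simp add: ennreal_plus[symmetric] polygon_length_nonneg ennreal_leI del: ennreal_plus)
 also have "\<dots> \<le> curve_length g a b + curve_length g b c"
 proof (intro add_mono polygon_le_curve_length)
  show "sorted (ys @ [b])" "sorted (b # zs)" using sorted ysb zsb by (auto simp: sorted_append)
  show "set (ys @ [b]) \<subseteq> {a..b}" "set (b # zs) \<subseteq> {b..c}"
   using xs(2) ysb zsb assms by (auto simp: eq)
 qed
 finally show "ennreal (polygon_length g xs) \<le> curve_length g a b + curve_length g b c" .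
qed

lemma curve_length_reparam_le:
 assumes "mono_on {a..b} h" "h ` {a..b} \<subseteq> {c..d}" "\<And>t. t \<in> {a..b} \<Longrightarrow> f t = g (h t)"
 shows "curve_length f a b \<le> curve_length g c d"
proof (rule curve_length_le)
 fix xs assume xs: "sorted xs" "set xs \<subseteq> {a..b}"
 have "polygon_length f xs = polygon_length g (map h xs)"
  unfolding polygon_length_map[symmetric] using xs assms(3) by (intro polygon_length_cong) auto
 moreover have "sorted (map h xs)"
  using xs assms(1) by (induction xs) (auto simp: mono_on_def)
 then have "ennreal (polygon_length g (map h xs)) \<le> curve_length g c d"
  using xs assms(2) by (intro polygon_le_curve_length) auto
 ultimately show "ennreal (polygon_length f xs) \<le> curve_length g c d" by simp
qed

lemma curve_length_reparam_antimono_le: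
 assumes "antimono_on {a..b} h" "h ` {a..b} \<subseteq> {c..d}" "\<And>t. t \<in> {a..b} \<Longrightarrow> f t = g (h t)"
 shows "curve_length f a b \<le> curve_length g c d"
proof (rule curve_length_le)
 fix xs assume xs: "sorted xs" "set xs \<subseteq> {a..b}"
 have "polygon_length f xs = polygon_length g (rev (map h xs))"
  unfolding polygon_length_rev polygon_length_map[symmetric] using xs assms(3) by (intro polygon_length_cong) auto
 moreover have "sorted (rev (map h xs))"
  using xs assms(1) by (induction xs) (auto simp: monotone_on_def sorted_append)
 then have "ennreal (polygon_length g (rev (map h xs))) \<le> curve_length g c d"
  using xs assms(2) by (intro polygon_le_curve_length) auto
 ultimately show "ennreal (polygon_length f xs) \<le> curve_length g c d" by simp
qed

lemma curve_length_shift_closed: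
 assumes per: "\<And>t. a (t + 2 * pi) = a t" and \<tau>: "0 \<le> \<tau>" "\<tau> \<le> 2 * pi"
 shows "curve_length (\<lambda>t. a (\<tau> + t)) 0 (2 * pi) \<le> curve_length a 0 (2 * pi)"
proof -
 have "curve_length (\<lambda>t. a (\<tau> + t)) 0 (2 * pi) \<le>
   curve_length (\<lambda>t. a (\<tau> + t)) 0 (2 * pi - \<tau>) + curve_length (\<lambda>t. a (\<tau> + t)) (2 * pi - \<tau>) (2 * pi)"
  using \<tau> by (intro curve_length_subadditive) auto
 also have "\<dots> \<le> curve_length a \<tau> (2 * pi) + curve_length a 0 \<tau>"
 proof (intro add_mono)
  show "curve_length (\<lambda>t. a (\<tau> + t)) 0 (2 * pi - \<tau>) \<le> curve_length a \<tau> (2 * pi)"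
   by (rule curve_length_reparam_le[where h = "\<lambda>t. \<tau> + t"]) (auto simp: mono_on_def)
  show "curve_length (\<lambda>t. a (\<tau> + t)) (2 * pi - \<tau>) (2 * pi) \<le> curve_length a 0 \<tau>"
  proof (rule curve_length_reparam_le[where h = "\<lambda>t. \<tau> + t - 2 * pi"])
   show "a (\<tau> + t) = a (\<tau> + t - 2 * pi)" for t using per[of "\<tau> + t - 2 * pi"] by simp
  qed (auto simp: mono_on_def)
 qed
 also have "\<dots> \<le> curve_length a 0 (2 * pi)"
  using curve_length_superadditive[of 0 \<tau> "2 * pi" a] \<tau> by (simp add: add.commute)
 finally show ?thesis .
qed

text \<open>For a fixed inscribed polygon of the image of a concentric circle, the sum of the side lengths is, after multiplication by unimodular constants, the modulus of a holomorphic function of the radius;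
 on the unit circle it is bounded by the length of the boundary.\<close>

lemma curve_length_concentric_le:
 assumes hol: "\<psi> holomorphic_on ball 0 1" and cont: "continuous_on (cball 0 1) \<psi>" and r: "0 < r" "r < 1"
 shows "curve_length (\<lambda>t. \<psi> (of_real r * cis t)) 0 (2 * pi) \<le> curve_length (\<lambda>t. \<psi> (cis t)) 0 (2 * pi)"
proof (cases "curve_length (\<lambda>t. \<psi> (cis t)) 0 (2 * pi) = \<infinity>")
 case False
 then obtain L where L: "curve_length (\<lambda>t. \<psi> (cis t)) 0 (2 * pi) = ennreal L" "0 \<le> L"
  by (cases "curve_length (\<lambda>t. \<psi> (cis t)) 0 (2 * pi)") auto
 show ?thesis
 proof (rule curve_length_le)
  fix xs :: "real list" assume xs: "sorted xs" "set xs \<subseteq> {0..2 * pi}"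
  define n where "n = length xs - 1"
  define \<Delta> where "\<Delta> z i = \<psi> (z * cis (xs ! i)) - \<psi> (z * cis (xs ! Suc i))" for z i
  \<comment> \<open>The unimodular constants are chosen so that at the given radius all terms become nonnegative.\<close>
  define W where "W z = (\<Sum>i<n. cnj (sgn (\<Delta> (of_real r) i)) * \<Delta> z i)" for z
  have poly: "polygon_length (\<lambda>t. \<psi> (z * cis t)) xs = (\<Sum>i<n. cmod (\<Delta> z i))" for z
   by (simp add: polygon_length_eq_sum n_def \<Delta>_def dist_norm)
  have Wle: "cmod (W z) \<le> (\<Sum>i<n. cmod (\<Delta> z i))" for z
  proof -
   have "cmod (W z) \<le> (\<Sum>i<n. cmod (cnj (sgn (\<Delta> (of_real r) i)) * \<Delta> z i))"
    unfolding W_def by (rule norm_sum)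
   also have "\<dots> \<le> (\<Sum>i<n. 1 * cmod (\<Delta> z i))"
    unfolding norm_mult by (intro sum_mono mult_right_mono) (auto simp: norm_sgn)
   finally show ?thesis by simp
  qed
  have "W (of_real r) = of_real (\<Sum>i<n. cmod (\<Delta> (of_real r) i))"
  proof -
   have "cnj (sgn v) * v = of_real (cmod v)" for v :: complex
   proof (cases "v = 0")
    case False
    have "cnj (sgn v) * v = (v * cnj v) / of_real (cmod v)" by (simp add: sgn_eq)
    also have "\<dots> = of_real (cmod v)" using False by (simp add: complex_norm_square[symmetric] power2_eq_square)
    finally show ?thesis .
   qed simp
   then show ?thesis by (simp add: W_def)
  qed
  then have Wr: "cmod (W (of_real r)) = (\<Sum>i<n. cmod (\<Delta> (of_real r) i))"
   by (simp add: sum_nonneg del: of_real_sum)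
  have "cmod (W (of_real r)) \<le> L"
  proof (rule maximum_modulus_frontier[where S = "ball 0 1" and f = W])
   have nl: "cmod (z * cis t) = cmod z" for z t by (simp add: norm_mult)
   have "(\<lambda>z. \<psi> (z * cis t)) holomorphic_on ball 0 1" for t
    by (rule holomorphic_on_compose_gen[OF _ hol, of "\<lambda>z. z * cis t", unfolded comp_def])
     (auto intro!: holomorphic_intros simp: nl)
   then show "W holomorphic_on interior (ball 0 1)"
    unfolding W_def \<Delta>_def by (auto intro!: holomorphic_intros)
   have "continuous_on (cball 0 1) (\<lambda>z. \<psi> (z * cis t))" for t
    by (intro continuous_on_compose2[OF cont] continuous_intros) (auto simp: nl)
   then show "continuous_on (closure (ball 0 1)) W"
    unfolding W_def \<Delta>_def by (auto intro!: continuous_intros)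
   show "cmod (W z) \<le> L" if "z \<in> frontier (ball 0 1)" for z
   proof -
    have "cmod z = 1" using that by simp
    define \<tau> where "\<tau> = Arg2pi z"
    have z: "z = cis \<tau>" using Arg2pi_eq[of z] \<open>cmod z = 1\<close> by (simp add: \<tau>_def cis_conv_exp)
    have \<tau>: "0 \<le> \<tau>" "\<tau> \<le> 2 * pi" using Arg2pi_ge_0[of z] Arg2pi_lt_2pi[of z] by (auto simp: \<tau>_def)
    have "ennreal (\<Sum>i<n. cmod (\<Delta> z i)) = ennreal (polygon_length (\<lambda>t. \<psi> (cis (\<tau> + t))) xs)"
     unfolding poly[symmetric] z by (simp add: cis_mult)
    also have "\<dots> \<le> curve_length (\<lambda>t. \<psi> (cis (\<tau> + t))) 0 (2 * pi)"
     by (rule polygon_le_curve_length[OF xs])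
    also have "\<dots> \<le> curve_length (\<lambda>t. \<psi> (cis t)) 0 (2 * pi)"
     by (rule curve_length_shift_closed[where a = "\<lambda>t. \<psi> (cis t)", OF _ \<tau>]) (simp add: cis_mult[symmetric])
    finally show ?thesis using Wle[of z] L by simp
   qed
   show "of_real r \<in> ball (0::complex) 1" using r by simp
  qed simp
  then show "ennreal (polygon_length (\<lambda>t. \<psi> (of_real r * cis t)) xs) \<le> curve_length (\<lambda>t. \<psi> (cis t)) 0 (2 * pi)"
   unfolding poly Wr L by (simp add: ennreal_leI)
 qed
qed simp

text \<open>On a fine equidistant partition the side of the inscribed polygon differs from the integral of the speed over the
 interval by at most \<open>\<epsilon>\<close> times the length of the interval, by uniform continuity of the derivative.\<close>

lemma integral_norm_derivative_le_curve_length: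
 fixes f f' :: "real \<Rightarrow> complex"
 assumes der: "\<And>t. (f has_vector_derivative f' t) (at t)" and cont: "continuous_on {0..b} f'" and b: "0 < b"
  and L: "curve_length f 0 b \<le> ennreal L" "0 \<le> L"
 shows "integral {0..b} (\<lambda>t. cmod (f' t)) \<le> L"
proof (rule field_le_epsilon)
 fix \<epsilon>' :: real assume \<epsilon>': "0 < \<epsilon>'"
 define \<epsilon> where "\<epsilon> = \<epsilon>' / b"
 have \<epsilon>: "0 < \<epsilon>" using \<epsilon>' b by (simp add: \<epsilon>_def)
 have "uniformly_continuous_on {0..b} f'" using cont by (intro compact_uniformly_continuous) auto
 then obtain \<delta> where \<delta>: "0 < \<delta>" "\<And>x y. x \<in> {0..b} \<Longrightarrow> y \<in> {0..b} \<Longrightarrow> dist y x < \<delta> \<Longrightarrow> dist (f' y) (f' x) < \<epsilon>"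
  unfolding uniformly_continuous_on_def using \<epsilon> by metis
 obtain N :: nat where N: "b / \<delta> < real N" using reals_Archimedean2 by blast
 have N0: "0 < N" using N b \<delta>(1) by (metis divide_pos_pos gr0I less_trans of_nat_0 order_less_irrefl)
 define h where "h = b / real N"
 have h: "0 < h" "h < \<delta>" "real N * h = b" using N N0 b \<delta>(1) by (auto simp: h_def field_simps)
 define T where "T k = real k * h" for k :: nat
 have T: "T k \<in> {0..b}" if "k \<le> N" for k
 proof -
  have "real k * h \<le> real N * h" using that h by (intro mult_right_mono) auto
  then show ?thesis using h by (simp add: T_def)
 qed
 have cint: "(\<lambda>t. cmod (f' t)) integrable_on {x..y}" if "x \<in> {0..b}" "y \<in> {0..b}" for x y
  using that by (intro integrable_continuous_interval continuous_intros continuous_on_subset[OF cont]) auto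
 have step: "integral {T k..T (Suc k)} (\<lambda>t. cmod (f' t)) \<le> cmod (f (T k) - f (T (Suc k))) + \<epsilon> * h" if k: "Suc k \<le> N" for k
 proof -
  have Tk: "T k \<in> {0..b}" "T (Suc k) \<in> {0..b}" "T (Suc k) = T k + h" using T[of k] T[of "Suc k"] k by (auto simp: T_def algebra_simps)
  have "cmod (f' x) \<le> (cmod (f (T k) - f (T (Suc k))) + \<epsilon> * h) / h" if x: "x \<in> {T k..T (Suc k)}" for x
  proof -
   have "cmod ((f (T (Suc k)) - T (Suc k) *\<^sub>R f' x) - (f (T k) - T k *\<^sub>R f' x)) \<le> \<epsilon> * cmod (of_real (T (Suc k)) - of_real (T k))"
   proof -
    have "norm ((f (T (Suc k)) - T (Suc k) *\<^sub>R f' x) - (f (T k) - T k *\<^sub>R f' x)) \<le> \<epsilon> * norm (T (Suc k) - T k)"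
    proof (rule differentiable_bound[where S = "{T k..T (Suc k)}" and f' = "\<lambda>t s. s *\<^sub>R (f' t - f' x)"])
     fix t assume t: "t \<in> {T k..T (Suc k)}"
     have "((\<lambda>t. f t - t *\<^sub>R f' x) has_vector_derivative (f' t - f' x)) (at t within {T k..T (Suc k)})"
      by (auto intro!: derivative_eq_intros has_vector_derivative_at_within[OF der])
     then show "((\<lambda>t. f t - t *\<^sub>R f' x) has_derivative (\<lambda>s. s *\<^sub>R (f' t - f' x))) (at t within {T k..T (Suc k)})"
      by (simp add: has_vector_derivative_def)
     have "dist (f' t) (f' x) < \<epsilon>" using t x Tk h by (intro \<delta>(2)) (auto simp: dist_real_def abs_if)
     then have "cmod (f' t - f' x) \<le> \<epsilon>" by (simp add: dist_norm)
     then show "onorm (\<lambda>s. s *\<^sub>R (f' t - f' x)) \<le> \<epsilon>"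
      by (intro onorm_le) (subst mult.commute[of \<epsilon>], simp add: mult_left_mono)
    qed (use h Tk in auto)
    then show ?thesis by (simp flip: of_real_diff)
   qed
   then have "cmod (f (T (Suc k)) - f (T k) - h *\<^sub>R f' x) \<le> \<epsilon> * h"
    using h by (simp add: Tk(3) algebra_simps)
   then have "cmod (h *\<^sub>R f' x) \<le> cmod (f (T k) - f (T (Suc k))) + \<epsilon> * h"
    using norm_triangle_ineq2[of "h *\<^sub>R f' x" "f (T (Suc k)) - f (T k)"] by (simp add: norm_minus_commute)
   then show ?thesis using h by (simp add: field_simps)
  qed
  then have "integral {T k..T (Suc k)} (\<lambda>t. cmod (f' t)) \<le> integral {T k..T (Suc k)} (\<lambda>t. (cmod (f (T k) - f (T (Suc k))) + \<epsilon> * h) / h)"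
   by (intro integral_le cint Tk integrable_const_ivl) auto
  also have "\<dots> = cmod (f (T k) - f (T (Suc k))) + \<epsilon> * h" using h Tk(3) by simp
  finally show ?thesis .
 qed
 have "integral {0..T k} (\<lambda>t. cmod (f' t)) \<le> (\<Sum>i<k. cmod (f (T i) - f (T (Suc i)))) + \<epsilon> * T k" if "k \<le> N" for k
  using that
 proof (induction k)
  case 0
  then show ?case by (simp add: T_def)
 next
  case (Suc k)
  have "integral {0..T (Suc k)} (\<lambda>t. cmod (f' t)) = integral {0..T k} (\<lambda>t. cmod (f' t)) + integral {T k..T (Suc k)} (\<lambda>t. cmod (f' t))"
   using T[of k] T[of "Suc k"] Suc.prems h b
   by (intro Henstock_Kurzweil_Integration.integral_combine[symmetric] cint) (auto simp: T_def algebra_simps)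
  then show ?case using Suc.IH Suc.prems step[OF Suc.prems] by (simp add: T_def algebra_simps)
 qed
 from this[of N] have "integral {0..b} (\<lambda>t. cmod (f' t)) \<le> (\<Sum>i<N. cmod (f (T i) - f (T (Suc i)))) + \<epsilon> * b"
  using h by (simp add: T_def)
 also have "(\<Sum>i<N. cmod (f (T i) - f (T (Suc i)))) \<le> L"
 proof -
  define xs where "xs = map T [0..<Suc N]"
  have "ennreal (polygon_length f xs) \<le> curve_length f 0 b"
  proof (rule polygon_le_curve_length)
   have "mono T" using h by (auto simp: mono_def T_def intro!: mult_right_mono)
   then show "sorted xs"
    unfolding xs_def by (simp add: sorted_iff_nth_mono monoD del: upt_Suc)
   show "set xs \<subseteq> {0..b}" using T by (auto simp: xs_def)
  qed
  then have "polygon_length f xs \<le> L" using L polygon_length_nonneg[of f xs] by (meson ennreal_le_iff order_trans)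
  moreover have "polygon_length f xs = (\<Sum>i<N. cmod (f (T i) - f (T (Suc i))))"
   unfolding polygon_length_eq_sum xs_def by (intro sum.cong) (auto simp: dist_norm simp del: upt_Suc)
  ultimately show ?thesis by simp
 qed
 finally show "integral {0..b} (\<lambda>t. cmod (f' t)) \<le> L + \<epsilon>'" using b by (simp add: \<epsilon>_def)
qed

section \<open>The boundary derivative of a conformal map onto a rectifiable Jordan domain\<close>

lemma has_vector_derivative_cis: "(cis has_vector_derivative (\<i> * cis t)) (at t within S)"
proof -
 have "((\<lambda>t. exp (\<i> * of_real t)) has_vector_derivative (\<i> * exp (\<i> * of_real t))) (at t within S)"
  by (auto intro!: derivative_eq_intros has_vector_derivative_real_field simp: mult_ac)
 then show ?thesis by (simp add: cis_conv_exp[abs_def])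
qed

lemma has_vector_derivative_circle:
 assumes hol: "\<psi> holomorphic_on ball 0 1" and r: "0 \<le> r" "r < 1"
 shows "((\<lambda>t. \<psi> (of_real r * cis t)) has_vector_derivative (of_real r * (\<i> * cis t) * deriv \<psi> (of_real r * cis t))) (at t)"
proof -
 have "of_real r * cis t \<in> ball 0 1" using r by (simp add: norm_mult)
 then have "(\<psi> has_field_derivative deriv \<psi> (of_real r * cis t)) (at (of_real r * cis t))"
  by (intro holomorphic_derivI[OF hol]) auto
 moreover have "((\<lambda>t. of_real r * cis t) has_vector_derivative (of_real r * (\<i> * cis t))) (at t)"
  by (intro has_vector_derivative_mult_right has_vector_derivative_cis)
 ultimately show ?thesis
  using field_vector_diff_chain_at[of "\<lambda>t. of_real r * cis t" "of_real r * (\<i> * cis t)" t \<psi>] by (simp add: comp_def)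
qed

lemma integral_circle_HK:
 fixes f :: "real \<Rightarrow> 'a::euclidean_space"
 assumes "continuous_on {0..2*pi} f"
 shows "integral {0..2*pi} f = (\<integral>t. f t \<partial>circle)"
 using circle_has_integral[OF integrable_circle_continuous[OF assms]] by (rule integral_unique)

lemma nn_integral_diff_tendsto:
 fixes f :: "'a \<Rightarrow> 'b::{banach, second_countable_topology}"
 assumes S: "\<And>k. integrable M (S k)" and f: "integrable M f"
  and lim: "(\<lambda>k. \<integral>\<^sup>+t. ennreal (norm (S k t - f t)) \<partial>M) \<longlonglongrightarrow> 0"
 shows "(\<lambda>k. \<integral>t. norm (S k t) \<partial>M) \<longlonglongrightarrow> (\<integral>t. norm (f t) \<partial>M)"
proof (rule tendsto_L1_int)
 have [measurable]: "\<And>k. S k \<in> borel_measurable M" "f \<in> borel_measurable M" using S f by auto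
 show "(\<lambda>k. \<integral>\<^sup>+t. ennreal (norm (norm (S k t) - norm (f t))) \<partial>M) \<longlonglongrightarrow> 0"
  by (rule tendsto_0_ennreal_le[OF lim]) (auto intro!: nn_integral_mono ennreal_leI norm_triangle_ineq3)
qed (use S f in auto)

locale rectifiable_jordan_disk = jordan_disk +
 assumes finite_length: "curve_length (\<lambda>t. \<psi> (cis t)) 0 (2 * pi) < \<infinity>"
begin

definition total_length :: real where
 "total_length = enn2real (curve_length (\<lambda>t. \<psi> (cis t)) 0 (2 * pi))"

lemma total_length: "curve_length (\<lambda>t. \<psi> (cis t)) 0 (2 * pi) = ennreal total_length" "0 \<le> total_length"
 using finite_length by (auto simp: total_length_def)

lemma deriv_holomorphic: "deriv \<psi> holomorphic_on ball 0 1"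
 by (rule holomorphic_deriv[OF hol open_ball])

lemma deriv_nonzero: "w \<in> ball 0 1 \<Longrightarrow> deriv \<psi> w \<noteq> 0"
 using inj by (intro holomorphic_injective_imp_regular[OF hol]) (auto intro: inj_on_subset)

text \<open>The left-hand side is the length of the image of the circle of radius \<open>r\<close>.\<close>

lemma circle_L1_bound:
 fixes r :: real
 assumes r: "0 < r" "r < 1"
 shows "r * (\<integral>t. cmod (deriv \<psi> (r * cis t)) \<partial>circle) \<le> total_length"
proof -
 define f' where "f' t = of_real r * (\<i> * cis t) * deriv \<psi> (of_real r * cis t)" for t
 have c: "continuous_on A (\<lambda>t. deriv \<psi> (of_real r * cis t))" for A by (rule continuous_on_radial[OF deriv_holomorphic r])
 then have cf: "continuous_on {0..2*pi} f'" unfolding f'_def by (intro continuous_intros)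
 have "integral {0..2*pi} (\<lambda>t. cmod (f' t)) \<le> total_length"
 proof (rule integral_norm_derivative_le_curve_length[where f = "\<lambda>t. \<psi> (of_real r * cis t)"])
  show "((\<lambda>t. \<psi> (of_real r * cis t)) has_vector_derivative f' t) (at t)" for t
   unfolding f'_def using r by (intro has_vector_derivative_circle hol) auto
  show "curve_length (\<lambda>t. \<psi> (of_real r * cis t)) 0 (2 * pi) \<le> ennreal total_length"
   using curve_length_concentric_le[OF hol cont r] by (simp add: total_length)
 qed (use cf total_length in auto)
 also have "integral {0..2*pi} (\<lambda>t. cmod (f' t)) = (\<integral>t. cmod (f' t) \<partial>circle)"
  by (intro integral_circle_HK continuous_intros cf)
 also have "\<dots> = (\<integral>t. r * cmod (deriv \<psi> (r * cis t)) \<partial>circle)"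
  using r by (simp add: f'_def norm_mult)
 finally show ?thesis by simp
qed

lemma deriv_log:
 obtains h where "h holomorphic_on ball 0 1" "\<And>w. w \<in> ball 0 1 \<Longrightarrow> deriv \<psi> w = exp (h w)"
proof -
 have "simply_connected (ball (0::complex) 1)" by (intro convex_imp_simply_connected convex_ball)
 then show ?thesis
  using simply_connected_eq_holomorphic_log[of "ball 0 1"] deriv_holomorphic deriv_nonzero that by auto
qed

text \<open>The theorem of F. and M. Riesz in the form needed here. Since \<open>\<psi>'\<close> has no zeros it is the square of an \<open>H\<^sup>2\<close> function;
 this gives boundary values in \<open>L\<^sup>1\<close> to which the dilates of \<open>\<psi>'\<close> converge in the mean.
 They vanish almost nowhere because \<open>log \<bar>\<psi>'\<bar>\<close> is harmonic, so that its negative part is integrable as soon as the positive part is.\<close>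

theorem boundary_derivative:
 obtains F :: "real \<Rightarrow> complex" and r :: "nat \<Rightarrow> real"
 where "integrable circle F" "AE t in circle. ntlim (deriv \<psi>) (cis t) (F t)"
  "AE t in circle. F t \<noteq> 0" "integrable circle (\<lambda>t. ln (cmod (F t)))"
  "\<And>k. 0 < r k" "\<And>k. r k < 1" "r \<longlonglongrightarrow> 1"
  "(\<lambda>k. \<integral>\<^sup>+t. ennreal (cmod (deriv \<psi> (r k * cis t) - F t)) \<partial>circle) \<longlonglongrightarrow> 0"
proof -
 obtain h where h: "h holomorphic_on ball 0 1" "\<And>w. w \<in> ball 0 1 \<Longrightarrow> deriv \<psi> w = exp (h w)"
  by (rule deriv_log) blast
 define s where "s w = exp (h w / 2)" for w
 have s: "s holomorphic_on ball 0 1" unfolding s_def by (intro holomorphic_intros h) auto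
 have s2: "(s w)\<^sup>2 = deriv \<psi> w" if "w \<in> ball 0 1" for w
  using h(2)[OF that] by (simp add: s_def exp_double[symmetric])
 \<comment> \<open>For radii below \<open>1/2\<close> the length bound is not useful, as it contains the factor \<open>r\<close>.\<close>
 obtain B where B: "\<And>w. w \<in> cball 0 (1/2) \<Longrightarrow> cmod (deriv \<psi> w) \<le> B"
 proof -
  have "compact (deriv \<psi> ` cball 0 (1/2))"
   by (intro compact_continuous_image holomorphic_on_imp_continuous_on[OF holomorphic_on_subset[OF deriv_holomorphic]]) auto
  then obtain B where "\<forall>y\<in>deriv \<psi> ` cball 0 (1/2). cmod y \<le> B" using compact_imp_bounded bounded_iff by metis
  then show ?thesis using that by blast
 qed
 have bnd: "(\<integral>t. (cmod (s (x * cis t)))\<^sup>2 \<partial>circle) \<le> max (2 * total_length) (B * (2 * pi))" if x: "0 < x" "x < 1" for x :: real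
 proof -
  have in_ball: "x * cis t \<in> ball 0 1" for t using x by (simp add: norm_mult)
  have eq: "(\<integral>t. (cmod (s (x * cis t)))\<^sup>2 \<partial>circle) = (\<integral>t. cmod (deriv \<psi> (x * cis t)) \<partial>circle)"
   using s2[OF in_ball] by (simp flip: norm_power)
  show ?thesis
  proof (cases "x \<le> 1/2")
   case True
   have "(\<integral>t. cmod (deriv \<psi> (x * cis t)) \<partial>circle) \<le> (\<integral>t. B \<partial>circle)"
    using x True by (intro integral_mono integrable_circle_continuous continuous_intros continuous_on_radial deriv_holomorphic
      finite_measure.integrable_const[OF finite_measure_circle] B) (auto simp: norm_mult)
   also have "\<dots> = B * (2 * pi)" by simp
   finally show ?thesis unfolding eq by simp
  next
   case False
   have "1/2 * (\<integral>t. cmod (deriv \<psi> (x * cis t)) \<partial>circle) \<le> x * (\<integral>t. cmod (deriv \<psi> (x * cis t)) \<partial>circle)"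
    using False by (intro mult_right_mono integral_nonneg_AE) auto
   with circle_L1_bound[OF x] show ?thesis unfolding eq by simp
  qed
 qed
 show ?thesis
 proof (rule H2_boundary_function[OF s bnd])
  fix f and r :: "nat \<Rightarrow> real"
  assume *: "f \<in> borel_measurable circle" "(\<integral>\<^sup>+t. ennreal ((cmod (f t))\<^sup>2) \<partial>circle) < \<infinity>"
   "\<And>k. 0 < r k" "\<And>k. r k < 1" "r \<longlonglongrightarrow> 1"
   "(\<lambda>k. \<integral>\<^sup>+t. ennreal ((cmod (s (r k * cis t) - f t))\<^sup>2) \<partial>circle) \<longlonglongrightarrow> 0"
  note [measurable] = *(1)
  define F where "F t = (f t)\<^sup>2" for t
  have F_int: "integrable circle F" unfolding F_def by (rule integrable_of_nn_square(2)[OF *(1,2)])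
  have in_ball: "of_real (r k) * cis t \<in> ball 0 1" for k t using *(3,4)[of k] by (simp add: norm_mult)
  have s_nt: "AE t in circle. ntlim s (cis t) (f t)" by (rule H2_ntlim[OF s *])
  have nt: "AE t in circle. ntlim (deriv \<psi>) (cis t) (F t)"
   using s_nt
  proof eventually_elim
   case (elim t)
   show ?case unfolding F_def
    by (rule ntlim_compose_eventually[OF elim]) (auto simp: s2)
  qed
  have sm: "(\<lambda>t. s (of_real (r k) * cis t)) \<in> borel_measurable circle" for k
   by (intro borel_measurable_circle_continuous continuous_on_radial s *)
  have L1: "(\<lambda>k. \<integral>\<^sup>+t. ennreal (cmod (deriv \<psi> (r k * cis t) - F t)) \<partial>circle) \<longlonglongrightarrow> 0"
   using L2_imp_L1_tendsto(2)[where S = "\<lambda>k t. s (of_real (r k) * cis t)", OF sm *(1,2,6)] unfolding F_def s2[OF in_ball] .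
  \<comment> \<open>The negative part of \<open>log \<bar>\<psi>'\<bar>\<close> in the limit; its integral is finite by Fatou's lemma and the mean value property of \<open>Re h\<close>.\<close>
  define N where "N t = liminf (\<lambda>k. ennreal (- Re (h (of_real (r k) * cis t))))" for t
  have hm[measurable]: "(\<lambda>t. h (of_real (r k) * cis t)) \<in> borel_measurable circle" for k
   by (intro borel_measurable_circle_continuous continuous_on_radial h *)
  \<comment> \<open>The radii are bounded away from \<open>0\<close>.\<close>
  obtain \<rho> where \<rho>: "0 < \<rho>" "\<And>k. \<rho> \<le> r k"
  proof -
   have "\<forall>\<^sub>F k in sequentially. 1/2 < r k" using *(5) by (rule order_tendstoD) simp
   then obtain K where K: "\<And>k. K \<le> k \<Longrightarrow> 1/2 < r k" by (auto simp: eventually_sequentially)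
   define \<rho> where "\<rho> = Min (insert (1/2) (r ` {..K}))"
   have "0 < \<rho>" unfolding \<rho>_def using *(3) by (subst Min_gr_iff) auto
   moreover have "\<rho> \<le> r k" for k
   proof (cases "k \<le> K")
    case True then show ?thesis unfolding \<rho>_def by (intro Min_le) auto
   next
    case False
    have "\<rho> \<le> 1/2" unfolding \<rho>_def by (intro Min_le) auto
    then show ?thesis using K[of k] False by simp
   qed
   ultimately show ?thesis using that by blast
  qed
  have "(\<integral>\<^sup>+t. ennreal (- Re (h (of_real (r k) * cis t))) \<partial>circle) \<le> ennreal (total_length / \<rho> + \<bar>2 * pi * Re (h 0)\<bar>)" for k
  proof -
   define H where "H t = h (of_real (r k) * cis t)" for t
   have Hc: "continuous_on A H" for A unfolding H_def by (intro continuous_on_radial h *)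
   have mean: "(\<integral>t. Re (H t) \<partial>circle) = 2 * pi * Re (h 0)"
   proof -
    have bd: "r k * cmod z < 1" if "cmod z \<le> 1" for z :: complex
     using *(3,4)[of k] that by (smt (verit) mult_left_le)
    have "continuous_on (cball 0 1) (\<lambda>z::complex. h (of_real (r k) * z))"
     using bd *(3)[of k] by (intro continuous_intros continuous_on_compose2[OF holomorphic_on_imp_continuous_on[OF h(1)]])
      (auto simp: norm_mult)
    moreover have "(\<lambda>z. h (of_real (r k) * z)) holomorphic_on ball 0 1"
     by (rule holomorphic_on_compose_gen[OF _ h(1), of "\<lambda>z. of_real (r k) * z", unfolded comp_def])
      (use bd *(3)[of k] in \<open>auto intro!: holomorphic_intros simp: norm_mult\<close>)
    ultimately have "(\<integral>t. h (of_real (r k) * cis t) * (cis t / (cis t - 0)) \<partial>circle) = 2 * pi * h (of_real (r k) * 0)"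
     by (rule circle_Cauchy_formula) simp
    then have "(\<integral>t. H t \<partial>circle) = 2 * pi * h 0" by (simp add: H_def)
    moreover have "(\<integral>t. Re (H t) \<partial>circle) = Re (\<integral>t. H t \<partial>circle)"
     by (intro integral_Re integrable_circle_continuous Hc)
    ultimately show ?thesis by simp
   qed
   have "(\<integral>\<^sup>+t. ennreal (- Re (H t)) \<partial>circle) \<le> (\<integral>\<^sup>+t. ennreal (cmod (deriv \<psi> (of_real (r k) * cis t)) - Re (H t)) \<partial>circle)"
    by (intro nn_integral_mono ennreal_leI) auto
   also have "\<dots> = ennreal (\<integral>t. cmod (deriv \<psi> (of_real (r k) * cis t)) - Re (H t) \<partial>circle)"
   proof (rule nn_integral_eq_integral)
    show "integrable circle (\<lambda>t. cmod (deriv \<psi> (of_real (r k) * cis t)) - Re (H t))"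
     by (intro integrable_circle_continuous continuous_intros continuous_on_radial deriv_holomorphic Hc *)
    have "Re (H t) \<le> cmod (deriv \<psi> (of_real (r k) * cis t))" for t
     using exp_ge_add_one_self[of "Re (H t)"] unfolding h(2)[OF in_ball] H_def[symmetric] norm_exp_eq_Re by linarith
    then show "AE t in circle. 0 \<le> cmod (deriv \<psi> (of_real (r k) * cis t)) - Re (H t)" by simp
   qed
   also have "(\<integral>t. cmod (deriv \<psi> (of_real (r k) * cis t)) - Re (H t) \<partial>circle) =
    (\<integral>t. cmod (deriv \<psi> (of_real (r k) * cis t)) \<partial>circle) - 2 * pi * Re (h 0)"
    unfolding mean[symmetric]
    by (intro Bochner_Integration.integral_diff integrable_circle_continuous continuous_intros continuous_on_radial deriv_holomorphic Hc *)
   also have "\<dots> \<le> total_length / \<rho> + \<bar>2 * pi * Re (h 0)\<bar>"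
   proof -
    have "\<rho> * (\<integral>t. cmod (deriv \<psi> (of_real (r k) * cis t)) \<partial>circle) \<le> r k * (\<integral>t. cmod (deriv \<psi> (of_real (r k) * cis t)) \<partial>circle)"
     by (intro mult_right_mono \<rho> integral_nonneg_AE) auto
    also have "\<dots> \<le> total_length" by (intro circle_L1_bound *)
    finally have "(\<integral>t. cmod (deriv \<psi> (of_real (r k) * cis t)) \<partial>circle) \<le> total_length / \<rho>"
     using \<rho>(1) by (simp add: field_simps)
    then show ?thesis by linarith
   qed
   finally show ?thesis by (simp add: H_def ennreal_leI)
  qed
  then have "liminf (\<lambda>k. \<integral>\<^sup>+t. ennreal (- Re (h (of_real (r k) * cis t))) \<partial>circle) \<le>
    liminf (\<lambda>k. ennreal (total_length / \<rho> + \<bar>2 * pi * Re (h 0)\<bar>))"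
   by (intro Liminf_mono always_eventually allI)
  also have "\<dots> < \<infinity>" by (simp add: Liminf_const)
  finally have "(\<integral>\<^sup>+t. N t \<partial>circle) < \<infinity>"
   unfolding N_def by (rule le_less_trans[OF nn_integral_liminf, rotated]) measurable
  moreover have Nm[measurable]: "N \<in> borel_measurable circle" unfolding N_def by measurable
  ultimately have Nfin: "AE t in circle. N t \<noteq> \<infinity>" by (intro nn_integral_PInf_AE) auto
  have lims: "AE t in circle. F t \<noteq> 0 \<and> N t = ennreal (- ln (cmod (F t)))"
   using nt Nfin
  proof eventually_elim
   case (elim t)
   have lim: "(\<lambda>k. cmod (deriv \<psi> (of_real (r k) * cis t))) \<longlonglongrightarrow> cmod (F t)"
    by (intro tendsto_norm ntlim_radial[OF elim(1)] *) simp
   have Re_h: "Re (h (of_real (r k) * cis t)) = ln (cmod (deriv \<psi> (of_real (r k) * cis t)))" for k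
    using h(2)[OF in_ball, of k t] by simp
   have Fnz: "F t \<noteq> 0"
   proof
    assume "F t = 0"
    then have "(\<lambda>k. cmod (deriv \<psi> (of_real (r k) * cis t))) \<longlonglongrightarrow> 0" using lim by simp
    then have "filterlim (\<lambda>k. cmod (deriv \<psi> (of_real (r k) * cis t))) (at_right 0) sequentially"
     using deriv_nonzero[OF in_ball] by (simp add: filterlim_at)
    then have "filterlim (\<lambda>k. ln (cmod (deriv \<psi> (of_real (r k) * cis t)))) at_bot sequentially"
     by (rule filterlim_compose[OF ln_at_0])
    then have "filterlim (\<lambda>k. - Re (h (of_real (r k) * cis t))) at_top sequentially"
     unfolding Re_h by (simp add: filterlim_uminus_at_top)
    then have "(\<lambda>k. ennreal (- Re (h (of_real (r k) * cis t)))) \<longlonglongrightarrow> \<infinity>"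
     by (simp add: ennreal_tendsto_top_eq_at_top)
    then have "N t = \<infinity>" unfolding N_def by (intro lim_imp_Liminf) auto
    then show False using elim(2) by simp
   qed
   have "(\<lambda>k. ennreal (- Re (h (of_real (r k) * cis t)))) \<longlonglongrightarrow> ennreal (- ln (cmod (F t)))"
    unfolding Re_h using Fnz by (intro tendsto_ennrealI tendsto_minus tendsto_ln lim) auto
   then have "N t = ennreal (- ln (cmod (F t)))" unfolding N_def by (intro lim_imp_Liminf) auto
   then show ?case using Fnz by simp
  qed
  have Fm[measurable]: "F \<in> borel_measurable circle" using F_int by auto
  have ln_int: "integrable circle (\<lambda>t. ln (cmod (F t)))"
  proof (rule integrableI_bounded)
   have "(\<integral>\<^sup>+t. ennreal (norm (ln (cmod (F t)))) \<partial>circle) \<le> (\<integral>\<^sup>+t. ennreal (norm (F t)) + N t \<partial>circle)"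
   proof (rule nn_integral_mono_AE)
    from lims show "AE t in circle. ennreal (norm (ln (cmod (F t)))) \<le> ennreal (norm (F t)) + N t"
    proof eventually_elim
     case (elim t)
     have "ln (cmod (F t)) \<le> cmod (F t)" using elim ln_bound[of "cmod (F t)"] by simp
     then have "ennreal (norm (ln (cmod (F t)))) \<le> ennreal (norm (F t)) + ennreal (- ln (cmod (F t)))"
     proof (cases "0 \<le> ln (cmod (F t))")
      case True
      then show ?thesis using \<open>ln (cmod (F t)) \<le> cmod (F t)\<close> by (simp add: ennreal_leI ennreal_neg add_increasing2)
     next
      case False
      then show ?thesis by (simp add: add_increasing)
     qed
     then show ?case using elim by simp
    qed
   qed
   also have "\<dots> = (\<integral>\<^sup>+t. ennreal (norm (F t)) \<partial>circle) + (\<integral>\<^sup>+t. N t \<partial>circle)"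
    by (intro nn_integral_add) measurable
   also have "\<dots> < \<infinity>" using F_int \<open>(\<integral>\<^sup>+t. N t \<partial>circle) < \<infinity>\<close> by (simp add: integrable_iff_bounded)
   finally show "(\<integral>\<^sup>+t. ennreal (norm (ln (cmod (F t)))) \<partial>circle) < \<infinity>" .
  qed measurable
  show ?thesis
   by (rule that[OF F_int nt _ ln_int *(3-5) L1]) (use lims in auto)
 qed
qed

end

section \<open>Arc length measure in terms of the boundary derivative\<close>

text \<open>The boundary function \<open>F\<close> of \<open>\<psi>'\<close> and a sequence of radii along which it is attained in the mean are fixed as parameters; they exist by
 \<open>boundary_derivative\<close>.\<close>

locale boundary_disk = rectifiable_jordan_disk +
 fixes F :: "real \<Rightarrow> complex" and r :: "nat \<Rightarrow> real"
 assumes F_int: "integrable circle F"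
  and F_nt: "AE t in circle. ntlim (deriv \<psi>) (cis t) (F t)"
  and F_nonzero: "AE t in circle. F t \<noteq> 0"
  and ln_F_int: "integrable circle (\<lambda>t. ln (cmod (F t)))"
  and r_pos: "\<And>k. 0 < r k" and r_less: "\<And>k. r k < 1" and r_lim: "r \<longlonglongrightarrow> 1"
  and F_lim: "(\<lambda>k. \<integral>\<^sup>+t. ennreal (cmod (deriv \<psi> (r k * cis t) - F t)) \<partial>circle) \<longlonglongrightarrow> 0"
begin

lemma F_measurable [measurable]: "F \<in> borel_measurable circle"
 using F_int by auto

lemma indicator_Ioc_measurable [measurable]: "indicator {x<..y::real} \<in> borel_measurable circle"
 by (rule borel_measurable_circle) simp

lemma integrable_indicator_circle:
 fixes f :: "real \<Rightarrow> 'a::{banach, second_countable_topology}"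
 assumes "integrable circle f"
 shows "integrable circle (\<lambda>t. indicator {x<..y} t *\<^sub>R f t)"
proof (rule Bochner_Integration.integrable_bound[OF assms])
 have [measurable]: "f \<in> borel_measurable circle" using assms by auto
 show "(\<lambda>t. indicator {x<..y} t *\<^sub>R f t) \<in> borel_measurable circle" by measurable
qed (auto split: split_indicator)

lemma integrable_F_cis: "integrable circle (\<lambda>t. \<i> * cis t * F t)"
proof (rule Bochner_Integration.integrable_bound[OF F_int])
 have [measurable]: "cis \<in> borel_measurable circle"
  by (intro borel_measurable_circle_continuous continuous_intros)
 show "(\<lambda>t. \<i> * cis t * F t) \<in> borel_measurable circle" by measurable
qed (auto simp: norm_mult)

text \<open>The fundamental theorem of calculus on the circles of radius \<open>r k\<close> survives the limit, because the derivative converges in \<open>L\<^sup>1\<close>.\<close>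

lemma boundary_increment:
 assumes xy: "0 \<le> x" "x \<le> y" "y \<le> 2 * pi"
 shows "\<psi> (cis y) - \<psi> (cis x) = (\<integral>t. indicator {x<..y} t *\<^sub>R (\<i> * cis t * F t) \<partial>circle)"
proof -
 define u where "u k t = of_real (r k) * (\<i> * cis t) * deriv \<psi> (of_real (r k) * cis t)" for k t
 have uc: "continuous_on A (u k)" for A k
  unfolding u_def by (intro continuous_intros continuous_on_radial deriv_holomorphic r_pos r_less)
 define err where "err k t = norm (indicator {x<..y} t *\<^sub>R u k t - indicator {x<..y} t *\<^sub>R (\<i> * cis t * F t))" for k t
 have FTC: "(\<integral>t. indicator {x<..y} t *\<^sub>R u k t \<partial>circle) = \<psi> (r k * cis y) - \<psi> (r k * cis x)" for k
 proof -
  have [measurable]: "u k \<in> borel_measurable borel" using uc by (intro borel_measurable_continuous_onI)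
  have "(\<integral>t. indicator {x<..y} t *\<^sub>R u k t \<partial>circle) = (\<integral>t. indicator {0..2*pi} t *\<^sub>R (indicator {x<..y} t *\<^sub>R u k t) \<partial>lborel)"
   unfolding circle_def by (rule integral_restrict_space) simp
  also have "\<dots> = (\<integral>t. indicator {x..y} t *\<^sub>R u k t \<partial>lborel)"
  proof (rule integral_cong_AE)
   have "AE t in lborel. t \<noteq> x" by (rule AE_lborel_singleton)
   then show "AE t in lborel. indicator {0..2*pi} t *\<^sub>R (indicator {x<..y} t *\<^sub>R u k t) = indicator {x..y} t *\<^sub>R u k t"
    by eventually_elim (use xy in \<open>auto split: split_indicator\<close>)
  qed measurable
  also have "\<dots> = \<psi> (of_real (r k) * cis y) - \<psi> (of_real (r k) * cis x)"
  proof (rule integral_FTC_Icc[where F = "\<lambda>t. \<psi> (of_real (r k) * cis t)"])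
   show "((\<lambda>t. \<psi> (of_real (r k) * cis t)) has_vector_derivative u k t) (at t within {x..y})" for t
    unfolding u_def
    by (rule has_vector_derivative_at_within[OF has_vector_derivative_circle[OF hol less_imp_le[OF r_pos] r_less]])
  qed (use xy uc in auto)
  finally show ?thesis .
 qed
 have "(\<lambda>k. \<integral>t. indicator {x<..y} t *\<^sub>R u k t \<partial>circle) \<longlonglongrightarrow> (\<integral>t. indicator {x<..y} t *\<^sub>R (\<i> * cis t * F t) \<partial>circle)"
 proof (rule tendsto_L1_int)
  show "integrable circle (\<lambda>t. indicator {x<..y} t *\<^sub>R u k t)" for k
   by (intro integrable_indicator_circle integrable_circle_continuous uc)
  show "integrable circle (\<lambda>t. indicator {x<..y} t *\<^sub>R (\<i> * cis t * F t))"
   by (intro integrable_indicator_circle integrable_F_cis)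
  define N where "N = (\<integral>\<^sup>+t. ennreal (cmod (F t)) \<partial>circle)"
  have N: "N < top" using F_int by (simp add: N_def integrable_iff_bounded)
  have dm: "(\<lambda>t. deriv \<psi> (of_real (r k) * cis t)) \<in> borel_measurable circle" for k
   by (intro borel_measurable_circle_continuous continuous_on_radial deriv_holomorphic r_pos r_less)
  have le: "(\<integral>\<^sup>+t. ennreal (err k t) \<partial>circle) \<le>
    (\<integral>\<^sup>+t. ennreal (cmod (deriv \<psi> (r k * cis t) - F t)) \<partial>circle) + ennreal (1 - r k) * N" for k
  proof -
   note [measurable] = dm[of k]
   have "(\<integral>\<^sup>+t. ennreal (err k t) \<partial>circle) \<le>
     (\<integral>\<^sup>+t. ennreal (cmod (deriv \<psi> (r k * cis t) - F t)) + ennreal (1 - r k) * ennreal (cmod (F t)) \<partial>circle)"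
   proof (rule nn_integral_mono)
    fix t
    define D where "D = deriv \<psi> (of_real (r k) * cis t)"
    have "u k t - \<i> * cis t * F t = \<i> * cis t * (of_real (r k) * (D - F t) - of_real (1 - r k) * F t)"
     by (simp add: u_def D_def algebra_simps)
    then have "cmod (u k t - \<i> * cis t * F t) = cmod (of_real (r k) * (D - F t) - of_real (1 - r k) * F t)"
     by (simp only: norm_mult norm_cis norm_ii mult_1)
    also have "\<dots> \<le> cmod (of_real (r k) * (D - F t)) + cmod (of_real (1 - r k) * F t)"
     by (rule norm_triangle_ineq4)
    also have "\<dots> = r k * cmod (D - F t) + (1 - r k) * cmod (F t)"
     unfolding norm_mult norm_of_real using r_pos[of k] r_less[of k] by simp
    also have "\<dots> \<le> 1 * cmod (D - F t) + (1 - r k) * cmod (F t)"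
     using r_less[of k] by (intro add_right_mono mult_right_mono) auto
    finally have le: "cmod (u k t - \<i> * cis t * F t) \<le> cmod (D - F t) + (1 - r k) * cmod (F t)" by simp
    have "err k t \<le> cmod (u k t - \<i> * cis t * F t)"
     by (auto simp: err_def split: split_indicator)
    with le have "ennreal (err k t) \<le> ennreal (cmod (D - F t) + (1 - r k) * cmod (F t))"
     by (intro ennreal_leI) simp
    also have "\<dots> = ennreal (cmod (D - F t)) + ennreal (1 - r k) * ennreal (cmod (F t))"
     using r_less[of k] by (simp add: ennreal_mult ennreal_plus)
    finally show "ennreal (err k t) \<le>
     ennreal (cmod (deriv \<psi> (r k * cis t) - F t)) + ennreal (1 - r k) * ennreal (cmod (F t))"
     by (simp add: D_def)
   qed
   also have "\<dots> = (\<integral>\<^sup>+t. ennreal (cmod (deriv \<psi> (r k * cis t) - F t)) \<partial>circle) + ennreal (1 - r k) * N"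
    unfolding N_def by (subst nn_integral_add, measurable, subst nn_integral_cmult, measurable)
   finally show ?thesis .
  qed
  have "(\<lambda>k. ennreal (1 - r k)) \<longlonglongrightarrow> ennreal (1 - 1)" by (intro tendsto_ennrealI tendsto_intros r_lim)
  then have "(\<lambda>k. ennreal (1 - r k) * N) \<longlonglongrightarrow> 0"
   using ennreal_tendsto_cmult[OF N, of "\<lambda>k. ennreal (1 - r k)" 0 sequentially] by (simp add: mult.commute)
  from tendsto_add[OF F_lim this]
  have "(\<lambda>k. (\<integral>\<^sup>+t. ennreal (cmod (deriv \<psi> (r k * cis t) - F t)) \<partial>circle) + ennreal (1 - r k) * N) \<longlonglongrightarrow> 0" by simp
  then show "(\<lambda>k. \<integral>\<^sup>+t. ennreal (norm (indicator {x<..y} t *\<^sub>R u k t - indicator {x<..y} t *\<^sub>R (\<i> * cis t * F t))) \<partial>circle) \<longlonglongrightarrow> 0"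
   unfolding err_def[symmetric] by (rule tendsto_0_ennreal_le[OF _ le])
 qed
 moreover have "(\<lambda>k. \<psi> (r k * cis y) - \<psi> (r k * cis x)) \<longlonglongrightarrow> \<psi> (cis y) - \<psi> (cis x)"
 proof -
  have "(\<lambda>k. \<psi> (of_real (r k) * cis t)) \<longlonglongrightarrow> \<psi> (of_real 1 * cis t)" for t
  proof (rule continuous_on_tendsto_compose[OF cont])
   show "(\<lambda>k. of_real (r k) * cis t) \<longlonglongrightarrow> of_real 1 * cis t" by (intro tendsto_intros r_lim)
   show "\<forall>\<^sub>F k in sequentially. of_real (r k) * cis t \<in> cball 0 1"
    using r_pos r_less by (auto simp: norm_mult abs_of_pos less_imp_le)
  qed simp
  then show ?thesis by (intro tendsto_diff) simp_all
 qed
 ultimately show ?thesis unfolding FTC by (rule LIMSEQ_unique[rotated])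
qed

text \<open>The boundary curve is an indefinite integral, so it is differentiable at Lebesgue points of the integrand.\<close>

theorem AE_regular: "AE t in circle. regular t (F t)"
proof -
 define K where "K t = \<i> * cis t * F t" for t
 have K: "integrable circle K" unfolding K_def by (rule integrable_F_cis)
 from AE_circle_lebesgue_point[OF K] F_nt F_nonzero show ?thesis
 proof eventually_elim
  case (elim x)
  define K0 where "K0 t = indicator {0..2*pi} t *\<^sub>R K t" for t
  have K0_int: "integrable lborel K0"
   using K by (simp add: circle_def integrable_restrict_space K0_def[abs_def])
  then have [measurable]: "K0 \<in> borel_measurable borel" by auto
  have x: "0 < x" "x < 2 * pi" and lp: "lebesgue_point K0 x"
   using elim(1) by (auto simp: circle_lebesgue_point_def K0_def[abs_def])
  have Kx: "K0 x = F x * (\<i> * cis x)" using x by (simp add: K0_def K_def)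
  have inc: "cmod ((\<psi> (cis v) - \<psi> (cis u)) - (v - u) *\<^sub>R K0 x) \<le> e * (v - u)"
   if uv: "0 \<le> u" "u < v" "v \<le> 2 * pi" and xuv: "x = u \<or> x = v" and e: "0 < e"
    and bd: "(\<integral>\<^sup>+t\<in>ball x (2 * (v - u)). ennreal (norm (K0 t - K0 x)) \<partial>lborel) \<le> ennreal (e * (v - u))" for u v e
  proof -
   have i0: "integrable lborel (\<lambda>t. indicator {u<..v} t *\<^sub>R K0 t)"
    using K0_int by (intro integrable_mult_indicator) auto
   have i1: "integrable lborel (\<lambda>t. indicator {u<..v} t *\<^sub>R K0 x)"
    by (intro integrable_scaleR_left integrable_real_indicator) (use uv in auto)
   have "\<psi> (cis v) - \<psi> (cis u) = (\<integral>t. indicator {u<..v} t *\<^sub>R K t \<partial>circle)"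
    unfolding K_def by (rule boundary_increment) (use uv in auto)
   also have "\<dots> = (\<integral>t. indicator {0..2*pi} t *\<^sub>R (indicator {u<..v} t *\<^sub>R K t) \<partial>lborel)"
    unfolding circle_def by (rule integral_restrict_space) simp
   also have "\<dots> = (\<integral>t. indicator {u<..v} t *\<^sub>R K0 t \<partial>lborel)"
    by (intro Bochner_Integration.integral_cong refl) (simp add: K0_def)
   finally have a: "\<psi> (cis v) - \<psi> (cis u) = (\<integral>t. indicator {u<..v} t *\<^sub>R K0 t \<partial>lborel)" .
   have b: "(v - u) *\<^sub>R K0 x = (\<integral>t. indicator {u<..v} t *\<^sub>R K0 x \<partial>lborel)"
    using uv by simp
   have c: "(\<psi> (cis v) - \<psi> (cis u)) - (v - u) *\<^sub>R K0 x = (\<integral>t. indicator {u<..v} t *\<^sub>R K0 t - indicator {u<..v} t *\<^sub>R K0 x \<partial>lborel)"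
    unfolding a b by (rule Bochner_Integration.integral_diff[OF i0 i1, symmetric])
   have "ennreal (cmod ((\<psi> (cis v) - \<psi> (cis u)) - (v - u) *\<^sub>R K0 x)) \<le> (\<integral>\<^sup>+t. ennreal (norm (indicator {u<..v} t *\<^sub>R K0 t - indicator {u<..v} t *\<^sub>R K0 x)) \<partial>lborel)"
    unfolding c by (rule integral_norm_bound_ennreal[OF Bochner_Integration.integrable_diff[OF i0 i1]])
   also have "\<dots> \<le> (\<integral>\<^sup>+t\<in>ball x (2 * (v - u)). ennreal (norm (K0 t - K0 x)) \<partial>lborel)"
   proof (rule nn_integral_mono)
    fix t
    have "t \<in> {u<..v} \<Longrightarrow> t \<in> ball x (2 * (v - u))" using xuv by (auto simp: dist_real_def)
    then show "ennreal (norm (indicator {u<..v} t *\<^sub>R K0 t - indicator {u<..v} t *\<^sub>R K0 x)) \<le> ennreal (norm (K0 t - K0 x)) * indicator (ball x (2 * (v - u))) t"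
     by (auto split: split_indicator)
   qed
   also have "\<dots> \<le> ennreal (e * (v - u))" by (rule bd)
   finally show ?thesis using e uv by simp
  qed
  have "((\<lambda>\<theta>. \<psi> (cis \<theta>)) has_derivative (\<lambda>h. h *\<^sub>R K0 x)) (at x)"
   unfolding has_derivative_at_alt
  proof (intro conjI allI impI)
   show "bounded_linear (\<lambda>h. h *\<^sub>R K0 x)" by (rule bounded_linear_scaleR_left)
   fix e :: real assume e: "0 < e"
   then obtain \<delta> where \<delta>: "0 < \<delta>" "\<And>h. 0 < h \<Longrightarrow> h < \<delta> \<Longrightarrow> (\<integral>\<^sup>+t\<in>ball x h. ennreal (norm (K0 t - K0 x)) \<partial>lborel) \<le> ennreal (e / 2 * h)"
    using lp unfolding lebesgue_point_def by (meson half_gt_zero)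
   show "\<exists>d>0. \<forall>y. norm (y - x) < d \<longrightarrow> norm (\<psi> (cis y) - \<psi> (cis x) - (y - x) *\<^sub>R K0 x) \<le> e * norm (y - x)"
   proof (intro exI[of _ "min (\<delta> / 2) (min x (2 * pi - x))"] conjI allI impI)
    show "0 < min (\<delta> / 2) (min x (2 * pi - x))" using \<delta> x by simp
    fix y assume y: "norm (y - x) < min (\<delta> / 2) (min x (2 * pi - x))"
    then have y': "0 \<le> y" "y \<le> 2 * pi" "2 * \<bar>y - x\<bar> < \<delta>" by (auto simp: abs_if split: if_splits)
    consider "y = x" | "x < y" | "y < x" by linarith
    then show "norm (\<psi> (cis y) - \<psi> (cis x) - (y - x) *\<^sub>R K0 x) \<le> e * norm (y - x)"
    proof cases
     case 2
     then have "0 < 2 * (y - x)" "2 * (y - x) < \<delta>" using y' by (auto simp: abs_if split: if_splits)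
     then have "(\<integral>\<^sup>+t\<in>ball x (2 * (y - x)). ennreal (norm (K0 t - K0 x)) \<partial>lborel) \<le> ennreal (e / 2 * (2 * (y - x)))"
      by (rule \<delta>(2))
     moreover have "e / 2 * (2 * (y - x)) = e * (y - x)" by simp
     ultimately have "(\<integral>\<^sup>+t\<in>ball x (2 * (y - x)). ennreal (norm (K0 t - K0 x)) \<partial>lborel) \<le> ennreal (e * (y - x))"
      by (simp only:)
     then show ?thesis using inc[of x y e] 2 x y' e by simp
    next
     case 3
     then have "0 < 2 * (x - y)" "2 * (x - y) < \<delta>" using y' by (auto simp: abs_if split: if_splits)
     then have "(\<integral>\<^sup>+t\<in>ball x (2 * (x - y)). ennreal (norm (K0 t - K0 x)) \<partial>lborel) \<le> ennreal (e / 2 * (2 * (x - y)))"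
      by (rule \<delta>(2))
     moreover have "e / 2 * (2 * (x - y)) = e * (x - y)" by simp
     ultimately have "(\<integral>\<^sup>+t\<in>ball x (2 * (x - y)). ennreal (norm (K0 t - K0 x)) \<partial>lborel) \<le> ennreal (e * (x - y))"
      by (simp only:)
     then have "cmod ((\<psi> (cis x) - \<psi> (cis y)) - (x - y) *\<^sub>R K0 x) \<le> e * (x - y)"
      using inc[of y x e] 3 x y' e by simp
     moreover have "(\<psi> (cis x) - \<psi> (cis y)) - (x - y) *\<^sub>R K0 x = - (\<psi> (cis y) - \<psi> (cis x) - (y - x) *\<^sub>R K0 x)"
      by (simp add: algebra_simps)
     ultimately show ?thesis using 3 by (simp only: norm_minus_cancel) simp
    qed simp
   qed
  qed
  then show ?case using elim by (simp add: regular_def has_vector_derivative_def Kx)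
 qed
qed

definition V :: "real \<Rightarrow> real \<Rightarrow> real" where
 "V x y = (\<integral>t. indicator {x<..y} t *\<^sub>R cmod (F t) \<partial>circle)"

lemma V_nonneg: "0 \<le> V x y"
 unfolding V_def by (intro integral_nonneg_AE) auto

lemma V_split: "x \<le> y \<Longrightarrow> y \<le> z \<Longrightarrow> V x z = V x y + V y z"
proof -
 assume "x \<le> y" "y \<le> z"
 then have "indicator {x<..z} t *\<^sub>R cmod (F t) = indicator {x<..y} t *\<^sub>R cmod (F t) + indicator {y<..z} t *\<^sub>R cmod (F t)" for t
  by (auto split: split_indicator)
 then show ?thesis unfolding V_def
  using integrable_indicator_circle[OF integrable_norm[OF F_int]] by simp
qed

lemma V_full: "V 0 (2 * pi) = (\<integral>t. cmod (F t) \<partial>circle)"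
 unfolding V_def
proof (rule integral_cong_AE)
 show "AE t in circle. indicator {0<..2*pi} t *\<^sub>R cmod (F t) = cmod (F t)"
  using AE_circle_interior by eventually_elim auto
qed measurable

lemma dist_le_V: "0 \<le> x \<Longrightarrow> x \<le> y \<Longrightarrow> y \<le> 2 * pi \<Longrightarrow> dist (\<psi> (cis x)) (\<psi> (cis y)) \<le> V x y"
proof -
 assume xy: "0 \<le> x" "x \<le> y" "y \<le> 2 * pi"
 have "dist (\<psi> (cis x)) (\<psi> (cis y)) = cmod (\<integral>t. indicator {x<..y} t *\<^sub>R (\<i> * cis t * F t) \<partial>circle)"
  unfolding boundary_increment[OF xy, symmetric] by (simp add: dist_norm norm_minus_commute)
 also have "\<dots> \<le> (\<integral>t. norm (indicator {x<..y} t *\<^sub>R (\<i> * cis t * F t)) \<partial>circle)"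
  by (rule integral_norm_bound)
 also have "\<dots> = V x y" unfolding V_def by (simp add: norm_mult)
 finally show ?thesis .
qed

lemma curve_length_le_V:
 assumes "0 \<le> x" "x \<le> y" "y \<le> 2 * pi"
 shows "curve_length (\<lambda>t. \<psi> (cis t)) x y \<le> ennreal (V x y)"
proof (rule curve_length_le)
 have *: "polygon_length (\<lambda>t. \<psi> (cis t)) (z # xs) \<le> V z y"
  if "sorted (z # xs)" "set (z # xs) \<subseteq> {x..y}" for z xs
  using that
 proof (induction xs arbitrary: z)
  case (Cons w ws)
  then have "dist (\<psi> (cis z)) (\<psi> (cis w)) \<le> V z w" using assms by (intro dist_le_V) auto
  moreover have "polygon_length (\<lambda>t. \<psi> (cis t)) (w # ws) \<le> V w y" using Cons by auto
  moreover have "V z y = V z w + V w y" using Cons by (intro V_split) auto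
  ultimately show ?case by simp
 qed (simp add: V_nonneg)
 fix xs :: "real list" assume xs: "sorted xs" "set xs \<subseteq> {x..y}"
 show "ennreal (polygon_length (\<lambda>t. \<psi> (cis t)) xs) \<le> ennreal (V x y)"
 proof (cases xs)
  case (Cons z zs)
  then have "polygon_length (\<lambda>t. \<psi> (cis t)) xs \<le> V z y" using *[of z zs] xs by simp
  also have "\<dots> \<le> V x y" using V_split[of x z y] V_nonneg[of x z] xs Cons by auto
  finally show ?thesis by (rule ennreal_leI)
 qed (simp add: V_nonneg)
qed

lemma V_full_le: "V 0 (2 * pi) \<le> total_length"
proof -
 have i: "integrable circle (\<lambda>t. deriv \<psi> (of_real (r k) * cis t))" for k
  by (intro integrable_circle_continuous continuous_on_radial deriv_holomorphic r_pos r_less)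
 have "(\<lambda>k. \<integral>t. cmod (deriv \<psi> (of_real (r k) * cis t)) \<partial>circle) \<longlonglongrightarrow> (\<integral>t. cmod (F t) \<partial>circle)"
  by (rule nn_integral_diff_tendsto[OF i F_int F_lim])
 from tendsto_mult[OF r_lim this]
 have "(\<lambda>k. r k * (\<integral>t. cmod (deriv \<psi> (of_real (r k) * cis t)) \<partial>circle)) \<longlonglongrightarrow> (\<integral>t. cmod (F t) \<partial>circle)" by simp
 then show ?thesis unfolding V_full
  by (rule LIMSEQ_le_const2) (use circle_L1_bound[OF r_pos r_less] in blast)
qed

text \<open>Every arc is at most as long as the integral of \<open>\<bar>F\<bar>\<close> over it. The total length is at least the full integral, being at least the length
 of the image of each concentric circle. Hence equality holds for all arcs.\<close>

theorem curve_length_eq_V: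
 assumes xy: "0 \<le> x" "x \<le> y" "y \<le> 2 * pi"
 shows "curve_length (\<lambda>t. \<psi> (cis t)) x y = ennreal (V x y)"
proof (rule antisym)
 define C where "C = curve_length (\<lambda>t. \<psi> (cis t)) x y"
 show le: "curve_length (\<lambda>t. \<psi> (cis t)) x y \<le> ennreal (V x y)" by (rule curve_length_le_V[OF xy])
 then obtain c where c: "C = ennreal c" "0 \<le> c" unfolding C_def
  by (cases "curve_length (\<lambda>t. \<psi> (cis t)) x y") (auto simp: top_unique)
 \<comment> \<open>Equality of the sums over the three arcs forces equality for the middle one.\<close>
 have "ennreal (V 0 x + V x y + V y (2 * pi)) = ennreal (V 0 (2 * pi))"
  using V_split[of 0 x "2 * pi"] V_split[of x y "2 * pi"] xy by (simp add: add.assoc)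
 also have "\<dots> \<le> curve_length (\<lambda>t. \<psi> (cis t)) 0 (2 * pi)"
  using V_full_le by (simp add: total_length ennreal_leI)
 also have "\<dots> \<le> curve_length (\<lambda>t. \<psi> (cis t)) 0 x + curve_length (\<lambda>t. \<psi> (cis t)) x (2 * pi)"
  using xy by (intro curve_length_subadditive) auto
 also have "\<dots> \<le> curve_length (\<lambda>t. \<psi> (cis t)) 0 x + (C + curve_length (\<lambda>t. \<psi> (cis t)) y (2 * pi))"
  unfolding C_def using xy by (intro add_left_mono curve_length_subadditive) auto
 also have "\<dots> \<le> ennreal (V 0 x) + (ennreal c + ennreal (V y (2 * pi)))"
  unfolding c(1) using xy by (intro add_mono curve_length_le_V order_refl) auto
 also have "\<dots> = ennreal (V 0 x + (c + V y (2 * pi)))"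
  using c V_nonneg by (simp add: ennreal_plus)
 finally have "V x y \<le> c" using c V_nonneg by (simp add: add_nonneg_nonneg)
 then show "ennreal (V x y) \<le> curve_length (\<lambda>t. \<psi> (cis t)) x y" using c by (simp add: C_def ennreal_leI)
qed

end

text \<open>The change of parameter is continuous because its graph is closed and its values lie in a compact interval; being injective, it is monotone.
 The base point is treated separately, since it corresponds to both endpoints.\<close>

lemma (in jordan_disk) boundary_reparametrization:
 assumes g: "simple_path g" "pathfinish g = pathstart g" "path_image g = frontier G" "pathstart g = \<psi> 1"
 obtains \<kappa> where "strict_mono_on {0..2*pi} \<kappa> \<or> strict_antimono_on {0..2*pi} \<kappa>"
  "\<kappa> ` {0..2*pi} = {0..1}" "\<And>x. x \<in> {0..2*pi} \<Longrightarrow> g (\<kappa> x) = \<psi> (cis x)"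
proof -
 have gc: "continuous_on {0..1} g" using g(1) by (simp add: simple_path_def path_def)
 have g01: "g 0 = \<psi> 1" "g 1 = \<psi> 1" using g by (auto simp: pathstart_def pathfinish_def)
 have g_inj: "s = s'" if "0 < s" "s < 1" "s' \<in> {0..1}" "g s = g s'" for s s'
 proof -
  have "\<forall>x\<in>{0..1}. \<forall>y\<in>{0..1}. g x = g y \<longrightarrow> x = y \<or> x = 0 \<and> y = 1 \<or> x = 1 \<and> y = 0"
   using g(1) by (simp add: simple_path_def loop_free_def)
  from bspec[OF bspec[OF this, of s], of s'] that show ?thesis by simp
 qed
 have a_ne: "\<psi> (cis x) \<noteq> \<psi> 1" if "0 < x" "x < 2 * pi" for x
 proof
  assume "\<psi> (cis x) = \<psi> 1"
  then have "cis x = cis 0" using inj by (auto simp: inj_on_def)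
  then show False using cis_eq_imp_eq[of x 0] that by simp
 qed
 have "\<exists>s. 0 < s \<and> s < 1 \<and> g s = \<psi> (cis x)" if x: "0 < x" "x < 2 * pi" for x
 proof -
  have "\<psi> (cis x) \<in> path_image g" using g(3) by (auto simp: frontier_eq)
  then obtain s where s: "0 \<le> s" "s \<le> 1" "g s = \<psi> (cis x)" by (auto simp: path_image_def)
  moreover have "s \<noteq> 0" "s \<noteq> 1" using s(3) g01 a_ne[OF x] by auto
  ultimately show ?thesis by (intro exI[of _ s]) auto
 qed
 then obtain \<kappa>0 where \<kappa>0: "\<And>x. 0 < x \<Longrightarrow> x < 2 * pi \<Longrightarrow> 0 < \<kappa>0 x \<and> \<kappa>0 x < 1 \<and> g (\<kappa>0 x) = \<psi> (cis x)"
  by metis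
 define S where "S = {0<..<2*pi}"
 have cont\<kappa>: "continuous_on S \<kappa>0"
 proof (subst continuous_closed_graph_eq[of "{0..1}"])
  show "\<kappa>0 \<in> S \<rightarrow> {0..1}" using \<kappa>0 by (force simp: S_def)
  have "(\<lambda>x. (x, \<kappa>0 x)) ` S = (S \<times> {0..1}) \<inter> (\<lambda>p. g (snd p) - \<psi> (cis (fst p))) -` {0}"
  proof (intro equalityI subsetI)
   fix p assume "p \<in> (\<lambda>x. (x, \<kappa>0 x)) ` S"
   then show "p \<in> (S \<times> {0..1}) \<inter> (\<lambda>p. g (snd p) - \<psi> (cis (fst p))) -` {0}" using \<kappa>0 by (force simp: S_def)
  next
   fix p assume p: "p \<in> (S \<times> {0..1}) \<inter> (\<lambda>p. g (snd p) - \<psi> (cis (fst p))) -` {0}"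
   then have "fst p \<in> S" "\<kappa>0 (fst p) = snd p"
    using \<kappa>0[of "fst p"] by (auto simp: S_def intro!: g_inj)
   then show "p \<in> (\<lambda>x. (x, \<kappa>0 x)) ` S" by (intro image_eqI[of _ _ "fst p"]) auto
  qed
  moreover have "continuous_on (S \<times> {0..1}) (\<lambda>p. g (snd p) - \<psi> (cis (fst p)))"
   by (intro continuous_intros continuous_on_compose2[OF gc] continuous_on_compose2[OF cont]) auto
  then have "closedin (top_of_set (S \<times> {0..1})) ((S \<times> {0..1}) \<inter> (\<lambda>p. g (snd p) - \<psi> (cis (fst p))) -` {0})"
   by (rule continuous_closedin_preimage) simp
  ultimately show "closedin (top_of_set (S \<times> {0..1})) ((\<lambda>x. (x, \<kappa>0 x)) ` S)" by simp
 qed simp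
 have inj\<kappa>: "inj_on \<kappa>0 S"
 proof (rule inj_onI)
  fix x y assume xy: "x \<in> S" "y \<in> S" "\<kappa>0 x = \<kappa>0 y"
  then have "\<psi> (cis x) = \<psi> (cis y)" using \<kappa>0[of x] \<kappa>0[of y] by (auto simp: S_def)
  then have "cis x = cis y" using inj by (auto simp: inj_on_def)
  then show "x = y" using cis_eq_imp_eq[of x y] xy by (auto simp: S_def abs_if)
 qed
 have surj\<kappa>: "\<exists>x\<in>S. \<kappa>0 x = s" if s: "0 < s" "s < 1" for s
 proof -
  have "g s \<in> frontier G" using g(3) s by (auto simp: path_image_def)
  then obtain u where u: "cmod u = 1" "g s = \<psi> u" by (auto simp: frontier_eq dist_norm)
  define x where "x = Arg2pi u"
  have ux: "u = cis x" using Arg2pi_eq[of u] u by (simp add: x_def cis_conv_exp)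
  have "x \<noteq> 0"
  proof
   assume "x = 0"
   then have "g s = g 0" using ux u g01 by simp
   then show False using g_inj[of s 0] s by simp
  qed
  then have x: "0 < x" "x < 2 * pi" using Arg2pi_ge_0[of u] Arg2pi_lt_2pi[of u] by (auto simp: x_def)
  then have "\<kappa>0 x = s" using \<kappa>0[OF x] s u(2) ux by (intro g_inj) auto
  then show ?thesis using x by (intro bexI[of _ x]) (auto simp: S_def)
 qed
 have "is_interval S" by (simp add: S_def is_interval_1)
 from injective_eq_monotone_map[OF this cont\<kappa>] inj\<kappa>
 have mono: "strict_mono_on S \<kappa>0 \<or> strict_antimono_on S \<kappa>0" by blast
 define \<kappa> where "\<kappa> c x = (if x \<le> 0 then c else if 2 * pi \<le> x then 1 - c else \<kappa>0 x)" for c x :: real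
 have g\<kappa>: "g (\<kappa> c x) = \<psi> (cis x)" if "c = 0 \<or> c = 1" "x \<in> {0..2*pi}" for c x
  using that \<kappa>0[of x] g01 by (auto simp: \<kappa>_def not_le)
 have im: "\<kappa> c ` {0..2*pi} = {0..1}" if c: "c = 0 \<or> c = 1" for c
 proof (intro equalityI subsetI)
  fix s assume "s \<in> \<kappa> c ` {0..2*pi}"
  then show "s \<in> {0..1}" using \<kappa>0 c by (auto simp: \<kappa>_def not_le less_imp_le)
 next
  fix s :: real assume s: "s \<in> {0..1}"
  consider "s = c" | "s = 1 - c" | "0 < s" "s < 1" using s c by fastforce
  then show "s \<in> \<kappa> c ` {0..2*pi}"
  proof cases
   case 1 then show ?thesis by (intro image_eqI[of _ _ 0]) (auto simp: \<kappa>_def)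
  next
   case 2
   moreover have "\<not> 2 * pi \<le> 0" using pi_gt_zero by linarith
   ultimately have "s = \<kappa> c (2 * pi)" by (simp only: \<kappa>_def if_False order_refl if_True)
   then show ?thesis by (intro image_eqI[of _ _ "2*pi"]) simp_all
  next
   case 3
   then obtain x where "x \<in> S" "\<kappa>0 x = s" using surj\<kappa> by blast
   then show ?thesis by (intro image_eqI[of _ _ x]) (auto simp: \<kappa>_def S_def)
  qed
 qed
 show ?thesis using mono
 proof
  assume "strict_mono_on S \<kappa>0"
  then have "\<kappa>0 x < \<kappa>0 y" if "0 < x" "x < y" "y < 2 * pi" for x y
   using that by (auto simp: monotone_on_def S_def)
  then have "strict_mono_on {0..2*pi} (\<kappa> 0)"
   unfolding monotone_on_def \<kappa>_def using \<kappa>0 by (auto simp: not_le)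
  then show ?thesis using that[of "\<kappa> 0"] g\<kappa> im by simp
 next
  assume "strict_antimono_on S \<kappa>0"
  then have "\<kappa>0 y < \<kappa>0 x" if "0 < x" "x < y" "y < 2 * pi" for x y
   using that by (auto simp: monotone_on_def S_def)
  then have "strict_antimono_on {0..2*pi} (\<kappa> 1)"
   unfolding monotone_on_def \<kappa>_def using \<kappa>0 by (auto simp: not_le)
  then show ?thesis using that[of "\<kappa> 1"] g\<kappa> im by simp
 qed
qed

lemma (in jordan_disk) finite_length_of_rectifiable:
 assumes g: "simple_path g" "pathfinish g = pathstart g" "path_image g = frontier G" "pathstart g = \<psi> 1"
  and rect: "rectifiable g"
 shows "curve_length (\<lambda>t. \<psi> (cis t)) 0 (2 * pi) < \<infinity>"
proof -
 obtain \<kappa> where \<kappa>: "strict_mono_on {0..2*pi} \<kappa> \<or> strict_antimono_on {0..2*pi} \<kappa>"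
  "\<kappa> ` {0..2*pi} = {0..1}" "\<And>x. x \<in> {0..2*pi} \<Longrightarrow> g (\<kappa> x) = \<psi> (cis x)"
  using boundary_reparametrization[OF g] by blast
 have "curve_length (\<lambda>t. \<psi> (cis t)) 0 (2 * pi) \<le> curve_length g 0 1"
  using \<kappa>(1)
 proof
  assume "strict_mono_on {0..2*pi} \<kappa>"
  then show ?thesis by (intro curve_length_reparam_le[where h = \<kappa>]) (use \<kappa> in \<open>auto simp: monotone_on_def le_less\<close>)
 next
  assume "strict_antimono_on {0..2*pi} \<kappa>"
  then show ?thesis by (intro curve_length_reparam_antimono_le[where h = \<kappa>]) (use \<kappa> in \<open>auto simp: monotone_on_def le_less\<close>)
 qed
 also have "\<dots> < \<infinity>" using rect by (simp add: rectifiable_def)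
 finally show ?thesis .
qed

context boundary_disk
begin

definition arc_measure :: "complex measure" where
 "arc_measure = distr (density circle (\<lambda>t. ennreal (cmod (F t)))) borel (\<lambda>t. \<psi> (cis t))"

lemma boundary_measurable [measurable]: "(\<lambda>t. \<psi> (cis t)) \<in> borel_measurable circle"
 by (intro borel_measurable_circle_continuous continuous_on_compose2[OF cont] continuous_intros) auto

text \<open>Both measures are images of measures on the parameter interval. Under the monotone change of parameter \<open>\<kappa>\<close>, the measure \<open>\<bar>F\<bar> dt\<close>
 goes over into the one whose distribution function is the length of the initial arc of \<open>g\<close>. If \<open>\<kappa>\<close> reverses the orientation, initial arcs of \<open>g\<close> are
 terminal arcs of the boundary map.\<close>

theorem arc_length_measure_eq:
 assumes g: "simple_path g" "pathfinish g = pathstart g" "path_image g = frontier G" "pathstart g = \<psi> 1"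
 shows "arc_length_measure g = completion arc_measure"
proof -
 obtain \<kappa> where \<kappa>: "strict_mono_on {0..2*pi} \<kappa> \<or> strict_antimono_on {0..2*pi} \<kappa>"
  "\<kappa> ` {0..2*pi} = {0..1}" "\<And>x. x \<in> {0..2*pi} \<Longrightarrow> g (\<kappa> x) = \<psi> (cis x)"
  using boundary_reparametrization[OF g] by blast
 have \<kappa>01: "\<kappa> x \<in> {0..1}" if "x \<in> {0..2*pi}" for x using \<kappa>(2) that by blast
 have "\<kappa> \<in> borel_measurable (restrict_space borel {0..2*pi})"
  using \<kappa>(1)
 proof
  assume "strict_mono_on {0..2*pi} \<kappa>"
  then show ?thesis by (intro borel_measurable_mono_on_fnc strict_mono_on_imp_mono_on)
 next
  assume "strict_antimono_on {0..2*pi} \<kappa>"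
  then have "mono_on {0..2*pi} (\<lambda>x. - \<kappa> x)" by (force simp: monotone_on_def le_less)
  then have "(\<lambda>x. - \<kappa> x) \<in> borel_measurable (restrict_space borel {0..2*pi})" by (rule borel_measurable_mono_on_fnc)
  then show ?thesis by simp
 qed
 then have [measurable]: "\<kappa> \<in> borel_measurable circle"
  by (subst measurable_cong_sets[OF sets_circle refl])
 define D where "D = density circle (\<lambda>t. ennreal (cmod (F t)))"
 have sD: "sets D = sets circle" "space D = {0..2*pi}" by (simp_all add: D_def)
 have [measurable]: "\<kappa> \<in> borel_measurable D" by (simp add: D_def)
 define N where "N = distr D borel \<kappa>"
 define FF where "FF s = enn2real (curve_length g 0 (max 0 (min 1 s)))" for s
 have emD: "emeasure D A = (\<integral>\<^sup>+t. ennreal (indicator A t *\<^sub>R cmod (F t)) \<partial>circle)" if "A \<in> sets circle" for A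
  unfolding D_def using that by (subst emeasure_density) (auto intro!: nn_integral_cong split: split_indicator)
 have V_em: "(\<integral>\<^sup>+t. ennreal (indicator {x<..y} t *\<^sub>R cmod (F t)) \<partial>circle) = ennreal (V x y)" for x y
  unfolding V_def by (rule nn_integral_eq_integral[OF integrable_indicator_circle[OF integrable_norm[OF F_int]]]) simp
 have fin: "emeasure D (space D) < \<infinity>"
 proof -
  have "emeasure D (space D) = (\<integral>\<^sup>+t. ennreal (norm (F t)) \<partial>circle)"
   unfolding sD by (subst emD) (auto simp: sets.top[of circle, simplified] intro!: nn_integral_cong)
  then show ?thesis using F_int by (simp add: integrable_iff_bounded)
 qed
 have finN: "finite_borel_measure N"
 proof -
  have "emeasure N (space N) < \<infinity>"
   using fin by (simp add: N_def emeasure_distr)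
  then have "finite_measure N" by (intro finite_measureI) auto
  then show ?thesis by (simp add: finite_borel_measure_def finite_borel_measure_axioms_def N_def)
 qed
 have cdfN: "cdf N = FF"
 proof
  fix s
  show "cdf N s = FF s"
  \<comment> \<open>The length function in the definition of the measure is constant outside \<open>[0, 1]\<close>.\<close>
  proof (cases "s < 0")
   case True
   have "\<kappa> -` {..s} \<inter> {0..2*pi} = {}" using \<kappa>01 True by force
   then have "cdf N s = 0" by (simp add: cdf_def N_def measure_distr sD)
   moreover have "curve_length g 0 0 \<le> 0"
   proof (rule curve_length_le)
    fix xs :: "real list" assume "sorted xs" "set xs \<subseteq> {0..0}"
    then have "polygon_length g xs = 0" by (induction g xs rule: polygon_length.induct) auto
    then show "ennreal (polygon_length g xs) \<le> 0" by simp
   qed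
   then have "FF s = 0" using True by (simp add: FF_def)
   ultimately show ?thesis by simp
  next
   case False
   define s' where "s' = min 1 s"
   have s': "s' \<in> {0..1}" "max 0 (min 1 s) = s'" using False by (auto simp: s'_def)
   then obtain x where x: "x \<in> {0..2*pi}" "\<kappa> x = s'" using \<kappa>(2) by (metis imageE)
   have set: "\<kappa> -` {..s} \<inter> {0..2*pi} = {t \<in> {0..2*pi}. \<kappa> t \<le> \<kappa> x}"
    using \<kappa>01 x(2) by (fastforce simp: s'_def)
   have mset: "{t \<in> {0..2*pi}. \<kappa> t \<le> \<kappa> x} \<in> sets circle"
    unfolding set[symmetric] using measurable_sets[of \<kappa> circle borel "{..s}"] by simp
   have meas: "cdf N s = measure D {t \<in> {0..2*pi}. \<kappa> t \<le> \<kappa> x}"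
    by (simp add: cdf_def N_def measure_distr sD set)
   show ?thesis using \<kappa>(1)
   proof
    assume sm: "strict_mono_on {0..2*pi} \<kappa>"
    have ord: "\<kappa> t \<le> \<kappa> t' \<longleftrightarrow> t \<le> t'" if "t \<in> {0..2*pi}" "t' \<in> {0..2*pi}" for t t'
     using sm that by (simp add: strict_mono_on_less_eq)
    have "emeasure D {t \<in> {0..2*pi}. \<kappa> t \<le> \<kappa> x} = ennreal (V 0 x)"
     unfolding emD[OF mset] V_em[symmetric]
    proof (rule nn_integral_cong_AE)
     show "AE t in circle. ennreal (indicator {t \<in> {0..2*pi}. \<kappa> t \<le> \<kappa> x} t *\<^sub>R cmod (F t)) = ennreal (indicator {0<..x} t *\<^sub>R cmod (F t))"
      using AE_circle_interior by eventually_elim (use x ord in \<open>auto split: split_indicator\<close>)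
    qed
    then have 1: "cdf N s = V 0 x" unfolding meas measure_def by (simp add: V_nonneg)
    have "curve_length g 0 s' = curve_length (\<lambda>t. \<psi> (cis t)) 0 x"
    proof (rule antisym)
     define hh where "hh = inv_into {0..2*pi} \<kappa>"
     have hh: "hh s \<in> {0..2*pi}" "\<kappa> (hh s) = s" if "s \<in> {0..1}" for s
      using that \<kappa>(2) by (auto simp: hh_def inv_into_into f_inv_into_f) (metis atLeastAtMost_iff inv_into_into that)+
     show "curve_length g 0 s' \<le> curve_length (\<lambda>t. \<psi> (cis t)) 0 x"
     proof (rule curve_length_reparam_le[where h = hh])
      show "mono_on {0..s'} hh"
      proof (rule mono_onI)
       fix u v assume "u \<in> {0..s'}" "v \<in> {0..s'}" "u \<le> v"
       then show "hh u \<le> hh v" using hh[of u] hh[of v] s' ord[of "hh u" "hh v"] by auto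
      qed
      show "hh ` {0..s'} \<subseteq> {0..x}"
      proof
       fix y assume "y \<in> hh ` {0..s'}"
       then obtain u where u: "u \<in> {0..s'}" "y = hh u" by blast
       then show "y \<in> {0..x}" using hh[of u] s' ord[of "hh u" x] x by auto
      qed
      show "g t = \<psi> (cis (hh t))" if "t \<in> {0..s'}" for t
       using \<kappa>(3)[OF hh(1)[of t]] hh(2)[of t] that s' by auto
     qed
     show "curve_length (\<lambda>t. \<psi> (cis t)) 0 x \<le> curve_length g 0 s'"
     proof (rule curve_length_reparam_le[where h = \<kappa>])
      show "mono_on {0..x} \<kappa>" using sm x by (auto simp: monotone_on_def le_less)
      show "\<kappa> ` {0..x} \<subseteq> {0..s'}" using \<kappa>01 x ord by fastforce
      show "\<psi> (cis t) = g (\<kappa> t)" if "t \<in> {0..x}" for t using that x \<kappa>(3) by auto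
     qed
    qed
    then show ?thesis using 1 x curve_length_eq_V[of 0 x] by (simp add: FF_def s' V_nonneg)
   next
    assume sm: "strict_antimono_on {0..2*pi} \<kappa>"
    have ord: "\<kappa> t \<le> \<kappa> t' \<longleftrightarrow> t' \<le> t" if "t \<in> {0..2*pi}" "t' \<in> {0..2*pi}" for t t'
    proof -
     have "t < t' \<Longrightarrow> \<kappa> t' < \<kappa> t" "t' < t \<Longrightarrow> \<kappa> t < \<kappa> t'" using sm that by (auto simp: monotone_on_def)
     then show ?thesis by (cases t t' rule: linorder_cases) auto
    qed
    have "emeasure D {t \<in> {0..2*pi}. \<kappa> t \<le> \<kappa> x} = ennreal (V x (2 * pi))"
     unfolding emD[OF mset] V_em[symmetric]
    proof (rule nn_integral_cong_AE)
     have "AE t in lborel. t \<noteq> x" by (rule AE_lborel_singleton)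
     then have "AE t in circle. t \<noteq> x" unfolding AE_circle by eventually_elim auto
     with AE_circle_interior show "AE t in circle. ennreal (indicator {t \<in> {0..2*pi}. \<kappa> t \<le> \<kappa> x} t *\<^sub>R cmod (F t)) = ennreal (indicator {x<..2*pi} t *\<^sub>R cmod (F t))"
      by eventually_elim (use x ord in \<open>auto split: split_indicator\<close>)
    qed
    then have 1: "cdf N s = V x (2 * pi)" unfolding meas measure_def by (simp add: V_nonneg)
    have "curve_length g 0 s' = curve_length (\<lambda>t. \<psi> (cis t)) x (2 * pi)"
    proof (rule antisym)
     define hh where "hh = inv_into {0..2*pi} \<kappa>"
     have hh: "hh s \<in> {0..2*pi}" "\<kappa> (hh s) = s" if "s \<in> {0..1}" for s
      using that \<kappa>(2) by (auto simp: hh_def inv_into_into f_inv_into_f) (metis atLeastAtMost_iff inv_into_into that)+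
     show "curve_length g 0 s' \<le> curve_length (\<lambda>t. \<psi> (cis t)) x (2 * pi)"
     proof (rule curve_length_reparam_antimono_le[where h = hh])
      show "antimono_on {0..s'} hh"
      proof (rule monotone_onI)
       fix u v assume "u \<in> {0..s'}" "v \<in> {0..s'}" "u \<le> v"
       then show "hh v \<le> hh u" using hh[of u] hh[of v] s' ord[of "hh u" "hh v"] by auto
      qed
      show "hh ` {0..s'} \<subseteq> {x..2 * pi}"
      proof
       fix y assume "y \<in> hh ` {0..s'}"
       then obtain u where u: "u \<in> {0..s'}" "y = hh u" by blast
       then show "y \<in> {x..2 * pi}" using hh[of u] s' ord[of "hh u" x] x by auto
      qed
      show "g t = \<psi> (cis (hh t))" if "t \<in> {0..s'}" for t
       using \<kappa>(3)[OF hh(1)[of t]] hh(2)[of t] that s' by auto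
     qed
     show "curve_length (\<lambda>t. \<psi> (cis t)) x (2 * pi) \<le> curve_length g 0 s'"
     proof (rule curve_length_reparam_antimono_le[where h = \<kappa>])
      show "antimono_on {x..2 * pi} \<kappa>" using sm x by (auto simp: monotone_on_def le_less)
      show "\<kappa> ` {x..2 * pi} \<subseteq> {0..s'}" using \<kappa>01 x ord by fastforce
      show "\<psi> (cis t) = g (\<kappa> t)" if "t \<in> {x..2 * pi}" for t using that x \<kappa>(3) by auto
     qed
    qed
    then show ?thesis using 1 x curve_length_eq_V[of x "2 * pi"] by (simp add: FF_def s' V_nonneg)
   qed
  qed
 qed
 have IN: "interval_measure FF = N"
 proof (rule cdf_unique')
  note fbm = finite_borel_measure.cdf_nondecreasing[OF finN] finite_borel_measure.cdf_is_right_cont[OF finN]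
   finite_borel_measure.cdf_lim_at_bot[OF finN] finite_borel_measure.cdf_lim_at_top[OF finN]
  show "finite_borel_measure N" by (rule finN)
  show "finite_borel_measure (interval_measure FF)"
   unfolding cdfN[symmetric] by (rule finite_borel_measure_interval_measure[OF fbm]) auto
  show "cdf (interval_measure FF) = cdf N"
   unfolding cdfN[symmetric] by (rule cdf_interval_measure[OF fbm(1-3)]) auto
 qed
 have gm: "g \<in> borel_measurable (restrict_space borel {0..1})"
  using g(1) by (intro borel_measurable_continuous_on_restrict) (simp add: simple_path_def path_def)
 have sN: "sets N = sets borel" "space N = UNIV" by (simp_all add: N_def)
 have gm': "g \<in> borel_measurable (restrict_space N {0..1})"
  using gm by (simp add: measurable_cong_sets[OF sets_restrict_space_cong[OF sN(1)] refl])
 have "distr (restrict_space N {0..1}) borel g = distr D borel (\<lambda>t. \<psi> (cis t))"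
 proof (rule measure_eqI)
  fix B assume "B \<in> sets (distr (restrict_space N {0..1}) borel g)"
  then have B: "B \<in> sets borel" by simp
  have gB: "g -` B \<inter> {0..1} \<in> sets (restrict_space borel {0..1})"
   using measurable_sets[OF gm B] by (simp add: space_restrict_space)
  then have gB': "g -` B \<inter> {0..1} \<in> sets borel" by (auto simp: sets_restrict_space_iff)
  have "emeasure (distr (restrict_space N {0..1}) borel g) B = emeasure (restrict_space N {0..1}) (g -` B \<inter> {0..1})"
   by (subst emeasure_distr[OF gm' B]) (simp add: space_restrict_space sN)
  also have "\<dots> = emeasure N (g -` B \<inter> {0..1})"
   by (rule emeasure_restrict_space) (auto simp: sN)
  also have "\<dots> = emeasure D (\<kappa> -` (g -` B \<inter> {0..1}) \<inter> space D)"
   unfolding N_def by (rule emeasure_distr[OF _ gB']) measurable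
  also have "\<kappa> -` (g -` B \<inter> {0..1}) \<inter> space D = (\<lambda>t. \<psi> (cis t)) -` B \<inter> space D"
   using \<kappa>(3) \<kappa>01 unfolding sD by auto
  also have "emeasure D \<dots> = emeasure (distr D borel (\<lambda>t. \<psi> (cis t))) B"
   by (rule emeasure_distr[symmetric, OF _ B]) (simp add: D_def)
  finally show "emeasure (distr (restrict_space N {0..1}) borel g) B = emeasure (distr D borel (\<lambda>t. \<psi> (cis t))) B" .
 qed simp
 then show ?thesis
  unfolding arc_length_measure_def arc_measure_def D_def[symmetric] FF_def[symmetric, abs_def] IN by simp
qed

end

section \<open>Smirnov functions are controlled by their boundary values\<close>

lemma integral_bounded_mult_tendsto:
 fixes M :: "nat \<Rightarrow> 'a \<Rightarrow> real" and X :: "nat \<Rightarrow> 'a \<Rightarrow> complex"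
 assumes [measurable]: "\<And>j. M j \<in> borel_measurable N" "m \<in> borel_measurable N"
  and M: "\<And>j t. 0 \<le> M j t" "\<And>j t. M j t \<le> C" and lim: "AE t in N. (\<lambda>j. M j t) \<longlonglongrightarrow> m t"
  and X: "\<And>j. integrable N (X j)" "integrable N Y"
  and XY: "(\<lambda>j. \<integral>\<^sup>+t. ennreal (norm (X j t - Y t)) \<partial>N) \<longlonglongrightarrow> 0"
 shows "(\<lambda>j. \<integral>t. M j t * norm (X j t) \<partial>N) \<longlonglongrightarrow> (\<integral>t. m t * norm (Y t) \<partial>N)"
proof -
 have [measurable]: "X j \<in> borel_measurable N" "Y \<in> borel_measurable N" for j using X by auto
 have C: "0 \<le> C" using order_trans[OF M(1) M(2)] by blast
 have bnd: "integrable N (\<lambda>t. M j t * norm (Z t))" if "integrable N Z" for Z :: "'a \<Rightarrow> complex" and j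
 proof (rule Bochner_Integration.integrable_bound)
  show "integrable N (\<lambda>t. C * norm (Z t))" using that by (intro integrable_mult_right integrable_norm)
  have [measurable]: "Z \<in> borel_measurable N" using that by auto
  show "(\<lambda>t. M j t * norm (Z t)) \<in> borel_measurable N" by measurable
  show "AE t in N. norm (M j t * norm (Z t)) \<le> norm (C * norm (Z t))"
   using M C by (intro AE_I2) (auto simp: abs_mult intro!: mult_right_mono)
 qed
 have 1: "(\<lambda>j. \<integral>t. M j t * norm (Y t) \<partial>N) \<longlonglongrightarrow> (\<integral>t. m t * norm (Y t) \<partial>N)"
 proof (rule integral_dominated_convergence[where w = "\<lambda>t. C * norm (Y t)"])
  show "integrable N (\<lambda>t. C * norm (Y t))" using X by (intro integrable_mult_right integrable_norm)
  show "AE t in N. (\<lambda>j. M j t * norm (Y t)) \<longlonglongrightarrow> m t * norm (Y t)"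
   using lim by eventually_elim (intro tendsto_intros)
  show "AE t in N. norm (M j t * norm (Y t)) \<le> C * norm (Y t)" for j
   using M C by (intro AE_I2) (auto simp: abs_mult intro!: mult_right_mono)
 qed measurable
 have id: "integrable N (\<lambda>t. norm (X j t - Y t))" for j using X by auto
 have "(\<lambda>j. ennreal (\<integral>t. norm (X j t - Y t) \<partial>N)) \<longlonglongrightarrow> ennreal 0"
  using XY nn_integral_eq_integral[OF id] by simp
 then have "(\<lambda>j. \<integral>t. norm (X j t - Y t) \<partial>N) \<longlonglongrightarrow> 0"
  by (subst (asm) tendsto_ennreal_iff) auto
 then have d: "(\<lambda>j. C * (\<integral>t. norm (X j t - Y t) \<partial>N)) \<longlonglongrightarrow> 0" by (rule tendsto_mult_right_zero)
 have "(\<lambda>j. (\<integral>t. M j t * norm (X j t) \<partial>N) - (\<integral>t. M j t * norm (Y t) \<partial>N)) \<longlonglongrightarrow> 0"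
 proof (rule Lim_null_comparison[OF always_eventually d], rule allI)
  fix j
  have "(\<integral>t. M j t * norm (X j t) \<partial>N) - (\<integral>t. M j t * norm (Y t) \<partial>N) = (\<integral>t. M j t * norm (X j t) - M j t * norm (Y t) \<partial>N)"
   using bnd X by simp
  also have "norm \<dots> \<le> (\<integral>t. norm (M j t * norm (X j t) - M j t * norm (Y t)) \<partial>N)" by (rule integral_norm_bound)
  also have "\<dots> \<le> (\<integral>t. C * norm (X j t - Y t) \<partial>N)"
  proof (rule integral_mono_AE)
   show "AE t in N. norm (M j t * norm (X j t) - M j t * norm (Y t)) \<le> C * norm (X j t - Y t)"
   proof (rule AE_I2)
    fix t
    have "norm (M j t * norm (X j t) - M j t * norm (Y t)) = M j t * \<bar>norm (X j t) - norm (Y t)\<bar>"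
     using M(1)[of j t] by (simp add: abs_mult right_diff_distrib[symmetric])
    also have "\<dots> \<le> C * norm (X j t - Y t)" using M C by (intro mult_mono norm_triangle_ineq3) auto
    finally show "norm (M j t * norm (X j t) - M j t * norm (Y t)) \<le> C * norm (X j t - Y t)" .
   qed
  qed (use bnd X id in auto)
  also have "\<dots> = C * (\<integral>t. norm (X j t - Y t) \<partial>N)" by simp
  finally show "norm ((\<integral>t. M j t * norm (X j t) \<partial>N) - (\<integral>t. M j t * norm (Y t) \<partial>N)) \<le> C * (\<integral>t. norm (X j t - Y t) \<partial>N)" .
 qed
 from tendsto_add[OF this 1] show ?thesis by simp
qed

text \<open>Passage to the boundary: truncation makes the dilates of \<open>H\<close> converge dominatedly.\<close>

lemma dilates_integral_bound:
 fixes H :: "complex \<Rightarrow> complex"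
 assumes hol: "H holomorphic_on ball 0 1" and h[measurable]: "h \<in> borel_measurable circle"
  and nt: "AE t in circle. ntlim H (cis t) (h t)"
  and r: "\<And>k. 0 < r k" "\<And>k. r k < 1" "r \<longlonglongrightarrow> 1"
  and X: "\<And>j. integrable circle (X j)" "integrable circle Y"
  and XY: "(\<lambda>j. \<integral>\<^sup>+t. ennreal (cmod (X j t - Y t)) \<partial>circle) \<longlonglongrightarrow> 0"
  and c: "0 \<le> c" and C: "0 \<le> C" and a: "a \<longlonglongrightarrow> L"
  and le: "\<And>j. a j \<le> c * (\<integral>t. min (cmod (H (of_real (r j) * cis t))) C * cmod (X j t) \<partial>circle)"
 shows "ennreal L \<le> ennreal c * (\<integral>\<^sup>+t. ennreal (cmod (h t)) * ennreal (cmod (Y t)) \<partial>circle)"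
proof -
 have [measurable]: "(\<lambda>t. H (of_real (r j) * cis t)) \<in> borel_measurable circle" for j
  by (intro borel_measurable_circle_continuous continuous_on_radial hol r)
 have [measurable]: "Y \<in> borel_measurable circle" using X by auto
 have "(\<lambda>j. \<integral>t. min (cmod (H (of_real (r j) * cis t))) C * cmod (X j t) \<partial>circle) \<longlonglongrightarrow>
   (\<integral>t. min (cmod (h t)) C * cmod (Y t) \<partial>circle)"
 proof (rule integral_bounded_mult_tendsto[OF _ _ _ _ _ X XY, where C = C])
  show "AE t in circle. (\<lambda>j. min (cmod (H (of_real (r j) * cis t))) C) \<longlonglongrightarrow> min (cmod (h t)) C"
   using nt by eventually_elim (intro tendsto_intros ntlim_radial r, auto)
 qed (use C in auto)
 from tendsto_mult_left[OF this, of c] have "L \<le> c * (\<integral>t. min (cmod (h t)) C * cmod (Y t) \<partial>circle)"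
  by (rule LIMSEQ_le[OF a]) (use le in blast)
 then have "ennreal L \<le> ennreal c * ennreal (\<integral>t. min (cmod (h t)) C * cmod (Y t) \<partial>circle)"
  using ennreal_leI unfolding ennreal_mult'[OF c, symmetric] by blast
 also have "ennreal (\<integral>t. min (cmod (h t)) C * cmod (Y t) \<partial>circle) = (\<integral>\<^sup>+t. ennreal (min (cmod (h t)) C * cmod (Y t)) \<partial>circle)"
 proof (rule nn_integral_eq_integral[symmetric])
  show "integrable circle (\<lambda>t. min (cmod (h t)) C * cmod (Y t))"
  proof (rule Bochner_Integration.integrable_bound)
   show "integrable circle (\<lambda>t. C * cmod (Y t))" using X by (intro integrable_mult_right integrable_norm)
   show "AE t in circle. norm (min (cmod (h t)) C * cmod (Y t)) \<le> norm (C * cmod (Y t))"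
    using C by (intro AE_I2) (auto simp: abs_mult intro!: mult_right_mono)
  qed measurable
 qed (use C in auto)
 also have "\<dots> \<le> (\<integral>\<^sup>+t. ennreal (cmod (h t)) * ennreal (cmod (Y t)) \<partial>circle)"
  using C by (intro nn_integral_mono) (auto simp: ennreal_mult'[symmetric] ennreal_leI mult_right_mono)
 finally show ?thesis by (simp add: mult_left_mono)
qed

lemma dilate_in_ball:
 fixes z :: complex and r :: real
 assumes "0 < r" "r < 1" "cmod z \<le> 1"
 shows "of_real r * z \<in> ball 0 1" "cmod (of_real r * z) \<le> r"
proof -
 show "cmod (of_real r * z) \<le> r" using assms mult_left_le[of "cmod z" r] by (simp add: norm_mult)
 with assms show "of_real r * z \<in> ball 0 1" by simp
qed

text \<open>Cauchy's formula for the bounded functions \<open>H E\<^sub>k\<close>, first on smaller circles, then \<open>r \<rightarrow> 1\<close>, and only then \<open>k \<rightarrow> \<infinity>\<close>. The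
 boundary values of the factors \<open>E\<^sub>k\<close> do not enter, since their modulus is at most one.\<close>

lemma smirnov_pointwise_bound:
 assumes H: "smirnov H" and h[measurable]: "h \<in> borel_measurable circle"
  and nt: "AE t in circle. ntlim H (cis t) (h t)" and w: "cmod w < 1"
 shows "ennreal (2 * pi * cmod (H w)) \<le> ennreal (1 / (1 - cmod w)) * (\<integral>\<^sup>+t. ennreal (cmod (h t)) \<partial>circle)"
proof -
 obtain E where E: "\<And>k::nat. E k holomorphic_on ball 0 1" "\<And>k w. w \<in> ball 0 1 \<Longrightarrow> cmod (E k w) \<le> 1"
   "\<And>k. \<exists>B. \<forall>w\<in>ball 0 1. cmod (H w * E k w) \<le> B" "\<And>w. w \<in> ball 0 1 \<Longrightarrow> (\<lambda>k. E k w) \<longlonglongrightarrow> 1"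
  using H unfolding smirnov_def by blast
 have hol: "H holomorphic_on ball 0 1" using H by (simp add: smirnov_def)
 define r :: "nat \<Rightarrow> real" where "r k = 1 - 1 / (real k + 2)" for k
 have r: "0 < r k" "r k < 1" for k by (auto simp: r_def)
 have "r \<longlonglongrightarrow> 1 - 0" unfolding r_def by (intro tendsto_intros) real_asymp
 then have r_lim: "r \<longlonglongrightarrow> 1" by simp
 have *: "ennreal (2 * pi * cmod (H w * E k w)) \<le> ennreal (1 / (1 - cmod w)) * (\<integral>\<^sup>+t. ennreal (cmod (h t)) * ennreal (cmod 1) \<partial>circle)" for k
 proof -
  obtain B where B: "\<And>w. w \<in> ball 0 1 \<Longrightarrow> cmod (H w * E k w) \<le> B" using E(3) by blast
  have B0: "0 \<le> B" using order_trans[OF norm_ge_zero B[of 0]] by simp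
  define K where "K z = H z * E k z" for z
  have Kh: "K holomorphic_on ball 0 1" unfolding K_def by (intro holomorphic_intros hol E)
  show ?thesis
  proof (rule dilates_integral_bound[OF hol h nt r r_lim, where X = "\<lambda>_ _. 1" and C = B])
   show "(\<lambda>j. 2 * pi * cmod (K (of_real (r j) * w))) \<longlonglongrightarrow> 2 * pi * cmod (H w * E k w)"
   proof -
    have "(\<lambda>j. K (of_real (r j) * w)) \<longlonglongrightarrow> K (of_real 1 * w)"
    proof (rule continuous_on_tendsto_compose[OF holomorphic_on_imp_continuous_on[OF Kh]])
     show "(\<lambda>j. of_real (r j) * w) \<longlonglongrightarrow> of_real 1 * w" by (intro tendsto_intros r_lim)
     show "\<forall>\<^sub>F j in sequentially. of_real (r j) * w \<in> ball 0 1"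
      using w by (intro always_eventually allI dilate_in_ball r) simp
    qed (use w in simp)
    then show ?thesis by (intro tendsto_intros) (simp_all add: K_def)
   qed
   show "2 * pi * cmod (K (of_real (r j) * w)) \<le> 1 / (1 - cmod w) * (\<integral>t. min (cmod (H (of_real (r j) * cis t))) B * cmod 1 \<partial>circle)" for j
   proof -
    have in_ball: "of_real (r j) * z \<in> ball 0 1" if "z \<in> cball 0 1" for z :: complex
     using that by (intro dilate_in_ball r) simp
    have "(\<integral>t. K (of_real (r j) * cis t) * (cis t / (cis t - w)) \<partial>circle) = 2 * pi * K (of_real (r j) * w)"
    proof (rule circle_Cauchy_formula[of "\<lambda>z. K (of_real (r j) * z)"])
     show "continuous_on (cball 0 1) (\<lambda>z. K (of_real (r j) * z))"
      by (rule continuous_on_compose2[OF holomorphic_on_imp_continuous_on[OF Kh]]) (use in_ball in \<open>auto intro!: continuous_intros\<close>)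
     have "K \<circ> (\<lambda>z. of_real (r j) * z) holomorphic_on ball 0 1"
      by (rule holomorphic_on_compose_gen[OF _ Kh]) (use in_ball in \<open>auto intro!: holomorphic_intros\<close>)
     then show "(\<lambda>z. K (of_real (r j) * z)) holomorphic_on ball 0 1" by (simp add: o_def)
    qed (rule w)
    then have "2 * pi * cmod (K (of_real (r j) * w)) = cmod (\<integral>t. K (of_real (r j) * cis t) * (cis t / (cis t - w)) \<partial>circle)"
     by (simp add: norm_mult)
    also have "\<dots> \<le> (\<integral>t. cmod (K (of_real (r j) * cis t) * (cis t / (cis t - w))) \<partial>circle)"
     by (rule integral_norm_bound)
    also have "\<dots> \<le> (\<integral>t. 1 / (1 - cmod w) * (min (cmod (H (of_real (r j) * cis t))) B * cmod (1::complex)) \<partial>circle)"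
    proof (rule integral_mono_AE)
     show "integrable circle (\<lambda>t. cmod (K (of_real (r j) * cis t) * (cis t / (cis t - w))))"
      by (intro integrable_norm integrable_circle_continuous continuous_intros continuous_on_radial Kh r)
       (use cis_minus_ne_0[OF w] in auto)
     show "integrable circle (\<lambda>t. 1 / (1 - cmod w) * (min (cmod (H (of_real (r j) * cis t))) B * cmod (1::complex)))"
      by (intro integrable_mult_right integrable_mult_left integrable_circle_continuous continuous_intros continuous_on_radial hol r)
     show "AE t in circle. cmod (K (of_real (r j) * cis t) * (cis t / (cis t - w))) \<le>
       1 / (1 - cmod w) * (min (cmod (H (of_real (r j) * cis t))) B * cmod (1::complex))"
     proof (rule AE_I2)
      fix t
      have z: "of_real (r j) * cis t \<in> ball 0 1" by (rule in_ball) simp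
      have "cmod (K (of_real (r j) * cis t)) \<le> min (cmod (H (of_real (r j) * cis t))) B"
       using B[OF z] E(2)[OF z, of k] mult_left_le[of "cmod (E k (of_real (r j) * cis t))" "cmod (H (of_real (r j) * cis t))"]
       by (simp add: K_def norm_mult)
      moreover have "cmod (cis t / (cis t - w)) \<le> 1 / (1 - cmod w)"
       using norm_triangle_ineq2[of "cis t" w] w by (simp add: norm_divide frac_le)
      ultimately have "cmod (K (of_real (r j) * cis t)) * cmod (cis t / (cis t - w)) \<le> min (cmod (H (of_real (r j) * cis t))) B * (1 / (1 - cmod w))"
       using B0 by (intro mult_mono) auto
      then show "cmod (K (of_real (r j) * cis t) * (cis t / (cis t - w))) \<le>
       1 / (1 - cmod w) * (min (cmod (H (of_real (r j) * cis t))) B * cmod (1::complex))"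
       by (simp only: norm_mult norm_one mult_1_right mult.commute)
     qed
    qed
    also have "\<dots> = 1 / (1 - cmod w) * (\<integral>t. min (cmod (H (of_real (r j) * cis t))) B * cmod (1::complex) \<partial>circle)" by simp
    finally show ?thesis .
   qed
  qed (use w B0 finite_measure.integrable_const[OF finite_measure_circle] in auto)
 qed
 have "(\<lambda>k. ennreal (2 * pi * cmod (H w * E k w))) \<longlonglongrightarrow> ennreal (2 * pi * cmod (H w * 1))"
  by (intro tendsto_ennrealI tendsto_intros E) (use w in simp)
 from LIMSEQ_le_const2[OF this] * show ?thesis by auto
qed

text \<open>Every point of a closed curve is within half its length of the center of mass; integration by
 parts against a sawtooth of height \<open>\<pi>\<close> gives this for the mean over the parameter. Here the mean is \<open>f 0\<close>.\<close>

lemma half_length_bound: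
 fixes f :: "complex \<Rightarrow> complex" and r :: real
 assumes f: "f holomorphic_on ball 0 1" and r: "0 < r" "r < 1" and w: "cmod w \<le> r"
 shows "cmod (f w - f 0) \<le> 1 / 2 * (\<integral>t. cmod (deriv f (of_real r * cis t)) \<partial>circle)"
proof -
 define a where "a t = f (of_real r * cis t)" for t
 define a' where "a' t = of_real r * (\<i> * cis t) * deriv f (of_real r * cis t)" for t
 define I where "I = (\<integral>t. cmod (deriv f (of_real r * cis t)) \<partial>circle)"
 have df: "deriv f holomorphic_on ball 0 1" by (intro holomorphic_deriv f) auto
 have ac: "continuous_on A a" for A unfolding a_def by (intro continuous_on_radial f r)
 have a'c: "continuous_on A a'" for A unfolding a'_def by (intro continuous_intros continuous_on_radial df r)
 have der: "(a has_vector_derivative a' t) (at t within A)" for t A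
  unfolding a_def[abs_def] a'_def
  by (rule has_vector_derivative_at_within[OF has_vector_derivative_circle[OF f less_imp_le[OF r(1)] r(2)]])
 have mean: "integral {0..2*pi} a = 2 * pi * f 0"
 proof -
  have in_ball: "of_real r * z \<in> ball 0 1" if "z \<in> cball 0 1" for z :: complex
   using that by (intro dilate_in_ball r) simp
  have "(\<integral>t. f (of_real r * cis t) * (cis t / (cis t - 0)) \<partial>circle) = 2 * pi * f (of_real r * 0)"
  proof (rule circle_Cauchy_formula[of "\<lambda>z. f (of_real r * z)"])
   show "continuous_on (cball 0 1) (\<lambda>z. f (of_real r * z))"
    by (rule continuous_on_compose2[OF holomorphic_on_imp_continuous_on[OF f]]) (use in_ball in \<open>auto intro!: continuous_intros\<close>)
   have "f \<circ> (\<lambda>z. of_real r * z) holomorphic_on ball 0 1"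
    by (rule holomorphic_on_compose_gen[OF _ f]) (use in_ball in \<open>auto intro!: holomorphic_intros\<close>)
   then show "(\<lambda>z. f (of_real r * z)) holomorphic_on ball 0 1" by (simp add: o_def)
  qed simp
  then show ?thesis unfolding integral_circle_HK[OF ac] a_def by simp
 qed
 have int_a': "integral {0..2*pi} (\<lambda>t. cmod (a' t)) \<le> I"
 proof -
  have "integral {0..2*pi} (\<lambda>t. cmod (a' t)) = (\<integral>t. cmod (a' t) \<partial>circle)"
   by (intro integral_circle_HK continuous_intros a'c)
  also have "\<dots> = r * I" by (simp add: a'_def I_def norm_mult r abs_of_pos)
  also have "\<dots> \<le> 1 * I" using r by (intro mult_right_mono) (auto simp: I_def)
  finally show ?thesis by simp
 qed
 have circ: "cmod (a x - f 0) \<le> 1 / 2 * I" if x: "0 \<le> x" "x \<le> 2 * pi" for x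
 proof -
  have part: "integral {u..v} (\<lambda>t. of_real (c - t) * a' t) = of_real (c - v) * a v - of_real (c - u) * a u + integral {u..v} a"
   (is ?eq) and est: "cmod (integral {u..v} (\<lambda>t. of_real (c - t) * a' t)) \<le> pi * integral {u..v} (\<lambda>t. cmod (a' t))"
   if "u \<le> v" "\<And>t. u \<le> t \<Longrightarrow> t \<le> v \<Longrightarrow> \<bar>c - t\<bar> \<le> pi" for u v c :: real
  proof -
   have "((\<lambda>t. of_real (c - t) * a' t + (- 1) * a t) has_integral of_real (c - v) * a v - of_real (c - u) * a u) {u..v}"
   proof (rule fundamental_theorem_of_calculus[where f = "\<lambda>t. of_real (c - t) * a t", OF that(1)])
    fix t
    have "((\<lambda>t. of_real (c - t) :: complex) has_vector_derivative - 1) (at t within {u..v})"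
     by (auto intro!: derivative_eq_intros)
    from has_vector_derivative_mult[OF this der]
    show "((\<lambda>t. of_real (c - t) * a t) has_vector_derivative of_real (c - t) * a' t + (- 1) * a t) (at t within {u..v})" .
   qed
   moreover have "(a has_integral integral {u..v} a) {u..v}" by (intro integrable_integral integrable_continuous_real ac)
   ultimately have "((\<lambda>t. of_real (c - t) * a' t + (- 1) * a t + a t) has_integral of_real (c - v) * a v - of_real (c - u) * a u + integral {u..v} a) {u..v}"
    by (rule has_integral_add)
   then show ?eq by (simp add: integral_unique)
   have "cmod (integral {u..v} (\<lambda>t. of_real (c - t) * a' t)) \<le> integral {u..v} (\<lambda>t. pi * cmod (a' t))"
   proof (rule integral_norm_bound_integral)
    show "cmod (of_real (c - t) * a' t) \<le> pi * cmod (a' t)" if "t \<in> {u..v}" for t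
     unfolding norm_mult norm_of_real using that \<open>\<And>t. u \<le> t \<Longrightarrow> t \<le> v \<Longrightarrow> \<bar>c - t\<bar> \<le> pi\<close>[of t] by (intro mult_right_mono) auto
   qed (intro integrable_continuous_real continuous_intros a'c)+
   then show "cmod (integral {u..v} (\<lambda>t. of_real (c - t) * a' t)) \<le> pi * integral {u..v} (\<lambda>t. cmod (a' t))" by simp
  qed
  have sum: "integral {0..x} a + integral {x..2*pi} a = 2 * pi * f 0"
   unfolding mean[symmetric] by (rule Henstock_Kurzweil_Integration.integral_combine) (use x in \<open>auto intro!: integrable_continuous_real ac\<close>)
  have per: "a (2 * pi) = a 0" by (simp add: a_def)
  have p1: "integral {0..x} (\<lambda>t. of_real ((x - pi) - t) * a' t) = of_real ((x - pi) - x) * a x - of_real ((x - pi) - 0) * a 0 + integral {0..x} a"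
   by (rule part) (use x in auto)
  have p2: "integral {x..2*pi} (\<lambda>t. of_real ((x + pi) - t) * a' t) = of_real ((x + pi) - 2 * pi) * a (2 * pi) - of_real ((x + pi) - x) * a x + integral {x..2*pi} a"
   by (rule part) (use x in auto)
  \<comment> \<open>The sawtooth jumps at \<open>x\<close> and takes values in \<open>[-\<pi>, \<pi>]\<close>; its derivative is \<open>-1\<close>, so integration by parts produces the jump times \<open>a x\<close> and the mean.\<close>
  have eq: "integral {0..x} (\<lambda>t. of_real ((x - pi) - t) * a' t) + integral {x..2*pi} (\<lambda>t. of_real ((x + pi) - t) * a' t) = - (2 * pi * (a x - f 0))"
   unfolding p1 p2 per using sum[symmetric] by (simp add: algebra_simps)
  have "2 * pi * cmod (a x - f 0) = cmod (- (2 * pi * (a x - f 0)))" by (simp add: norm_mult)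
  also have "\<dots> \<le> cmod (integral {0..x} (\<lambda>t. of_real ((x - pi) - t) * a' t)) + cmod (integral {x..2*pi} (\<lambda>t. of_real ((x + pi) - t) * a' t))"
   unfolding eq[symmetric] by (rule norm_triangle_ineq)
  also have "\<dots> \<le> pi * integral {0..x} (\<lambda>t. cmod (a' t)) + pi * integral {x..2*pi} (\<lambda>t. cmod (a' t))"
   using x by (intro add_mono est) (auto simp: abs_if)
  also have "\<dots> = pi * integral {0..2*pi} (\<lambda>t. cmod (a' t))"
   unfolding distrib_left[symmetric]
   by (subst Henstock_Kurzweil_Integration.integral_combine) (use x in \<open>auto intro!: integrable_continuous_real continuous_intros a'c\<close>)
  also have "\<dots> \<le> pi * I" using int_a' by simp
  finally show ?thesis by (simp add: field_simps)
 qed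
 have "cmod ((\<lambda>z. f z - f 0) w) \<le> 1 / 2 * I"
 proof (rule maximum_modulus_frontier[of "\<lambda>z. f z - f 0" "cball 0 r"])
  have sub: "cball 0 r \<subseteq> ball (0::complex) 1" using r by auto
  show "(\<lambda>z. f z - f 0) holomorphic_on interior (cball 0 r)"
   using sub by (intro holomorphic_intros holomorphic_on_subset[OF f]) auto
  show "continuous_on (closure (cball 0 r)) (\<lambda>z. f z - f 0)"
   using sub by (intro continuous_intros continuous_on_subset[OF holomorphic_on_imp_continuous_on[OF f]]) auto
  fix z :: complex assume "z \<in> frontier (cball 0 r)"
  then have z: "cmod z = r" using r by simp
  have "z = of_real r * cis (Arg2pi z)" using Arg2pi_eq[of z] z by (simp add: cis_conv_exp)
  then show "cmod (f z - f 0) \<le> 1 / 2 * I"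
   using circ[of "Arg2pi z"] Arg2pi_ge_0[of z] Arg2pi_lt_2pi[of z] by (simp add: a_def)
 qed (use w in auto)
 then show ?thesis by (simp add: I_def)
qed

text \<open>The same two limits as for point values, applied to a primitive of \<open>H E\<^sub>k \<psi>'\<close>: the function \<open>H E\<^sub>k\<close> is bounded and \<open>\<psi>'\<close> converges in
 \<open>L\<^sup>1\<close>. In the last limit the primitives converge because they are integrals over a segment inside the disk.\<close>

lemma (in boundary_disk) smirnov_primitive_bound:
 assumes H: "smirnov H" and h[measurable]: "h \<in> borel_measurable circle"
  and nt: "AE t in circle. ntlim H (cis t) (h t)" and w: "cmod w < 1"
  and P: "\<And>z. z \<in> ball 0 1 \<Longrightarrow> (P has_field_derivative H z * deriv \<psi> z) (at z)"
 shows "ennreal (cmod (P w - P 0)) \<le> ennreal (1 / 2) * (\<integral>\<^sup>+t. ennreal (cmod (h t)) * ennreal (cmod (F t)) \<partial>circle)"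
proof -
 obtain E where E: "\<And>k::nat. E k holomorphic_on ball 0 1" "\<And>k w. w \<in> ball 0 1 \<Longrightarrow> cmod (E k w) \<le> 1"
   "\<And>k. \<exists>B. \<forall>w\<in>ball 0 1. cmod (H w * E k w) \<le> B" "\<And>w. w \<in> ball 0 1 \<Longrightarrow> (\<lambda>k. E k w) \<longlonglongrightarrow> 1"
  using H unfolding smirnov_def by blast
 have Hh: "H holomorphic_on ball 0 1" using H by (simp add: smirnov_def)
 have "\<exists>Pk. \<forall>z\<in>ball 0 1. (Pk has_field_derivative H z * E k z * deriv \<psi> z) (at z)" for k
 proof -
  have "(\<lambda>z. H z * E k z * deriv \<psi> z) holomorphic_on ball 0 1"
   by (intro holomorphic_intros Hh E deriv_holomorphic)
  then obtain g where
   "\<And>z. z \<in> ball 0 1 \<Longrightarrow> (g has_field_derivative H z * E k z * deriv \<psi> z) (at z within ball 0 1)"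
   by (rule holomorphic_convex_primitive'[OF convex_ball open_ball]) blast
  then show ?thesis by (intro exI[of _ g] ballI) (metis at_within_open open_ball)
 qed
 then obtain Pk where Pk: "\<And>k z. z \<in> ball 0 1 \<Longrightarrow> (Pk k has_field_derivative H z * E k z * deriv \<psi> z) (at z)"
  by metis
 have *: "ennreal (cmod (Pk k w - Pk k 0)) \<le> ennreal (1 / 2) * (\<integral>\<^sup>+t. ennreal (cmod (h t)) * ennreal (cmod (F t)) \<partial>circle)" for k
 proof -
  obtain B where B: "\<And>w. w \<in> ball 0 1 \<Longrightarrow> cmod (H w * E k w) \<le> B" using E(3) by blast
  have B0: "0 \<le> B" using order_trans[OF norm_ge_zero B[of 0]] by simp
  have Pkh: "Pk k holomorphic_on ball 0 1" using Pk[of _ k] unfolding holomorphic_on_open[OF open_ball] by blast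
  have i: "integrable circle (\<lambda>t. deriv \<psi> (of_real (r j) * cis t))" for j
   by (intro integrable_circle_continuous continuous_on_radial deriv_holomorphic r_pos r_less)
  show ?thesis
  proof (rule dilates_integral_bound[OF Hh h nt r_pos r_less r_lim i F_int F_lim _ B0])
   have rw: "cmod (of_real (r j) * w) \<le> r j" "of_real (r j) * w \<in> ball 0 1" for j
    using w dilate_in_ball[OF r_pos r_less, of w j] by auto
   have "(\<lambda>j. Pk k (of_real (r j) * w)) \<longlonglongrightarrow> Pk k (of_real 1 * w)"
   proof (rule continuous_on_tendsto_compose[OF holomorphic_on_imp_continuous_on[OF Pkh]])
    show "(\<lambda>j. of_real (r j) * w) \<longlonglongrightarrow> of_real 1 * w" by (intro tendsto_intros r_lim)
   qed (use w rw(2) in simp_all)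
   then show "(\<lambda>j. cmod (Pk k (of_real (r j) * w) - Pk k 0)) \<longlonglongrightarrow> cmod (Pk k w - Pk k 0)" by (intro tendsto_intros) simp
   show "cmod (Pk k (of_real (r j) * w) - Pk k 0) \<le>
    1 / 2 * (\<integral>t. min (cmod (H (of_real (r j) * cis t))) B * cmod (deriv \<psi> (of_real (r j) * cis t)) \<partial>circle)" for j
   proof -
    have "cmod (Pk k (of_real (r j) * w) - Pk k 0) \<le> 1 / 2 * (\<integral>t. cmod (deriv (Pk k) (of_real (r j) * cis t)) \<partial>circle)"
     by (rule half_length_bound[OF Pkh r_pos r_less rw(1)])
    also have "(\<integral>t. cmod (deriv (Pk k) (of_real (r j) * cis t)) \<partial>circle) \<le>
     (\<integral>t. min (cmod (H (of_real (r j) * cis t))) B * cmod (deriv \<psi> (of_real (r j) * cis t)) \<partial>circle)"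
    proof (rule integral_mono_AE)
     show "integrable circle (\<lambda>t. cmod (deriv (Pk k) (of_real (r j) * cis t)))"
      by (intro integrable_norm integrable_circle_continuous continuous_on_radial holomorphic_deriv Pkh r_pos r_less) auto
     show "integrable circle (\<lambda>t. min (cmod (H (of_real (r j) * cis t))) B * cmod (deriv \<psi> (of_real (r j) * cis t)))"
      by (intro integrable_circle_continuous continuous_intros continuous_on_radial Hh deriv_holomorphic r_pos r_less)
     show "AE t in circle. cmod (deriv (Pk k) (of_real (r j) * cis t)) \<le> min (cmod (H (of_real (r j) * cis t))) B * cmod (deriv \<psi> (of_real (r j) * cis t))"
     proof (rule AE_I2)
      fix t
      have z: "of_real (r j) * cis t \<in> ball 0 1" using r_pos[of j] r_less[of j] by (simp add: norm_mult)
      have "cmod (H (of_real (r j) * cis t) * E k (of_real (r j) * cis t)) \<le> min (cmod (H (of_real (r j) * cis t))) B"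
       using B[OF z] E(2)[OF z, of k] mult_left_le[of "cmod (E k (of_real (r j) * cis t))" "cmod (H (of_real (r j) * cis t))"]
       by (simp add: norm_mult)
      then show "cmod (deriv (Pk k) (of_real (r j) * cis t)) \<le> min (cmod (H (of_real (r j) * cis t))) B * cmod (deriv \<psi> (of_real (r j) * cis t))"
       unfolding DERIV_imp_deriv[OF Pk[OF z]] norm_mult[of "H _ * _"] by (rule mult_right_mono) simp
     qed
    qed
    finally show ?thesis by simp
   qed
  qed simp
 qed
 have seg: "of_real s * w \<in> ball 0 1" if "s \<in> {0..1}" for s :: real
  using that w mult_left_le_one_le[of "cmod w" s] by (auto simp: norm_mult)
 have FTC: "((\<lambda>s. w * f (of_real s * w)) has_integral U w - U 0) {0..1}"
  if "\<And>z. z \<in> ball 0 1 \<Longrightarrow> (U has_field_derivative f z) (at z)" for U f :: "complex \<Rightarrow> complex"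
 proof -
  have "((\<lambda>s. w * f (of_real s * w)) has_integral U (of_real 1 * w) - U (of_real 0 * w)) {0..1}"
  proof (rule fundamental_theorem_of_calculus)
   fix s :: real assume "s \<in> {0..1}"
   note d = that[OF seg[OF this]]
   have "((\<lambda>s. of_real s * w) has_vector_derivative w) (at s within {0..1})"
    by (auto intro!: derivative_eq_intros)
   from field_vector_diff_chain_within[OF this has_field_derivative_at_within[OF d]]
   show "((\<lambda>s. U (of_real s * w)) has_vector_derivative w * f (of_real s * w)) (at s within {0..1})" by (simp add: o_def)
  qed simp
  then show ?thesis by simp
 qed
 have "continuous_on {0..1} (\<lambda>s. cmod (w * (H (of_real s * w) * deriv \<psi> (of_real s * w))))"
  by (intro continuous_intros continuous_on_compose2[OF holomorphic_on_imp_continuous_on[OF Hh]]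
   continuous_on_compose2[OF holomorphic_on_imp_continuous_on[OF deriv_holomorphic]]) (use seg in auto)
 from integrable_continuous_real[OF this]
 have dom: "(\<lambda>s. cmod (w * (H (of_real s * w) * deriv \<psi> (of_real s * w)))) integrable_on {0..1}" .
 note FTCk = FTC[of "Pk _" "\<lambda>z. H z * E _ z * deriv \<psi> z", OF Pk]
 have "(\<lambda>k. integral {0..1} (\<lambda>s. w * (H (of_real s * w) * E k (of_real s * w) * deriv \<psi> (of_real s * w)))) \<longlonglongrightarrow>
   integral {0..1} (\<lambda>s. w * (H (of_real s * w) * deriv \<psi> (of_real s * w)))"
 proof (rule dominated_convergence(2)[OF _ dom])
  show "(\<lambda>s. w * (H (of_real s * w) * E k (of_real s * w) * deriv \<psi> (of_real s * w))) integrable_on {0..1}" for k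
   using FTCk[of k] by (rule has_integral_integrable)
  show "norm (w * (H (of_real s * w) * E k (of_real s * w) * deriv \<psi> (of_real s * w))) \<le> cmod (w * (H (of_real s * w) * deriv \<psi> (of_real s * w)))"
   if "s \<in> {0..1}" for k s
  proof -
   have "cmod (w * (H (of_real s * w) * E k (of_real s * w) * deriv \<psi> (of_real s * w))) =
     cmod (w * (H (of_real s * w) * deriv \<psi> (of_real s * w))) * cmod (E k (of_real s * w))"
    by (simp add: norm_mult)
   also have "\<dots> \<le> cmod (w * (H (of_real s * w) * deriv \<psi> (of_real s * w))) * 1"
    by (rule mult_left_mono[OF E(2)[OF seg[OF that]]]) simp
   finally show ?thesis by simp
  qed
  show "(\<lambda>k. w * (H (of_real s * w) * E k (of_real s * w) * deriv \<psi> (of_real s * w))) \<longlonglongrightarrow> w * (H (of_real s * w) * deriv \<psi> (of_real s * w))"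
   if "s \<in> {0..1}" for s
  proof -
   have "(\<lambda>k. w * (H (of_real s * w) * E k (of_real s * w) * deriv \<psi> (of_real s * w))) \<longlonglongrightarrow> w * (H (of_real s * w) * 1 * deriv \<psi> (of_real s * w))"
    by (intro tendsto_intros E(4)[OF seg[OF that]])
   then show ?thesis by simp
  qed
 qed
 then have "(\<lambda>k. Pk k w - Pk k 0) \<longlonglongrightarrow> P w - P 0"
  using integral_unique[OF FTCk] integral_unique[OF FTC[of P "\<lambda>z. H z * deriv \<psi> z", OF P]] by simp
 then have "(\<lambda>k. ennreal (cmod (Pk k w - Pk k 0))) \<longlonglongrightarrow> ennreal (cmod (P w - P 0))"
  by (intro tendsto_ennrealI tendsto_norm)
 from LIMSEQ_le_const2[OF this] * show ?thesis by blast
qed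

section \<open>Integration with respect to arc length on the circle\<close>

lemma (in complete_measure) borel_measurable_cong_AE:
 assumes g: "g \<in> borel_measurable M" and eq: "AE x in M. f x = g x"
 shows "f \<in> borel_measurable M"
proof (rule measurableI)
 fix B :: "'b set" assume "B \<in> sets borel"
 then have A: "g -` B \<inter> space M \<in> sets M" by (rule measurable_sets[OF g])
 have "AE x in M. x \<in> g -` B \<inter> space M \<longleftrightarrow> x \<in> f -` B \<inter> space M"
  using eq by eventually_elim auto
 from in_sets_AE[OF this A] show "f -` B \<inter> space M \<in> sets M" by auto
qed auto

context boundary_disk
begin

text \<open>A Borel inverse of the parametrization of the boundary, with arbitrary values elsewhere; it transports null sets and measurable functions from the circle to the curve.\<close>

definition boundary_param :: "complex \<Rightarrow> real" where
 "boundary_param z = (let u = (if z \<in> frontier G then \<phi> z else 1) in if u \<in> \<real>\<^sub>\<ge>\<^sub>0 then 0 else Arg2pi u)"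

lemma boundary_param_measurable: "boundary_param \<in> measurable borel circle"
proof -
 have 1: "(\<lambda>z. if z \<in> frontier G then \<phi> z else 1) \<in> borel_measurable borel"
  by (intro borel_measurable_continuous_on_if continuous_on_subset[OF cont_\<phi>]) (auto simp: frontier_def)
 have 2: "(\<lambda>u. if u \<in> \<real>\<^sub>\<ge>\<^sub>0 then 0 else Arg2pi u) \<in> borel_measurable borel"
 proof (intro borel_measurable_continuous_on_if continuous_at_imp_continuous_on ballI continuous_at_Arg2pi)
  show "\<real>\<^sub>\<ge>\<^sub>0 \<in> sets (borel :: complex measure)" by (intro borel_closed closed_nonneg_Reals_complex)
 qed auto
 have "(\<lambda>z. (\<lambda>u. if u \<in> \<real>\<^sub>\<ge>\<^sub>0 then 0 else Arg2pi u) (if z \<in> frontier G then \<phi> z else 1)) \<in> borel_measurable borel"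
  by (rule measurable_compose[OF 1 2])
 then have "boundary_param \<in> borel_measurable borel" by (simp add: boundary_param_def[abs_def] Let_def)
 moreover have "boundary_param z \<in> {0..2*pi}" for z
  using Arg2pi_ge_0 less_imp_le[OF Arg2pi_lt_2pi] by (auto simp: boundary_param_def Let_def)
 ultimately show ?thesis
  unfolding measurable_cong_sets[OF refl sets_circle] by (intro measurable_restrict_space2) auto
qed

lemma boundary_param_inverse: "z \<in> frontier G \<Longrightarrow> \<psi> (cis (boundary_param z)) = z"
proof -
 assume z: "z \<in> frontier G"
 then obtain u where u: "cmod u = 1" "z = \<psi> u" by (auto simp: frontier_eq dist_norm)
 have pu: "\<phi> z = u" using \<phi>\<psi>[of u] u by simp
 have "cis (boundary_param z) = u"
 proof (cases "u \<in> \<real>\<^sub>\<ge>\<^sub>0")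
  case True
  then have "u = 1" using u by (auto elim!: nonneg_Reals_cases)
  then show ?thesis using True z pu by (simp add: boundary_param_def)
 next
  case False
  then show ?thesis using Arg2pi_eq[of u] u z pu by (simp add: boundary_param_def cis_conv_exp)
 qed
 then show ?thesis using u by simp
qed

lemma boundary_in_frontier: "\<psi> (cis t) \<in> frontier G"
 by (auto simp: frontier_eq)

lemma boundary_param_cis: "0 < t \<Longrightarrow> t < 2 * pi \<Longrightarrow> boundary_param (\<psi> (cis t)) = t"
proof -
 assume t: "0 < t" "t < 2 * pi"
 have "\<psi> (cis (boundary_param (\<psi> (cis t)))) = \<psi> (cis t)" by (rule boundary_param_inverse[OF boundary_in_frontier])
 then have eq: "cis (boundary_param (\<psi> (cis t))) = cis t" using inj by (auto simp: inj_on_def)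
 have "boundary_param (\<psi> (cis t)) \<in> {0..2*pi}"
  using measurable_space[OF boundary_param_measurable] by simp
 with t show ?thesis by (intro cis_eq_imp_eq[OF eq]) auto
qed

lemma emeasure_arc:
 assumes "A \<in> sets borel"
 shows "emeasure arc_measure A = (\<integral>\<^sup>+t. ennreal (cmod (F t)) * indicator A (\<psi> (cis t)) \<partial>circle)"
proof -
 have m: "(\<lambda>t. \<psi> (cis t)) \<in> borel_measurable (density circle (\<lambda>t. ennreal (cmod (F t))))" by simp
 have s: "(\<lambda>t. \<psi> (cis t)) -` A \<inter> {0..2*pi} \<in> sets circle"
  using measurable_sets[OF boundary_measurable assms] by simp
 have "emeasure arc_measure A = emeasure (density circle (\<lambda>t. ennreal (cmod (F t)))) ((\<lambda>t. \<psi> (cis t)) -` A \<inter> {0..2*pi})"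
  unfolding arc_measure_def by (subst emeasure_distr[OF m assms]) simp
 also have "\<dots> = (\<integral>\<^sup>+t. ennreal (cmod (F t)) * indicator A (\<psi> (cis t)) \<partial>circle)"
  by (subst emeasure_density[OF _ s]) (auto intro!: nn_integral_cong split: split_indicator)
 finally show ?thesis .
qed

text \<open>Stated for arbitrary predicates, since boundary values are defined by a limit that may fail to exist and are not known to be measurable.\<close>

lemma AE_arc: "(AE z in completion arc_measure. P z) \<longleftrightarrow> (AE t in circle. P (\<psi> (cis t)))"
proof
 assume "AE z in completion arc_measure. P z"
 then have "AE z in arc_measure. P z" by (simp add: AE_completion_iff)
 then have "AE t in density circle (\<lambda>t. ennreal (cmod (F t))). P (\<psi> (cis t))"
  unfolding arc_measure_def by (rule AE_distrD[rotated]) simp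
 then have "AE t in circle. 0 < ennreal (cmod (F t)) \<longrightarrow> P (\<psi> (cis t))"
  by (subst (asm) AE_density) simp_all
 with F_nonzero show "AE t in circle. P (\<psi> (cis t))" by eventually_elim simp
next
 assume "AE t in circle. P (\<psi> (cis t))"
 then obtain N where N: "N \<in> null_sets circle" "{t\<in>{0..2*pi}. \<not> P (\<psi> (cis t))} \<subseteq> N"
  unfolding eventually_ae_filter by auto
 \<comment> \<open>Points off the curve are added, as \<open>P\<close> says nothing about them.\<close>
 define Z where "Z = - frontier G \<union> boundary_param -` N"
 have "boundary_param -` N \<inter> space borel \<in> sets borel"
  using N(1) by (intro measurable_sets[OF boundary_param_measurable]) auto
 then have Z: "Z \<in> sets borel" unfolding Z_def by (intro sets.Un) auto
 have "emeasure arc_measure Z = (\<integral>\<^sup>+t. 0 \<partial>circle)"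
  unfolding emeasure_arc[OF Z]
 proof (rule nn_integral_cong_AE)
  have "AE t in circle. t \<notin> N" using N(1) by (rule AE_not_in)
  with AE_circle_interior show "AE t in circle. ennreal (cmod (F t)) * indicator Z (\<psi> (cis t)) = 0"
   by eventually_elim (simp add: Z_def boundary_in_frontier boundary_param_cis)
 qed
 then have "Z \<in> null_sets arc_measure" using Z by (simp add: null_sets_def arc_measure_def)
 moreover have "{z \<in> space arc_measure. \<not> P z} \<subseteq> Z"
 proof
  fix z assume z: "z \<in> {z \<in> space arc_measure. \<not> P z}"
  show "z \<in> Z"
  proof (cases "z \<in> frontier G")
   case True
   have "boundary_param z \<in> {0..2*pi}" using measurable_space[OF boundary_param_measurable] by simp
   then show ?thesis using z N(2) boundary_param_inverse[OF True] by (auto simp: Z_def)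
  qed (simp add: Z_def)
 qed
 ultimately have "AE z in arc_measure. P z" unfolding eventually_ae_filter by blast
 then show "AE z in completion arc_measure. P z" by (rule AE_completion)
qed

text \<open>The integrand need only agree almost everywhere on the curve with a measurable function of the parameter; a measurable representative on the plane is
 obtained from \<open>boundary_param\<close>.\<close>

lemma nn_integral_arc:
 assumes Y: "Y \<in> borel_measurable circle" and eq: "AE t in circle. X (\<psi> (cis t)) = Y t"
 shows "(\<integral>\<^sup>+z. X z \<partial>completion arc_measure) = (\<integral>\<^sup>+t. ennreal (cmod (F t)) * Y t \<partial>circle)"
proof -
 define X0 where "X0 z = Y (boundary_param z)" for z
 have X0: "X0 \<in> borel_measurable borel"
  unfolding X0_def[abs_def] by (rule measurable_compose[OF boundary_param_measurable Y])
 note [measurable] = measurable_compose[OF boundary_measurable X0]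
 have X0_eq: "AE t in circle. X0 (\<psi> (cis t)) = Y t"
  using AE_circle_interior by eventually_elim (simp add: X0_def boundary_param_cis)
 have "AE z in completion arc_measure. X z = X0 z"
  unfolding AE_arc using eq X0_eq by eventually_elim simp
 then have "(\<integral>\<^sup>+z. X z \<partial>completion arc_measure) = (\<integral>\<^sup>+z. X0 z \<partial>completion arc_measure)" by (rule nn_integral_cong_AE)
 also have "\<dots> = (\<integral>\<^sup>+t. X0 (\<psi> (cis t)) \<partial>density circle (\<lambda>t. ennreal (cmod (F t))))"
  unfolding nn_integral_completion arc_measure_def by (rule nn_integral_distr) (simp_all add: X0)
 also have "\<dots> = (\<integral>\<^sup>+t. ennreal (cmod (F t)) * X0 (\<psi> (cis t)) \<partial>circle)"
  by (rule nn_integral_density) auto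
 also have "\<dots> = (\<integral>\<^sup>+t. ennreal (cmod (F t)) * Y t \<partial>circle)"
  by (rule nn_integral_cong_AE) (use X0_eq in eventually_elim, simp)
 finally show ?thesis .
qed

lemma integral_arc:
 fixes Y :: "real \<Rightarrow> 'b::{banach, second_countable_topology}"
 assumes Y: "Y \<in> borel_measurable circle" and eq: "AE t in circle. X (\<psi> (cis t)) = Y t"
 shows "(\<integral>z. X z \<partial>completion arc_measure) = (\<integral>t. cmod (F t) *\<^sub>R Y t \<partial>circle)"
proof -
 define X0 where "X0 z = Y (boundary_param z)" for z
 have X0: "X0 \<in> borel_measurable borel"
  unfolding X0_def[abs_def] by (rule measurable_compose[OF boundary_param_measurable Y])
 then have X0': "X0 \<in> borel_measurable arc_measure" by (simp add: arc_measure_def)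
 note Xa[measurable] = measurable_compose[OF boundary_measurable X0]
 note [measurable] = Y
 have X0_eq: "AE t in circle. X0 (\<psi> (cis t)) = Y t"
  using AE_circle_interior by eventually_elim (simp add: X0_def boundary_param_cis)
 have XX: "AE z in completion arc_measure. X z = X0 z"
  unfolding AE_arc using eq X0_eq by eventually_elim simp
 have mX0: "X0 \<in> borel_measurable (completion arc_measure)" by (rule measurable_completion[OF X0'])
 have "(\<integral>z. X z \<partial>completion arc_measure) = (\<integral>z. X0 z \<partial>completion arc_measure)"
  by (rule integral_cong_AE[OF completion.borel_measurable_cong_AE[OF mX0 XX] mX0 XX])
 also have "\<dots> = (\<integral>t. X0 (\<psi> (cis t)) \<partial>density circle (\<lambda>t. ennreal (cmod (F t))))"
  unfolding integral_completion[OF X0'] unfolding arc_measure_def by (rule integral_distr[OF _ X0]) simp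
 also have "\<dots> = (\<integral>t. cmod (F t) *\<^sub>R X0 (\<psi> (cis t)) \<partial>circle)"
  by (rule integral_density) auto
 also have "\<dots> = (\<integral>t. cmod (F t) *\<^sub>R Y t \<partial>circle)"
  by (rule integral_cong_AE) (use X0_eq in \<open>measurable, eventually_elim, simp\<close>)
 finally show ?thesis .
qed

end

section \<open>A Hoelder inequality\<close>

text \<open>Bernoulli's inequality for \<open>a / b\<close>.\<close>

lemma young_power:
 fixes a b :: real
 assumes a: "0 \<le> a" and b: "0 \<le> b"
 shows "real (Suc n) * (a * b ^ n) \<le> a ^ Suc n + real n * b ^ Suc n"
proof (cases "b = 0")
 case True then show ?thesis using a by (cases n) auto
next
 case False
 then have b: "0 < b" using b by simp
 have "1 + real (Suc n) * (a / b - 1) \<le> (1 + (a / b - 1)) ^ Suc n"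
  using a b by (intro Bernoulli_inequality) simp
 then have "b ^ Suc n * (1 + real (Suc n) * (a / b - 1)) \<le> b ^ Suc n * (a / b) ^ Suc n"
  using b by (intro mult_left_mono) auto
 also have "b ^ Suc n * (a / b) ^ Suc n = a ^ Suc n" using b by (simp add: power_divide)
 also have "b ^ Suc n * (1 + real (Suc n) * (a / b - 1)) = real (Suc n) * (a * b ^ n) - real n * b ^ Suc n"
  using b by (simp add: field_simps)
 finally show ?thesis by simp
qed

text \<open>Young's inequality with the convex combination as second factor, applied to both terms.\<close>

lemma power_convex_combination:
 fixes y z \<theta> \<eta> :: real
 assumes yz: "0 \<le> y" "0 \<le> z" and \<theta>: "0 \<le> \<theta>" "0 \<le> \<eta>" "\<theta> + \<eta> = 1"
 shows "(\<theta> * y + \<eta> * z) ^ Suc n \<le> \<theta> * y ^ Suc n + \<eta> * z ^ Suc n"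
proof -
 define w where "w = \<theta> * y + \<eta> * z"
 have w: "0 \<le> w" using yz \<theta> by (simp add: w_def)
 have "real (Suc n) * w ^ Suc n = \<theta> * (real (Suc n) * (y * w ^ n)) + \<eta> * (real (Suc n) * (z * w ^ n))"
  by (simp add: w_def algebra_simps)
 also have "\<dots> \<le> \<theta> * (y ^ Suc n + real n * w ^ Suc n) + \<eta> * (z ^ Suc n + real n * w ^ Suc n)"
  using \<theta> by (intro add_mono mult_left_mono young_power yz w) auto
 also have "\<dots> = \<theta> * y ^ Suc n + \<eta> * z ^ Suc n + (\<theta> + \<eta>) * (real n * w ^ Suc n)" by (simp add: algebra_simps)
 finally show ?thesis unfolding \<theta> w_def[symmetric] by (simp add: algebra_simps)
qed

lemma power_diff_bound:
 fixes f b :: complex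
 shows "cmod (f ^ Suc n - b ^ Suc n) \<le> cmod (f - b) * (cmod f + cmod b) ^ n"
proof (induction n)
 case (Suc n)
 have "f ^ Suc (Suc n) - b ^ Suc (Suc n) = f * (f ^ Suc n - b ^ Suc n) + (f - b) * b ^ Suc n"
  by (simp add: algebra_simps)
 also have "cmod \<dots> \<le> cmod f * cmod (f ^ Suc n - b ^ Suc n) + cmod (f - b) * cmod b ^ Suc n"
  by (metis norm_mult norm_power norm_triangle_ineq)
 also have "\<dots> \<le> cmod f * (cmod (f - b) * (cmod f + cmod b) ^ n) + cmod (f - b) * (cmod b * (cmod f + cmod b) ^ n)"
  unfolding power_Suc[of "cmod b"] by (intro add_mono mult_left_mono Suc power_mono) auto
 also have "\<dots> = cmod (f - b) * (cmod f + cmod b) ^ Suc n" by (simp add: algebra_simps)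
 finally show ?case .
qed simp

text \<open>The weights \<open>s\<close> and \<open>t\<close> are dual to each other: \<open>s t\<^sup>n = 1\<close>. Normalizing the three functions, the integrand is
 bounded by Young's inequality and the convexity of the power.\<close>

lemma weighted_hoelder_aux:
 fixes x y z s t :: "'a \<Rightarrow> real" and A B C :: real
 assumes [measurable]: "x \<in> borel_measurable M" "y \<in> borel_measurable M" "z \<in> borel_measurable M"
  "s \<in> borel_measurable M" "t \<in> borel_measurable M"
  and pos: "\<And>u. 0 \<le> x u" "\<And>u. 0 \<le> y u" "\<And>u. 0 \<le> z u" "\<And>u. 0 \<le> s u" "\<And>u. 0 \<le> t u"
  and dual: "AE u in M. s u * t u ^ n = 1"
  and ABC: "0 < A" "0 < B" "0 < C"
  and ix: "(\<integral>\<^sup>+u. ennreal ((x u * s u) ^ Suc n) \<partial>M) \<le> ennreal (A ^ Suc n)"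
  and iy: "(\<integral>\<^sup>+u. ennreal ((y u * t u) ^ Suc n) \<partial>M) \<le> ennreal (B ^ Suc n)"
  and iz: "(\<integral>\<^sup>+u. ennreal ((z u * t u) ^ Suc n) \<partial>M) \<le> ennreal (C ^ Suc n)"
 shows "(\<integral>\<^sup>+u. ennreal (x u * (y u + z u) ^ n) \<partial>M) \<le> ennreal (A * (B + C) ^ n)"
proof -
 define p where "p = real (Suc n)"
 define S where "S = B + C"
 have S: "0 < S" using ABC by (simp add: S_def)
 \<comment> \<open>The constants arise from undoing the normalization by \<open>A\<close>, \<open>B\<close>, \<open>C\<close>.\<close>
 define K where "K = A * S ^ n / p"
 define \<alpha> where "\<alpha> = K / A ^ Suc n"
 define \<beta> where "\<beta> = K * real n * (B / S) / B ^ Suc n"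
 define \<gamma> where "\<gamma> = K * real n * (C / S) / C ^ Suc n"
 have p: "0 < p" by (simp add: p_def)
 have K: "0 < K" using ABC S p by (simp add: K_def)
 have nn: "0 \<le> \<alpha>" "0 \<le> \<beta>" "0 \<le> \<gamma>" using K ABC S by (auto simp: \<alpha>_def \<beta>_def \<gamma>_def)
 have pw: "x u * (y u + z u) ^ n \<le> \<alpha> * (x u * s u) ^ Suc n + \<beta> * (y u * t u) ^ Suc n + \<gamma> * (z u * t u) ^ Suc n"
  if d: "s u * t u ^ n = 1" for u
 proof -
  define X where "X = x u * s u / A"
  define Y where "Y = y u * t u / B"
  define Z where "Z = z u * t u / C"
  define W where "W = B / S * Y + C / S * Z"
  have nnn: "0 \<le> X" "0 \<le> Y" "0 \<le> Z" "0 \<le> W" using pos ABC S by (auto simp: X_def Y_def Z_def W_def)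
  have W: "W = (y u + z u) * t u / S" using ABC S by (simp add: W_def Y_def Z_def field_simps)
  have "x u * (y u + z u) ^ n = (s u * t u ^ n) * (x u * (y u + z u) ^ n)" using d by simp
  also have "\<dots> = K * (p * (X * W ^ n))"
   using ABC S p by (simp add: K_def X_def W power_divide power_mult_distrib)
  also have "\<dots> \<le> K * (X ^ Suc n + real n * W ^ Suc n)"
   using K unfolding p_def by (intro mult_left_mono young_power nnn) auto
  also have "W ^ Suc n \<le> B / S * Y ^ Suc n + C / S * Z ^ Suc n"
   unfolding W_def using ABC S by (intro power_convex_combination nnn) (auto simp: S_def add_divide_distrib[symmetric])
  finally have "x u * (y u + z u) ^ n \<le> K * (X ^ Suc n + real n * (B / S * Y ^ Suc n + C / S * Z ^ Suc n))"
   using K by (simp add: mult_left_mono)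
  also have "\<dots> = \<alpha> * (x u * s u) ^ Suc n + \<beta> * (y u * t u) ^ Suc n + \<gamma> * (z u * t u) ^ Suc n"
   unfolding X_def Y_def Z_def \<alpha>_def \<beta>_def \<gamma>_def power_divide by (simp add: algebra_simps)
  finally show ?thesis .
 qed
 have "(\<integral>\<^sup>+u. ennreal (x u * (y u + z u) ^ n) \<partial>M) \<le>
   (\<integral>\<^sup>+u. ennreal \<alpha> * ennreal ((x u * s u) ^ Suc n) + ennreal \<beta> * ennreal ((y u * t u) ^ Suc n) + ennreal \<gamma> * ennreal ((z u * t u) ^ Suc n) \<partial>M)"
 proof (rule nn_integral_mono_AE)
  show "AE u in M. ennreal (x u * (y u + z u) ^ n) \<le>
   ennreal \<alpha> * ennreal ((x u * s u) ^ Suc n) + ennreal \<beta> * ennreal ((y u * t u) ^ Suc n) + ennreal \<gamma> * ennreal ((z u * t u) ^ Suc n)"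
   using dual
  proof eventually_elim
   case (elim u)
   have "ennreal (x u * (y u + z u) ^ n) \<le> ennreal (\<alpha> * (x u * s u) ^ Suc n + \<beta> * (y u * t u) ^ Suc n + \<gamma> * (z u * t u) ^ Suc n)"
    by (rule ennreal_leI[OF pw[OF elim]])
   also have "\<dots> = ennreal \<alpha> * ennreal ((x u * s u) ^ Suc n) + ennreal \<beta> * ennreal ((y u * t u) ^ Suc n) + ennreal \<gamma> * ennreal ((z u * t u) ^ Suc n)"
    using nn pos[of u] by (subst ennreal_plus, simp, simp, subst ennreal_plus, simp, simp) (simp add: ennreal_mult' del: power_Suc)
   finally show ?case .
  qed
 qed
 also have "\<dots> = ennreal \<alpha> * (\<integral>\<^sup>+u. ennreal ((x u * s u) ^ Suc n) \<partial>M) + ennreal \<beta> * (\<integral>\<^sup>+u. ennreal ((y u * t u) ^ Suc n) \<partial>M) + ennreal \<gamma> * (\<integral>\<^sup>+u. ennreal ((z u * t u) ^ Suc n) \<partial>M)"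
  by (simp add: nn_integral_add nn_integral_cmult del: power_Suc)
 also have "\<dots> \<le> ennreal \<alpha> * ennreal (A ^ Suc n) + ennreal \<beta> * ennreal (B ^ Suc n) + ennreal \<gamma> * ennreal (C ^ Suc n)"
  by (intro add_mono mult_left_mono ix iy iz) auto
 also have "\<dots> = ennreal (\<alpha> * A ^ Suc n + \<beta> * B ^ Suc n + \<gamma> * C ^ Suc n)"
  using nn ABC by (simp add: ennreal_mult'[symmetric] ennreal_plus[symmetric] del: ennreal_plus power_Suc)
 also have "\<alpha> * A ^ Suc n + \<beta> * B ^ Suc n + \<gamma> * C ^ Suc n = K + K * real n * (B / S) + K * real n * (C / S)"
  using ABC by (simp add: \<alpha>_def \<beta>_def \<gamma>_def del: power_Suc)
 also have "\<dots> = K * (1 + real n * ((B + C) / S))" by (simp add: algebra_simps add_divide_distrib)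
 also have "\<dots> = K * p" using S by (simp add: S_def p_def)
 also have "\<dots> = A * (B + C) ^ n" using p by (simp add: K_def S_def)
 finally show ?thesis .
qed

text \<open>The bounds are first increased by \<open>e k > 0\<close>, so that normalizing does not divide by zero.\<close>

lemma weighted_hoelder:
 fixes x y z s t :: "'a \<Rightarrow> real" and A B C :: real
 assumes meas: "x \<in> borel_measurable M" "y \<in> borel_measurable M" "z \<in> borel_measurable M"
  "s \<in> borel_measurable M" "t \<in> borel_measurable M"
  and pos: "\<And>u. 0 \<le> x u" "\<And>u. 0 \<le> y u" "\<And>u. 0 \<le> z u" "\<And>u. 0 \<le> s u" "\<And>u. 0 \<le> t u"
  and dual: "AE u in M. s u * t u ^ n = 1"
  and ABC: "0 \<le> A" "0 \<le> B" "0 \<le> C"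
  and ix: "(\<integral>\<^sup>+u. ennreal ((x u * s u) ^ Suc n) \<partial>M) = ennreal (A ^ Suc n)"
  and iy: "(\<integral>\<^sup>+u. ennreal ((y u * t u) ^ Suc n) \<partial>M) = ennreal (B ^ Suc n)"
  and iz: "(\<integral>\<^sup>+u. ennreal ((z u * t u) ^ Suc n) \<partial>M) = ennreal (C ^ Suc n)"
 shows "(\<integral>\<^sup>+u. ennreal (x u * (y u + z u) ^ n) \<partial>M) \<le> ennreal (A * (B + C) ^ n)"
proof -
 define e where "e k = 1 / real (Suc k)" for k
 have e: "0 < e k" for k by (simp add: e_def)
 have e0: "e \<longlonglongrightarrow> 0" unfolding e_def by (rule LIMSEQ_Suc[OF lim_const_over_n])
 have "(\<integral>\<^sup>+u. ennreal (x u * (y u + z u) ^ n) \<partial>M) \<le> ennreal ((A + e k) * ((B + e k) + (C + e k)) ^ n)" for k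
 proof (rule weighted_hoelder_aux[OF meas pos dual])
  have le: "ennreal (a ^ Suc n) \<le> ennreal ((a + e k) ^ Suc n)" if "0 \<le> a" for a
   using that e[of k] by (intro ennreal_leI power_mono) auto
  show "(\<integral>\<^sup>+u. ennreal ((x u * s u) ^ Suc n) \<partial>M) \<le> ennreal ((A + e k) ^ Suc n)" unfolding ix by (rule le[OF ABC(1)])
  show "(\<integral>\<^sup>+u. ennreal ((y u * t u) ^ Suc n) \<partial>M) \<le> ennreal ((B + e k) ^ Suc n)" unfolding iy by (rule le[OF ABC(2)])
  show "(\<integral>\<^sup>+u. ennreal ((z u * t u) ^ Suc n) \<partial>M) \<le> ennreal ((C + e k) ^ Suc n)" unfolding iz by (rule le[OF ABC(3)])
 qed (use e[of k] ABC in auto)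
 moreover have "(\<lambda>k. ennreal ((A + e k) * ((B + e k) + (C + e k)) ^ n)) \<longlonglongrightarrow> ennreal ((A + 0) * ((B + 0) + (C + 0)) ^ n)"
  by (intro tendsto_ennrealI tendsto_intros e0)
 ultimately show ?thesis using LIMSEQ_le_const[of _ "ennreal ((A + 0) * ((B + 0) + (C + 0)) ^ n)"] by auto
qed

section \<open>The error estimate on the disk\<close>

lemma ntlim_algebra:
 fixes f g :: "complex \<Rightarrow> complex"
 shows "ntlim (\<lambda>_. c) \<zeta> c"
  and "ntlim f \<zeta> a \<Longrightarrow> ntlim g \<zeta> b \<Longrightarrow> ntlim (\<lambda>w. f w - g w) \<zeta> (a - b)"
  and "ntlim f \<zeta> a \<Longrightarrow> ntlim g \<zeta> b \<Longrightarrow> ntlim (\<lambda>w. f w * g w) \<zeta> (a * b)"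
  and "ntlim f \<zeta> a \<Longrightarrow> ntlim (\<lambda>w. f w ^ n) \<zeta> (a ^ n)"
 unfolding ntlim_def by (auto intro!: tendsto_intros)

lemma ntlim_continuous:
 assumes "continuous_on (cball 0 1) f"
 shows "ntlim f (cis t) (f (cis t))"
 unfolding ntlim_def
proof (intro allI impI)
 fix \<beta> :: real
 have "(f \<longlongrightarrow> f (cis t)) (at (cis t) within cball 0 1)"
  using assms by (simp add: continuous_on_def)
 then show "(f \<longlongrightarrow> f (cis t)) (at (cis t) within stolz \<beta> (cis t))"
  by (rule tendsto_within_subset) (auto simp: stolz_def)
qed

lemma ennreal_powr_root_finite:
 assumes "0 < p" "ennreal_powr x (1 / real p) \<noteq> \<infinity>"
 obtains A where "0 \<le> A" "x = ennreal (A ^ p)" "ennreal_powr x (1 / real p) = ennreal A"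
proof -
 have "x \<noteq> \<infinity>" using assms(2) by (auto simp: ennreal_powr_def)
 then obtain a where a: "0 \<le> a" "x = ennreal a" by (cases x) auto
 have "(a powr (1 / real p)) ^ p = a"
  using a assms by (cases "a = 0") (auto simp: powr_realpow[symmetric] powr_powr)
 then show ?thesis using that[of "a powr (1 / real p)"] a by (simp add: ennreal_powr_def)
qed

lemma ennreal_powr_root_eq_0:
 assumes "0 < p" "ennreal_powr x (1 / real p) = 0"
 shows "x = 0"
proof (rule ennreal_powr_root_finite[OF assms(1), of x])
 show "ennreal_powr x (1 / real p) \<noteq> \<infinity>" using assms(2) by simp
 fix A assume "0 \<le> A" "x = ennreal (A ^ p)" "ennreal_powr x (1 / real p) = ennreal A"
 then show "x = 0" using assms by (simp add: power_0_left)
qed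

text \<open>The data of the approximation problem in the disk: \<open>\<rho>\<close> is the weight on the curve as a function of the angle, \<open>d\<close> the boundary function of the outer
 function with modulus \<open>exp u\<close>, which represents the Szego function up to a constant factor, and \<open>c\<close> turns it into \<open>D / D(0)\<close>.\<close>

locale outer_disk = boundary_disk +
 fixes p :: nat and u :: "real \<Rightarrow> real" and d :: "real \<Rightarrow> complex" and \<rho> :: "real \<Rightarrow> real" and c :: complex
 assumes p: "2 \<le> p"
  and u_int: "integrable circle u"
  and d_meas [measurable]: "d \<in> borel_measurable circle"
  and d_nt: "AE t in circle. ntlim (\<lambda>w. exp (herglotz u w)) (cis t) (d t) \<and> cmod (d t) = exp (u t)"
  and \<rho>_meas [measurable]: "\<rho> \<in> borel_measurable circle"
  and \<rho>_pos: "AE t in circle. 0 < \<rho> t"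
  and exp_u: "AE t in circle. exp (u t) ^ p = \<rho> t * cmod (F t)"
  and c: "c \<noteq> 0"
begin

definition outer :: "complex \<Rightarrow> complex" where
 "outer w = exp (herglotz u w)"

lemma outer_nonzero: "outer w \<noteq> 0" by (simp add: outer_def)

lemma outer_holomorphic: "outer holomorphic_on ball 0 1"
 unfolding outer_def[abs_def] by (intro holomorphic_intros herglotz_holomorphic u_int)

lemma smirnov_outer': "smirnov outer"
 unfolding outer_def[abs_def] by (rule smirnov_outer[OF u_int])

text \<open>The \<open>p\<close>-th power of the norm of \<open>D / D(0) - Q\<close> with weight \<open>\<rho>\<close> on the curve, as an integral over the circle.\<close>

definition weighted_error :: "complex poly \<Rightarrow> ennreal" where
 "weighted_error Q = (\<integral>\<^sup>+t. ennreal (cmod (F t)) * ennreal (cmod (c * d t - poly Q (\<psi> (cis t))) ^ p * \<rho> t) \<partial>circle)"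

lemma poly_boundary:
 fixes Q :: "complex poly"
 shows "smirnov (\<lambda>w. poly Q (\<psi> w))" "ntlim (\<lambda>w. poly Q (\<psi> w)) (cis t) (poly Q (\<psi> (cis t)))"
  "(\<lambda>t. poly Q (\<psi> (cis t))) \<in> borel_measurable circle"
proof -
 have c: "continuous_on (cball 0 1) (\<lambda>w. poly Q (\<psi> w))" by (intro continuous_intros cont)
 then have "bounded ((\<lambda>w. poly Q (\<psi> w)) ` cball 0 1)"
  by (intro compact_imp_bounded compact_continuous_image) auto
 then obtain B where "\<forall>w\<in>cball 0 1. cmod (poly Q (\<psi> w)) \<le> B" by (auto simp: bounded_iff)
 then show "smirnov (\<lambda>w. poly Q (\<psi> w))"
  by (intro smirnov_bounded[of _ B] holomorphic_intros hol) auto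
 show "ntlim (\<lambda>w. poly Q (\<psi> w)) (cis t) (poly Q (\<psi> (cis t)))" by (rule ntlim_continuous[OF c])
 show "(\<lambda>t. poly Q (\<psi> (cis t))) \<in> borel_measurable circle"
  by (intro borel_measurable_circle_continuous continuous_on_compose2[OF c] continuous_intros) auto
qed

lemma primitive_error:
 fixes Q :: "complex poly"
 assumes w: "cmod w < 1"
  and P: "\<And>z. z \<in> ball 0 1 \<Longrightarrow> (P has_field_derivative (poly Q (\<psi> z) ^ p - (c * outer z) ^ p) * deriv \<psi> z) (at z)"
 shows "ennreal (cmod (P w - P 0)) \<le> ennreal (1 / 2) *
  (\<integral>\<^sup>+t. ennreal (cmod (poly Q (\<psi> (cis t)) ^ p - (c * d t) ^ p)) * ennreal (cmod (F t)) \<partial>circle)"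
proof (rule smirnov_primitive_bound[OF _ _ _ w P])
 note [measurable] = poly_boundary(3)
 show "smirnov (\<lambda>z. poly Q (\<psi> z) ^ p - (c * outer z) ^ p)"
  by (intro smirnov_diff smirnov_power smirnov_cmult poly_boundary smirnov_outer')
 show "(\<lambda>t. poly Q (\<psi> (cis t)) ^ p - (c * d t) ^ p) \<in> borel_measurable circle" by measurable
 show "AE t in circle. ntlim (\<lambda>z. poly Q (\<psi> z) ^ p - (c * outer z) ^ p) (cis t) (poly Q (\<psi> (cis t)) ^ p - (c * d t) ^ p)"
  using d_nt by eventually_elim (unfold outer_def, intro ntlim_algebra poly_boundary, blast)
qed

text \<open>By the defining property of the outer function, \<open>(Q - B) D\<close> has on the circle the same \<open>L\<^sup>p\<close> norm
 as \<open>Q - B\<close> has on the curve with the weight \<open>\<rho>\<close>.\<close>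

lemma pointwise_error:
 fixes Q :: "complex poly"
 assumes w: "cmod w < 1" and e: "0 < e"
  and le: "weighted_error Q \<le> ennreal (e ^ p)"
 shows "2 * pi * cmod (poly Q (\<psi> w) - c * outer w) * cmod (outer w) \<le> 1 / (1 - cmod w) * ((1 + 2 * pi) * e)"
proof -
 note [measurable] = poly_boundary(3)
 define h where "h t = (poly Q (\<psi> (cis t)) - c * d t) * d t" for t
 have [measurable]: "h \<in> borel_measurable circle" unfolding h_def by measurable
 have hp: "AE t in circle. ennreal (cmod (h t) ^ p) = ennreal (cmod (F t)) * ennreal (cmod (c * d t - poly Q (\<psi> (cis t))) ^ p * \<rho> t)"
  using d_nt exp_u
 proof eventually_elim
  case (elim t)
  have "cmod (h t) ^ p = cmod (c * d t - poly Q (\<psi> (cis t))) ^ p * cmod (d t) ^ p"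
   by (simp add: h_def norm_mult power_mult_distrib norm_minus_commute)
  also have "\<dots> = cmod (F t) * (cmod (c * d t - poly Q (\<psi> (cis t))) ^ p * \<rho> t)" using elim by simp
  finally show ?case by (simp add: ennreal_mult')
 qed
 \<comment> \<open>A form of Hoelder's inequality on a finite measure space that avoids roots.\<close>
 have young: "x \<le> e * (x / e) ^ p + e" if "0 \<le> x" for x
 proof (cases "x \<le> e")
  case True then show ?thesis using e that by (simp add: add_increasing)
 next
  case False
  then have "(x / e) ^ 1 \<le> (x / e) ^ p" using e p by (intro power_increasing) auto
  then have "e * (x / e) \<le> e * (x / e) ^ p" using e by (intro mult_left_mono) auto
  then show ?thesis using e by simp
 qed
 have "(\<integral>\<^sup>+t. ennreal (cmod (h t)) \<partial>circle) \<le> (\<integral>\<^sup>+t. ennreal (e / e ^ p) * ennreal (cmod (h t) ^ p) + ennreal e \<partial>circle)"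
 proof (rule nn_integral_mono)
  fix t
  have "ennreal (cmod (h t)) \<le> ennreal (e / e ^ p * cmod (h t) ^ p + e)"
   using young[of "cmod (h t)"] by (intro ennreal_leI) (simp add: power_divide)
  also have "\<dots> = ennreal (e / e ^ p) * ennreal (cmod (h t) ^ p) + ennreal e"
   using e by (subst ennreal_plus) (auto simp: ennreal_mult'[symmetric])
  finally show "ennreal (cmod (h t)) \<le> ennreal (e / e ^ p) * ennreal (cmod (h t) ^ p) + ennreal e" .
 qed
 also have "\<dots> = ennreal (e / e ^ p) * (\<integral>\<^sup>+t. ennreal (cmod (h t) ^ p) \<partial>circle) + ennreal e * ennreal (2 * pi)"
  by (simp add: nn_integral_add nn_integral_cmult)
 also have "(\<integral>\<^sup>+t. ennreal (cmod (h t) ^ p) \<partial>circle) \<le> ennreal (e ^ p)"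
  using le nn_integral_cong_AE[OF hp] by (simp add: weighted_error_def)
 also have "ennreal (e / e ^ p) * ennreal (e ^ p) + ennreal e * ennreal (2 * pi) = ennreal ((1 + 2 * pi) * e)"
  using e by (simp add: ennreal_mult'[symmetric] ennreal_plus[symmetric] algebra_simps del: ennreal_plus)
 finally have L1: "(\<integral>\<^sup>+t. ennreal (cmod (h t)) \<partial>circle) \<le> ennreal ((1 + 2 * pi) * e)"
  by (simp add: mult_left_mono)
 have "ennreal (2 * pi * cmod ((poly Q (\<psi> w) - c * outer w) * outer w)) \<le> ennreal (1 / (1 - cmod w)) * (\<integral>\<^sup>+t. ennreal (cmod (h t)) \<partial>circle)"
 proof (rule smirnov_pointwise_bound[OF _ _ _ w])
  show "smirnov (\<lambda>w. (poly Q (\<psi> w) - c * outer w) * outer w)"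
   by (intro smirnov_binary(2) smirnov_diff smirnov_cmult poly_boundary smirnov_outer')
  show "AE t in circle. ntlim (\<lambda>w. (poly Q (\<psi> w) - c * outer w) * outer w) (cis t) (h t)"
   using d_nt by eventually_elim (unfold outer_def h_def, intro ntlim_algebra poly_boundary, blast+)
 qed measurable
 also have "\<dots> \<le> ennreal (1 / (1 - cmod w)) * ennreal ((1 + 2 * pi) * e)" by (intro mult_left_mono L1) simp
 also have "\<dots> = ennreal (1 / (1 - cmod w) * ((1 + 2 * pi) * e))" using w by (intro ennreal_mult'[symmetric]) simp
 finally show ?thesis
  using w e by (subst (asm) ennreal_le_iff) (auto simp: norm_mult mult.assoc intro!: mult_nonneg_nonneg divide_nonneg_nonneg)
qed

text \<open>In the arithmetic of \<open>[0, \<infinity>]\<close> the product on the right may be \<open>0 \<cdot> \<infinity> = 0\<close>. This does not happen unless the left-hand side vanishes: if \<open>\<alpha> = 0\<close> then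
 \<open>Q = c d\<close> almost everywhere, and \<open>\<gamma>\<close> is positive because \<open>d\<close> has no zeros. If all three norms are finite, the weighted inequality of Hoelder applies.\<close>

theorem error_estimate:
 fixes Q :: "complex poly"
 assumes q: "q = real p / (real p - 1)"
  and \<alpha>: "\<alpha> = ennreal_powr (weighted_error Q) (1 / real p)"
  and \<beta>: "\<beta> = ennreal_powr (\<integral>\<^sup>+t. ennreal (cmod (F t)) * ennreal (cmod (poly Q (\<psi> (cis t))) ^ p * \<rho> t powr (1 - q)) \<partial>circle) (1 / real p)"
  and \<gamma>: "\<gamma> = ennreal_powr (\<integral>\<^sup>+t. ennreal (cmod (F t)) * ennreal (cmod (d t) ^ p * \<rho> t powr (1 - q)) \<partial>circle) (1 / real p)"
 shows "ennreal (1 / 2) * (\<integral>\<^sup>+t. ennreal (cmod (poly Q (\<psi> (cis t)) ^ p - (c * d t) ^ p)) * ennreal (cmod (F t)) \<partial>circle)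
  \<le> \<alpha> / 2 * (\<gamma> * ennreal (cmod c) + \<beta>) ^ (p - 1)"
  (is "_ * ?I \<le> _")
proof (cases "?I = 0")
 case False
 note [measurable] = poly_boundary(3)
 have p0: "0 < p" and p1: "0 < p - 1" "Suc (p - 1) = p" using p by auto
 define x where "x t = cmod (poly Q (\<psi> (cis t)) - c * d t)" for t
 define y where "y t = cmod (poly Q (\<psi> (cis t)))" for t
 define z where "z t = cmod (c * d t)" for t
 have [measurable]: "x \<in> borel_measurable circle" "y \<in> borel_measurable circle" "z \<in> borel_measurable circle"
  unfolding x_def y_def z_def by measurable
 have \<alpha>0: "\<alpha> \<noteq> 0"
 proof
  assume "\<alpha> = 0"
  then have 0: "weighted_error Q = 0"
   unfolding \<alpha> by (rule ennreal_powr_root_eq_0[OF p0])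
  have "AE t in circle. ennreal (cmod (F t)) * ennreal (cmod (c * d t - poly Q (\<psi> (cis t))) ^ p * \<rho> t) = 0"
   using 0 unfolding weighted_error_def by (subst (asm) nn_integral_0_iff_AE) measurable
  with F_nonzero \<rho>_pos have "AE t in circle. ennreal (cmod (poly Q (\<psi> (cis t)) ^ p - (c * d t) ^ p)) * ennreal (cmod (F t)) = 0"
  proof eventually_elim
   case (elim t)
   then have "cmod (c * d t - poly Q (\<psi> (cis t))) ^ p * \<rho> t \<le> 0" by (simp add: ennreal_eq_0_iff)
   then have "cmod (c * d t - poly Q (\<psi> (cis t))) ^ p \<le> 0" using elim(2) by (simp add: mult_le_0_iff)
   then have "poly Q (\<psi> (cis t)) = c * d t" using p0 by (auto simp: power_le_zero_eq)
   then show ?case by simp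
  qed
  then have "?I = 0" by (subst nn_integral_0_iff_AE) measurable
  with False show False by simp
 qed
 have \<gamma>0: "\<gamma> \<noteq> 0"
 proof
  assume "\<gamma> = 0"
  then have 0: "(\<integral>\<^sup>+t. ennreal (cmod (F t)) * ennreal (cmod (d t) ^ p * \<rho> t powr (1 - q)) \<partial>circle) = 0"
   unfolding \<gamma> by (rule ennreal_powr_root_eq_0[OF p0])
  have "AE t in circle. ennreal (cmod (F t)) * ennreal (cmod (d t) ^ p * \<rho> t powr (1 - q)) = 0"
   using 0 by (subst (asm) nn_integral_0_iff_AE) measurable
  with F_nonzero \<rho>_pos d_nt have "AE t in circle. ennreal (cmod (poly Q (\<psi> (cis t)) ^ p - (c * d t) ^ p)) * ennreal (cmod (F t)) = 0"
  proof eventually_elim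
   case (elim t)
   have "0 < cmod (d t) ^ p * \<rho> t powr (1 - q)" using elim by simp
   then have "ennreal (cmod (d t) ^ p * \<rho> t powr (1 - q)) \<noteq> 0" by (simp only: ennreal_eq_0_iff not_le)
   then show ?case using elim(1,4) by simp
  qed
  then have "?I = 0" by (subst nn_integral_0_iff_AE) measurable
  with False show False by simp
 qed
 have cpos: "ennreal (cmod c) \<noteq> 0" using c by simp
 consider (inf1) "\<alpha> = \<infinity>" | (inf2) "\<gamma> = \<infinity>" | (inf3) "\<beta> = \<infinity>"
  | (fin) "\<alpha> \<noteq> \<infinity>" "\<beta> \<noteq> \<infinity>" "\<gamma> \<noteq> \<infinity>" by blast
 then show ?thesis
 proof cases
  case inf1
  define S where "S = \<gamma> * ennreal (cmod c) + \<beta>"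
  have "S \<noteq> 0" unfolding S_def using \<gamma>0 cpos by auto
  then show ?thesis unfolding S_def[symmetric] using inf1 by (simp add: ennreal_top_divide ennreal_top_mult)
 next
  case inf2
  then have "(\<gamma> * ennreal (cmod c) + \<beta>) ^ (p - 1) = top" using cpos p1(1) by (simp add: ennreal_top_mult power_eq_top_ennreal)
  then show ?thesis using \<alpha>0 by (simp only:) (simp add: ennreal_mult_top)
 next
  case inf3
  then have "(\<gamma> * ennreal (cmod c) + \<beta>) ^ (p - 1) = top" using p1(1) by (simp add: power_eq_top_ennreal)
  then show ?thesis using \<alpha>0 by (simp only:) (simp add: ennreal_mult_top)
 next
  case fin0: fin
  obtain A where A: "0 \<le> A" "\<alpha> = ennreal A"
   "weighted_error Q = ennreal (A ^ p)"
   using fin0(1) unfolding \<alpha> by (rule ennreal_powr_root_finite[OF p0])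
  obtain B where B: "0 \<le> B" "\<beta> = ennreal B"
   "(\<integral>\<^sup>+t. ennreal (cmod (F t)) * ennreal (cmod (poly Q (\<psi> (cis t))) ^ p * \<rho> t powr (1 - q)) \<partial>circle) = ennreal (B ^ p)"
   using fin0(2) unfolding \<beta> by (rule ennreal_powr_root_finite[OF p0])
  obtain C where C: "0 \<le> C" "\<gamma> = ennreal C"
   "(\<integral>\<^sup>+t. ennreal (cmod (F t)) * ennreal (cmod (d t) ^ p * \<rho> t powr (1 - q)) \<partial>circle) = ennreal (C ^ p)"
   using fin0(3) unfolding \<gamma> by (rule ennreal_powr_root_finite[OF p0])
  note fin = A B C
  define M where "M = density circle (\<lambda>t. ennreal (cmod (F t)))"
  have M: "(\<integral>\<^sup>+t. X t \<partial>M) = (\<integral>\<^sup>+t. ennreal (cmod (F t)) * X t \<partial>circle)" if "X \<in> borel_measurable circle" for X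
   unfolding M_def using that by (intro nn_integral_density) auto
  define s where "s t = \<rho> t powr (1 / real p)" for t
  define v where "v t = \<rho> t powr ((1 - q) / real p)" for t
  have [measurable]: "s \<in> borel_measurable circle" "v \<in> borel_measurable circle"
   unfolding s_def v_def by measurable
  have qp: "1 / real p + real (p - 1) * ((1 - q) / real p) = 0"
   using p by (simp add: q of_nat_diff field_simps)
  have dual: "s t * v t ^ (p - 1) = 1" and sp: "s t ^ p = \<rho> t" and vp: "v t ^ p = \<rho> t powr (1 - q)" if "0 < \<rho> t" for t
  proof -
   have "v t ^ (p - 1) = \<rho> t powr (real (p - 1) * ((1 - q) / real p))"
    using that by (simp add: v_def powr_realpow[symmetric] powr_powr mult.commute)
   then show "s t * v t ^ (p - 1) = 1" unfolding s_def using that qp by (simp add: powr_add[symmetric])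
   show "s t ^ p = \<rho> t" "v t ^ p = \<rho> t powr (1 - q)"
    using that p0 by (simp_all add: s_def v_def powr_realpow[symmetric] powr_powr)
  qed
  have "?I = (\<integral>\<^sup>+t. ennreal (cmod (poly Q (\<psi> (cis t)) ^ p - (c * d t) ^ p)) \<partial>M)"
   by (subst M) (simp_all add: mult.commute)
  also have "\<dots> \<le> (\<integral>\<^sup>+t. ennreal (x t * (y t + z t) ^ (p - 1)) \<partial>M)"
   unfolding x_def y_def z_def using power_diff_bound[of _ "p - 1"] unfolding p1 by (intro nn_integral_mono ennreal_leI) auto
  also have "\<dots> \<le> ennreal (A * (B + cmod c * C) ^ (p - 1))"
  proof (rule weighted_hoelder[where s = s and t = v])
   have "AE t in M. 0 < \<rho> t" unfolding M_def using \<rho>_pos by (subst AE_density) auto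
   then show "AE t in M. s t * v t ^ (p - 1) = 1" by eventually_elim (rule dual)
   have "(\<integral>\<^sup>+t. ennreal ((x t * s t) ^ Suc (p - 1)) \<partial>M) = weighted_error Q"
    unfolding p1 weighted_error_def by (subst M, measurable, rule nn_integral_cong_AE, use \<rho>_pos in eventually_elim)
     (simp add: x_def sp power_mult_distrib norm_minus_commute)
   then show "(\<integral>\<^sup>+t. ennreal ((x t * s t) ^ Suc (p - 1)) \<partial>M) = ennreal (A ^ Suc (p - 1))" using fin p1 by simp
   have "(\<integral>\<^sup>+t. ennreal ((y t * v t) ^ Suc (p - 1)) \<partial>M) = (\<integral>\<^sup>+t. ennreal (cmod (F t)) * ennreal (cmod (poly Q (\<psi> (cis t))) ^ p * \<rho> t powr (1 - q)) \<partial>circle)"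
    unfolding p1 by (subst M, measurable, rule nn_integral_cong_AE, use \<rho>_pos in eventually_elim)
     (simp add: y_def vp power_mult_distrib)
   then show "(\<integral>\<^sup>+t. ennreal ((y t * v t) ^ Suc (p - 1)) \<partial>M) = ennreal (B ^ Suc (p - 1))" using fin p1 by simp
   have "(\<integral>\<^sup>+t. ennreal ((z t * v t) ^ Suc (p - 1)) \<partial>M) = (\<integral>\<^sup>+t. ennreal (cmod c ^ p) * (ennreal (cmod (F t)) * ennreal (cmod (d t) ^ p * \<rho> t powr (1 - q))) \<partial>circle)"
    unfolding p1 by (subst M, measurable, rule nn_integral_cong_AE, use \<rho>_pos in eventually_elim)
     (simp add: z_def vp power_mult_distrib norm_mult ennreal_mult' ac_simps)
   also have "\<dots> = ennreal (cmod c ^ p) * ennreal (C ^ p)"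
    by (subst nn_integral_cmult) (use fin in auto)
   also have "\<dots> = ennreal ((cmod c * C) ^ Suc (p - 1))" unfolding p1 power_mult_distrib by (rule ennreal_mult'[symmetric]) simp
   finally show "(\<integral>\<^sup>+t. ennreal ((z t * v t) ^ Suc (p - 1)) \<partial>M) = ennreal ((cmod c * C) ^ Suc (p - 1))" .
  qed (use fin in \<open>auto simp: M_def x_def y_def z_def s_def v_def\<close>)
  finally have "ennreal (1 / 2) * ?I \<le> ennreal (1 / 2) * ennreal (A * (B + cmod c * C) ^ (p - 1))" by (rule mult_left_mono) simp
  also have "\<dots> = ennreal (1 / 2 * (A * (B + cmod c * C) ^ (p - 1)))" by (rule ennreal_mult'[symmetric]) simp
  also have "1 / 2 * (A * (B + cmod c * C) ^ (p - 1)) = A / 2 * (C * cmod c + B) ^ (p - 1)" by (simp add: ac_simps)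
  also have "ennreal \<dots> = ennreal (A / 2) * ennreal ((C * cmod c + B) ^ (p - 1))" by (rule ennreal_mult') (use fin in simp)
  also have "ennreal ((C * cmod c + B) ^ (p - 1)) = ennreal (C * cmod c + B) ^ (p - 1)" by (rule ennreal_power[symmetric]) (use fin in simp)
  also have "ennreal (C * cmod c + B) = \<gamma> * ennreal (cmod c) + \<beta>" using fin by (simp add: ennreal_plus ennreal_mult')
  also have "ennreal (A / 2) = \<alpha> / 2" using fin by (simp add: ennreal_divide_numeral)
  finally show ?thesis .
 qed
qed simp

end

text \<open>On a compact subdisk all quantities in the pointwise estimate are under control, since the outer function has no zeros.\<close>

lemma (in outer_disk) compact_error:
 assumes R: "0 < R" "R < 1"
 obtains C where "0 \<le> C"
  "\<And>Q e P w. 0 < e \<Longrightarrow> e \<le> 1 \<Longrightarrow>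
   weighted_error Q \<le> ennreal (e ^ p) \<Longrightarrow>
   (\<And>z. z \<in> ball 0 1 \<Longrightarrow> (P has_field_derivative (poly Q (\<psi> z) ^ p - (c * outer z) ^ p) * deriv \<psi> z) (at z)) \<Longrightarrow>
   cmod w \<le> R \<Longrightarrow> cmod (P w - P 0) \<le> C * e"
proof -
 define K where "K = cball (0::complex) R"
 have K: "compact K" "0 \<in> K" "convex K" and K1: "K \<subseteq> ball 0 1" using R by (auto simp: K_def)
 have oc: "continuous_on K outer" and pc: "continuous_on K (deriv \<psi>)"
  using K1 by (auto intro: continuous_on_subset[OF holomorphic_on_imp_continuous_on] outer_holomorphic deriv_holomorphic)
 have "bounded (outer ` K)" "bounded (deriv \<psi> ` K)"
  by (intro compact_imp_bounded compact_continuous_image oc pc K)+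
 then obtain M1 M2 where M1: "\<forall>z\<in>K. cmod (outer z) \<le> M1" and M2: "\<forall>z\<in>K. cmod (deriv \<psi> z) \<le> M2" by (auto simp: bounded_iff)
 have "continuous_on K (\<lambda>z. cmod (outer z))" by (intro continuous_intros oc)
 from continuous_attains_inf[OF K(1) _ this] K(2) obtain z0 where z0: "z0 \<in> K" "\<forall>z\<in>K. cmod (outer z0) \<le> cmod (outer z)" by auto
 \<comment> \<open>A lower bound for the outer function allows division by it.\<close>
 define \<delta> where "\<delta> = cmod (outer z0)"
 have \<delta>: "0 < \<delta>" using outer_nonzero by (simp add: \<delta>_def)
 have M0: "0 \<le> M1" "0 \<le> M2" using M1 M2 K(2) norm_ge_zero order_trans by blast+
 define C1 where "C1 = (1 + 2 * pi) / (1 - R) / \<delta>"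
 have C1: "0 \<le> C1" using R \<delta> by (simp add: C1_def)
 define C where "C = C1 * (2 * cmod c * M1 + C1) ^ (p - 1) * M2"
 show ?thesis
 proof (rule that[of C])
  show "0 \<le> C" using C1 M0 by (simp add: C_def)
 next
  fix Q :: "complex poly" and e :: real and P :: "complex \<Rightarrow> complex" and w :: complex
  assume e: "0 < e" "e \<le> 1"
   and le: "weighted_error Q \<le> ennreal (e ^ p)"
   and P: "\<And>z. z \<in> ball 0 1 \<Longrightarrow> (P has_field_derivative (poly Q (\<psi> z) ^ p - (c * outer z) ^ p) * deriv \<psi> z) (at z)"
   and w: "cmod w \<le> R"
  have diff: "cmod (poly Q (\<psi> z) - c * outer z) \<le> C1 * e" if z: "z \<in> K" for z
  proof -
   define X where "X = cmod (poly Q (\<psi> z) - c * outer z)"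
   have zR: "cmod z \<le> R" "cmod z < 1" using z R by (auto simp: K_def)
   have "1 * X * \<delta> \<le> 2 * pi * X * cmod (outer z)"
    using z0(2) z pi_ge_two \<delta> by (intro mult_mono) (auto simp: X_def \<delta>_def)
   also have "\<dots> \<le> 1 / (1 - cmod z) * ((1 + 2 * pi) * e)"
    unfolding X_def by (rule pointwise_error[OF zR(2) e(1) le])
   also have "\<dots> \<le> 1 / (1 - R) * ((1 + 2 * pi) * e)"
    using zR R e by (intro mult_right_mono divide_left_mono) auto
   finally have "X * \<delta> \<le> 1 / (1 - R) * ((1 + 2 * pi) * e)" by simp
   then have "X \<le> 1 / (1 - R) * ((1 + 2 * pi) * e) / \<delta>" using \<delta> by (simp only: pos_le_divide_eq)
   also have "\<dots> = C1 * e" by (simp add: C1_def)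
   finally show ?thesis by (simp add: X_def)
  qed
  have "cmod (P w - P 0) \<le> C * e * cmod (w - 0)"
  proof (rule field_differentiable_bound[OF K(3)])
   fix z assume z: "z \<in> K"
   show "(P has_field_derivative (poly Q (\<psi> z) ^ p - (c * outer z) ^ p) * deriv \<psi> z) (at z within K)"
    by (rule has_field_derivative_at_within[OF P]) (use z K1 in auto)
   have co: "cmod (c * outer z) \<le> cmod c * M1" unfolding norm_mult using M1 z by (intro mult_left_mono) auto
   have "cmod (poly Q (\<psi> z)) \<le> cmod (poly Q (\<psi> z) - c * outer z) + cmod (c * outer z)"
    using norm_triangle_ineq[of "poly Q (\<psi> z) - c * outer z" "c * outer z"] by simp
   also have "\<dots> \<le> C1 * 1 + cmod c * M1"
    using diff[OF z] C1 e co by (intro add_mono order_trans[OF diff[OF z]] mult_left_mono) auto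
   finally have sum: "cmod (poly Q (\<psi> z)) + cmod (c * outer z) \<le> 2 * cmod c * M1 + C1" using co by simp
   have "cmod (poly Q (\<psi> z) ^ p - (c * outer z) ^ p) \<le> cmod (poly Q (\<psi> z) - c * outer z) * (cmod (poly Q (\<psi> z)) + cmod (c * outer z)) ^ (p - 1)"
    using power_diff_bound[of _ "p - 1"] p by auto
   also have "\<dots> \<le> (C1 * e) * (2 * cmod c * M1 + C1) ^ (p - 1)"
    using C1 e by (intro mult_mono power_mono diff z sum) auto
   finally have "cmod (poly Q (\<psi> z) ^ p - (c * outer z) ^ p) * cmod (deriv \<psi> z) \<le> (C1 * e) * (2 * cmod c * M1 + C1) ^ (p - 1) * M2"
    by (rule mult_mono) (use M2 z C1 e M0 in auto)
   also have "\<dots> = C * e" by (simp add: C_def)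
   finally show "cmod ((poly Q (\<psi> z) ^ p - (c * outer z) ^ p) * deriv \<psi> z) \<le> C * e" by (simp add: norm_mult)
  qed (use w K in \<open>auto simp: K_def\<close>)
  also have "\<dots> \<le> C * e * 1" using w R C1 M0 e by (intro mult_left_mono) (auto simp: C_def)
  finally show "cmod (P w - P 0) \<le> C * e" by simp
 qed
qed

section \<open>Integrals along paths\<close>

lemma path_integral_primitive:
 assumes G: "open G" "connected G" and z: "\<xi> \<in> G" "z \<in> G"
  and U: "\<And>z. z \<in> G \<Longrightarrow> (U has_field_derivative f z) (at z)"
 shows "path_integral G \<xi> f z = U z - U \<xi>"
 unfolding path_integral_def
proof (rule the_equality)
 show int: "\<forall>c. valid_path c \<and> path_image c \<subseteq> G \<and> pathstart c = \<xi> \<and> pathfinish c = z \<longrightarrow> (f has_contour_integral U z - U \<xi>) c"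
  using contour_integral_primitive[of G U f] has_field_derivative_at_within[OF U] by blast
 fix I assume I: "\<forall>c. valid_path c \<and> path_image c \<subseteq> G \<and> pathstart c = \<xi> \<and> pathfinish c = z \<longrightarrow> (f has_contour_integral I) c"
 obtain c where "polynomial_function c" "path_image c \<subseteq> G" "pathstart c = \<xi>" "pathfinish c = z"
  using connected_open_polynomial_connected[OF G z] by blast
 then show "I = U z - U \<xi>"
  using int I has_contour_integral_unique valid_path_polynomial_function by metis
qed

section \<open>The Szego function as an outer function\<close>

context boundary_disk
begin

lemma bvalue_boundary:
 assumes "AE t in circle. ntlim (\<lambda>w. f (\<psi> w)) (cis t) (L t)"
 shows "AE t in circle. bvalue G f (\<psi> (cis t)) = L t"
 using AE_regular assms by eventually_elim (rule bvalue_eq)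

text \<open>The derivative of the inverse map is \<open>\<omega> / \<psi>'\<close> inside the disk. The constant \<open>\<omega>\<close> allows for a rotation of the conformal map.\<close>

lemma bvalue_deriv_inverse:
 assumes hol0: "(\<lambda>z. \<omega> * \<phi> z) holomorphic_on G"
 shows "AE t in circle. bvalue G (deriv (\<lambda>z. \<omega> * \<phi> z)) (\<psi> (cis t)) = \<omega> / F t"
proof (rule bvalue_boundary)
 have *: "deriv (\<lambda>z. \<omega> * \<phi> z) (\<psi> w) = \<omega> / deriv \<psi> w" if w: "cmod w < 1" for w
 proof -
  have wb: "w \<in> ball 0 1" using w by simp
  then have "\<psi> w \<in> G" using image by blast
  then have 1: "((\<lambda>z. \<omega> * \<phi> z) has_field_derivative deriv (\<lambda>z. \<omega> * \<phi> z) (\<psi> w)) (at (\<psi> w))"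
   by (rule holomorphic_derivI[OF hol0 open_G])
  have 2: "(\<psi> has_field_derivative deriv \<psi> w) (at w)"
   by (rule holomorphic_derivI[OF hol open_ball wb])
  have "((\<lambda>w. \<omega> * \<phi> (\<psi> w)) has_field_derivative deriv (\<lambda>z. \<omega> * \<phi> z) (\<psi> w) * deriv \<psi> w) (at w)"
   by (rule DERIV_chain2[OF 1 2])
  moreover have "((\<lambda>w. \<omega> * \<phi> (\<psi> w)) has_field_derivative \<omega>) (at w)"
  proof (rule has_field_derivative_transform_within_open[OF _ open_ball wb])
   show "((\<lambda>w. \<omega> * w) has_field_derivative \<omega>) (at w)" by (auto intro!: derivative_eq_intros)
   show "\<And>x. x \<in> ball 0 1 \<Longrightarrow> \<omega> * x = \<omega> * \<phi> (\<psi> x)" using \<phi>\<psi> by simp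
  qed
  ultimately have "deriv (\<lambda>z. \<omega> * \<phi> z) (\<psi> w) * deriv \<psi> w = \<omega>" by (rule DERIV_unique)
  then show ?thesis using deriv_nonzero[OF wb] by (simp add: field_simps)
 qed
 show "AE t in circle. ntlim (\<lambda>w. deriv (\<lambda>z. \<omega> * \<phi> z) (\<psi> w)) (cis t) (\<omega> / F t)"
  using F_nt F_nonzero
 proof eventually_elim
  case (elim t)
  show ?case by (rule ntlim_compose_eventually[OF elim(1), where F = "\<lambda>y. \<omega> / y"]) (use elim * in \<open>auto intro!: continuous_intros\<close>)
 qed
qed

text \<open>Substituting \<open>t = \<psi>(e\<^sup>i\<^sup>s)\<close> turns the integral in the Szego function into the Herglotz integral of \<open>log (\<rho> \<bar>F\<bar>) / p\<close>. This function is
 integrable: its positive part is at most \<open>\<rho> \<bar>F\<bar>\<close>, and its negative part is controlled by the Szego condition and the integrability of \<open>log \<bar>F\<bar>\<close>.\<close>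

theorem szego_function_outer:
 assumes p: "2 \<le> p" and \<omega>: "cmod \<omega> = 1" and hol0: "(\<lambda>z. \<omega> * \<phi> z) holomorphic_on G"
  and \<phi>0: "\<phi>0 = (\<lambda>z. \<omega> * \<phi> z)" and \<phi>': "\<phi>' = bvalue G (deriv \<phi>0)" and \<Lambda>: "\<Lambda> = completion arc_measure"
  and \<rho>m: "\<rho> \<in> borel_measurable \<Lambda>" and \<rho>_nonneg: "\<And>z. z \<in> frontier G \<Longrightarrow> 0 \<le> \<rho> z"
  and \<rho>_int: "(\<integral>\<^sup>+t. ennreal (\<rho> t) \<partial>\<Lambda>) < \<infinity>" and szego: "szego_condition \<Lambda> \<phi>' \<rho>"
  and D: "D = szego_function p \<Lambda> \<phi>0 \<phi>' \<rho>" and zero: "0 \<in> G"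
 obtains u d \<rho>1 \<kappa> where "outer_disk G \<psi> \<phi> F r p u d \<rho>1 (\<kappa> / D 0)"
  "AE t in circle. \<rho> (\<psi> (cis t)) = \<rho>1 t"
  "AE t in circle. cmod (\<phi>' (\<psi> (cis t))) = 1 / cmod (F t)"
  "AE t in circle. bvalue G D (\<psi> (cis t)) = \<kappa> * d t"
  "\<And>z. z \<in> G \<Longrightarrow> D z = \<kappa> * exp (herglotz u (\<phi> z))" "cmod \<kappa> = 1" "0 < Re (D 0)" "D 0 = of_real (Re (D 0))"
proof -
 obtain \<rho>0 where \<rho>0: "\<rho>0 \<in> borel_measurable arc_measure" "AE z in arc_measure. \<rho> z = \<rho>0 z"
  using completion_ex_borel_measurable_real[of \<rho> arc_measure] \<rho>m unfolding \<Lambda> by blast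
 define \<rho>1 where "\<rho>1 t = \<rho>0 (\<psi> (cis t))" for t
 have "\<rho>0 \<in> borel_measurable borel" using \<rho>0(1) by (simp add: arc_measure_def)
 then have \<rho>1m [measurable]: "\<rho>1 \<in> borel_measurable circle"
  unfolding \<rho>1_def[abs_def] by (rule measurable_compose[OF boundary_measurable])
 have \<rho>1_eq: "AE t in circle. \<rho> (\<psi> (cis t)) = \<rho>1 t"
  using AE_completion[OF \<rho>0(2)] unfolding AE_arc \<rho>1_def .
 have \<phi>'_eq: "AE t in circle. cmod (\<phi>' (\<psi> (cis t))) = 1 / cmod (F t)"
  using bvalue_deriv_inverse[OF hol0] unfolding \<phi>' \<phi>0
  by eventually_elim (simp add: norm_divide \<omega>)
 define X where "X t = (if \<rho>1 t = 0 then \<infinity> else ennreal (- ln (\<rho>1 t)))" for t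
 have [measurable]: "X \<in> borel_measurable circle" unfolding X_def by measurable
 have "(\<integral>\<^sup>+z. (if \<rho> z = 0 then \<infinity> else ennreal (- ln (\<rho> z))) * ennreal (cmod (\<phi>' z)) \<partial>\<Lambda>) =
   (\<integral>\<^sup>+t. ennreal (cmod (F t)) * (X t * ennreal (1 / cmod (F t))) \<partial>circle)"
  unfolding \<Lambda>
 proof (rule nn_integral_arc)
  show "AE t in circle. (if \<rho> (\<psi> (cis t)) = 0 then \<infinity> else ennreal (- ln (\<rho> (\<psi> (cis t))))) * ennreal (cmod (\<phi>' (\<psi> (cis t)))) =
    X t * ennreal (1 / cmod (F t))"
   using \<rho>1_eq \<phi>'_eq by eventually_elim (simp add: X_def)
 qed measurable
 also have "\<dots> = (\<integral>\<^sup>+t. X t \<partial>circle)"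
 proof (rule nn_integral_cong_AE, use F_nonzero in eventually_elim)
  fix t assume "F t \<noteq> 0"
  then have "ennreal (cmod (F t)) * ennreal (1 / cmod (F t)) = 1" by (simp add: ennreal_mult'[symmetric])
  then show "ennreal (cmod (F t)) * (X t * ennreal (1 / cmod (F t))) = X t" by (metis mult.left_commute mult.right_neutral)
 qed
 \<comment> \<open>An infinite value of \<open>X\<close> on a set of positive measure is excluded, so the weight is positive almost everywhere.\<close>
 finally have X_fin: "(\<integral>\<^sup>+t. X t \<partial>circle) < \<infinity>" using szego by (simp add: szego_condition_def)
 then have "AE t in circle. X t \<noteq> \<infinity>" by (intro nn_integral_PInf_AE) auto
 with \<rho>1_eq have \<rho>1_pos: "AE t in circle. 0 < \<rho>1 t"
 proof eventually_elim
  case (elim t)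
  then show ?case using \<rho>_nonneg[OF boundary_in_frontier[of t]] by (auto simp: X_def split: if_splits)
 qed
 have "(\<integral>\<^sup>+z. ennreal (\<rho> z) \<partial>\<Lambda>) = (\<integral>\<^sup>+t. ennreal (cmod (F t)) * ennreal (\<rho>1 t) \<partial>circle)"
  unfolding \<Lambda> by (rule nn_integral_arc) (use \<rho>1_eq in \<open>auto elim: eventually_mono\<close>)
 then have \<rho>1_fin: "(\<integral>\<^sup>+t. ennreal (cmod (F t)) * ennreal (\<rho>1 t) \<partial>circle) < \<infinity>" using \<rho>_int by simp
 define u where "u t = ln (\<rho>1 t * cmod (F t)) / real p" for t
 have [measurable]: "u \<in> borel_measurable circle" unfolding u_def by measurable
 have "integrable circle (\<lambda>t. ln (\<rho>1 t * cmod (F t)))"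
 proof (rule integrableI_bounded)
  have "(\<integral>\<^sup>+t. ennreal (norm (ln (\<rho>1 t * cmod (F t)))) \<partial>circle) \<le>
    (\<integral>\<^sup>+t. ennreal (cmod (F t)) * ennreal (\<rho>1 t) + (X t + ennreal \<bar>ln (cmod (F t))\<bar>) \<partial>circle)"
  proof (rule nn_integral_mono_AE, use F_nonzero \<rho>1_pos in eventually_elim)
   fix t assume t: "F t \<noteq> 0" "0 < \<rho>1 t"
   have "ln (\<rho>1 t * cmod (F t)) \<le> \<rho>1 t * cmod (F t) - 1" using t by (intro ln_le_minus_one) simp
   moreover have "ln (\<rho>1 t * cmod (F t)) = ln (\<rho>1 t) + ln (cmod (F t))" using t by (simp add: ln_mult)
   moreover have "0 \<le> \<rho>1 t * cmod (F t)" using t by simp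
   ultimately have "\<bar>ln (\<rho>1 t * cmod (F t))\<bar> \<le> cmod (F t) * \<rho>1 t + (max 0 (- ln (\<rho>1 t)) + \<bar>ln (cmod (F t))\<bar>)"
    by (simp add: mult.commute abs_if max_def)
   then have "ennreal (norm (ln (\<rho>1 t * cmod (F t)))) \<le> ennreal (cmod (F t) * \<rho>1 t + (max 0 (- ln (\<rho>1 t)) + \<bar>ln (cmod (F t))\<bar>))"
    by (intro ennreal_leI) simp
   also have "\<dots> = ennreal (cmod (F t)) * ennreal (\<rho>1 t) + (ennreal (max 0 (- ln (\<rho>1 t))) + ennreal \<bar>ln (cmod (F t))\<bar>)"
    using t by (simp add: ennreal_plus ennreal_mult')
   also have "ennreal (max 0 (- ln (\<rho>1 t))) = X t" using t by (simp add: X_def max_def ennreal_neg)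
   finally show "ennreal (norm (ln (\<rho>1 t * cmod (F t)))) \<le> ennreal (cmod (F t)) * ennreal (\<rho>1 t) + (X t + ennreal \<bar>ln (cmod (F t))\<bar>)" .
  qed
  also have "\<dots> = (\<integral>\<^sup>+t. ennreal (cmod (F t)) * ennreal (\<rho>1 t) \<partial>circle) + ((\<integral>\<^sup>+t. X t \<partial>circle) + (\<integral>\<^sup>+t. ennreal \<bar>ln (cmod (F t))\<bar> \<partial>circle))"
   by (simp add: nn_integral_add)
  also have "\<dots> < \<infinity>" using \<rho>1_fin X_fin ln_F_int by (simp add: integrable_iff_bounded)
  finally show "(\<integral>\<^sup>+t. ennreal (norm (ln (\<rho>1 t * cmod (F t)))) \<partial>circle) < \<infinity>" .
 qed measurable
 then have u_int: "integrable circle u" unfolding u_def by (rule integrable_divide)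
 obtain d where d: "d \<in> borel_measurable circle"
  "AE t in circle. ntlim (\<lambda>w. exp (herglotz u w)) (cis t) (d t) \<and> cmod (d t) = exp (u t)"
  by (rule outer_ntlim[OF u_int]) blast
 have \<omega>0: "\<omega> \<noteq> 0" using \<omega> by auto
 have disk: "szego_disk p \<Lambda> \<phi>0 \<phi>' \<rho> (\<omega> * w) = exp (herglotz u w)" if w: "cmod w < 1" for w
 proof -
  define Y where "Y t = (cis t + w) / (cis t - w) * of_real (ln (\<rho>1 t * cmod (F t)) / cmod (F t))" for t
  have "continuous_on {0..2*pi} (\<lambda>t. (cis t + w) / (cis t - w))"
   by (intro continuous_intros) (use cis_minus_ne_0[OF w] in auto)
  note [measurable] = borel_measurable_circle_continuous[OF this]
  have Ym: "Y \<in> borel_measurable circle" unfolding Y_def by measurable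
  have "(\<integral>t. (\<phi>0 t + \<omega> * w) / (\<phi>0 t - \<omega> * w) * of_real (ln (\<rho> t / cmod (\<phi>' t)) * cmod (\<phi>' t)) \<partial>\<Lambda>) = (\<integral>t. cmod (F t) *\<^sub>R Y t \<partial>circle)"
   unfolding \<Lambda>
  proof (rule integral_arc[OF Ym], use \<rho>1_eq \<phi>'_eq in eventually_elim)
   fix t assume t: "\<rho> (\<psi> (cis t)) = \<rho>1 t" "cmod (\<phi>' (\<psi> (cis t))) = 1 / cmod (F t)"
   have "\<phi>0 (\<psi> (cis t)) = \<omega> * cis t" using \<phi>\<psi>[of "cis t"] by (simp add: \<phi>0)
   moreover have "(\<omega> * cis t + \<omega> * w) / (\<omega> * cis t - \<omega> * w) = (cis t + w) / (cis t - w)"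
    using \<omega>0 by (simp add: distrib_left[symmetric] right_diff_distrib[symmetric])
   ultimately show "(\<phi>0 (\<psi> (cis t)) + \<omega> * w) / (\<phi>0 (\<psi> (cis t)) - \<omega> * w) *
     of_real (ln (\<rho> (\<psi> (cis t)) / cmod (\<phi>' (\<psi> (cis t)))) * cmod (\<phi>' (\<psi> (cis t)))) = Y t"
    unfolding t Y_def by simp
  qed
  also have "\<dots> = (\<integral>t. of_real (real p) * ((cis t + w) / (cis t - w) * of_real (u t)) \<partial>circle)"
  proof (rule integral_cong_AE)
   have cancel: "of_real f * (k * of_real (L / f)) = k * of_real L" if "f \<noteq> 0" for f L :: real and k :: complex
    using that by simp
   show "AE t in circle. cmod (F t) *\<^sub>R Y t = of_real (real p) * ((cis t + w) / (cis t - w) * of_real (u t))"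
    using F_nonzero by eventually_elim (use p in \<open>simp only: Y_def u_def scaleR_conv_of_real cancel norm_eq_zero of_nat_eq_0_iff\<close>, simp add: cancel)
  qed (use Ym in measurable)
  also have "\<dots> = of_real (real p) * (\<integral>t. (cis t + w) / (cis t - w) * of_real (u t) \<partial>circle)" by (rule integral_mult_right_zero)
  finally show ?thesis using p by (simp add: szego_disk_def herglotz_def)
 qed
 define s0 where "s0 = szego_disk p \<Lambda> \<phi>0 \<phi>' \<rho> (\<phi>0 0)"
 have s0: "s0 \<noteq> 0" by (simp add: s0_def szego_disk_def)
 define \<kappa> where "\<kappa> = of_real (cmod s0) / s0"
 have \<kappa>: "cmod \<kappa> = 1" using s0 by (simp add: \<kappa>_def norm_divide)
 have Dz: "D z = \<kappa> * exp (herglotz u (\<phi> z))" if zG: "z \<in> G" for z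
 proof -
  obtain w where "w \<in> ball 0 1" "z = \<psi> w" using zG image by blast
  then have w: "cmod w < 1" "z = \<psi> w" by simp_all
  then have "\<phi> z = w" using \<phi>\<psi>[of w] by simp
  then show ?thesis using disk[OF w(1)] by (simp add: D szego_function_def \<kappa>_def s0_def \<phi>0)
 qed
 have D0: "D 0 = of_real (cmod s0)" using s0 by (simp add: D szego_function_def s0_def)
 have D_nt: "AE t in circle. ntlim (\<lambda>w. D (\<psi> w)) (cis t) (\<kappa> * d t)"
  using d(2)
 proof eventually_elim
  case (elim t)
  show ?case
  proof (rule ntlim_compose_eventually[where F = "\<lambda>y. \<kappa> * y"])
   show "ntlim (\<lambda>w. exp (herglotz u w)) (cis t) (d t)" using elim by blast
   show "D (\<psi> w) = \<kappa> * exp (herglotz u w)" if "cmod w < 1" for w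
    using Dz[of "\<psi> w"] \<phi>\<psi>[of w] mem_G_iff[of w] that by simp
  qed (auto intro!: continuous_intros)
 qed
 have "outer_disk G \<psi> \<phi> F r p u d \<rho>1 (\<kappa> / D 0)"
 proof unfold_locales
  show "AE t in circle. exp (u t) ^ p = \<rho>1 t * cmod (F t)"
   using \<rho>1_pos F_nonzero by eventually_elim (use p in \<open>simp add: u_def exp_of_nat_mult[symmetric]\<close>)
  show "\<kappa> / D 0 \<noteq> 0" using \<kappa> s0 by (auto simp: D0)
 qed (fact p u_int d \<rho>1m \<rho>1_pos)+
 then show ?thesis
  by (rule that[OF _ \<rho>1_eq \<phi>'_eq bvalue_boundary[OF D_nt] Dz \<kappa>]) (use s0 in \<open>auto simp: D0\<close>)
qed

end

text \<open>The conformal map is rotated by \<open>\<omega> = \<phi> (g 0)\<close>, so that the boundary map and \<open>g\<close> have the same base point.\<close>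

lemma normalized_conformal_map_disk:
 assumes g: "simple_path g" "pathfinish g = pathstart g" and G: "G = inside (path_image g)"
  and \<phi>: "normalized_conformal_map G \<xi> \<phi>" and \<xi>: "\<xi> \<in> G"
 obtains \<omega> \<psi> \<phi>1 where "cmod \<omega> = 1" "\<phi> = (\<lambda>z. \<omega> * \<phi>1 z)" "jordan_disk G \<psi> \<phi>1" "pathstart g = \<psi> 1"
  "frontier G = path_image g" "\<psi> 0 = \<xi>" "\<phi> holomorphic_on G"
proof -
 have o: "open G" and c: "connected G" and fr: "frontier G = path_image g"
  using Jordan_inside_outside[OF g] by (auto simp: G)
 have hol: "\<phi> holomorphic_on G" and bij: "bij_betw \<phi> G (ball 0 1)" and \<phi>\<xi>: "\<phi> \<xi> = 0"
  using \<phi> by (auto simp: normalized_conformal_map_def)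
 obtain \<psi>0 where hom: "homeomorphism (closure G) (cball 0 1) \<phi> \<psi>0"
  using \<phi> by (auto simp: normalized_conformal_map_def)
 note hD = homeomorphism_apply1[OF hom] homeomorphism_apply2[OF hom] homeomorphism_image1[OF hom] homeomorphism_image2[OF hom]
  homeomorphism_cont1[OF hom] homeomorphism_cont2[OF hom]
 have GcG: "G \<subseteq> closure G" by (rule closure_subset)
 have g0: "g 0 \<in> frontier G" unfolding fr path_image_def by simp
 then have g0c: "g 0 \<in> closure G" by (simp add: frontier_def)
 define \<omega> where "\<omega> = \<phi> (g 0)"
 have \<omega>: "cmod \<omega> = 1" using \<phi> g0 by (auto simp: normalized_conformal_map_def \<omega>_def)
 then have \<omega>0: "\<omega> \<noteq> 0" by auto
 define \<psi> where "\<psi> w = \<psi>0 (\<omega> * w)" for w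
 define \<phi>1 where "\<phi>1 z = \<phi> z / \<omega>" for z
 obtain k where k: "k holomorphic_on (\<phi> ` G)" "\<And>z. z \<in> G \<Longrightarrow> k (\<phi> z) = z"
  by (rule holomorphic_has_inverse[OF hol o bij_betw_imp_inj_on[OF bij]]) blast
 have im: "\<phi> ` G = ball 0 1" using bij by (simp add: bij_betw_def)
 have \<psi>0k: "\<psi>0 w = k w" if w: "w \<in> ball 0 1" for w
 proof -
  obtain z where z: "z \<in> G" "w = \<phi> z" using w im by blast
  then show ?thesis using k(2) hD(1)[of z] GcG by auto
 qed
 have \<psi>0_hol: "\<psi>0 holomorphic_on ball 0 1"
  using k(1) unfolding im by (rule holomorphic_transform) (simp add: \<psi>0k)
 have "(\<lambda>w. \<omega> * w) ` {w. P (cmod w)} = {w. P (cmod w)}" for P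
 proof (intro equalityI subsetI)
  fix v assume "v \<in> {w. P (cmod w)}"
  then have "v / \<omega> \<in> {w. P (cmod w)}" by (simp add: norm_divide \<omega>)
  moreover have "v = \<omega> * (v / \<omega>)" using \<omega>0 by simp
  ultimately show "v \<in> (\<lambda>w. \<omega> * w) ` {w. P (cmod w)}" by (rule rev_image_eqI)
 qed (auto simp: norm_mult \<omega>)
 from this[of "\<lambda>x. x < 1"] this[of "\<lambda>x. x \<le> 1"]
 have rot: "(\<lambda>w. \<omega> * w) ` ball 0 1 = ball 0 1" "(\<lambda>w. \<omega> * w) ` cball 0 1 = cball 0 1"
  by (simp_all add: ball_def cball_def)
 have "jordan_disk G \<psi> \<phi>1"
 proof
  show "open G" "connected G" by fact+
  have "\<psi>0 \<circ> (\<lambda>w. \<omega> * w) holomorphic_on ball 0 1"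
   by (rule holomorphic_on_compose) (use rot \<psi>0_hol in \<open>auto intro!: holomorphic_intros\<close>)
  then show "\<psi> holomorphic_on ball 0 1" by (simp add: o_def \<psi>_def[abs_def])
  show "\<psi> ` ball 0 1 = G"
  proof -
   have "\<psi> ` ball 0 1 = \<psi>0 ` (\<lambda>w. \<omega> * w) ` ball 0 1" by (simp add: \<psi>_def[abs_def] image_image)
   also have "\<dots> = k ` \<phi> ` G" unfolding rot im by (rule image_cong) (simp_all add: \<psi>0k)
   also have "\<dots> = G" using k(2) by (simp add: image_image)
   finally show ?thesis .
  qed
  show "homeomorphism (cball 0 1) (closure G) \<psi> \<phi>1"
  proof (rule homeomorphismI)
   show "continuous_on (cball 0 1) \<psi>"
    unfolding \<psi>_def by (intro continuous_on_compose2[OF hD(6)] continuous_intros) (use rot in auto)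
   show "continuous_on (closure G) \<phi>1"
    unfolding \<phi>1_def by (intro continuous_intros hD(5)) (use \<omega>0 in auto)
   show "\<psi> ` cball 0 1 \<subseteq> closure G"
    using rot(2) hD(4) by (auto simp: \<psi>_def)
   show "\<phi>1 ` closure G \<subseteq> cball 0 1"
   proof
    fix w assume "w \<in> \<phi>1 ` closure G"
    then obtain z where z: "z \<in> closure G" "w = \<phi> z / \<omega>" by (auto simp: \<phi>1_def)
    then have "\<phi> z \<in> cball 0 1" using hD(3) by blast
    then show "w \<in> cball 0 1" using z \<omega> by (simp add: norm_divide)
   qed
   show "\<phi>1 (\<psi> w) = w" if "w \<in> cball 0 1" for w
   proof -
    have "\<omega> * w \<in> cball 0 1" using that by (simp add: norm_mult \<omega>)
    then show ?thesis using hD(2) \<omega>0 by (simp add: \<phi>1_def \<psi>_def)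
   qed
   show "\<psi> (\<phi>1 z) = z" if "z \<in> closure G" for z
    using hD(1)[OF that] \<omega>0 by (simp add: \<phi>1_def \<psi>_def)
  qed
 qed
 moreover have "pathstart g = \<psi> 1" using hD(1)[OF g0c] by (simp add: \<psi>_def \<omega>_def pathstart_def)
 moreover have "\<psi> 0 = \<xi>" using hD(1)[of \<xi>] GcG \<xi> \<phi>\<xi> by (auto simp: \<psi>_def)
 moreover have "\<phi> = (\<lambda>z. \<omega> * \<phi>1 z)" using \<omega>0 by (simp add: \<phi>1_def fun_eq_iff)
 ultimately show ?thesis by (intro that[OF \<omega> _ _ _ fr _ hol])
qed

theorem theorem2p1:
 fixes p :: nat and q :: real and g :: "real \<Rightarrow> complex" and E G :: "complex set"
  and \<xi> :: complex and \<sigma> \<Lambda> :: "complex measure" and \<rho> \<nu> :: "complex \<Rightarrow> real"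
  and \<phi> \<phi>' D \<Phi> :: "complex \<Rightarrow> complex" and m :: "nat \<Rightarrow> ennreal"
  and Q :: "nat \<Rightarrow> complex poly" and J :: "nat \<Rightarrow> complex \<Rightarrow> complex" and \<gamma> :: ennreal
 assumes p: "2 \<le> p" and q: "q = real p / (real p - 1)"
  and jordan: "simple_path g" "pathfinish g = pathstart g" and rect: "rectifiable g"
  and E: "E = path_image g" and G: "G = inside E"
  and \<Lambda>: "\<Lambda> = arc_length_measure g"
  and zero: "0 \<in> G" and \<xi>: "\<xi> \<in> G"
  and \<phi>: "normalized_conformal_map G \<xi> \<phi>" and \<phi>': "\<phi>' = bvalue G (deriv \<phi>)"
  and \<sigma>: "sets \<sigma> = sets borel" "finite_measure \<sigma>" "emeasure \<sigma> (- E) = 0"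
  and ac: "abs_cont_part \<sigma> \<Lambda> \<rho>"
  and \<rho>_nonneg: "\<forall>t\<in>E. 0 \<le> \<rho> t"
  and \<rho>_int: "(\<integral>\<^sup>+t. ennreal (\<rho> t) \<partial>\<Lambda>) < \<infinity>"
  and szego: "szego_condition \<Lambda> \<phi>' \<rho>"
  and D: "D = szego_function p \<Lambda> \<phi> \<phi>' \<rho>"
  and m: "\<forall>n. m n = extremal_constant p \<Lambda> G \<rho> D \<xi> n"
  and Q: "\<forall>n. extremal_poly p \<Lambda> G \<rho> D \<xi> n (Q n)"
  and J: "\<forall>n. J n = path_integral G \<xi> (\<lambda>t. poly (Q n) t ^ p)"
  and \<Phi>: "\<Phi> = path_integral G \<xi> (\<lambda>t. (D t / D 0) ^ p)"
  and \<nu>: "\<nu> = (\<lambda>t. \<rho> t powr (1 - q))"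
  and \<gamma>: "\<gamma> = gamma_const p q \<Lambda> G \<phi>' D"
 shows "(\<forall>n. (SUP z\<in>G. ennreal (cmod (J n z - \<Phi> z))) \<le>
      m n / 2 * (\<gamma> / ennreal (Re (D 0)) + Lp_norm p \<Lambda> \<nu> (poly (Q n))) ^ (p - 1)) \<and>
    (m \<longlonglongrightarrow> 0 \<longrightarrow> (\<forall>K. compact K \<and> K \<subseteq> G \<longrightarrow> uniform_limit K J \<Phi> sequentially))"
proof -
 have p0: "0 < p" using p by simp
 obtain \<omega> \<psi> \<phi>1 where \<omega>: "cmod \<omega> = 1" and \<phi>1: "\<phi> = (\<lambda>z. \<omega> * \<phi>1 z)" and jd: "jordan_disk G \<psi> \<phi>1"
  and g1: "pathstart g = \<psi> 1" and fr: "frontier G = path_image g" and \<psi>0: "\<psi> 0 = \<xi>" and \<phi>hol: "\<phi> holomorphic_on G"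
  using G unfolding E by (rule normalized_conformal_map_disk[OF jordan _ \<phi> \<xi>])
 interpret jordan_disk G \<psi> \<phi>1 by (rule jd)
 interpret rectifiable_jordan_disk G \<psi> \<phi>1
  by unfold_locales (rule finite_length_of_rectifiable[OF jordan fr[symmetric] g1 rect])
 obtain F :: "real \<Rightarrow> complex" and r :: "nat \<Rightarrow> real" where Fr: "integrable circle F" "AE t in circle. ntlim (deriv \<psi>) (cis t) (F t)"
  "AE t in circle. F t \<noteq> 0" "integrable circle (\<lambda>t. ln (cmod (F t)))"
  "\<And>k. 0 < r k" "\<And>k. r k < 1" "r \<longlonglongrightarrow> 1"
  "(\<lambda>k. \<integral>\<^sup>+t. ennreal (cmod (deriv \<psi> (r k * cis t) - F t)) \<partial>circle) \<longlonglongrightarrow> 0"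
  by (rule boundary_derivative) (rule that)
 interpret boundary_disk G \<psi> \<phi>1 F r by unfold_locales (fact Fr)+
 have \<Lambda>': "\<Lambda> = completion arc_measure"
  unfolding \<Lambda> by (rule arc_length_measure_eq[OF jordan fr[symmetric] g1])
 have \<rho>m: "\<rho> \<in> borel_measurable \<Lambda>" using ac by (simp add: abs_cont_part_def)
 obtain u d \<rho>1 \<kappa> where od: "outer_disk G \<psi> \<phi>1 F r p u d \<rho>1 (\<kappa> / D 0)"
  and \<rho>1: "AE t in circle. \<rho> (\<psi> (cis t)) = \<rho>1 t"
  and \<phi>'_eq: "AE t in circle. cmod (\<phi>' (\<psi> (cis t))) = 1 / cmod (F t)"
  and D_eq: "AE t in circle. bvalue G D (\<psi> (cis t)) = \<kappa> * d t"
  and Dz: "\<And>z. z \<in> G \<Longrightarrow> D z = \<kappa> * exp (herglotz u (\<phi>1 z))" and \<kappa>: "cmod \<kappa> = 1"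
  and D0: "0 < Re (D 0)" "D 0 = of_real (Re (D 0))"
 proof (rule szego_function_outer[OF p \<omega> _ \<phi>1 \<phi>' \<Lambda>' \<rho>m _ \<rho>_int szego D zero])
  show "(\<lambda>z. \<omega> * \<phi>1 z) holomorphic_on G" using \<phi>hol \<phi>1 by simp
  show "0 \<le> \<rho> z" if "z \<in> frontier G" for z using \<rho>_nonneg that fr E by simp
 qed (rule that)
 interpret outer_disk G \<psi> \<phi>1 F r p u d \<rho>1 "\<kappa> / D 0" by (rule od)
 note [measurable] = poly_boundary(3)
 have "cmod (D 0) = cmod (of_real (Re (D 0)))" using D0(2) by (rule arg_cong)
 also have "\<dots> = Re (D 0)" using D0(1) by (simp only: norm_of_real abs_of_pos)
 finally have normc: "cmod (\<kappa> / D 0) = 1 / Re (D 0)" by (simp add: norm_divide \<kappa>)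
 have in_disk: "cmod (\<phi>1 z) < 1" "\<psi> (\<phi>1 z) = z" if z: "z \<in> G" for z
 proof -
  obtain w where "w \<in> ball 0 1" "z = \<psi> w" using z image by blast
  then have w: "cmod w < 1" "z = \<psi> w" by simp_all
  then show "cmod (\<phi>1 z) < 1" "\<psi> (\<phi>1 z) = z" using \<phi>\<psi>[of w] by auto
 qed
 have \<phi>1hol: "\<phi>1 holomorphic_on G"
 proof -
  have "(\<lambda>z. \<phi> z / \<omega>) holomorphic_on G" by (intro holomorphic_intros \<phi>hol) (use \<omega> in auto)
  moreover have "\<omega> \<noteq> 0" using \<omega> by auto
  then have "(\<lambda>z. \<phi> z / \<omega>) = \<phi>1" unfolding \<phi>1 by simp
  ultimately show ?thesis by simp
 qed
 have Dhol: "D holomorphic_on G"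
 proof -
  have "herglotz u \<circ> \<phi>1 holomorphic_on G"
   by (rule holomorphic_on_compose_gen[OF \<phi>1hol herglotz_holomorphic[OF u_int]]) (use in_disk in auto)
  then have "(\<lambda>z. \<kappa> * exp ((herglotz u \<circ> \<phi>1) z)) holomorphic_on G" by (intro holomorphic_intros)
  then show ?thesis by (rule holomorphic_transform) (simp add: Dz)
 qed
 have Dc: "D (\<psi> w) / D 0 = \<kappa> / D 0 * outer w" if "w \<in> ball 0 1" for w
  using Dz[of "\<psi> w"] mem_G_iff[of w] \<phi>\<psi>[of w] that by (simp add: outer_def)
 have "simply_connected G" unfolding G E by (rule simply_connected_inside_simple_path[OF jordan(1)])
 then have prim: "\<exists>h. \<forall>z. z \<in> G \<longrightarrow> (h has_field_derivative f z) (at z)" if "f holomorphic_on G" for f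
  using that simply_connected_eq_global_primitive[OF open_G] by blast
 have Jprim: "\<exists>P. (\<forall>z\<in>ball 0 1. (P has_field_derivative (poly (Q n) (\<psi> z) ^ p - (\<kappa> / D 0 * outer z) ^ p) * deriv \<psi> z) (at z)) \<and>
   (\<forall>z\<in>G. J n z - \<Phi> z = P (\<phi>1 z) - P 0)" for n
 proof -
  have "(\<lambda>z. poly (Q n) z ^ p) holomorphic_on G" by (intro holomorphic_intros)
  then obtain U where U: "\<And>z. z \<in> G \<Longrightarrow> (U has_field_derivative poly (Q n) z ^ p) (at z)"
   using prim by blast
  have "(\<lambda>z. (D z / D 0) ^ p) holomorphic_on G" by (intro holomorphic_intros Dhol) (use D0 in auto)
  then obtain W where W: "\<And>z. z \<in> G \<Longrightarrow> (W has_field_derivative (D z / D 0) ^ p) (at z)"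
   using prim by blast
  have "((\<lambda>w. U (\<psi> w) - W (\<psi> w)) has_field_derivative (poly (Q n) (\<psi> z) ^ p - (\<kappa> / D 0 * outer z) ^ p) * deriv \<psi> z) (at z)"
   if z: "z \<in> ball 0 1" for z
  proof -
   have zG: "\<psi> z \<in> G" using image z by blast
   have 2: "(\<psi> has_field_derivative deriv \<psi> z) (at z)" by (rule holomorphic_derivI[OF hol open_ball z])
   show ?thesis
    using DERIV_diff[OF DERIV_chain2[OF U[OF zG] 2] DERIV_chain2[OF W[OF zG] 2]]
    unfolding Dc[OF z] by (simp add: left_diff_distrib)
  qed
  moreover have "J n z - \<Phi> z = (U (\<psi> (\<phi>1 z)) - W (\<psi> (\<phi>1 z))) - (U (\<psi> 0) - W (\<psi> 0))" if z: "z \<in> G" for z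
   using path_integral_primitive[OF open_G connected_G \<xi> z U] path_integral_primitive[OF open_G connected_G \<xi> z W]
   by (simp add: J[rule_format] \<Phi> in_disk(2)[OF z] \<psi>0)
  ultimately show ?thesis by (intro exI[of _ "\<lambda>w. U (\<psi> w) - W (\<psi> w)"]) blast
 qed
 have m_eq: "m n = ennreal_powr (weighted_error (Q n)) (1 / real p)" for n
 proof -
  have "m n = ennreal_powr (\<integral>\<^sup>+t. ennreal (cmod (bvalue G D t / D 0 - poly (Q n) t) ^ p * \<rho> t) \<partial>\<Lambda>) (1 / real p)"
   using m Q by (simp add: extremal_poly_def extremal_dist_def Lp_norm_def)
  also have "(\<integral>\<^sup>+t. ennreal (cmod (bvalue G D t / D 0 - poly (Q n) t) ^ p * \<rho> t) \<partial>\<Lambda>) =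
   weighted_error (Q n)"
   unfolding \<Lambda>' weighted_error_def by (rule nn_integral_arc, measurable) (use \<rho>1 D_eq in eventually_elim, simp)
  finally show ?thesis .
 qed
 have Q_eq: "Lp_norm p \<Lambda> \<nu> (poly (Q n)) =
   ennreal_powr (\<integral>\<^sup>+t. ennreal (cmod (F t)) * ennreal (cmod (poly (Q n) (\<psi> (cis t))) ^ p * \<rho>1 t powr (1 - q)) \<partial>circle) (1 / real p)" for n
  unfolding Lp_norm_def \<nu> \<Lambda>'
  by (subst nn_integral_arc[where Y = "\<lambda>t. ennreal (cmod (poly (Q n) (\<psi> (cis t))) ^ p * \<rho>1 t powr (1 - q))"], measurable)
   (use \<rho>1 in eventually_elim, simp_all)
 have \<gamma>_eq: "\<gamma> = ennreal_powr (\<integral>\<^sup>+t. ennreal (cmod (F t)) * ennreal (cmod (d t) ^ p * \<rho>1 t powr (1 - q)) \<partial>circle) (1 / real p)"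
 proof -
  have "AE t in circle. ennreal (cmod (bvalue G D (\<psi> (cis t))) powr (real p * (2 - q)) * cmod (\<phi>' (\<psi> (cis t))) powr (1 - q)) =
    ennreal (cmod (d t) ^ p * \<rho>1 t powr (1 - q))"
   using D_eq \<phi>'_eq \<rho>_pos exp_u d_nt F_nonzero
  proof eventually_elim
   case (elim t)
   define R where "R = \<rho>1 t * cmod (F t)"
   have R: "0 < R" "cmod (d t) ^ p = R" "0 < cmod (d t)" using elim by (simp_all add: R_def)
   have "cmod (d t) powr (real p * (2 - q)) = R powr (1 + (1 - q))"
    using R by (simp add: powr_powr[symmetric] powr_realpow)
   also have "\<dots> = R * (\<rho>1 t powr (1 - q) * cmod (F t) powr (1 - q))"
   proof -
    have "R powr (1 + (1 - q)) = R * R powr (1 - q)" unfolding powr_add using R by simp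
    also have "R powr (1 - q) = \<rho>1 t powr (1 - q) * cmod (F t) powr (1 - q)"
     unfolding R_def by (rule powr_mult)
    finally show ?thesis .
   qed
   finally show ?case using elim R(2) \<kappa> by (simp add: norm_mult powr_divide)
  qed
  then show ?thesis unfolding \<gamma> gamma_const_def \<Lambda>'
   by (subst nn_integral_arc[where Y = "\<lambda>t. ennreal (cmod (d t) ^ p * \<rho>1 t powr (1 - q))"], measurable)
 qed
 have \<gamma>D: "\<gamma> / ennreal (Re (D 0)) = \<gamma> * ennreal (cmod (\<kappa> / D 0))"
  unfolding normc divide_ennreal_def using D0(1) by (simp add: inverse_ennreal inverse_eq_divide)
 show ?thesis
 proof (intro conjI allI impI)
  fix n
  obtain P where P: "\<And>z. z \<in> ball 0 1 \<Longrightarrow> (P has_field_derivative (poly (Q n) (\<psi> z) ^ p - (\<kappa> / D 0 * outer z) ^ p) * deriv \<psi> z) (at z)"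
   "\<And>z. z \<in> G \<Longrightarrow> J n z - \<Phi> z = P (\<phi>1 z) - P 0"
   using Jprim[of n] by blast
  show "(SUP z\<in>G. ennreal (cmod (J n z - \<Phi> z))) \<le>
    m n / 2 * (\<gamma> / ennreal (Re (D 0)) + Lp_norm p \<Lambda> \<nu> (poly (Q n))) ^ (p - 1)"
  proof (rule SUP_least)
   fix z assume z: "z \<in> G"
   have "ennreal (cmod (P (\<phi>1 z) - P 0)) \<le> ennreal (1 / 2) *
    (\<integral>\<^sup>+t. ennreal (cmod (poly (Q n) (\<psi> (cis t)) ^ p - (\<kappa> / D 0 * d t) ^ p)) * ennreal (cmod (F t)) \<partial>circle)"
    by (rule primitive_error[OF in_disk(1)[OF z] P(1)])
   also have "\<dots> \<le> m n / 2 * (\<gamma> * ennreal (cmod (\<kappa> / D 0)) + Lp_norm p \<Lambda> \<nu> (poly (Q n))) ^ (p - 1)"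
    by (rule error_estimate[OF q m_eq Q_eq \<gamma>_eq])
   finally show "ennreal (cmod (J n z - \<Phi> z)) \<le> m n / 2 * (\<gamma> / ennreal (Re (D 0)) + Lp_norm p \<Lambda> \<nu> (poly (Q n))) ^ (p - 1)"
    unfolding P(2)[OF z] \<gamma>D .
  qed
 next
  fix K assume m0: "m \<longlonglongrightarrow> 0" and K: "compact K \<and> K \<subseteq> G"
  \<comment> \<open>A compact subset of \<open>G\<close> corresponds to a subset of a smaller disk; the case \<open>K = {}\<close> needs an arbitrary radius.\<close>
  obtain R where R: "0 < R" "R < 1" "\<And>z. z \<in> K \<Longrightarrow> cmod (\<phi>1 z) \<le> R"
  proof (cases "K = {}")
   case True then show ?thesis using that[of "1 / 2"] by simp
  next
   case False
   have "continuous_on K (\<lambda>z. cmod (\<phi>1 z))"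
    using K by (intro continuous_intros continuous_on_subset[OF holomorphic_on_imp_continuous_on[OF \<phi>1hol]]) auto
   from continuous_attains_sup[OF conjunct1[OF K] False this]
   obtain z0 where z0: "z0 \<in> K" "\<forall>z\<in>K. cmod (\<phi>1 z) \<le> cmod (\<phi>1 z0)" by blast
   show ?thesis
   proof (rule that[of "max (1 / 2) (cmod (\<phi>1 z0))"])
    have "z0 \<in> G" using z0(1) K by blast
    then show "max (1 / 2) (cmod (\<phi>1 z0)) < 1" using in_disk(1) by simp
    show "cmod (\<phi>1 z) \<le> max (1 / 2) (cmod (\<phi>1 z0))" if "z \<in> K" for z using z0(2) that by (simp add: max.coboundedI2)
   qed simp
  qed
  obtain C where C: "0 \<le> C" and err:
   "\<And>Q e P w. 0 < e \<Longrightarrow> e \<le> 1 \<Longrightarrow>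
   weighted_error Q \<le> ennreal (e ^ p) \<Longrightarrow>
   (\<And>z. z \<in> ball 0 1 \<Longrightarrow> (P has_field_derivative (poly Q (\<psi> z) ^ p - (\<kappa> / D 0 * outer z) ^ p) * deriv \<psi> z) (at z)) \<Longrightarrow>
   cmod w \<le> R \<Longrightarrow> cmod (P w - P 0) \<le> C * e"
   using R(1,2) by (rule compact_error) blast
  show "uniform_limit K J \<Phi> sequentially"
  proof (rule uniform_limitI)
   fix \<epsilon> :: real assume \<epsilon>: "0 < \<epsilon>"
   \<comment> \<open>The bound on compact sets is linear in \<open>e\<close> only for \<open>e \<le> 1\<close>, because of the power.\<close>
   define e where "e = min 1 (\<epsilon> / (C + 1))"
   have e: "0 < e" "e \<le> 1" "e \<le> \<epsilon> / (C + 1)" using \<epsilon> C by (auto simp: e_def)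
   have "C * e \<le> C * (\<epsilon> / (C + 1))" using C e by (intro mult_left_mono) auto
   also have "\<dots> < \<epsilon>" using C \<epsilon> by (simp add: field_simps)
   finally have Ce: "C * e < \<epsilon>" .
   have "\<forall>\<^sub>F n in sequentially. m n < ennreal e" using order_tendstoD(2)[OF m0] e by simp
   then show "\<forall>\<^sub>F n in sequentially. \<forall>z\<in>K. dist (J n z) (\<Phi> z) < \<epsilon>"
   proof eventually_elim
    case (elim n)
    then have "m n \<noteq> \<infinity>" by auto
    then obtain A where A: "0 \<le> A" "m n = ennreal A"
     "weighted_error (Q n) = ennreal (A ^ p)"
     unfolding m_eq by (rule ennreal_powr_root_finite[OF p0])
    have "A < e" using elim A e by (simp add: ennreal_less_iff)
    then have le: "weighted_error (Q n) \<le> ennreal (e ^ p)"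
     unfolding A(3) using A(1) by (intro ennreal_leI power_mono) auto
    obtain P where P: "\<And>z. z \<in> ball 0 1 \<Longrightarrow> (P has_field_derivative (poly (Q n) (\<psi> z) ^ p - (\<kappa> / D 0 * outer z) ^ p) * deriv \<psi> z) (at z)"
     "\<And>z. z \<in> G \<Longrightarrow> J n z - \<Phi> z = P (\<phi>1 z) - P 0"
     using Jprim[of n] by blast
    show ?case
    proof
     fix z assume z: "z \<in> K"
     have "dist (J n z) (\<Phi> z) = cmod (P (\<phi>1 z) - P 0)" using P(2)[of z] z K by (auto simp: dist_norm)
     also have "\<dots> \<le> C * e" by (rule err[OF e(1,2) le P(1) R(3)[OF z]])
     finally show "dist (J n z) (\<Phi> z) < \<epsilon>" using Ce by simp
    qed
   qed
  qed
 qed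
qed

end
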